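(* Let $\mathcal{B}$ be a finitely bi-accessible 2-category with $\mathcal{B}_0$ a generator of bicompact objects. Let $B$ be an object of $\mathcal{B}$ and let $F : I_B \to \mathcal{B}_0$ be a pseudofunctor with $I_B$ bifiltered such that $B \simeq \mathrm{bicolim}\, F$, with bicolimit inclusions $q_i : F(i) \to B$ and invertible 2-cells $q_d : q_j F(d) \simeq q_i$ for $d : i\to j$. Then the inclusion $I_B \to \mathcal{B}_\omega \downarrow B$ sending $i$ to $q_i : F(i) \to B$ (and $d$ to $(F(d),q_d)$) is bicofinal; consequently $\mathcal{B}_\omega \downarrow B$ is bifiltered and $B$ is the bicolimit $B \simeq \mathrm{bicolim}\; (\mathcal{B}_\omega \downarrow B)$ of the canonical projection $\mathcal{B}_\omega\downarrow B \to \mathcal{B}$.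
   Context: Conventions: a 2-category is a strict 2-category with small hom-categories $\mathcal{B}[X,Y]$; $\mathbf{Cat}$ is the 2-category of small categories. The (conical) bicolimit of a pseudofunctor $F : I \to \mathcal{B}$ is an object $\mathrm{bicolim}\,F$ with equivalences, pseudonatural in $X$, between $\mathcal{B}[\mathrm{bicolim}\,F, X]$ and the category of pseudococones (pseudonatural transformations) from $F$ to the constant functor at $X$. A 2-category $I$ is bifiltered if it is non-empty and: (1) any two objects $i,i'$ admit 1-cells $i\to i''\leftarrow i'$; (2) for any parallel $d,d' : i \rightrightarrows i'$ there are $f : i'\to i''$ and an invertible 2-cell $fd \simeq fd'$; (3) for any parallel 2-cells $\alpha,\alpha' : d \Rightarrow d' : i \to i'$ there is $f : i'\to i''$ with $f*\alpha=f*\alpha'$. An object $K$ of $\mathcal{B}$ is bicompact if for any small bifiltered 2-category $I$ and pseudofunctor $F : I \to \mathcal{B}$ (with a bicolimit) the canonical functor $\mathrm{bicolim}_{i \in I}\, \mathcal{B}[K,F(i)] \to \mathcal{B}[K,\mathrm{bicolim}_I F]$ is an equivalence of categories. $\mathcal{B}$ is finitely bi-accessible if it has (small) bifiltered bicolimits and there is an essentially small full (on 1-cells and 2-cells) sub-2-category $\mathcal{B}_0 \hookrightarrow \mathcal{B}$ of bicompact objects such that every object of $\mathcal{B}$ is a bifiltered bicolimit of objects of $\mathcal{B}_0$; such a $\mathcal{B}_0$ is called a generator of bicompact objects. $\mathcal{B}_\omega$ denotes the full sub-2-category of all bicompact objects. The pseudoslice $\mathcal{B}_\omega \downarrow B$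 (canonical pseudococone) has as objects pairs $(K,a)$ with $K$ bicompact and $a : K \to B$; a 1-cell $(K_1,a_1)\to(K_2,a_2)$ is a pair $(k,\phi)$ with $k : K_1\to K_2$ and an invertible 2-cell $\phi : a_2 k \simeq a_1$; a 2-cell $(k,\phi)\Rightarrow(k',\phi')$ is a 2-cell $\theta : k \Rightarrow k'$ with $\phi'\circ(a_2*\theta)=\phi$. A pseudofunctor $G : I \to J$ with $I$ bifiltered is bicofinal if: every object $j$ of $J$ admits a 1-cell $j\to G(i)$; for any parallel $d,t : j \rightrightarrows G(i)$ there are $s : i\to i'$ in $I$ and an invertible 2-cell $G(s)d\simeq G(s)t$; for any parallel 2-cells $\alpha,\alpha' : d\Rightarrow t : j\to G(i)$ there is $s : i\to i'$ with $G(s)*\alpha=G(s)*\alpha'$. *)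

theory Defs
  imports Main "HOL-Library.FuncSet" "HOL-Library.Equipollence"
begin

section \<open>Size\<close>

text \<open>
  A type \<open>'u\<close> plays the role of a Grothendieck universe: a set, of any type, is small if it has
  strictly fewer elements than \<open>'u\<close>, and the cardinality of \<open>'u\<close> is an infinite regular strong limit.
  The countable case, in which small means finite, is allowed, so that the assumption is satisfiable
  without large cardinals. Up to isomorphism a small category or 2-category has its cells in \<open>'u\<close>,
  and a 2-category with at most \<open>'u\<close>-many objects and with small hom-categories
  has its 1-cells and 2-cells in \<open>'u\<close>.
\<close>

definition small :: "'u itself \<Rightarrow> 'a set \<Rightarrow> bool" where
  "small _ A \<longleftrightarrow> A \<prec> (UNIV :: 'u set)"

definition universe :: "'u itself \<Rightarrow> bool" where
  "universe U \<longleftrightarrow>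
     infinite (UNIV :: 'u set) \<and>
     (\<forall>A :: 'u set. small U A \<longrightarrow> small U (Pow A)) \<and>
     (\<forall>(A :: 'u set) (f :: 'u \<Rightarrow> 'u set).
        small U A \<longrightarrow> (\<forall>a\<in>A. small U (f a)) \<longrightarrow> small U (\<Union>a\<in>A. f a))"


section \<open>Categories\<close>

record ('o, 'a) cat =
  cObj :: "'o set"
  cArr :: "'a set"
  cDom :: "'a \<Rightarrow> 'o"
  cCod :: "'a \<Rightarrow> 'o"
  cId :: "'o \<Rightarrow> 'a"
  cComp :: "'a \<Rightarrow> 'a \<Rightarrow> 'a"

locale category =
  fixes C :: "('o, 'a) cat"
  assumes dom_cod: "f \<in> cArr C \<Longrightarrow> cDom C f \<in> cObj C \<and> cCod C f \<in> cObj C"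
    and id: "x \<in> cObj C \<Longrightarrow> cId C x \<in> cArr C \<and> cDom C (cId C x) = x \<and> cCod C (cId C x) = x"
    and comp: "\<lbrakk>f \<in> cArr C; g \<in> cArr C; cDom C g = cCod C f\<rbrakk> \<Longrightarrow>
      cComp C g f \<in> cArr C \<and> cDom C (cComp C g f) = cDom C f \<and> cCod C (cComp C g f) = cCod C g"
    and comp_assoc: "\<lbrakk>f \<in> cArr C; g \<in> cArr C; h \<in> cArr C; cDom C g = cCod C f; cDom C h = cCod C g\<rbrakk> \<Longrightarrow>
      cComp C (cComp C h g) f = cComp C h (cComp C g f)"
    and comp_id: "f \<in> cArr C \<Longrightarrow> cComp C f (cId C (cDom C f)) = f \<and> cComp C (cId C (cCod C f)) f = f"

definition cIso :: "('o, 'a) cat \<Rightarrow> 'a \<Rightarrow> bool" where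
  "cIso C f \<longleftrightarrow> f \<in> cArr C \<and>
     (\<exists>g\<in>cArr C. cDom C g = cCod C f \<and> cCod C g = cDom C f \<and>
        cComp C g f = cId C (cDom C f) \<and> cComp C f g = cId C (cCod C f))"

text \<open>
  Functors and natural transformations carry their source and target, and their maps are extensional,
  so that equality of records is equality of functors and of natural transformations.
\<close>

record ('o, 'a, 'p, 'b) funct =
  fDom :: "('o, 'a) cat"
  fCod :: "('p, 'b) cat"
  fOb :: "'o \<Rightarrow> 'p"
  fAr :: "'a \<Rightarrow> 'b"

definition is_functor :: "('o, 'a, 'p, 'b) funct \<Rightarrow> bool" where
  "is_functor F \<longleftrightarrow> (let C = fDom F; D = fCod F in
     category C \<and> category D \<and>
     fOb F \<in> cObj C \<rightarrow>\<^sub>E cObj D \<and> fAr F \<in> cArr C \<rightarrow>\<^sub>E cArr D \<and>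
     (\<forall>f\<in>cArr C. cDom D (fAr F f) = fOb F (cDom C f) \<and> cCod D (fAr F f) = fOb F (cCod C f)) \<and>
     (\<forall>x\<in>cObj C. fAr F (cId C x) = cId D (fOb F x)) \<and>
     (\<forall>f\<in>cArr C. \<forall>g\<in>cArr C. cDom C g = cCod C f \<longrightarrow>
        fAr F (cComp C g f) = cComp D (fAr F g) (fAr F f)))"

definition functor_from_to :: "('o, 'a) cat \<Rightarrow> ('p, 'b) cat \<Rightarrow> ('o, 'a, 'p, 'b) funct \<Rightarrow> bool" where
  "functor_from_to C D F \<longleftrightarrow> is_functor F \<and> fDom F = C \<and> fCod F = D"

definition fId :: "('o, 'a) cat \<Rightarrow> ('o, 'a, 'o, 'a) funct" where
  "fId C = \<lparr>fDom = C, fCod = C, fOb = (\<lambda>x\<in>cObj C. x), fAr = (\<lambda>f\<in>cArr C. f)\<rparr>"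

definition fComp :: "('p, 'b, 'q, 'd) funct \<Rightarrow> ('o, 'a, 'p, 'b) funct \<Rightarrow> ('o, 'a, 'q, 'd) funct" where
  "fComp G F = \<lparr>fDom = fDom F, fCod = fCod G,
     fOb = (\<lambda>x\<in>cObj (fDom F). fOb G (fOb F x)),
     fAr = (\<lambda>f\<in>cArr (fDom F). fAr G (fAr F f))\<rparr>"

record ('o, 'a, 'p, 'b) nattr =
  nDom :: "('o, 'a, 'p, 'b) funct"
  nCod :: "('o, 'a, 'p, 'b) funct"
  nAt :: "'o \<Rightarrow> 'b"

definition is_nattr :: "('o, 'a, 'p, 'b) nattr \<Rightarrow> bool" where
  "is_nattr \<alpha> \<longleftrightarrow> (let F = nDom \<alpha>; G = nCod \<alpha>; C = fDom F; D = fCod F in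
     functor_from_to C D F \<and> functor_from_to C D G \<and>
     nAt \<alpha> \<in> cObj C \<rightarrow>\<^sub>E cArr D \<and>
     (\<forall>x\<in>cObj C. cDom D (nAt \<alpha> x) = fOb F x \<and> cCod D (nAt \<alpha> x) = fOb G x) \<and>
     (\<forall>f\<in>cArr C. cComp D (nAt \<alpha> (cCod C f)) (fAr F f) = cComp D (fAr G f) (nAt \<alpha> (cDom C f))))"

definition nat_iso :: "('o, 'a, 'p, 'b) funct \<Rightarrow> ('o, 'a, 'p, 'b) funct \<Rightarrow> ('o, 'a, 'p, 'b) nattr \<Rightarrow> bool" where
  "nat_iso F G \<alpha> \<longleftrightarrow> is_nattr \<alpha> \<and> nDom \<alpha> = F \<and> nCod \<alpha> = G \<and>
     (\<forall>x\<in>cObj (fDom F). cIso (fCod F) (nAt \<alpha> x))"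

definition is_equivalence :: "('o, 'a, 'p, 'b) funct \<Rightarrow> bool" where
  "is_equivalence F \<longleftrightarrow> is_functor F \<and>
     (\<exists>G. functor_from_to (fCod F) (fDom F) G \<and>
        (\<exists>\<eta>. nat_iso (fId (fDom F)) (fComp G F) \<eta>) \<and>
        (\<exists>\<epsilon>. nat_iso (fComp F G) (fId (fCod F)) \<epsilon>))"


section \<open>Strict 2-categories\<close>

record ('o, 'a, 'c) twocat =
  Ob :: "'o set"
  Ar :: "'a set"
  Cl :: "'c set"
  src :: "'a \<Rightarrow> 'o"
  trg :: "'a \<Rightarrow> 'o"
  dom2 :: "'c \<Rightarrow> 'a"
  cod2 :: "'c \<Rightarrow> 'a"
  id1 :: "'o \<Rightarrow> 'a"
  cmp1 :: "'a \<Rightarrow> 'a \<Rightarrow> 'a" (infixl "\<cdot>\<index>" 75)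
  id2 :: "'a \<Rightarrow> 'c"
  vcmp :: "'c \<Rightarrow> 'c \<Rightarrow> 'c" (infixl "\<bullet>\<index>" 65)
  hcmp :: "'c \<Rightarrow> 'c \<Rightarrow> 'c" (infixl "\<star>\<index>" 70)

definition arr :: "('o, 'a, 'c) twocat \<Rightarrow> 'a \<Rightarrow> 'o \<Rightarrow> 'o \<Rightarrow> bool" where
  "arr B f X Y \<longleftrightarrow> f \<in> Ar B \<and> src B f = X \<and> trg B f = Y"

definition cell :: "('o, 'a, 'c) twocat \<Rightarrow> 'c \<Rightarrow> 'a \<Rightarrow> 'a \<Rightarrow> bool" where
  "cell B \<alpha> f g \<longleftrightarrow> \<alpha> \<in> Cl B \<and> dom2 B \<alpha> = f \<and> cod2 B \<alpha> = g"

locale two_category =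
  fixes B :: "('o, 'a, 'c) twocat" (structure)
  assumes src_trg: "f \<in> Ar B \<Longrightarrow> src B f \<in> Ob B \<and> trg B f \<in> Ob B"
    and dom_cod: "\<alpha> \<in> Cl B \<Longrightarrow> dom2 B \<alpha> \<in> Ar B \<and> cod2 B \<alpha> \<in> Ar B \<and>
      src B (dom2 B \<alpha>) = src B (cod2 B \<alpha>) \<and> trg B (dom2 B \<alpha>) = trg B (cod2 B \<alpha>)"
    and id1: "X \<in> Ob B \<Longrightarrow> arr B (id1 B X) X X"
    and cmp1: "\<lbrakk>arr B f X Y; arr B g Y Z\<rbrakk> \<Longrightarrow> arr B (g \<cdot> f) X Z"
    and cmp1_assoc: "\<lbrakk>arr B f W X; arr B g X Y; arr B h Y Z\<rbrakk> \<Longrightarrow> (h \<cdot> g) \<cdot> f = h \<cdot> (g \<cdot> f)"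
    and cmp1_id: "arr B f X Y \<Longrightarrow> f \<cdot> id1 B X = f \<and> id1 B Y \<cdot> f = f"
    and id2: "f \<in> Ar B \<Longrightarrow> cell B (id2 B f) f f"
    and vcmp: "\<lbrakk>cell B \<alpha> f g; cell B \<beta> g h\<rbrakk> \<Longrightarrow> cell B (\<beta> \<bullet> \<alpha>) f h"
    and vcmp_assoc: "\<lbrakk>cell B \<alpha> f g; cell B \<beta> g h; cell B \<gamma> h k\<rbrakk> \<Longrightarrow> (\<gamma> \<bullet> \<beta>) \<bullet> \<alpha> = \<gamma> \<bullet> (\<beta> \<bullet> \<alpha>)"
    and vcmp_id: "cell B \<alpha> f g \<Longrightarrow> \<alpha> \<bullet> id2 B f = \<alpha> \<and> id2 B g \<bullet> \<alpha> = \<alpha>"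
    and hcmp: "\<lbrakk>cell B \<alpha> f f'; cell B \<beta> g g'; trg B f = src B g\<rbrakk> \<Longrightarrow> cell B (\<beta> \<star> \<alpha>) (g \<cdot> f) (g' \<cdot> f')"
    and hcmp_assoc: "\<lbrakk>cell B \<alpha> f f'; cell B \<beta> g g'; cell B \<gamma> h h'; trg B f = src B g; trg B g = src B h\<rbrakk> \<Longrightarrow>
      (\<gamma> \<star> \<beta>) \<star> \<alpha> = \<gamma> \<star> (\<beta> \<star> \<alpha>)"
    and hcmp_id1: "cell B \<alpha> f g \<Longrightarrow>
      \<alpha> \<star> id2 B (id1 B (src B f)) = \<alpha> \<and> id2 B (id1 B (trg B f)) \<star> \<alpha> = \<alpha>"
    and hcmp_id2: "\<lbrakk>arr B f X Y; arr B g Y Z\<rbrakk> \<Longrightarrow> id2 B g \<star> id2 B f = id2 B (g \<cdot> f)"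
    and interchange: "\<lbrakk>cell B \<alpha> f f'; cell B \<alpha>' f' f''; cell B \<beta> g g'; cell B \<beta>' g' g''; trg B f = src B g\<rbrakk> \<Longrightarrow>
      (\<beta>' \<bullet> \<beta>) \<star> (\<alpha>' \<bullet> \<alpha>) = (\<beta>' \<star> \<alpha>') \<bullet> (\<beta> \<star> \<alpha>)"

definition inv_cell :: "('o, 'a, 'c) twocat \<Rightarrow> 'c \<Rightarrow> 'a \<Rightarrow> 'a \<Rightarrow> bool" where
  "inv_cell B \<alpha> f g \<longleftrightarrow> cell B \<alpha> f g \<and>
     (\<exists>\<beta>. cell B \<beta> g f \<and> \<beta> \<bullet>\<^bsub>B\<^esub> \<alpha> = id2 B f \<and> \<alpha> \<bullet>\<^bsub>B\<^esub> \<beta> = id2 B g)"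

definition equivalent_objects :: "('o, 'a, 'c) twocat \<Rightarrow> 'o \<Rightarrow> 'o \<Rightarrow> bool" where
  "equivalent_objects B X Y \<longleftrightarrow> (\<exists>f g. arr B f X Y \<and> arr B g Y X \<and>
     (\<exists>\<eta>. inv_cell B \<eta> (id1 B X) (g \<cdot>\<^bsub>B\<^esub> f)) \<and> (\<exists>\<epsilon>. inv_cell B \<epsilon> (f \<cdot>\<^bsub>B\<^esub> g) (id1 B Y)))"

definition full_sub :: "('o, 'a, 'c) twocat \<Rightarrow> 'o set \<Rightarrow> ('o, 'a, 'c) twocat" where
  "full_sub B S = B \<lparr>Ob := Ob B \<inter> S,
     Ar := {f \<in> Ar B. src B f \<in> S \<and> trg B f \<in> S},
     Cl := {\<alpha> \<in> Cl B. src B (dom2 B \<alpha>) \<in> S \<and> trg B (dom2 B \<alpha>) \<in> S}\<rparr>"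

definition hom_cat :: "('o, 'a, 'c) twocat \<Rightarrow> 'o \<Rightarrow> 'o \<Rightarrow> ('a, 'c) cat" where
  "hom_cat B X Y = \<lparr>cObj = {f. arr B f X Y}, cArr = {\<alpha> \<in> Cl B. arr B (dom2 B \<alpha>) X Y},
     cDom = dom2 B, cCod = cod2 B, cId = id2 B, cComp = vcmp B\<rparr>"

definition small_homs :: "'u itself \<Rightarrow> ('o, 'a, 'c) twocat \<Rightarrow> bool" where
  "small_homs U B \<longleftrightarrow> (\<forall>X\<in>Ob B. \<forall>Y\<in>Ob B. small U (cObj (hom_cat B X Y)) \<and> small U (cArr (hom_cat B X Y)))"

definition small_twocat :: "'u itself \<Rightarrow> ('o, 'a, 'c) twocat \<Rightarrow> bool" where
  "small_twocat U I \<longleftrightarrow> two_category I \<and> small U (Ob I) \<and> small U (Ar I) \<and> small U (Cl I)"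

definition Cat :: "(('u, 'u) cat, ('u, 'u, 'u, 'u) funct, ('u, 'u, 'u, 'u) nattr) twocat" where
  "Cat = (let Obs = {C. category C \<and> small TYPE('u) (cObj C) \<and> small TYPE('u) (cArr C)} in
    \<lparr>Ob = Obs,
     Ar = {F. is_functor F \<and> fDom F \<in> Obs \<and> fCod F \<in> Obs},
     Cl = {\<alpha>. is_nattr \<alpha> \<and> fDom (nDom \<alpha>) \<in> Obs \<and> fCod (nDom \<alpha>) \<in> Obs},
     src = fDom, trg = fCod, dom2 = nDom, cod2 = nCod,
     id1 = fId,
     cmp1 = fComp,
     id2 = (\<lambda>F. \<lparr>nDom = F, nCod = F, nAt = (\<lambda>x\<in>cObj (fDom F). cId (fCod F) (fOb F x))\<rparr>),
     vcmp = (\<lambda>\<beta> \<alpha>. \<lparr>nDom = nDom \<alpha>, nCod = nCod \<beta>,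
       nAt = (\<lambda>x\<in>cObj (fDom (nDom \<alpha>)). cComp (fCod (nDom \<alpha>)) (nAt \<beta> x) (nAt \<alpha> x))\<rparr>),
     hcmp = (\<lambda>\<beta> \<alpha>. \<lparr>nDom = fComp (nDom \<beta>) (nDom \<alpha>), nCod = fComp (nCod \<beta>) (nCod \<alpha>),
       nAt = (\<lambda>x\<in>cObj (fDom (nDom \<alpha>)). cComp (fCod (nDom \<beta>))
         (nAt \<beta> (fOb (nCod \<alpha>) x)) (fAr (nDom \<beta>) (nAt \<alpha> x)))\<rparr>)\<rparr>)"


section \<open>Pseudofunctors\<close>

text \<open>
  The coherence cells are \<open>P2c F e d : F(e) F(d) \<Rightarrow> F(ed)\<close> and \<open>P0c F i : 1 \<Rightarrow> F(1\<^sub>i)\<close>.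
\<close>

record ('i, 'j, 'k, 'o, 'a, 'c) psfun =
  P0 :: "'i \<Rightarrow> 'o"
  P1 :: "'j \<Rightarrow> 'a"
  P2 :: "'k \<Rightarrow> 'c"
  P2c :: "'j \<Rightarrow> 'j \<Rightarrow> 'c"
  P0c :: "'i \<Rightarrow> 'c"

locale pseudofunctor =
  I: two_category I + J: two_category J
  for I :: "('i, 'j, 'k) twocat" and J :: "('o, 'a, 'c) twocat" +
  fixes F :: "('i, 'j, 'k, 'o, 'a, 'c) psfun"
  assumes P0: "i \<in> Ob I \<Longrightarrow> P0 F i \<in> Ob J"
    and P1: "arr I d i i' \<Longrightarrow> arr J (P1 F d) (P0 F i) (P0 F i')"
    and P2: "cell I \<alpha> d d' \<Longrightarrow> cell J (P2 F \<alpha>) (P1 F d) (P1 F d')"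
    and P2_id: "d \<in> Ar I \<Longrightarrow> P2 F (id2 I d) = id2 J (P1 F d)"
    and P2_vcmp: "\<lbrakk>cell I \<alpha> d d'; cell I \<beta> d' d''\<rbrakk> \<Longrightarrow> P2 F (\<beta> \<bullet>\<^bsub>I\<^esub> \<alpha>) = P2 F \<beta> \<bullet>\<^bsub>J\<^esub> P2 F \<alpha>"
    and P2c: "\<lbrakk>arr I d i i'; arr I e i' i''\<rbrakk> \<Longrightarrow>
      inv_cell J (P2c F e d) (P1 F e \<cdot>\<^bsub>J\<^esub> P1 F d) (P1 F (e \<cdot>\<^bsub>I\<^esub> d))"
    and P2c_natural: "\<lbrakk>cell I \<alpha> d d'; cell I \<beta> e e'; trg I d = src I e\<rbrakk> \<Longrightarrow>
      P2c F e' d' \<bullet>\<^bsub>J\<^esub> (P2 F \<beta> \<star>\<^bsub>J\<^esub> P2 F \<alpha>) = P2 F (\<beta> \<star>\<^bsub>I\<^esub> \<alpha>) \<bullet>\<^bsub>J\<^esub> P2c F e d"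
    and P0c: "i \<in> Ob I \<Longrightarrow> inv_cell J (P0c F i) (id1 J (P0 F i)) (P1 F (id1 I i))"
    and coh_assoc: "\<lbrakk>arr I d i i'; arr I e i' i''; arr I f i'' i'''\<rbrakk> \<Longrightarrow>
      P2c F f (e \<cdot>\<^bsub>I\<^esub> d) \<bullet>\<^bsub>J\<^esub> (id2 J (P1 F f) \<star>\<^bsub>J\<^esub> P2c F e d) =
      P2c F (f \<cdot>\<^bsub>I\<^esub> e) d \<bullet>\<^bsub>J\<^esub> (P2c F f e \<star>\<^bsub>J\<^esub> id2 J (P1 F d))"
    and coh_unit: "arr I d i i' \<Longrightarrow>
      P2c F d (id1 I i) \<bullet>\<^bsub>J\<^esub> (id2 J (P1 F d) \<star>\<^bsub>J\<^esub> P0c F i) = id2 J (P1 F d) \<and>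
      P2c F (id1 I i') d \<bullet>\<^bsub>J\<^esub> (P0c F i' \<star>\<^bsub>J\<^esub> id2 J (P1 F d)) = id2 J (P1 F d)"

definition post1 :: "('o, 'a, 'c) twocat \<Rightarrow> 'o \<Rightarrow> 'a \<Rightarrow> ('a, 'c, 'a, 'c) funct" where
  "post1 B K g = \<lparr>fDom = hom_cat B K (src B g), fCod = hom_cat B K (trg B g),
     fOb = (\<lambda>f\<in>cObj (hom_cat B K (src B g)). g \<cdot>\<^bsub>B\<^esub> f),
     fAr = (\<lambda>\<alpha>\<in>cArr (hom_cat B K (src B g)). id2 B g \<star>\<^bsub>B\<^esub> \<alpha>)\<rparr>"

definition post2 :: "('o, 'a, 'c) twocat \<Rightarrow> 'o \<Rightarrow> 'c \<Rightarrow> ('a, 'c, 'a, 'c) nattr" where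
  "post2 B K \<gamma> = \<lparr>nDom = post1 B K (dom2 B \<gamma>), nCod = post1 B K (cod2 B \<gamma>),
     nAt = (\<lambda>f\<in>cObj (hom_cat B K (src B (dom2 B \<gamma>))). \<gamma> \<star>\<^bsub>B\<^esub> id2 B f)\<rparr>"

text \<open>
  The composite of \<open>F\<close> with the representable \<open>B[K,-]\<close>. As the latter is a strict 2-functor, its
  coherence cells are the images of those of \<open>F\<close>.
\<close>

definition hom_psfun :: "('o, 'u, 'u) twocat \<Rightarrow> 'o \<Rightarrow> ('i, 'j, 'k, 'o, 'u, 'u) psfun \<Rightarrow>
    ('i, 'j, 'k, ('u, 'u) cat, ('u, 'u, 'u, 'u) funct, ('u, 'u, 'u, 'u) nattr) psfun" where
  "hom_psfun B K F = \<lparr>P0 = (\<lambda>i. hom_cat B K (P0 F i)),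
     P1 = (\<lambda>d. post1 B K (P1 F d)),
     P2 = (\<lambda>\<alpha>. post2 B K (P2 F \<alpha>)),
     P2c = (\<lambda>e d. post2 B K (P2c F e d)),
     P0c = (\<lambda>i. post2 B K (P0c F i))\<rparr>"


section \<open>Pseudococones and bicolimits\<close>

text \<open>
  Pseudonatural transformations from \<open>F\<close> to the constant functor at \<open>X\<close>, with structure cells
  \<open>legc q d : q\<^sub>j F(d) \<Rightarrow> q\<^sub>i\<close> for \<open>d : i \<rightarrow> j\<close>, and the modifications between them.
\<close>

record ('i, 'j, 'a, 'c) cocone =
  leg :: "'i \<Rightarrow> 'a"
  legc :: "'j \<Rightarrow> 'c"

definition pseudococone :: "('o, 'a, 'c) twocat \<Rightarrow> ('i, 'j, 'k) twocat \<Rightarrow>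
    ('i, 'j, 'k, 'o, 'a, 'c) psfun \<Rightarrow> 'o \<Rightarrow> ('i, 'j, 'a, 'c) cocone \<Rightarrow> bool" where
  "pseudococone B I F X q \<longleftrightarrow>
     leg q \<in> extensional (Ob I) \<and> legc q \<in> extensional (Ar I) \<and>
     (\<forall>i\<in>Ob I. arr B (leg q i) (P0 F i) X) \<and>
     (\<forall>d i j. arr I d i j \<longrightarrow> inv_cell B (legc q d) (leg q j \<cdot>\<^bsub>B\<^esub> P1 F d) (leg q i)) \<and>
     (\<forall>\<alpha> d d' i j. cell I \<alpha> d d' \<and> arr I d i j \<longrightarrow>
        legc q d' \<bullet>\<^bsub>B\<^esub> (id2 B (leg q j) \<star>\<^bsub>B\<^esub> P2 F \<alpha>) = legc q d) \<and>
     (\<forall>d e i j k. arr I d i j \<and> arr I e j k \<longrightarrow>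
        legc q (e \<cdot>\<^bsub>I\<^esub> d) \<bullet>\<^bsub>B\<^esub> (id2 B (leg q k) \<star>\<^bsub>B\<^esub> P2c F e d) =
        legc q d \<bullet>\<^bsub>B\<^esub> (legc q e \<star>\<^bsub>B\<^esub> id2 B (P1 F d))) \<and>
     (\<forall>i\<in>Ob I. legc q (id1 I i) \<bullet>\<^bsub>B\<^esub> (id2 B (leg q i) \<star>\<^bsub>B\<^esub> P0c F i) = id2 B (leg q i))"

record ('i, 'j, 'a, 'c) modif =
  mDom :: "('i, 'j, 'a, 'c) cocone"
  mCod :: "('i, 'j, 'a, 'c) cocone"
  mAt :: "'i \<Rightarrow> 'c"

definition modification :: "('o, 'a, 'c) twocat \<Rightarrow> ('i, 'j, 'k) twocat \<Rightarrow>
    ('i, 'j, 'k, 'o, 'a, 'c) psfun \<Rightarrow> 'o \<Rightarrow> ('i, 'j, 'a, 'c) modif \<Rightarrow> bool" where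
  "modification B I F X m \<longleftrightarrow>
     pseudococone B I F X (mDom m) \<and> pseudococone B I F X (mCod m) \<and>
     mAt m \<in> extensional (Ob I) \<and>
     (\<forall>i\<in>Ob I. cell B (mAt m i) (leg (mDom m) i) (leg (mCod m) i)) \<and>
     (\<forall>d i j. arr I d i j \<longrightarrow>
        mAt m i \<bullet>\<^bsub>B\<^esub> legc (mDom m) d = legc (mCod m) d \<bullet>\<^bsub>B\<^esub> (mAt m j \<star>\<^bsub>B\<^esub> id2 B (P1 F d)))"

definition cocone_cat :: "('o, 'a, 'c) twocat \<Rightarrow> ('i, 'j, 'k) twocat \<Rightarrow>
    ('i, 'j, 'k, 'o, 'a, 'c) psfun \<Rightarrow> 'o \<Rightarrow> (('i, 'j, 'a, 'c) cocone, ('i, 'j, 'a, 'c) modif) cat" where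
  "cocone_cat B I F X = \<lparr>cObj = {q. pseudococone B I F X q}, cArr = {m. modification B I F X m},
     cDom = mDom, cCod = mCod,
     cId = (\<lambda>q. \<lparr>mDom = q, mCod = q, mAt = (\<lambda>i\<in>Ob I. id2 B (leg q i))\<rparr>),
     cComp = (\<lambda>n m. \<lparr>mDom = mDom m, mCod = mCod n, mAt = (\<lambda>i\<in>Ob I. mAt n i \<bullet>\<^bsub>B\<^esub> mAt m i)\<rparr>)\<rparr>"

definition cocone_post :: "('o, 'a, 'c) twocat \<Rightarrow> ('i, 'j, 'k) twocat \<Rightarrow> 'a \<Rightarrow>
    ('i, 'j, 'a, 'c) cocone \<Rightarrow> ('i, 'j, 'a, 'c) cocone" where
  "cocone_post B I g q = \<lparr>leg = (\<lambda>i\<in>Ob I. g \<cdot>\<^bsub>B\<^esub> leg q i), legc = (\<lambda>d\<in>Ar I. id2 B g \<star>\<^bsub>B\<^esub> legc q d)\<rparr>"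

definition modif_post :: "('o, 'a, 'c) twocat \<Rightarrow> ('i, 'j, 'k) twocat \<Rightarrow> 'a \<Rightarrow>
    ('i, 'j, 'a, 'c) modif \<Rightarrow> ('i, 'j, 'a, 'c) modif" where
  "modif_post B I g m = \<lparr>mDom = cocone_post B I g (mDom m), mCod = cocone_post B I g (mCod m),
     mAt = (\<lambda>i\<in>Ob I. id2 B g \<star>\<^bsub>B\<^esub> mAt m i)\<rparr>"

definition cocone_post2 :: "('o, 'a, 'c) twocat \<Rightarrow> ('i, 'j, 'k) twocat \<Rightarrow> 'c \<Rightarrow>
    ('i, 'j, 'a, 'c) cocone \<Rightarrow> ('i, 'j, 'a, 'c) modif" where
  "cocone_post2 B I \<gamma> q = \<lparr>mDom = cocone_post B I (dom2 B \<gamma>) q, mCod = cocone_post B I (cod2 B \<gamma>) q,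
     mAt = (\<lambda>i\<in>Ob I. \<gamma> \<star>\<^bsub>B\<^esub> id2 B (leg q i))\<rparr>"

text \<open>
  A family of equivalences \<open>\<Phi>\<^sub>X : B[L,X] \<rightarrow> PsCocone(F,X)\<close>, pseudonatural in \<open>X\<close>. The structure
  isomorphisms are \<open>\<sigma> g f : g \<Phi>\<^sub>X(f) \<cong> \<Phi>\<^sub>Y(gf)\<close> for \<open>g : X \<rightarrow> Y\<close> and \<open>f : L \<rightarrow> X\<close>.
\<close>

locale bicolimit_equivalence =
  pseudofunctor I B F
  for B :: "('o, 'a, 'c) twocat" and I :: "('i, 'j, 'k) twocat"
    and F :: "('i, 'j, 'k, 'o, 'a, 'c) psfun" +
  fixes L :: 'o
    and \<Phi> :: "'o \<Rightarrow> ('a, 'c, ('i, 'j, 'a, 'c) cocone, ('i, 'j, 'a, 'c) modif) funct"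
    and \<sigma> :: "'a \<Rightarrow> 'a \<Rightarrow> ('i, 'j, 'a, 'c) modif"
  assumes vertex: "L \<in> Ob B"
    and equiv: "X \<in> Ob B \<Longrightarrow>
      functor_from_to (hom_cat B L X) (cocone_cat B I F X) (\<Phi> X) \<and> is_equivalence (\<Phi> X)"
    and iso: "\<lbrakk>arr B g X Y; arr B f L X\<rbrakk> \<Longrightarrow> cIso (cocone_cat B I F Y) (\<sigma> g f) \<and>
      mDom (\<sigma> g f) = cocone_post B I g (fOb (\<Phi> X) f) \<and> mCod (\<sigma> g f) = fOb (\<Phi> Y) (g \<cdot>\<^bsub>B\<^esub> f)"
    and natural_fun: "\<lbrakk>arr B g X Y; arr B f L X; cell B \<alpha> f f'\<rbrakk> \<Longrightarrow>
      cComp (cocone_cat B I F Y) (\<sigma> g f') (modif_post B I g (fAr (\<Phi> X) \<alpha>)) =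
      cComp (cocone_cat B I F Y) (fAr (\<Phi> Y) (id2 B g \<star>\<^bsub>B\<^esub> \<alpha>)) (\<sigma> g f)"
    and natural_cell: "\<lbrakk>arr B g X Y; arr B f L X; cell B \<gamma> g g'\<rbrakk> \<Longrightarrow>
      cComp (cocone_cat B I F Y) (\<sigma> g' f) (cocone_post2 B I \<gamma> (fOb (\<Phi> X) f)) =
      cComp (cocone_cat B I F Y) (fAr (\<Phi> Y) (\<gamma> \<star>\<^bsub>B\<^esub> id2 B f)) (\<sigma> g f)"
    and natural_comp: "\<lbrakk>arr B g X Y; arr B h Y Z; arr B f L X\<rbrakk> \<Longrightarrow>
      \<sigma> (h \<cdot>\<^bsub>B\<^esub> g) f = cComp (cocone_cat B I F Z) (\<sigma> h (g \<cdot>\<^bsub>B\<^esub> f)) (modif_post B I h (\<sigma> g f))"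
    and natural_id: "arr B f L X \<Longrightarrow> \<sigma> (id1 B X) f = cId (cocone_cat B I F X) (fOb (\<Phi> X) f)"

text \<open>The bicolimit inclusions are the pseudococone corresponding to the identity of the vertex.\<close>

definition is_bicolimit :: "('o, 'a, 'c) twocat \<Rightarrow> ('i, 'j, 'k) twocat \<Rightarrow>
    ('i, 'j, 'k, 'o, 'a, 'c) psfun \<Rightarrow> 'o \<Rightarrow> ('i, 'j, 'a, 'c) cocone \<Rightarrow> bool" where
  "is_bicolimit B I F L q \<longleftrightarrow>
     (\<exists>\<Phi> \<sigma>. bicolimit_equivalence B I F L \<Phi> \<sigma> \<and> fOb (\<Phi> L) (id1 B L) = q)"


section \<open>Bifiltered 2-categories and bicofinal pseudofunctors\<close>

definition bifiltered :: "('i, 'j, 'k) twocat \<Rightarrow> bool" where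
  "bifiltered I \<longleftrightarrow> two_category I \<and> Ob I \<noteq> {} \<and>
     (\<forall>i\<in>Ob I. \<forall>i'\<in>Ob I. \<exists>i'' f g. arr I f i i'' \<and> arr I g i' i'') \<and>
     (\<forall>i i' d d'. arr I d i i' \<and> arr I d' i i' \<longrightarrow>
        (\<exists>i'' f \<theta>. arr I f i' i'' \<and> inv_cell I \<theta> (f \<cdot>\<^bsub>I\<^esub> d) (f \<cdot>\<^bsub>I\<^esub> d'))) \<and>
     (\<forall>i i' d d' \<alpha> \<alpha>'. arr I d i i' \<and> arr I d' i i' \<and> cell I \<alpha> d d' \<and> cell I \<alpha>' d d' \<longrightarrow>
        (\<exists>i'' f. arr I f i' i'' \<and> id2 I f \<star>\<^bsub>I\<^esub> \<alpha> = id2 I f \<star>\<^bsub>I\<^esub> \<alpha>'))"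

definition bicofinal :: "('i, 'j, 'k) twocat \<Rightarrow> ('o, 'a, 'c) twocat \<Rightarrow>
    ('i, 'j, 'k, 'o, 'a, 'c) psfun \<Rightarrow> bool" where
  "bicofinal I J G \<longleftrightarrow> bifiltered I \<and> pseudofunctor I J G \<and>
     (\<forall>j\<in>Ob J. \<exists>i d. i \<in> Ob I \<and> arr J d j (P0 G i)) \<and>
     (\<forall>j i d t. i \<in> Ob I \<and> arr J d j (P0 G i) \<and> arr J t j (P0 G i) \<longrightarrow>
        (\<exists>i' s \<theta>. arr I s i i' \<and> inv_cell J \<theta> (P1 G s \<cdot>\<^bsub>J\<^esub> d) (P1 G s \<cdot>\<^bsub>J\<^esub> t))) \<and>
     (\<forall>j i d t \<alpha> \<alpha>'. i \<in> Ob I \<and> arr J d j (P0 G i) \<and> arr J t j (P0 G i) \<and>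
        cell J \<alpha> d t \<and> cell J \<alpha>' d t \<longrightarrow>
        (\<exists>i' s. arr I s i i' \<and> id2 J (P1 G s) \<star>\<^bsub>J\<^esub> \<alpha> = id2 J (P1 G s) \<star>\<^bsub>J\<^esub> \<alpha>'))"


section \<open>Bicompact objects and finitely bi-accessible 2-categories\<close>

definition hom_cocone :: "('o, 'u, 'u) twocat \<Rightarrow> ('i, 'j, 'k) twocat \<Rightarrow> 'o \<Rightarrow> ('i, 'j, 'u, 'u) cocone \<Rightarrow>
    ('i, 'j, ('u, 'u, 'u, 'u) funct, ('u, 'u, 'u, 'u) nattr) cocone" where
  "hom_cocone B I K q =
     \<lparr>leg = (\<lambda>i\<in>Ob I. post1 B K (leg q i)), legc = (\<lambda>d\<in>Ar I. post2 B K (legc q d))\<rparr>"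

text \<open>
  The canonical functor \<open>H : bicolim B[K,F(i)] \<rightarrow> B[K,L]\<close> is determined up to isomorphism by
  \<open>H \<circ> p \<cong> B[K,q]\<close>, where \<open>p\<close> and \<open>q\<close> are the bicolimit inclusions of \<open>bicolim B[K,F(i)]\<close>
  and of \<open>L = bicolim F\<close>. Both bicolimits are determined up to equivalence.
\<close>

definition canonical_functor :: "('o, 'u, 'u) twocat \<Rightarrow> ('u, 'u, 'u) twocat \<Rightarrow>
    ('u, 'u, 'u, 'o, 'u, 'u) psfun \<Rightarrow> 'o \<Rightarrow> 'o \<Rightarrow> ('u, 'u, 'u, 'u) cocone \<Rightarrow>
    ('u, 'u) cat \<Rightarrow> ('u, 'u, ('u, 'u, 'u, 'u) funct, ('u, 'u, 'u, 'u) nattr) cocone \<Rightarrow>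
    ('u, 'u, 'u, 'u) funct \<Rightarrow> bool" where
  "canonical_functor B I F K L q C p H \<longleftrightarrow> arr Cat H C (hom_cat B K L) \<and>
     (\<exists>m. cIso (cocone_cat Cat I (hom_psfun B K F) (hom_cat B K L)) m \<and>
        mDom m = cocone_post Cat I H p \<and> mCod m = hom_cocone B I K q)"

definition bicompact :: "('o, 'u, 'u) twocat \<Rightarrow> 'o \<Rightarrow> bool" where
  "bicompact B K \<longleftrightarrow> K \<in> Ob B \<and>
     (\<forall>(I :: ('u, 'u, 'u) twocat) F L q.
        small_twocat TYPE('u) I \<and> bifiltered I \<and> pseudofunctor I B F \<and> is_bicolimit B I F L q \<longrightarrow>
        (\<exists>C p H. is_bicolimit Cat I (hom_psfun B K F) C p \<and>
           canonical_functor B I F K L q C p H \<and> is_equivalence H))"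

definition has_bifiltered_bicolimits :: "('o, 'u, 'u) twocat \<Rightarrow> bool" where
  "has_bifiltered_bicolimits B \<longleftrightarrow>
     (\<forall>(I :: ('u, 'u, 'u) twocat) F.
        small_twocat TYPE('u) I \<and> bifiltered I \<and> pseudofunctor I B F \<longrightarrow> (\<exists>L q. is_bicolimit B I F L q))"

text \<open>
  A full sub-2-category is given by its set of objects. As the hom-categories are small, it is
  essentially small if its objects form, up to equivalence, a small set.
\<close>

definition bicompact_generator :: "('o, 'u, 'u) twocat \<Rightarrow> 'o set \<Rightarrow> bool" where
  "bicompact_generator B B0 \<longleftrightarrow>
     (\<forall>K\<in>B0. bicompact B K) \<and>
     (\<exists>S\<subseteq>B0. small TYPE('u) S \<and> (\<forall>K\<in>B0. \<exists>K'\<in>S. equivalent_objects B K K')) \<and>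
     (\<forall>X\<in>Ob B. \<exists>(I :: ('u, 'u, 'u) twocat) F q.
        small_twocat TYPE('u) I \<and> bifiltered I \<and> pseudofunctor I (full_sub B B0) F \<and> is_bicolimit B I F X q)"

definition finitely_biaccessible :: "('o, 'u, 'u) twocat \<Rightarrow> bool" where
  "finitely_biaccessible B \<longleftrightarrow> two_category B \<and> small_homs TYPE('u) B \<and>
     has_bifiltered_bicolimits B \<and> (\<exists>B0. bicompact_generator B B0)"


section \<open>The pseudoslice\<close>

text \<open>
  The pseudoslice over \<open>b\<close> of the full sub-2-category with set of objects \<open>S\<close>. Its cells carry
  their source and target.
\<close>

type_synonym ('o, 'a) sl_ob = "'o \<times> 'a"
type_synonym ('o, 'a, 'c) sl_ar = "('o, 'a) sl_ob \<times> ('o, 'a) sl_ob \<times> 'a \<times> 'c"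
type_synonym ('o, 'a, 'c) sl_cl = "('o, 'a, 'c) sl_ar \<times> ('o, 'a, 'c) sl_ar \<times> 'c"

definition pseudoslice :: "('o, 'a, 'c) twocat \<Rightarrow> 'o set \<Rightarrow> 'o \<Rightarrow>
    (('o, 'a) sl_ob, ('o, 'a, 'c) sl_ar, ('o, 'a, 'c) sl_cl) twocat" where
  "pseudoslice B S b = (let
     Obs = {(K, a). K \<in> S \<and> arr B a K b};
     Ars = {((K1, a1), (K2, a2), k, \<phi>). (K1, a1) \<in> Obs \<and> (K2, a2) \<in> Obs \<and>
       arr B k K1 K2 \<and> inv_cell B \<phi> (a2 \<cdot>\<^bsub>B\<^esub> k) a1};
     Cls = {(((K1, a1), (K2, a2), k, \<phi>), ((K1', a1'), (K2', a2'), k', \<phi>'), \<theta>).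
       ((K1, a1), (K2, a2), k, \<phi>) \<in> Ars \<and> ((K1', a1'), (K2', a2'), k', \<phi>') \<in> Ars \<and>
       (K1', a1') = (K1, a1) \<and> (K2', a2') = (K2, a2) \<and>
       cell B \<theta> k k' \<and> \<phi>' \<bullet>\<^bsub>B\<^esub> (id2 B a2 \<star>\<^bsub>B\<^esub> \<theta>) = \<phi>};
     cmp = (\<lambda>(y, z, l, \<psi>) (x, y', k, \<phi>). (x, z, l \<cdot>\<^bsub>B\<^esub> k, \<phi> \<bullet>\<^bsub>B\<^esub> (\<psi> \<star>\<^bsub>B\<^esub> id2 B k)))
   in
    \<lparr>Ob = Obs, Ar = Ars, Cl = Cls,
     src = (\<lambda>(x, y, k, \<phi>). x),
     trg = (\<lambda>(x, y, k, \<phi>). y),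
     dom2 = (\<lambda>(u, v, \<theta>). u),
     cod2 = (\<lambda>(u, v, \<theta>). v),
     id1 = (\<lambda>(K, a). ((K, a), (K, a), id1 B K, id2 B a)),
     cmp1 = cmp,
     id2 = (\<lambda>(x, y, k, \<phi>). ((x, y, k, \<phi>), (x, y, k, \<phi>), id2 B k)),
     vcmp = (\<lambda>(v', w, \<theta>') (u, v, \<theta>). (u, w, \<theta>' \<bullet>\<^bsub>B\<^esub> \<theta>)),
     hcmp = (\<lambda>(u', v', \<theta>') (u, v, \<theta>). (cmp u' u, cmp v' v, \<theta>' \<star>\<^bsub>B\<^esub> \<theta>))\<rparr>)"

abbreviation compact_slice :: "('o, 'u, 'u) twocat \<Rightarrow> 'o \<Rightarrow>
    (('o, 'u) sl_ob, ('o, 'u, 'u) sl_ar, ('o, 'u, 'u) sl_cl) twocat" where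
  "compact_slice B b \<equiv> pseudoslice B {K. bicompact B K} b"

definition slice_proj :: "('o, 'a, 'c) twocat \<Rightarrow>
    (('o, 'a) sl_ob, ('o, 'a, 'c) sl_ar, ('o, 'a, 'c) sl_cl, 'o, 'a, 'c) psfun" where
  "slice_proj B = \<lparr>P0 = (\<lambda>(K, a). K),
     P1 = (\<lambda>(x, y, k, \<phi>). k),
     P2 = (\<lambda>(u, v, \<theta>). \<theta>),
     P2c = (\<lambda>(y, z, l, \<psi>) (x, y', k, \<phi>). id2 B (l \<cdot>\<^bsub>B\<^esub> k)),
     P0c = (\<lambda>(K, a). id2 B (id1 B K))\<rparr>"

definition slice_cocone :: "('o, 'a, 'c) twocat \<Rightarrow> 'o set \<Rightarrow> 'o \<Rightarrow>
    (('o, 'a) sl_ob, ('o, 'a, 'c) sl_ar, 'a, 'c) cocone" where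
  "slice_cocone B S b = \<lparr>leg = (\<lambda>(K, a)\<in>Ob (pseudoslice B S b). a),
     legc = (\<lambda>(x, y, k, \<phi>)\<in>Ar (pseudoslice B S b). \<phi>)\<rparr>"

definition slice_incl :: "('o, 'a, 'c) twocat \<Rightarrow> ('i, 'j, 'k) twocat \<Rightarrow> 'o set \<Rightarrow> 'o \<Rightarrow>
    ('i, 'j, 'k, 'o, 'a, 'c) psfun \<Rightarrow> ('i, 'j, 'a, 'c) cocone \<Rightarrow>
    ('i, 'j, 'k, ('o, 'a) sl_ob, ('o, 'a, 'c) sl_ar, ('o, 'a, 'c) sl_cl) psfun" where
  "slice_incl B I S b F q = (let
     ob = (\<lambda>i. (P0 F i, leg q i));
     ar = (\<lambda>d. (ob (src I d), ob (trg I d), P1 F d, legc q d));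
     Sl = pseudoslice B S b
   in
    \<lparr>P0 = ob,
     P1 = ar,
     P2 = (\<lambda>\<alpha>. (ar (dom2 I \<alpha>), ar (cod2 I \<alpha>), P2 F \<alpha>)),
     P2c = (\<lambda>e d. (ar e \<cdot>\<^bsub>Sl\<^esub> ar d, ar (e \<cdot>\<^bsub>I\<^esub> d), P2c F e d)),
     P0c = (\<lambda>i. (id1 Sl (ob i), ar (id1 I i), P0c F i))\<rparr>)"

end

theory Submission
  imports Defs
begin

text \<open>
  Let \<open>K\<close> be bicompact and \<open>b \<simeq> bicolim F\<close>. Bicofinality amounts to three statements on the
  1-cells \<open>x : K \<rightarrow> F(i)\<close>: every \<open>K \<rightarrow> b\<close> is isomorphic to some \<open>q\<^sub>i x\<close>; every 2-cell
  \<open>q\<^sub>i x \<Rightarrow> q\<^sub>i y\<close> comes from a 2-cell \<open>F(s) x \<Rightarrow> F(s) y\<close> for some \<open>s : i \<rightarrow> k\<close>; and 2-cells with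
  the same whiskering by \<open>q\<^sub>i\<close> become equal after whiskering by some \<open>F(s)\<close>. By bicompactness it
  suffices to prove them for the bicolimit \<open>C\<close> in \<open>Cat\<close> of the categories \<open>B[K,F(i)]\<close>, and there
  they follow from the universal property without constructing \<open>C\<close>. The inclusions of \<open>C\<close> factor
  through a category whose arrows are the morphisms of \<open>C\<close> induced by 2-cells
  \<open>F(s) x \<Rightarrow> F(t) y\<close>, so the identity of \<open>C\<close> does too, which gives the first two statements. For
  the third, the germs of such 2-cells out of a fixed \<open>x\<close> form a pseudococone to a small category
  of partial equivalence relations, which identifies two 2-cells only if they become equal at a
  later stage; it factors through \<open>C\<close>. An invertible \<open>q\<^sub>i x \<Rightarrow> q\<^sub>i y\<close> comes from an invertible
  2-cell, since the one that induces the inverse becomes its inverse at a later stage.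

  Bicofinality carries bifilteredness over to the pseudoslice, and makes the restriction of
  pseudococones along the inclusion fully faithful. Since the canonical pseudococone restricts to
  the bicolimit pseudococone \<open>q\<close>, it is a bicolimit itself.
\<close>

section \<open>Calculus of 2-cells\<close>

text \<open>Bicompactness supplies only some bicolimit \<open>C\<close> in \<open>Cat\<close>, known
  through functors out of it, while bicofinality asks about the objects and arrows inside it. Hence
  the two test categories. The germ category keeps arrows of \<open>C\<close> as its arrows and so
  shows which objects and arrows \<open>C\<close> has, but not when two 2-cells become equal in it;
  the category of relations carries no arrows of \<open>C\<close> and decides exactly that. Both
  must be small for the universal property to apply: here the closure of \<open>universe\<close>
  under small unions enters and, for the sets of relations, under power sets. Three features of
  \<open>I\<close> shape the germs. Two cells can be compared only after their stages have been
  joined, which conditions (1) and (2) allow up to an invertible 2-cell; the choices made are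
  reconciled by (3); and (2) with (3) make every 2-cell of \<open>I\<close> invertible at a later
  stage, so that germs are invariant under all of them. The second condition of bicofinality asks
  for an invertible 2-cell, whereas fullness of the canonical functor yields a mere 2-cell at some
  stage; invertibility therefore takes an argument of its own.\<close>

definition iso2 :: "('o, 'a, 'c) twocat \<Rightarrow> 'c \<Rightarrow> bool" where
  "iso2 B \<theta> \<longleftrightarrow> inv_cell B \<theta> (dom2 B \<theta>) (cod2 B \<theta>)"

definition inv2 :: "('o, 'a, 'c) twocat \<Rightarrow> 'c \<Rightarrow> 'c" where
  "inv2 B \<theta> = (SOME \<beta>. cell B \<beta> (cod2 B \<theta>) (dom2 B \<theta>) \<and>
     \<beta> \<bullet>\<^bsub>B\<^esub> \<theta> = id2 B (dom2 B \<theta>) \<and> \<theta> \<bullet>\<^bsub>B\<^esub> \<beta> = id2 B (cod2 B \<theta>))"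

text \<open>Separates invertibility from the boundary, which then appears as two equations for
  rewriting; nearly all side conditions below are of that kind.\<close>

lemma inv_cell_iff: "inv_cell B \<theta> f g \<longleftrightarrow> iso2 B \<theta> \<and> dom2 B \<theta> = f \<and> cod2 B \<theta> = g"
  by (auto simp: iso2_def inv_cell_def cell_def)

lemma iso2_Cl [simp]: "iso2 B \<theta> \<Longrightarrow> \<theta> \<in> Cl B"
  by (auto simp: iso2_def inv_cell_def cell_def)

context two_category
begin

text \<open>Here and in the lemmas that follow, the axioms are recast from \<open>arr\<close> and
  \<open>cell\<close> to membership and boundary equations, so that composability can be decided by
  rewriting.\<close>

lemma src_Ob [simp]: "f \<in> Ar B \<Longrightarrow> src B f \<in> Ob B"
  and trg_Ob [simp]: "f \<in> Ar B \<Longrightarrow> trg B f \<in> Ob B"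
  using src_trg by auto

lemma dom2_Ar [simp]: "\<alpha> \<in> Cl B \<Longrightarrow> dom2 B \<alpha> \<in> Ar B"
  and cod2_Ar [simp]: "\<alpha> \<in> Cl B \<Longrightarrow> cod2 B \<alpha> \<in> Ar B"
  and src_cod2: "\<alpha> \<in> Cl B \<Longrightarrow> src B (cod2 B \<alpha>) = src B (dom2 B \<alpha>)"
  and trg_cod2: "\<alpha> \<in> Cl B \<Longrightarrow> trg B (cod2 B \<alpha>) = trg B (dom2 B \<alpha>)"
  using dom_cod by auto

lemma id1_simps [simp]:
  assumes "X \<in> Ob B"
  shows "id1 B X \<in> Ar B" "src B (id1 B X) = X" "trg B (id1 B X) = X"
  using id1[OF assms] by (auto simp: arr_def)

lemma cmp1_simps [simp]:
  assumes "f \<in> Ar B" "g \<in> Ar B" "trg B f = src B g"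
  shows "g \<cdot> f \<in> Ar B" "src B (g \<cdot> f) = src B f" "trg B (g \<cdot> f) = trg B g"
  using cmp1[of f _ _ g] assms by (auto simp: arr_def)

lemma cmp1_assoc' [simp]:
  "\<lbrakk>f \<in> Ar B; g \<in> Ar B; h \<in> Ar B; trg B f = src B g; trg B g = src B h\<rbrakk> \<Longrightarrow> (h \<cdot> g) \<cdot> f = h \<cdot> (g \<cdot> f)"
  using cmp1_assoc[of f _ _ g _ h] by (auto simp: arr_def)

lemma cmp1_id' [simp]:
  "\<lbrakk>f \<in> Ar B; src B f = X\<rbrakk> \<Longrightarrow> f \<cdot> id1 B X = f"
  "\<lbrakk>f \<in> Ar B; trg B f = Y\<rbrakk> \<Longrightarrow> id1 B Y \<cdot> f = f"
  using cmp1_id[of f] by (auto simp: arr_def)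

lemma id2_simps [simp]:
  assumes "f \<in> Ar B"
  shows "id2 B f \<in> Cl B" "dom2 B (id2 B f) = f" "cod2 B (id2 B f) = f"
  using id2[OF assms] by (auto simp: cell_def)

lemma vcmp_simps [simp]:
  assumes "\<alpha> \<in> Cl B" "\<beta> \<in> Cl B" "cod2 B \<alpha> = dom2 B \<beta>"
  shows "\<beta> \<bullet> \<alpha> \<in> Cl B" "dom2 B (\<beta> \<bullet> \<alpha>) = dom2 B \<alpha>" "cod2 B (\<beta> \<bullet> \<alpha>) = cod2 B \<beta>"
  using vcmp[of \<alpha> _ _ \<beta>] assms by (auto simp: cell_def)

lemma vcmp_assoc' [simp]:
  "\<lbrakk>\<alpha> \<in> Cl B; \<beta> \<in> Cl B; \<gamma> \<in> Cl B; cod2 B \<alpha> = dom2 B \<beta>; cod2 B \<beta> = dom2 B \<gamma>\<rbrakk>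
    \<Longrightarrow> (\<gamma> \<bullet> \<beta>) \<bullet> \<alpha> = \<gamma> \<bullet> (\<beta> \<bullet> \<alpha>)"
  using vcmp_assoc[of \<alpha> _ _ \<beta> _ \<gamma>] by (auto simp: cell_def)

lemma vcmp_id' [simp]:
  "\<lbrakk>\<alpha> \<in> Cl B; dom2 B \<alpha> = f\<rbrakk> \<Longrightarrow> \<alpha> \<bullet> id2 B f = \<alpha>"
  "\<lbrakk>\<alpha> \<in> Cl B; cod2 B \<alpha> = f\<rbrakk> \<Longrightarrow> id2 B f \<bullet> \<alpha> = \<alpha>"
  using vcmp_id[of \<alpha>] by (auto simp: cell_def)

lemma hcmp_simps [simp]:
  assumes "\<alpha> \<in> Cl B" "\<beta> \<in> Cl B" "trg B (dom2 B \<alpha>) = src B (dom2 B \<beta>)"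
  shows "\<beta> \<star> \<alpha> \<in> Cl B" "dom2 B (\<beta> \<star> \<alpha>) = dom2 B \<beta> \<cdot> dom2 B \<alpha>" "cod2 B (\<beta> \<star> \<alpha>) = cod2 B \<beta> \<cdot> cod2 B \<alpha>"
  using hcmp[of \<alpha> _ _ \<beta>] assms by (auto simp: cell_def)

lemma hcmp_assoc' [simp]:
  "\<lbrakk>\<alpha> \<in> Cl B; \<beta> \<in> Cl B; \<gamma> \<in> Cl B; trg B (dom2 B \<alpha>) = src B (dom2 B \<beta>); trg B (dom2 B \<beta>) = src B (dom2 B \<gamma>)\<rbrakk>
    \<Longrightarrow> (\<gamma> \<star> \<beta>) \<star> \<alpha> = \<gamma> \<star> (\<beta> \<star> \<alpha>)"
  using hcmp_assoc[of \<alpha> _ _ \<beta> _ _ \<gamma>] by (auto simp: cell_def)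

lemma hcmp_id1' [simp]:
  "\<lbrakk>\<alpha> \<in> Cl B; src B (dom2 B \<alpha>) = X\<rbrakk> \<Longrightarrow> \<alpha> \<star> id2 B (id1 B X) = \<alpha>"
  "\<lbrakk>\<alpha> \<in> Cl B; trg B (dom2 B \<alpha>) = X\<rbrakk> \<Longrightarrow> id2 B (id1 B X) \<star> \<alpha> = \<alpha>"
  using hcmp_id1[of \<alpha>] by (auto simp: cell_def)

lemma hcmp_id2' [simp]:
  "\<lbrakk>f \<in> Ar B; g \<in> Ar B; trg B f = src B g\<rbrakk> \<Longrightarrow> id2 B g \<star> id2 B f = id2 B (g \<cdot> f)"
  using hcmp_id2[of f _ _ g] by (auto simp: arr_def)

lemma interchange':
  "\<lbrakk>\<alpha> \<in> Cl B; \<alpha>' \<in> Cl B; \<beta> \<in> Cl B; \<beta>' \<in> Cl B; cod2 B \<alpha> = dom2 B \<alpha>'; cod2 B \<beta> = dom2 B \<beta>';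
    trg B (dom2 B \<alpha>) = src B (dom2 B \<beta>)\<rbrakk> \<Longrightarrow>
    (\<beta>' \<bullet> \<beta>) \<star> (\<alpha>' \<bullet> \<alpha>) = (\<beta>' \<star> \<alpha>') \<bullet> (\<beta> \<star> \<alpha>)"
  using interchange[of \<alpha> _ _ \<alpha>' _ \<beta> _ _ \<beta>'] by (auto simp: cell_def)

text \<open>Oriented against \<open>hcmp_assoc'\<close> on purpose: neighbouring identity cells are
  fused, so that a normal form has one whiskering 1-cell on either side. Where a square has to be
  matched unfused, the rule is switched off.\<close>

lemma whisker_left_left [simp]:
  "\<lbrakk>f \<in> Ar B; g \<in> Ar B; \<alpha> \<in> Cl B; trg B f = src B g; trg B (dom2 B \<alpha>) = src B f\<rbrakk> \<Longrightarrow>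
    id2 B g \<star> (id2 B f \<star> \<alpha>) = id2 B (g \<cdot> f) \<star> \<alpha>"
  using hcmp_assoc'[of \<alpha> "id2 B f" "id2 B g"] by simp

lemma whisker_left_vcmp [simp]:
  assumes "\<alpha> \<in> Cl B" "\<beta> \<in> Cl B" "cod2 B \<alpha> = dom2 B \<beta>" "g \<in> Ar B" "trg B (dom2 B \<alpha>) = src B g"
  shows "id2 B g \<star> (\<beta> \<bullet> \<alpha>) = (id2 B g \<star> \<beta>) \<bullet> (id2 B g \<star> \<alpha>)"
  using interchange'[of \<alpha> \<beta> "id2 B g" "id2 B g"] assms by simp

lemma whisker_right_vcmp [simp]:
  assumes "\<alpha> \<in> Cl B" "\<beta> \<in> Cl B" "cod2 B \<alpha> = dom2 B \<beta>" "f \<in> Ar B" "src B (dom2 B \<alpha>) = trg B f"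
  shows "(\<beta> \<bullet> \<alpha>) \<star> id2 B f = (\<beta> \<star> id2 B f) \<bullet> (\<alpha> \<star> id2 B f)"
  using interchange'[of "id2 B f" "id2 B f" \<alpha> \<beta>] assms by simp

text \<open>Both sides are \<open>\<beta> \<star> \<alpha>\<close>: interchange, with identity cells
  inserted before one factor and after the other.\<close>

lemma whisker_exchange:
  assumes "\<alpha> \<in> Cl B" "\<beta> \<in> Cl B" "trg B (dom2 B \<alpha>) = src B (dom2 B \<beta>)"
  shows "(\<beta> \<star> id2 B (cod2 B \<alpha>)) \<bullet> (id2 B (dom2 B \<beta>) \<star> \<alpha>) = (id2 B (cod2 B \<beta>) \<star> \<alpha>) \<bullet> (\<beta> \<star> id2 B (dom2 B \<alpha>))"
  using interchange'[of \<alpha> "id2 B (cod2 B \<alpha>)" "id2 B (dom2 B \<beta>)" \<beta>]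
    interchange'[of "id2 B (dom2 B \<alpha>)" \<alpha> \<beta> "id2 B (cod2 B \<beta>)"] assms by (simp add: trg_cod2 src_cod2)

lemma whisker_exchange':
  assumes "\<alpha> \<in> Cl B" "\<beta> \<in> Cl B" "dom2 B \<alpha> = f" "cod2 B \<alpha> = f'" "dom2 B \<beta> = g" "cod2 B \<beta> = g'" "trg B f = src B g"
  shows "(\<beta> \<star> id2 B f') \<bullet> (id2 B g \<star> \<alpha>) = (id2 B g' \<star> \<alpha>) \<bullet> (\<beta> \<star> id2 B f)"
  using whisker_exchange[of \<alpha> \<beta>] assms by auto

lemma iso2I:
  assumes "\<alpha> \<in> Cl B" "\<beta> \<in> Cl B" "dom2 B \<beta> = cod2 B \<alpha>" "cod2 B \<beta> = dom2 B \<alpha>"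
    "\<beta> \<bullet> \<alpha> = id2 B (dom2 B \<alpha>)" "\<alpha> \<bullet> \<beta> = id2 B (cod2 B \<alpha>)"
  shows "iso2 B \<alpha>"
  using assms unfolding iso2_def inv_cell_def cell_def by blast

lemma inv2_props:
  assumes "iso2 B \<theta>"
  shows "cell B (inv2 B \<theta>) (cod2 B \<theta>) (dom2 B \<theta>) \<and>
     inv2 B \<theta> \<bullet> \<theta> = id2 B (dom2 B \<theta>) \<and> \<theta> \<bullet> inv2 B \<theta> = id2 B (cod2 B \<theta>)"
  unfolding inv2_def
  by (rule someI_ex) (use assms in \<open>auto simp: iso2_def inv_cell_def\<close>)

lemma inv2_simps [simp]:
  assumes "iso2 B \<theta>"
  shows "inv2 B \<theta> \<in> Cl B" "dom2 B (inv2 B \<theta>) = cod2 B \<theta>" "cod2 B (inv2 B \<theta>) = dom2 B \<theta>"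
    "inv2 B \<theta> \<bullet> \<theta> = id2 B (dom2 B \<theta>)" "\<theta> \<bullet> inv2 B \<theta> = id2 B (cod2 B \<theta>)"
  using inv2_props[OF assms] by (auto simp: cell_def)

text \<open>Vertical composites are nested to the right, where a cell and its inverse meet only in
  front of a tail; cancellation is needed in this form too.\<close>

lemma inv2_tail [simp]:
  assumes "iso2 B \<theta>" "\<tau> \<in> Cl B"
  shows "cod2 B \<tau> = dom2 B \<theta> \<Longrightarrow> inv2 B \<theta> \<bullet> (\<theta> \<bullet> \<tau>) = \<tau>"
    "cod2 B \<tau> = cod2 B \<theta> \<Longrightarrow> \<theta> \<bullet> (inv2 B \<theta> \<bullet> \<tau>) = \<tau>"
proof -
  show "inv2 B \<theta> \<bullet> (\<theta> \<bullet> \<tau>) = \<tau>" if "cod2 B \<tau> = dom2 B \<theta>"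
    using vcmp_assoc'[of \<tau> \<theta> "inv2 B \<theta>", symmetric] assms that by simp
  show "\<theta> \<bullet> (inv2 B \<theta> \<bullet> \<tau>) = \<tau>" if "cod2 B \<tau> = cod2 B \<theta>"
    using vcmp_assoc'[of \<tau> "inv2 B \<theta>" \<theta>, symmetric] assms that by simp
qed

lemma inv2_unique:
  assumes "iso2 B \<theta>" "\<beta> \<in> Cl B" "dom2 B \<beta> = cod2 B \<theta>" "cod2 B \<beta> = dom2 B \<theta>" "\<beta> \<bullet> \<theta> = id2 B (dom2 B \<theta>)"
  shows "inv2 B \<theta> = \<beta>"
proof -
  have "\<beta> = (\<beta> \<bullet> \<theta>) \<bullet> inv2 B \<theta>"
    using assms(1-4) by simp
  also have "\<dots> = inv2 B \<theta>"
    unfolding assms(5) using assms(1) by simp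
  finally show ?thesis by simp
qed

lemma iso2_inv2 [simp]: "iso2 B \<theta> \<Longrightarrow> iso2 B (inv2 B \<theta>)"
  by (rule iso2I[of _ \<theta>]) auto

lemma inv2_inv2 [simp]: "iso2 B \<theta> \<Longrightarrow> inv2 B (inv2 B \<theta>) = \<theta>"
  by (rule inv2_unique) auto

lemma iso2_id2 [simp]: "f \<in> Ar B \<Longrightarrow> iso2 B (id2 B f)"
  by (rule iso2I[of _ "id2 B f"]) auto

lemma inv2_id2 [simp]: "f \<in> Ar B \<Longrightarrow> inv2 B (id2 B f) = id2 B f"
  by (rule inv2_unique) auto

lemma iso2_vcmp [simp]: "\<lbrakk>iso2 B \<alpha>; iso2 B \<beta>; cod2 B \<alpha> = dom2 B \<beta>\<rbrakk> \<Longrightarrow> iso2 B (\<beta> \<bullet> \<alpha>)"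
  by (rule iso2I[of _ "inv2 B \<alpha> \<bullet> inv2 B \<beta>"]) auto

lemma inv2_vcmp [simp]:
  "\<lbrakk>iso2 B \<alpha>; iso2 B \<beta>; cod2 B \<alpha> = dom2 B \<beta>\<rbrakk> \<Longrightarrow> inv2 B (\<beta> \<bullet> \<alpha>) = inv2 B \<alpha> \<bullet> inv2 B \<beta>"
  by (rule inv2_unique) auto

lemma iso2_hcmp [simp]:
  assumes "iso2 B \<alpha>" "iso2 B \<beta>" "trg B (dom2 B \<alpha>) = src B (dom2 B \<beta>)"
  shows "iso2 B (\<beta> \<star> \<alpha>)"
proof (rule iso2I[of _ "inv2 B \<beta> \<star> inv2 B \<alpha>"])
  show "(inv2 B \<beta> \<star> inv2 B \<alpha>) \<bullet> (\<beta> \<star> \<alpha>) = id2 B (dom2 B (\<beta> \<star> \<alpha>))"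
    using interchange'[of \<alpha> "inv2 B \<alpha>" \<beta> "inv2 B \<beta>"] assms by simp
  show "(\<beta> \<star> \<alpha>) \<bullet> (inv2 B \<beta> \<star> inv2 B \<alpha>) = id2 B (cod2 B (\<beta> \<star> \<alpha>))"
    using interchange'[of "inv2 B \<alpha>" \<alpha> "inv2 B \<beta>" \<beta>] assms by (simp add: trg_cod2 src_cod2)
qed (use assms in \<open>auto simp: trg_cod2 src_cod2\<close>)

lemma inv2_hcmp:
  assumes "iso2 B \<alpha>" "iso2 B \<beta>" "trg B (dom2 B \<alpha>) = src B (dom2 B \<beta>)"
  shows "inv2 B (\<beta> \<star> \<alpha>) = inv2 B \<beta> \<star> inv2 B \<alpha>"
proof (rule inv2_unique)
  show "(inv2 B \<beta> \<star> inv2 B \<alpha>) \<bullet> (\<beta> \<star> \<alpha>) = id2 B (dom2 B (\<beta> \<star> \<alpha>))"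
    using interchange'[of \<alpha> "inv2 B \<alpha>" \<beta> "inv2 B \<beta>"] assms by simp
qed (use assms in \<open>auto simp: trg_cod2 src_cod2\<close>)

lemma inv2_whisker [simp]:
  "\<lbrakk>iso2 B \<alpha>; g \<in> Ar B; trg B (dom2 B \<alpha>) = src B g\<rbrakk> \<Longrightarrow> inv2 B (id2 B g \<star> \<alpha>) = id2 B g \<star> inv2 B \<alpha>"
  "\<lbrakk>iso2 B \<alpha>; f \<in> Ar B; trg B f = src B (dom2 B \<alpha>)\<rbrakk> \<Longrightarrow> inv2 B (\<alpha> \<star> id2 B f) = inv2 B \<alpha> \<star> id2 B f"
  by (simp_all add: inv2_hcmp)

lemma inv2_whisker_cancel [simp]:
  assumes "iso2 B \<theta>"
  shows "\<lbrakk>f \<in> Ar B; trg B f = src B (dom2 B \<theta>)\<rbrakk> \<Longrightarrow> (inv2 B \<theta> \<star> id2 B f) \<bullet> (\<theta> \<star> id2 B f) = id2 B (dom2 B \<theta> \<cdot> f)"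
    "\<lbrakk>f \<in> Ar B; trg B f = src B (dom2 B \<theta>)\<rbrakk> \<Longrightarrow> (\<theta> \<star> id2 B f) \<bullet> (inv2 B \<theta> \<star> id2 B f) = id2 B (cod2 B \<theta> \<cdot> f)"
    "\<lbrakk>g \<in> Ar B; trg B (dom2 B \<theta>) = src B g\<rbrakk> \<Longrightarrow> (id2 B g \<star> inv2 B \<theta>) \<bullet> (id2 B g \<star> \<theta>) = id2 B (g \<cdot> dom2 B \<theta>)"
    "\<lbrakk>g \<in> Ar B; trg B (dom2 B \<theta>) = src B g\<rbrakk> \<Longrightarrow> (id2 B g \<star> \<theta>) \<bullet> (id2 B g \<star> inv2 B \<theta>) = id2 B (g \<cdot> cod2 B \<theta>)"
proof -
  have c: "src B (cod2 B \<theta>) = src B (dom2 B \<theta>)" "trg B (cod2 B \<theta>) = trg B (dom2 B \<theta>)"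
    using assms src_cod2 trg_cod2 by auto
  show "(inv2 B \<theta> \<star> id2 B f) \<bullet> (\<theta> \<star> id2 B f) = id2 B (dom2 B \<theta> \<cdot> f)"
    "(\<theta> \<star> id2 B f) \<bullet> (inv2 B \<theta> \<star> id2 B f) = id2 B (cod2 B \<theta> \<cdot> f)"
    if "f \<in> Ar B" "trg B f = src B (dom2 B \<theta>)"
    using whisker_right_vcmp[of \<theta> "inv2 B \<theta>" f, symmetric] whisker_right_vcmp[of "inv2 B \<theta>" \<theta> f, symmetric] that assms c
    by (simp_all del: whisker_right_vcmp)
  show "(id2 B g \<star> inv2 B \<theta>) \<bullet> (id2 B g \<star> \<theta>) = id2 B (g \<cdot> dom2 B \<theta>)"
    "(id2 B g \<star> \<theta>) \<bullet> (id2 B g \<star> inv2 B \<theta>) = id2 B (g \<cdot> cod2 B \<theta>)"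
    if "g \<in> Ar B" "trg B (dom2 B \<theta>) = src B g"
    using whisker_left_vcmp[of \<theta> "inv2 B \<theta>" g, symmetric] whisker_left_vcmp[of "inv2 B \<theta>" \<theta> g, symmetric] that assms c
    by (simp_all del: whisker_left_vcmp)
qed

lemma inv2_whisker_tail [simp]:
  assumes "iso2 B \<theta>" "\<tau> \<in> Cl B"
  shows "\<lbrakk>f \<in> Ar B; trg B f = src B (dom2 B \<theta>); cod2 B \<tau> = dom2 B \<theta> \<cdot> f\<rbrakk> \<Longrightarrow> (inv2 B \<theta> \<star> id2 B f) \<bullet> ((\<theta> \<star> id2 B f) \<bullet> \<tau>) = \<tau>"
    "\<lbrakk>f \<in> Ar B; trg B f = src B (dom2 B \<theta>); cod2 B \<tau> = cod2 B \<theta> \<cdot> f\<rbrakk> \<Longrightarrow> (\<theta> \<star> id2 B f) \<bullet> ((inv2 B \<theta> \<star> id2 B f) \<bullet> \<tau>) = \<tau>"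
    "\<lbrakk>g \<in> Ar B; trg B (dom2 B \<theta>) = src B g; cod2 B \<tau> = g \<cdot> dom2 B \<theta>\<rbrakk> \<Longrightarrow> (id2 B g \<star> inv2 B \<theta>) \<bullet> ((id2 B g \<star> \<theta>) \<bullet> \<tau>) = \<tau>"
    "\<lbrakk>g \<in> Ar B; trg B (dom2 B \<theta>) = src B g; cod2 B \<tau> = g \<cdot> cod2 B \<theta>\<rbrakk> \<Longrightarrow> (id2 B g \<star> \<theta>) \<bullet> ((id2 B g \<star> inv2 B \<theta>) \<bullet> \<tau>) = \<tau>"
proof -
  have c: "src B (cod2 B \<theta>) = src B (dom2 B \<theta>)" "trg B (cod2 B \<theta>) = trg B (dom2 B \<theta>)"
    using assms src_cod2 trg_cod2 by auto
  show "(inv2 B \<theta> \<star> id2 B f) \<bullet> ((\<theta> \<star> id2 B f) \<bullet> \<tau>) = \<tau>"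
    if "f \<in> Ar B" "trg B f = src B (dom2 B \<theta>)" "cod2 B \<tau> = dom2 B \<theta> \<cdot> f"
    by (subst vcmp_assoc'[symmetric]) (use that assms c in simp_all)
  show "(\<theta> \<star> id2 B f) \<bullet> ((inv2 B \<theta> \<star> id2 B f) \<bullet> \<tau>) = \<tau>"
    if "f \<in> Ar B" "trg B f = src B (dom2 B \<theta>)" "cod2 B \<tau> = cod2 B \<theta> \<cdot> f"
    by (subst vcmp_assoc'[symmetric]) (use that assms c in simp_all)
  show "(id2 B g \<star> inv2 B \<theta>) \<bullet> ((id2 B g \<star> \<theta>) \<bullet> \<tau>) = \<tau>"
    if "g \<in> Ar B" "trg B (dom2 B \<theta>) = src B g" "cod2 B \<tau> = g \<cdot> dom2 B \<theta>"
    by (subst vcmp_assoc'[symmetric]) (use that assms c in simp_all)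
  show "(id2 B g \<star> \<theta>) \<bullet> ((id2 B g \<star> inv2 B \<theta>) \<bullet> \<tau>) = \<tau>"
    if "g \<in> Ar B" "trg B (dom2 B \<theta>) = src B g" "cod2 B \<tau> = g \<cdot> cod2 B \<theta>"
    by (subst vcmp_assoc'[symmetric]) (use that assms c in simp_all)
qed

lemma vcmp_left_cancel:
  "\<lbrakk>iso2 B \<theta>; \<alpha> \<in> Cl B; \<beta> \<in> Cl B; cod2 B \<alpha> = dom2 B \<theta>; cod2 B \<beta> = dom2 B \<theta>\<rbrakk>
    \<Longrightarrow> \<theta> \<bullet> \<alpha> = \<theta> \<bullet> \<beta> \<longleftrightarrow> \<alpha> = \<beta>"
  by (metis inv2_tail(1))

lemma vcmp_right_cancel:
  assumes "iso2 B \<theta>" "\<alpha> \<in> Cl B" "\<beta> \<in> Cl B" "dom2 B \<alpha> = cod2 B \<theta>" "dom2 B \<beta> = cod2 B \<theta>"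
  shows "\<alpha> \<bullet> \<theta> = \<beta> \<bullet> \<theta> \<longleftrightarrow> \<alpha> = \<beta>"
proof
  assume "\<alpha> \<bullet> \<theta> = \<beta> \<bullet> \<theta>"
  then have "(\<alpha> \<bullet> \<theta>) \<bullet> inv2 B \<theta> = (\<beta> \<bullet> \<theta>) \<bullet> inv2 B \<theta>" by simp
  then show "\<alpha> = \<beta>" using assms by simp
qed simp

text \<open>Lets a commuting square act inside a composite nested to the right, where its left-hand
  side does not occur as a subterm.\<close>

lemma vcmp_tail:
  assumes "\<beta> \<bullet> \<alpha> = \<delta> \<bullet> \<gamma>" "\<alpha> \<in> Cl B" "\<beta> \<in> Cl B" "\<gamma> \<in> Cl B" "\<delta> \<in> Cl B" "\<tau> \<in> Cl B"
    "cod2 B \<alpha> = dom2 B \<beta>" "cod2 B \<gamma> = dom2 B \<delta>" "cod2 B \<tau> = dom2 B \<alpha>" "dom2 B \<gamma> = dom2 B \<alpha>"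
  shows "\<beta> \<bullet> (\<alpha> \<bullet> \<tau>) = \<delta> \<bullet> (\<gamma> \<bullet> \<tau>)"
  using assms vcmp_assoc'[of \<tau> \<alpha> \<beta>] vcmp_assoc'[of \<tau> \<gamma> \<delta>] by simp

end

context pseudofunctor
begin

lemma P0_Ob [simp]: "i \<in> Ob I \<Longrightarrow> P0 F i \<in> Ob J"
  by (rule P0)

lemma P1_simps [simp]:
  assumes "d \<in> Ar I"
  shows "P1 F d \<in> Ar J" "src J (P1 F d) = P0 F (src I d)" "trg J (P1 F d) = P0 F (trg I d)"
  using P1[of d] assms by (auto simp: arr_def)

lemma P2_simps [simp]:
  assumes "\<alpha> \<in> Cl I"
  shows "P2 F \<alpha> \<in> Cl J" "dom2 J (P2 F \<alpha>) = P1 F (dom2 I \<alpha>)" "cod2 J (P2 F \<alpha>) = P1 F (cod2 I \<alpha>)"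
  using P2[of \<alpha>] assms by (auto simp: cell_def)

lemma P2_id' [simp]: "d \<in> Ar I \<Longrightarrow> P2 F (id2 I d) = id2 J (P1 F d)"
  by (rule P2_id)

lemma P2_vcmp' [simp]:
  "\<lbrakk>\<alpha> \<in> Cl I; \<beta> \<in> Cl I; cod2 I \<alpha> = dom2 I \<beta>\<rbrakk> \<Longrightarrow> P2 F (\<beta> \<bullet>\<^bsub>I\<^esub> \<alpha>) = P2 F \<beta> \<bullet>\<^bsub>J\<^esub> P2 F \<alpha>"
  using P2_vcmp[of \<alpha> _ _ \<beta>] by (auto simp: cell_def)

lemma P2_iso2 [simp]: "iso2 I \<theta> \<Longrightarrow> iso2 J (P2 F \<theta>)"
proof (rule J.iso2I[of _ "P2 F (inv2 I \<theta>)"])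
  assume i: "iso2 I \<theta>"
  show "P2 F (inv2 I \<theta>) \<bullet>\<^bsub>J\<^esub> P2 F \<theta> = id2 J (dom2 J (P2 F \<theta>))"
    using i P2_vcmp'[of \<theta> "inv2 I \<theta>"] by simp
  show "P2 F \<theta> \<bullet>\<^bsub>J\<^esub> P2 F (inv2 I \<theta>) = id2 J (cod2 J (P2 F \<theta>))"
    using i P2_vcmp'[of "inv2 I \<theta>" \<theta>] by simp
qed auto

lemma P2c_simps [simp]:
  assumes "d \<in> Ar I" "e \<in> Ar I" "trg I d = src I e"
  shows "iso2 J (P2c F e d)" "dom2 J (P2c F e d) = P1 F e \<cdot>\<^bsub>J\<^esub> P1 F d" "cod2 J (P2c F e d) = P1 F (e \<cdot>\<^bsub>I\<^esub> d)"
  using P2c[of d _ _ e] assms by (auto simp: arr_def inv_cell_iff)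

lemma P0c_simps [simp]:
  assumes "i \<in> Ob I"
  shows "iso2 J (P0c F i)" "dom2 J (P0c F i) = id1 J (P0 F i)" "cod2 J (P0c F i) = P1 F (id1 I i)"
  using P0c[of i] assms by (auto simp: arr_def inv_cell_iff)

lemma P2c_natural':
  "\<lbrakk>\<alpha> \<in> Cl I; \<beta> \<in> Cl I; trg I (dom2 I \<alpha>) = src I (dom2 I \<beta>)\<rbrakk> \<Longrightarrow>
    P2c F (cod2 I \<beta>) (cod2 I \<alpha>) \<bullet>\<^bsub>J\<^esub> (P2 F \<beta> \<star>\<^bsub>J\<^esub> P2 F \<alpha>) = P2 F (\<beta> \<star>\<^bsub>I\<^esub> \<alpha>) \<bullet>\<^bsub>J\<^esub> P2c F (dom2 I \<beta>) (dom2 I \<alpha>)"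
  using P2c_natural[of \<alpha> _ _ \<beta>] by (auto simp: cell_def)

lemma coh_assoc': "\<lbrakk>d \<in> Ar I; e \<in> Ar I; f \<in> Ar I; trg I d = src I e; trg I e = src I f\<rbrakk> \<Longrightarrow>
  P2c F f (e \<cdot>\<^bsub>I\<^esub> d) \<bullet>\<^bsub>J\<^esub> (id2 J (P1 F f) \<star>\<^bsub>J\<^esub> P2c F e d) =
      P2c F (f \<cdot>\<^bsub>I\<^esub> e) d \<bullet>\<^bsub>J\<^esub> (P2c F f e \<star>\<^bsub>J\<^esub> id2 J (P1 F d))"
  using coh_assoc[of d _ _ e _ f] by (auto simp: arr_def)

lemma coh_unit':
  assumes "d \<in> Ar I"
  shows "P2c F d (id1 I (src I d)) \<bullet>\<^bsub>J\<^esub> (id2 J (P1 F d) \<star>\<^bsub>J\<^esub> P0c F (src I d)) = id2 J (P1 F d)"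
    "P2c F (id1 I (trg I d)) d \<bullet>\<^bsub>J\<^esub> (P0c F (trg I d) \<star>\<^bsub>J\<^esub> id2 J (P1 F d)) = id2 J (P1 F d)"
  using coh_unit[of d] assms by (auto simp: arr_def)

end

section \<open>Equivalences of categories\<close>

definition cInv :: "('o, 'a) cat \<Rightarrow> 'a \<Rightarrow> 'a" where
  "cInv C f = (SOME g. g \<in> cArr C \<and> cDom C g = cCod C f \<and> cCod C g = cDom C f \<and>
        cComp C g f = cId C (cDom C f) \<and> cComp C f g = cId C (cCod C f))"

context category
begin

lemma cDom_Obj [simp]: "f \<in> cArr C \<Longrightarrow> cDom C f \<in> cObj C"
  and cCod_Obj [simp]: "f \<in> cArr C \<Longrightarrow> cCod C f \<in> cObj C"
  using dom_cod by auto

lemma cId_simps [simp]: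
  "x \<in> cObj C \<Longrightarrow> cId C x \<in> cArr C" "x \<in> cObj C \<Longrightarrow> cDom C (cId C x) = x" "x \<in> cObj C \<Longrightarrow> cCod C (cId C x) = x"
  using id by auto

lemma cComp_simps [simp]:
  assumes "f \<in> cArr C" "g \<in> cArr C" "cDom C g = cCod C f"
  shows "cComp C g f \<in> cArr C" "cDom C (cComp C g f) = cDom C f" "cCod C (cComp C g f) = cCod C g"
  using comp[OF assms] by auto

lemma cComp_assoc [simp]:
  "\<lbrakk>f \<in> cArr C; g \<in> cArr C; h \<in> cArr C; cDom C g = cCod C f; cDom C h = cCod C g\<rbrakk> \<Longrightarrow>
      cComp C (cComp C h g) f = cComp C h (cComp C g f)"
  using comp_assoc by auto

lemma cComp_id [simp]:
  "\<lbrakk>f \<in> cArr C; cDom C f = x\<rbrakk> \<Longrightarrow> cComp C f (cId C x) = f"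
  "\<lbrakk>f \<in> cArr C; cCod C f = x\<rbrakk> \<Longrightarrow> cComp C (cId C x) f = f"
  using comp_id[of f] by auto

lemma cIso_Arr [simp]: "cIso C f \<Longrightarrow> f \<in> cArr C"
  by (auto simp: cIso_def)

lemma cInv_simps [simp]:
  assumes "cIso C f"
  shows "cInv C f \<in> cArr C" "cDom C (cInv C f) = cCod C f" "cCod C (cInv C f) = cDom C f"
    "cComp C (cInv C f) f = cId C (cDom C f)" "cComp C f (cInv C f) = cId C (cCod C f)"
proof -
  have "cInv C f \<in> cArr C \<and> cDom C (cInv C f) = cCod C f \<and> cCod C (cInv C f) = cDom C f \<and>
        cComp C (cInv C f) f = cId C (cDom C f) \<and> cComp C f (cInv C f) = cId C (cCod C f)"
    unfolding cInv_def by (rule someI_ex) (use assms in \<open>unfold cIso_def, blast\<close>)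
  then show "cInv C f \<in> cArr C" "cDom C (cInv C f) = cCod C f" "cCod C (cInv C f) = cDom C f"
    "cComp C (cInv C f) f = cId C (cDom C f)" "cComp C f (cInv C f) = cId C (cCod C f)" by auto
qed

lemma cIsoI:
  "\<lbrakk>f \<in> cArr C; g \<in> cArr C; cDom C g = cCod C f; cCod C g = cDom C f;
    cComp C g f = cId C (cDom C f); cComp C f g = cId C (cCod C f)\<rbrakk> \<Longrightarrow> cIso C f"
  unfolding cIso_def by blast

lemma cInv_tail [simp]:
  assumes "cIso C f" "g \<in> cArr C"
  shows "cCod C g = cDom C f \<Longrightarrow> cComp C (cInv C f) (cComp C f g) = g"
    "cCod C g = cCod C f \<Longrightarrow> cComp C f (cComp C (cInv C f) g) = g"
proof -
  show "cComp C (cInv C f) (cComp C f g) = g" if "cCod C g = cDom C f"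
    using cComp_assoc[of g f "cInv C f", symmetric] assms that by simp
  show "cComp C f (cComp C (cInv C f) g) = g" if "cCod C g = cCod C f"
    using cComp_assoc[of g "cInv C f" f, symmetric] assms that by simp
qed

lemma cIso_cInv [simp]: "cIso C f \<Longrightarrow> cIso C (cInv C f)"
  by (rule cIsoI[of _ f]) auto

lemma cIso_cId [simp]: "x \<in> cObj C \<Longrightarrow> cIso C (cId C x)"
  by (rule cIsoI[of _ "cId C x"]) auto

lemma cIso_cComp [simp]: "\<lbrakk>cIso C f; cIso C g; cDom C g = cCod C f\<rbrakk> \<Longrightarrow> cIso C (cComp C g f)"
  by (rule cIsoI[of _ "cComp C (cInv C f) (cInv C g)"]) auto

lemma cComp_left_cancel:
  assumes "cComp C f g = cComp C f h" "cIso C f" "g \<in> cArr C" "h \<in> cArr C" "cCod C g = cDom C f" "cCod C h = cDom C f"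
  shows "g = h"
  by (metis assms cInv_tail(1))

lemma cComp_right_cancel:
  assumes "cComp C g f = cComp C h f" "cIso C f" "g \<in> cArr C" "h \<in> cArr C" "cDom C g = cCod C f" "cDom C h = cCod C f"
  shows "g = h"
proof -
  have "cComp C (cComp C g f) (cInv C f) = cComp C (cComp C h f) (cInv C f)" using assms(1) by simp
  then show ?thesis using assms(2-) by simp
qed

lemma cInv_unique:
  "\<lbrakk>cIso C f; g \<in> cArr C; cDom C g = cCod C f; cCod C g = cDom C f; cComp C g f = cId C (cDom C f)\<rbrakk>
    \<Longrightarrow> cInv C f = g"
  by (rule cComp_right_cancel[of _ f]) auto

end

lemma is_functorD:
  assumes "is_functor F"
  shows "category (fDom F)" "category (fCod F)"
    "x \<in> cObj (fDom F) \<Longrightarrow> fOb F x \<in> cObj (fCod F)"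
    "f \<in> cArr (fDom F) \<Longrightarrow> fAr F f \<in> cArr (fCod F)"
    "f \<in> cArr (fDom F) \<Longrightarrow> cDom (fCod F) (fAr F f) = fOb F (cDom (fDom F) f)"
    "f \<in> cArr (fDom F) \<Longrightarrow> cCod (fCod F) (fAr F f) = fOb F (cCod (fDom F) f)"
    "x \<in> cObj (fDom F) \<Longrightarrow> fAr F (cId (fDom F) x) = cId (fCod F) (fOb F x)"
    "\<lbrakk>f \<in> cArr (fDom F); g \<in> cArr (fDom F); cDom (fDom F) g = cCod (fDom F) f\<rbrakk> \<Longrightarrow>
       fAr F (cComp (fDom F) g f) = cComp (fCod F) (fAr F g) (fAr F f)"
    "fOb F \<in> extensional (cObj (fDom F))" "fAr F \<in> extensional (cArr (fDom F))"
  using assms by (auto simp: is_functor_def Let_def PiE_def)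

lemma is_functorI:
  assumes "category (fDom F)" "category (fCod F)"
    "fOb F \<in> extensional (cObj (fDom F))" "fAr F \<in> extensional (cArr (fDom F))"
    "\<And>x. x \<in> cObj (fDom F) \<Longrightarrow> fOb F x \<in> cObj (fCod F)"
    "\<And>f. f \<in> cArr (fDom F) \<Longrightarrow> fAr F f \<in> cArr (fCod F)"
    "\<And>f. f \<in> cArr (fDom F) \<Longrightarrow> cDom (fCod F) (fAr F f) = fOb F (cDom (fDom F) f)"
    "\<And>f. f \<in> cArr (fDom F) \<Longrightarrow> cCod (fCod F) (fAr F f) = fOb F (cCod (fDom F) f)"
    "\<And>x. x \<in> cObj (fDom F) \<Longrightarrow> fAr F (cId (fDom F) x) = cId (fCod F) (fOb F x)"
    "\<And>f g. \<lbrakk>f \<in> cArr (fDom F); g \<in> cArr (fDom F); cDom (fDom F) g = cCod (fDom F) f\<rbrakk> \<Longrightarrow>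
       fAr F (cComp (fDom F) g f) = cComp (fCod F) (fAr F g) (fAr F f)"
  shows "is_functor F"
  using assms by (auto simp: is_functor_def Let_def PiE_def)

lemma functor_cIso:
  assumes F: "is_functor F" and f: "cIso (fDom F) f"
  shows "cIso (fCod F) (fAr F f)"
proof -
  interpret C: category "fDom F" using F by (rule is_functorD)
  interpret D: category "fCod F" using F by (rule is_functorD)
  note [simp] = is_functorD(3-7)[OF F] is_functorD(8)[OF F, symmetric]
  show ?thesis
    by (rule D.cIsoI[of _ "fAr F (cInv (fDom F) f)"]) (use f in auto)
qed

definition fully_faithful :: "('o, 'a, 'p, 'b) funct \<Rightarrow> bool" where
  "fully_faithful F \<longleftrightarrow> (\<forall>x\<in>cObj (fDom F). \<forall>x'\<in>cObj (fDom F). \<forall>h\<in>cArr (fCod F).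
     cDom (fCod F) h = fOb F x \<and> cCod (fCod F) h = fOb F x' \<longrightarrow>
     (\<exists>!f. f \<in> cArr (fDom F) \<and> cDom (fDom F) f = x \<and> cCod (fDom F) f = x' \<and> fAr F f = h))"

definition ess_surj :: "('o, 'a, 'p, 'b) funct \<Rightarrow> bool" where
  "ess_surj F \<longleftrightarrow> (\<forall>y\<in>cObj (fCod F). \<exists>x\<in>cObj (fDom F). \<exists>e.
     cIso (fCod F) e \<and> cDom (fCod F) e = fOb F x \<and> cCod (fCod F) e = y)"

lemma fully_faithful_ex:
  assumes "fully_faithful F" "x \<in> cObj (fDom F)" "x' \<in> cObj (fDom F)" "h \<in> cArr (fCod F)"
    "cDom (fCod F) h = fOb F x" "cCod (fCod F) h = fOb F x'"
  obtains f where "f \<in> cArr (fDom F)" "cDom (fDom F) f = x" "cCod (fDom F) f = x'" "fAr F f = h"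
  using assms unfolding fully_faithful_def by metis

lemma fully_faithful_inj:
  assumes "fully_faithful F" "is_functor F" "f \<in> cArr (fDom F)" "g \<in> cArr (fDom F)"
    "cDom (fDom F) f = cDom (fDom F) g" "cCod (fDom F) f = cCod (fDom F) g" "fAr F f = fAr F g"
  shows "f = g"
proof -
  interpret C: category "fDom F" using assms(2) by (rule is_functorD)
  have "\<exists>!k. k \<in> cArr (fDom F) \<and> cDom (fDom F) k = cDom (fDom F) g \<and> cCod (fDom F) k = cCod (fDom F) g \<and> fAr F k = fAr F g"
    using assms(1) is_functorD(4-6)[OF assms(2,4)] assms(4) unfolding fully_faithful_def by simp
  then show ?thesis using assms by metis
qed

lemma fully_faithful_cIso:
  assumes ff: "fully_faithful F" and F: "is_functor F" and f: "f \<in> cArr (fDom F)" and i: "cIso (fCod F) (fAr F f)"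
  shows "cIso (fDom F) f"
proof -
  interpret C: category "fDom F" using F by (rule is_functorD)
  interpret D: category "fCod F" using F by (rule is_functorD)
  note [simp] = is_functorD(3-8)[OF F]
  obtain g where g: "g \<in> cArr (fDom F)" "cDom (fDom F) g = cCod (fDom F) f" "cCod (fDom F) g = cDom (fDom F) f"
    "fAr F g = cInv (fCod F) (fAr F f)"
    by (rule fully_faithful_ex[OF ff, of "cCod (fDom F) f" "cDom (fDom F) f" "cInv (fCod F) (fAr F f)"])
      (use i f in auto)
  show ?thesis
  proof (rule C.cIsoI[of _ g])
    show "cComp (fDom F) g f = cId (fDom F) (cDom (fDom F) f)"
      by (rule fully_faithful_inj[OF ff F]) (use f g i in auto)
    show "cComp (fDom F) f g = cId (fDom F) (cCod (fDom F) f)"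
      by (rule fully_faithful_inj[OF ff F]) (use f g i in auto)
  qed (use f g in auto)
qed

lemma fId_simps [simp]: "fDom (fId C) = C" "fCod (fId C) = C"
  "x \<in> cObj C \<Longrightarrow> fOb (fId C) x = x" "f \<in> cArr C \<Longrightarrow> fAr (fId C) f = f"
  by (auto simp: fId_def)

lemma fComp_simps [simp]: "fDom (fComp G F) = fDom F" "fCod (fComp G F) = fCod G"
  "x \<in> cObj (fDom F) \<Longrightarrow> fOb (fComp G F) x = fOb G (fOb F x)"
  "f \<in> cArr (fDom F) \<Longrightarrow> fAr (fComp G F) f = fAr G (fAr F f)"
  by (auto simp: fComp_def)

lemma is_functor_fId: "category C \<Longrightarrow> is_functor (fId C)"
proof -
  assume "category C"
  then interpret category C .
  show ?thesis by (rule is_functorI) (auto simp: fId_def intro: category_axioms)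
qed

lemma is_functor_fComp:
  assumes "is_functor F" "is_functor G" "fDom G = fCod F"
  shows "is_functor (fComp G F)"
proof -
  interpret C: category "fDom F" using assms(1) by (rule is_functorD)
  show ?thesis
    by (rule is_functorI)
      (use assms is_functorD[OF assms(1)] is_functorD[OF assms(2)] in \<open>auto simp: fComp_def\<close>)
qed

lemma nat_isoD:
  assumes "nat_iso F G \<alpha>"
  shows "is_functor F" "is_functor G" "fDom G = fDom F" "fCod G = fCod F"
    "x \<in> cObj (fDom F) \<Longrightarrow> cIso (fCod F) (nAt \<alpha> x)"
    "x \<in> cObj (fDom F) \<Longrightarrow> cDom (fCod F) (nAt \<alpha> x) = fOb F x"
    "x \<in> cObj (fDom F) \<Longrightarrow> cCod (fCod F) (nAt \<alpha> x) = fOb G x"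
    "f \<in> cArr (fDom F) \<Longrightarrow> cComp (fCod F) (nAt \<alpha> (cCod (fDom F) f)) (fAr F f) =
       cComp (fCod F) (fAr G f) (nAt \<alpha> (cDom (fDom F) f))"
  using assms by (auto simp: nat_iso_def is_nattr_def Let_def functor_from_to_def)

lemma nat_isoI:
  assumes "is_functor F" "is_functor G" "fDom G = fDom F" "fCod G = fCod F"
    "\<And>x. x \<in> cObj (fDom F) \<Longrightarrow> cIso (fCod F) (a x)"
    "\<And>x. x \<in> cObj (fDom F) \<Longrightarrow> cDom (fCod F) (a x) = fOb F x"
    "\<And>x. x \<in> cObj (fDom F) \<Longrightarrow> cCod (fCod F) (a x) = fOb G x"
    "\<And>f. f \<in> cArr (fDom F) \<Longrightarrow> cComp (fCod F) (a (cCod (fDom F) f)) (fAr F f) =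
       cComp (fCod F) (fAr G f) (a (cDom (fDom F) f))"
  shows "nat_iso F G \<lparr>nDom = F, nCod = G, nAt = restrict a (cObj (fDom F))\<rparr>"
proof -
  interpret C: category "fDom F" using assms(1) by (rule is_functorD)
  interpret D: category "fCod F" using assms(1) by (rule is_functorD)
  show ?thesis
    using assms by (auto simp: nat_iso_def is_nattr_def Let_def functor_from_to_def)
qed

text \<open>No triangle identities are available. Naturality of \<eta> makes \<open>F\<close>
  faithful and naturality of \<epsilon> makes \<open>G\<close> faithful; fullness of
  \<open>F\<close> follows because a candidate need only be compared with \<open>h\<close> after
  applying \<open>G\<close>.\<close>

lemma is_equivalence_fully_faithful:
  assumes "is_equivalence F"
  shows "fully_faithful F" "ess_surj F"
proof -
  from assms obtain G \<eta> \<epsilon> where F: "is_functor F" and G: "is_functor G" and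
    GD [simp]: "fDom G = fCod F" "fCod G = fDom F"
    and \<eta>: "nat_iso (fId (fDom F)) (fComp G F) \<eta>" and \<epsilon>: "nat_iso (fComp F G) (fId (fCod F)) \<epsilon>"
    by (auto simp: is_equivalence_def functor_from_to_def)
  interpret C: category "fDom F" using F by (rule is_functorD)
  interpret D: category "fCod F" using F by (rule is_functorD)
  note [simp] = is_functorD(3-8)[OF F] is_functorD(3-8)[OF G, simplified]
    nat_isoD(5-7)[OF \<eta>, simplified] nat_isoD(5-7)[OF \<epsilon>, simplified]
  have e [simp]: "fOb (fComp G F) x = fOb G (fOb F x)" if "x \<in> cObj (fDom F)" for x using that by simp
  have \<eta>n: "cComp (fDom F) (nAt \<eta> (cCod (fDom F) f)) f =
       cComp (fDom F) (fAr G (fAr F f)) (nAt \<eta> (cDom (fDom F) f))" if "f \<in> cArr (fDom F)" for f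
    using nat_isoD(8)[OF \<eta>, of f] that by simp
  have \<epsilon>n: "cComp (fCod F) (nAt \<epsilon> (cCod (fCod F) f)) (fAr F (fAr G f)) =
       cComp (fCod F) f (nAt \<epsilon> (cDom (fCod F) f))" if "f \<in> cArr (fCod F)" for f
    using nat_isoD(8)[OF \<epsilon>, of f] that by simp
  have G_inj: "f = g" if fg: "f \<in> cArr (fCod F)" "g \<in> cArr (fCod F)"
    "cDom (fCod F) f = cDom (fCod F) g" "cCod (fCod F) f = cCod (fCod F) g" "fAr G f = fAr G g" for f g
    by (rule D.cComp_right_cancel[of _ "nAt \<epsilon> (cDom (fCod F) f)"]) (use fg \<epsilon>n[of f] \<epsilon>n[of g] in auto)
  have F_inj: "f = g" if fg: "f \<in> cArr (fDom F)" "g \<in> cArr (fDom F)"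
    "cDom (fDom F) f = cDom (fDom F) g" "cCod (fDom F) f = cCod (fDom F) g" "fAr F f = fAr F g" for f g
    by (rule C.cComp_left_cancel[of "nAt \<eta> (cCod (fDom F) f)"]) (use fg \<eta>n[of f] \<eta>n[of g] in auto)
  show "ess_surj F"
    unfolding ess_surj_def
  proof
    fix y assume "y \<in> cObj (fCod F)"
    then show "\<exists>x\<in>cObj (fDom F). \<exists>e. cIso (fCod F) e \<and> cDom (fCod F) e = fOb F x \<and> cCod (fCod F) e = y"
      by (intro bexI[of _ "fOb G y"] exI[of _ "nAt \<epsilon> y"]) auto
  qed
  show "fully_faithful F"
    unfolding fully_faithful_def
  proof (intro ballI impI ex_ex1I)
    fix x x' h assume h: "x \<in> cObj (fDom F)" "x' \<in> cObj (fDom F)" "h \<in> cArr (fCod F)"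
      "cDom (fCod F) h = fOb F x \<and> cCod (fCod F) h = fOb F x'"
    \<comment> \<open>The only candidate that naturality of \<eta> allows for a preimage of
      \<open>h\<close>.\<close>
    define f where "f = cComp (fDom F) (cInv (fDom F) (nAt \<eta> x')) (cComp (fDom F) (fAr G h) (nAt \<eta> x))"
    have f: "f \<in> cArr (fDom F)" "cDom (fDom F) f = x" "cCod (fDom F) f = x'"
      using h by (auto simp: f_def)
    have "fAr G (fAr F f) = fAr G h"
    proof (rule C.cComp_right_cancel[of _ "nAt \<eta> x"])
      have "cComp (fDom F) (fAr G (fAr F f)) (nAt \<eta> x) = cComp (fDom F) (nAt \<eta> x') f"
        using \<eta>n[OF f(1)] f by simp
      also have "\<dots> = cComp (fDom F) (fAr G h) (nAt \<eta> x)"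
        using h by (simp add: f_def)
      finally show "cComp (fDom F) (fAr G (fAr F f)) (nAt \<eta> x) = cComp (fDom F) (fAr G h) (nAt \<eta> x)" .
    qed (use h f in auto)
    then have "fAr F f = h"
      by (intro G_inj) (use h f in auto)
    with f show "\<exists>f. f \<in> cArr (fDom F) \<and> cDom (fDom F) f = x \<and> cCod (fDom F) f = x' \<and> fAr F f = h" by blast
  qed (use F_inj in auto)
qed

text \<open>Preimages and comparison isomorphisms are chosen object by object; on arrows the
  quasi-inverse is then forced, and uniqueness of lifts gives functoriality and naturality.\<close>

lemma fully_faithful_is_equivalence:
  assumes F: "is_functor F" and ff: "fully_faithful F" and es: "ess_surj F"
  shows "is_equivalence F"
proof -
  let ?C = "fDom F" and ?D = "fCod F"
  interpret C: category ?C using F by (rule is_functorD)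
  interpret D: category ?D using F by (rule is_functorD)
  note [simp] = is_functorD(3-8)[OF F]
  obtain g e where ge [simp]: "y \<in> cObj ?D \<Longrightarrow> g y \<in> cObj ?C" "y \<in> cObj ?D \<Longrightarrow> cIso ?D (e y)"
    "y \<in> cObj ?D \<Longrightarrow> cDom ?D (e y) = fOb F (g y)" "y \<in> cObj ?D \<Longrightarrow> cCod ?D (e y) = y" for y
    using es unfolding ess_surj_def by metis
  define lift where "lift x x' h = (THE f. f \<in> cArr ?C \<and> cDom ?C f = x \<and> cCod ?C f = x' \<and> fAr F f = h)" for x x' h
  have lift [simp]: "lift x x' h \<in> cArr ?C" "cDom ?C (lift x x' h) = x" "cCod ?C (lift x x' h) = x'" "fAr F (lift x x' h) = h"
    if "x \<in> cObj ?C" "x' \<in> cObj ?C" "h \<in> cArr ?D" "cDom ?D h = fOb F x" "cCod ?D h = fOb F x'" for x x' h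
  proof -
    have "\<exists>!f. f \<in> cArr ?C \<and> cDom ?C f = x \<and> cCod ?C f = x' \<and> fAr F f = h"
      using ff that unfolding fully_faithful_def by blast
    from theI'[OF this] show "lift x x' h \<in> cArr ?C" "cDom ?C (lift x x' h) = x" "cCod ?C (lift x x' h) = x'" "fAr F (lift x x' h) = h"
      unfolding lift_def by blast+
  qed
  note inj = fully_faithful_inj[OF ff F]
  \<comment> \<open>On arrows: the lift of \<open>h\<close> conjugated by the chosen isomorphisms,
    which is what makes \<open>e\<close> natural.\<close>
  define G where "G = \<lparr>fDom = ?D, fCod = ?C, fOb = (\<lambda>y\<in>cObj ?D. g y),
    fAr = (\<lambda>h\<in>cArr ?D. lift (g (cDom ?D h)) (g (cCod ?D h))
      (cComp ?D (cInv ?D (e (cCod ?D h))) (cComp ?D h (e (cDom ?D h)))))\<rparr>"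
  have GD [simp]: "fDom G = ?D" "fCod G = ?C" by (auto simp: G_def)
  have GO [simp]: "y \<in> cObj ?D \<Longrightarrow> fOb G y = g y" for y by (simp add: G_def)
  have GA: "fAr G h \<in> cArr ?C" "cDom ?C (fAr G h) = g (cDom ?D h)" "cCod ?C (fAr G h) = g (cCod ?D h)"
    "fAr F (fAr G h) = cComp ?D (cInv ?D (e (cCod ?D h))) (cComp ?D h (e (cDom ?D h)))"
    if "h \<in> cArr ?D" for h
    using that by (simp_all add: G_def)
  have G: "is_functor G"
  proof (rule is_functorI)
    fix y assume "y \<in> cObj (fDom G)"
    then show "fAr G (cId (fDom G) y) = cId (fCod G) (fOb G y)"
      by (intro inj) (auto simp: GA)
  next
    fix f h assume "f \<in> cArr (fDom G)" "h \<in> cArr (fDom G)" "cDom (fDom G) h = cCod (fDom G) f"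
    then show "fAr G (cComp (fDom G) h f) = cComp (fCod G) (fAr G h) (fAr G f)"
      by (intro inj) (auto simp: GA)
  qed (auto simp: GA G_def intro: C.category_axioms D.category_axioms)
  have FG: "is_functor (fComp F G)" "is_functor (fComp G F)"
    by (auto intro!: is_functor_fComp F G)
  have "nat_iso (fComp F G) (fId ?D) \<lparr>nDom = fComp F G, nCod = fId ?D, nAt = restrict e (cObj (fDom (fComp F G)))\<rparr>"
    by (rule nat_isoI) (auto intro: FG is_functor_fId D.category_axioms simp: GA)
  moreover have "nat_iso (fId ?C) (fComp G F) \<lparr>nDom = fId ?C, nCod = fComp G F,
     nAt = restrict (\<lambda>x. lift x (g (fOb F x)) (cInv ?D (e (fOb F x)))) (cObj (fDom (fId ?C)))\<rparr>"
  proof (rule nat_isoI)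
    fix f assume "f \<in> cArr (fDom (fId ?C))"
    then show "cComp (fCod (fId (fDom F))) (lift (cCod (fDom (fId (fDom F))) f) (g (fOb F (cCod (fDom (fId (fDom F))) f)))
            (cInv (fCod F) (e (fOb F (cCod (fDom (fId (fDom F))) f))))) (fAr (fId (fDom F)) f) =
         cComp (fCod (fId (fDom F))) (fAr (fComp G F) f) (lift (cDom (fDom (fId (fDom F))) f)
          (g (fOb F (cDom (fDom (fId (fDom F))) f))) (cInv (fCod F) (e (fOb F (cDom (fDom (fId (fDom F))) f)))))"
      by (intro inj) (auto simp: GA)
  next
    fix x assume "x \<in> cObj (fDom (fId ?C))"
    then show "cIso (fCod (fId (fDom F))) (lift x (g (fOb F x)) (cInv (fCod F) (e (fOb F x))))"
      by (auto intro!: fully_faithful_cIso[OF ff F])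
  qed (auto intro: FG is_functor_fId C.category_axioms simp: GA)
  ultimately show ?thesis
    unfolding is_equivalence_def functor_from_to_def using F G GD by blast
qed

section \<open>Pseudococones and bicolimits\<close>

context two_category
begin

lemma hom_cat_simps [simp]:
  "cObj (hom_cat B X Y) = {f \<in> Ar B. src B f = X \<and> trg B f = Y}"
  "cArr (hom_cat B X Y) = {\<alpha> \<in> Cl B. src B (dom2 B \<alpha>) = X \<and> trg B (dom2 B \<alpha>) = Y}"
  "cDom (hom_cat B X Y) = dom2 B" "cCod (hom_cat B X Y) = cod2 B"
  "cId (hom_cat B X Y) = id2 B" "cComp (hom_cat B X Y) = vcmp B"
  by (auto simp: hom_cat_def arr_def)

lemma category_hom_cat: "category (hom_cat B X Y)"
  by unfold_locales (auto simp: src_cod2 trg_cod2)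

lemma cIso_hom_cat:
  assumes "cIso (hom_cat B X Y) \<theta>"
  shows "iso2 B \<theta>" "src B (dom2 B \<theta>) = X" "trg B (dom2 B \<theta>) = Y"
  using assms by (auto simp: cIso_def intro: iso2I)

end

context pseudofunctor
begin

lemma pseudococoneD:
  assumes "pseudococone J I F X q"
  shows "i \<in> Ob I \<Longrightarrow> leg q i \<in> Ar J" "i \<in> Ob I \<Longrightarrow> src J (leg q i) = P0 F i" "i \<in> Ob I \<Longrightarrow> trg J (leg q i) = X"
    "d \<in> Ar I \<Longrightarrow> iso2 J (legc q d)" "d \<in> Ar I \<Longrightarrow> dom2 J (legc q d) = leg q (trg I d) \<cdot>\<^bsub>J\<^esub> P1 F d"
    "d \<in> Ar I \<Longrightarrow> cod2 J (legc q d) = leg q (src I d)"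
  using assms unfolding pseudococone_def arr_def inv_cell_iff by auto

lemma pseudococone_eqs:
  assumes "pseudococone J I F X q"
  shows "\<alpha> \<in> Cl I \<Longrightarrow> legc q (cod2 I \<alpha>) \<bullet>\<^bsub>J\<^esub> (id2 J (leg q (trg I (dom2 I \<alpha>))) \<star>\<^bsub>J\<^esub> P2 F \<alpha>) = legc q (dom2 I \<alpha>)"
    "\<lbrakk>d \<in> Ar I; e \<in> Ar I; trg I d = src I e\<rbrakk> \<Longrightarrow>
        legc q (e \<cdot>\<^bsub>I\<^esub> d) \<bullet>\<^bsub>J\<^esub> (id2 J (leg q (trg I e)) \<star>\<^bsub>J\<^esub> P2c F e d) =
        legc q d \<bullet>\<^bsub>J\<^esub> (legc q e \<star>\<^bsub>J\<^esub> id2 J (P1 F d))"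
    "i \<in> Ob I \<Longrightarrow> legc q (id1 I i) \<bullet>\<^bsub>J\<^esub> (id2 J (leg q i) \<star>\<^bsub>J\<^esub> P0c F i) = id2 J (leg q i)"
proof -
  note * = assms[unfolded pseudococone_def arr_def cell_def]
  show "legc q (cod2 I \<alpha>) \<bullet>\<^bsub>J\<^esub> (id2 J (leg q (trg I (dom2 I \<alpha>))) \<star>\<^bsub>J\<^esub> P2 F \<alpha>) = legc q (dom2 I \<alpha>)" if "\<alpha> \<in> Cl I"
    using * that by simp
  show "legc q (e \<cdot>\<^bsub>I\<^esub> d) \<bullet>\<^bsub>J\<^esub> (id2 J (leg q (trg I e)) \<star>\<^bsub>J\<^esub> P2c F e d) =
        legc q d \<bullet>\<^bsub>J\<^esub> (legc q e \<star>\<^bsub>J\<^esub> id2 J (P1 F d))" if "d \<in> Ar I" "e \<in> Ar I" "trg I d = src I e"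
    using * that by simp
  show "legc q (id1 I i) \<bullet>\<^bsub>J\<^esub> (id2 J (leg q i) \<star>\<^bsub>J\<^esub> P0c F i) = id2 J (leg q i)" if "i \<in> Ob I"
    using * that by simp
qed

lemma pseudococoneI:
  assumes "leg q \<in> extensional (Ob I)" "legc q \<in> extensional (Ar I)"
    "\<And>i. i \<in> Ob I \<Longrightarrow> leg q i \<in> Ar J" "\<And>i. i \<in> Ob I \<Longrightarrow> src J (leg q i) = P0 F i" "\<And>i. i \<in> Ob I \<Longrightarrow> trg J (leg q i) = X"
    "\<And>d. d \<in> Ar I \<Longrightarrow> iso2 J (legc q d)" "\<And>d. d \<in> Ar I \<Longrightarrow> dom2 J (legc q d) = leg q (trg I d) \<cdot>\<^bsub>J\<^esub> P1 F d"
    "\<And>d. d \<in> Ar I \<Longrightarrow> cod2 J (legc q d) = leg q (src I d)"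
    "\<And>\<alpha>. \<alpha> \<in> Cl I \<Longrightarrow> legc q (cod2 I \<alpha>) \<bullet>\<^bsub>J\<^esub> (id2 J (leg q (trg I (dom2 I \<alpha>))) \<star>\<^bsub>J\<^esub> P2 F \<alpha>) = legc q (dom2 I \<alpha>)"
    "\<And>d e. \<lbrakk>d \<in> Ar I; e \<in> Ar I; trg I d = src I e\<rbrakk> \<Longrightarrow>
        legc q (e \<cdot>\<^bsub>I\<^esub> d) \<bullet>\<^bsub>J\<^esub> (id2 J (leg q (trg I e)) \<star>\<^bsub>J\<^esub> P2c F e d) =
        legc q d \<bullet>\<^bsub>J\<^esub> (legc q e \<star>\<^bsub>J\<^esub> id2 J (P1 F d))"
    "\<And>i. i \<in> Ob I \<Longrightarrow> legc q (id1 I i) \<bullet>\<^bsub>J\<^esub> (id2 J (leg q i) \<star>\<^bsub>J\<^esub> P0c F i) = id2 J (leg q i)"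
  shows "pseudococone J I F X q"
  unfolding pseudococone_def arr_def inv_cell_iff cell_def using assms by auto

lemma modificationD:
  assumes "modification J I F X m"
  shows "i \<in> Ob I \<Longrightarrow> mAt m i \<in> Cl J" "i \<in> Ob I \<Longrightarrow> dom2 J (mAt m i) = leg (mDom m) i"
    "i \<in> Ob I \<Longrightarrow> cod2 J (mAt m i) = leg (mCod m) i"
    "pseudococone J I F X (mDom m)" "pseudococone J I F X (mCod m)" "mAt m \<in> extensional (Ob I)"
  using assms unfolding modification_def cell_def by auto

lemma modification_eq:
  "\<lbrakk>modification J I F X m; d \<in> Ar I\<rbrakk> \<Longrightarrow> mAt m (src I d) \<bullet>\<^bsub>J\<^esub> legc (mDom m) d =
    legc (mCod m) d \<bullet>\<^bsub>J\<^esub> (mAt m (trg I d) \<star>\<^bsub>J\<^esub> id2 J (P1 F d))"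
  unfolding modification_def arr_def by auto

lemma modificationI:
  assumes "pseudococone J I F X (mDom m)" "pseudococone J I F X (mCod m)" "mAt m \<in> extensional (Ob I)"
    "\<And>i. i \<in> Ob I \<Longrightarrow> mAt m i \<in> Cl J" "\<And>i. i \<in> Ob I \<Longrightarrow> dom2 J (mAt m i) = leg (mDom m) i"
    "\<And>i. i \<in> Ob I \<Longrightarrow> cod2 J (mAt m i) = leg (mCod m) i"
    "\<And>d. d \<in> Ar I \<Longrightarrow> mAt m (src I d) \<bullet>\<^bsub>J\<^esub> legc (mDom m) d =
      legc (mCod m) d \<bullet>\<^bsub>J\<^esub> (mAt m (trg I d) \<star>\<^bsub>J\<^esub> id2 J (P1 F d))"
  shows "modification J I F X m"
  unfolding modification_def arr_def cell_def using assms by auto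

lemma cocone_cat_simps [simp]:
  "cObj (cocone_cat J I F X) = {q. pseudococone J I F X q}"
  "cArr (cocone_cat J I F X) = {m. modification J I F X m}"
  "cDom (cocone_cat J I F X) = mDom" "cCod (cocone_cat J I F X) = mCod"
  "mDom (cId (cocone_cat J I F X) q) = q" "mCod (cId (cocone_cat J I F X) q) = q"
  "i \<in> Ob I \<Longrightarrow> mAt (cId (cocone_cat J I F X) q) i = id2 J (leg q i)"
  "mDom (cComp (cocone_cat J I F X) n m) = mDom m" "mCod (cComp (cocone_cat J I F X) n m) = mCod n"
  "i \<in> Ob I \<Longrightarrow> mAt (cComp (cocone_cat J I F X) n m) i = mAt n i \<bullet>\<^bsub>J\<^esub> mAt m i"
  by (auto simp: cocone_cat_def)

lemma mAt_extensional [simp]: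
  "mAt (cId (cocone_cat J I F X) q) \<in> extensional (Ob I)"
  "mAt (cComp (cocone_cat J I F X) n m) \<in> extensional (Ob I)"
  by (auto simp: cocone_cat_def)

lemma modif_eqI:
  assumes "mDom m = mDom n" "mCod m = mCod n" "mAt m \<in> extensional (Ob I)" "mAt n \<in> extensional (Ob I)"
    "\<And>i. i \<in> Ob I \<Longrightarrow> mAt m i = mAt n i"
  shows "m = (n :: ('i, 'j, 'a, 'c) modif)"
proof -
  have "mAt m = mAt n" using assms by (intro extensionalityI) auto
  then show ?thesis using assms(1,2) by (cases m, cases n) simp
qed

lemma modification_cId:
  assumes "pseudococone J I F X q"
  shows "modification J I F X (cId (cocone_cat J I F X) q)"
  by (rule modificationI) (use assms pseudococoneD[OF assms] in auto)

lemma modification_cComp: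
  assumes m: "modification J I F X m" and n: "modification J I F X n" and [simp]: "mCod m = mDom n"
  shows "modification J I F X (cComp (cocone_cat J I F X) n m)"
proof (rule modificationI)
  fix d assume d: "d \<in> Ar I"
  note [simp] = modificationD(1-3)[OF m] modificationD(1-3)[OF n]
    pseudococoneD[OF modificationD(4)[OF m]] pseudococoneD[OF modificationD(4)[OF n]]  pseudococoneD[OF modificationD(5)[OF n]]
  have "mAt n (src I d) \<bullet>\<^bsub>J\<^esub> (mAt m (src I d) \<bullet>\<^bsub>J\<^esub> legc (mDom m) d)
    = mAt n (src I d) \<bullet>\<^bsub>J\<^esub> (legc (mDom n) d \<bullet>\<^bsub>J\<^esub> (mAt m (trg I d) \<star>\<^bsub>J\<^esub> id2 J (P1 F d)))"
    using modification_eq[OF m d] by simp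
  also have "\<dots> = legc (mCod n) d \<bullet>\<^bsub>J\<^esub> (mAt n (trg I d) \<star>\<^bsub>J\<^esub> id2 J (P1 F d) \<bullet>\<^bsub>J\<^esub> (mAt m (trg I d) \<star>\<^bsub>J\<^esub> id2 J (P1 F d)))"
    by (rule J.vcmp_tail) (use d modification_eq[OF n d] in auto)
  finally show "mAt (cComp (cocone_cat J I F X) n m) (src I d) \<bullet>\<^bsub>J\<^esub> legc (mDom (cComp (cocone_cat J I F X) n m)) d =
      legc (mCod (cComp (cocone_cat J I F X) n m)) d \<bullet>\<^bsub>J\<^esub> (mAt (cComp (cocone_cat J I F X) n m) (trg I d) \<star>\<^bsub>J\<^esub> id2 J (P1 F d))"
    using d by simp
qed (use modificationD[OF m] modificationD[OF n] in auto)

lemma category_cocone_cat: "category (cocone_cat J I F X)"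
proof
  fix f g h assume "f \<in> cArr (cocone_cat J I F X)" "g \<in> cArr (cocone_cat J I F X)" "h \<in> cArr (cocone_cat J I F X)"
    "cDom (cocone_cat J I F X) g = cCod (cocone_cat J I F X) f" "cDom (cocone_cat J I F X) h = cCod (cocone_cat J I F X) g"
  then show "cComp (cocone_cat J I F X) (cComp (cocone_cat J I F X) h g) f = cComp (cocone_cat J I F X) h (cComp (cocone_cat J I F X) g f)"
    using modificationD[of X f] modificationD[of X g] modificationD[of X h]
    by (intro modif_eqI) auto
next
  fix f assume "f \<in> cArr (cocone_cat J I F X)"
  then show "cComp (cocone_cat J I F X) f (cId (cocone_cat J I F X) (cDom (cocone_cat J I F X) f)) = f \<and>
         cComp (cocone_cat J I F X) (cId (cocone_cat J I F X) (cCod (cocone_cat J I F X) f)) f = f"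
    using modificationD[of X f] pseudococoneD[of X]
    by (intro conjI modif_eqI) auto
qed (auto intro: modificationD modification_cId modification_cComp)

lemma cocone_cat_cIso:
  assumes m: "modification J I F X m"
  shows "cIso (cocone_cat J I F X) m \<longleftrightarrow> (\<forall>i\<in>Ob I. iso2 J (mAt m i))"
proof
  assume "cIso (cocone_cat J I F X) m"
  then obtain n where n: "modification J I F X n" "mDom n = mCod m" "mCod n = mDom m"
    and eq: "cComp (cocone_cat J I F X) n m = cId (cocone_cat J I F X) (mDom m)"
      "cComp (cocone_cat J I F X) m n = cId (cocone_cat J I F X) (mCod m)"
    unfolding cIso_def by auto
  show "\<forall>i\<in>Ob I. iso2 J (mAt m i)"
  proof
    fix i assume i: "i \<in> Ob I"
    have "mAt n i \<bullet>\<^bsub>J\<^esub> mAt m i = id2 J (leg (mDom m) i)" "mAt m i \<bullet>\<^bsub>J\<^esub> mAt n i = id2 J (leg (mCod m) i)"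
      using arg_cong[OF eq(1), of "\<lambda>k. mAt k i"] arg_cong[OF eq(2), of "\<lambda>k. mAt k i"] i by simp_all
    then show "iso2 J (mAt m i)"
      using i n modificationD[OF m] modificationD[OF n(1)] by (intro J.iso2I[of _ "mAt n i"]) auto
  qed
next
  assume iso: "\<forall>i\<in>Ob I. iso2 J (mAt m i)"
  interpret category "cocone_cat J I F X" by (rule category_cocone_cat)
  note [simp] = modificationD(1-3)[OF m] pseudococoneD[OF modificationD(4)[OF m]] pseudococoneD[OF modificationD(5)[OF m]]
  let ?n = "\<lparr>mDom = mCod m, mCod = mDom m, mAt = (\<lambda>i\<in>Ob I. inv2 J (mAt m i))\<rparr>"
  have n: "modification J I F X ?n"
  proof (rule modificationI)
    fix d assume d: "d \<in> Ar I"
    \<comment> \<open>The modification law of \<open>m\<close>, composed with inverse components on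
      both sides, is the law for the componentwise inverse.\<close>
    have "inv2 J (mAt m (src I d)) \<bullet>\<^bsub>J\<^esub> ((legc (mCod m) d \<bullet>\<^bsub>J\<^esub> (mAt m (trg I d) \<star>\<^bsub>J\<^esub> id2 J (P1 F d))) \<bullet>\<^bsub>J\<^esub> inv2 J (mAt m (trg I d) \<star>\<^bsub>J\<^esub> id2 J (P1 F d)))
       = inv2 J (mAt m (src I d)) \<bullet>\<^bsub>J\<^esub> ((mAt m (src I d) \<bullet>\<^bsub>J\<^esub> legc (mDom m) d) \<bullet>\<^bsub>J\<^esub> inv2 J (mAt m (trg I d) \<star>\<^bsub>J\<^esub> id2 J (P1 F d)))"
      using modification_eq[OF m d] by simp
    then have "inv2 J (mAt m (src I d)) \<bullet>\<^bsub>J\<^esub> legc (mCod m) d = legc (mDom m) d \<bullet>\<^bsub>J\<^esub> inv2 J (mAt m (trg I d) \<star>\<^bsub>J\<^esub> id2 J (P1 F d))"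
      using iso d by (simp del: J.inv2_whisker)
    then show "mAt ?n (src I d) \<bullet>\<^bsub>J\<^esub> legc (mDom ?n) d = legc (mCod ?n) d \<bullet>\<^bsub>J\<^esub> (mAt ?n (trg I d) \<star>\<^bsub>J\<^esub> id2 J (P1 F d))"
      using d iso by simp
  qed (use iso modificationD[OF m] in auto)
  show "cIso (cocone_cat J I F X) m"
    by (rule cIsoI[of _ ?n]) (use m n iso in \<open>auto intro!: modif_eqI\<close>)
qed

lemma cocone_post_simps [simp]:
  "i \<in> Ob I \<Longrightarrow> leg (cocone_post J I g q) i = g \<cdot>\<^bsub>J\<^esub> leg q i"
  "d \<in> Ar I \<Longrightarrow> legc (cocone_post J I g q) d = id2 J g \<star>\<^bsub>J\<^esub> legc q d"
  by (auto simp: cocone_post_def)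

lemma modif_post_simps [simp]:
  "mDom (modif_post J I g m) = cocone_post J I g (mDom m)" "mCod (modif_post J I g m) = cocone_post J I g (mCod m)"
  "i \<in> Ob I \<Longrightarrow> mAt (modif_post J I g m) i = id2 J g \<star>\<^bsub>J\<^esub> mAt m i" "mAt (modif_post J I g m) \<in> extensional (Ob I)"
  by (auto simp: modif_post_def)

lemma cocone_post2_simps [simp]:
  "mDom (cocone_post2 J I \<gamma> q) = cocone_post J I (dom2 J \<gamma>) q" "mCod (cocone_post2 J I \<gamma> q) = cocone_post J I (cod2 J \<gamma>) q"
  "i \<in> Ob I \<Longrightarrow> mAt (cocone_post2 J I \<gamma> q) i = \<gamma> \<star>\<^bsub>J\<^esub> id2 J (leg q i)" "mAt (cocone_post2 J I \<gamma> q) \<in> extensional (Ob I)"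
  by (auto simp: cocone_post2_def)

lemma pseudococone_post:
  assumes q: "pseudococone J I F X q" and g: "g \<in> Ar J" "src J g = X" "trg J g = Y"
  shows "pseudococone J I F Y (cocone_post J I g q)"
proof -
  note [simp] = pseudococoneD[OF q]
  show ?thesis
  proof (rule pseudococoneI)
    fix \<alpha> assume \<alpha>: "\<alpha> \<in> Cl I"
    show "legc (cocone_post J I g q) (cod2 I \<alpha>) \<bullet>\<^bsub>J\<^esub> (id2 J (leg (cocone_post J I g q) (trg I (dom2 I \<alpha>))) \<star>\<^bsub>J\<^esub> P2 F \<alpha>) =
      legc (cocone_post J I g q) (dom2 I \<alpha>)"
      using arg_cong[OF pseudococone_eqs(1)[OF q \<alpha>], of "\<lambda>x. id2 J g \<star>\<^bsub>J\<^esub> x"] \<alpha> g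
      by (simp add: I.trg_cod2 I.src_cod2)
  next
    fix d e assume d: "d \<in> Ar I" "e \<in> Ar I" "trg I d = src I e"
    show "legc (cocone_post J I g q) (e \<cdot>\<^bsub>I\<^esub> d) \<bullet>\<^bsub>J\<^esub> (id2 J (leg (cocone_post J I g q) (trg I e)) \<star>\<^bsub>J\<^esub> P2c F e d) =
       legc (cocone_post J I g q) d \<bullet>\<^bsub>J\<^esub> (legc (cocone_post J I g q) e \<star>\<^bsub>J\<^esub> id2 J (P1 F d))"
      using arg_cong[OF pseudococone_eqs(2)[OF q d], of "\<lambda>x. id2 J g \<star>\<^bsub>J\<^esub> x"] d g by simp
  next
    fix i assume i: "i \<in> Ob I"
    show "legc (cocone_post J I g q) (id1 I i) \<bullet>\<^bsub>J\<^esub> (id2 J (leg (cocone_post J I g q) i) \<star>\<^bsub>J\<^esub> P0c F i) =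
         id2 J (leg (cocone_post J I g q) i)"
      using arg_cong[OF pseudococone_eqs(3)[OF q i], of "\<lambda>x. id2 J g \<star>\<^bsub>J\<^esub> x"] i g by simp
  qed (use g in \<open>auto simp: cocone_post_def\<close>)
qed

text \<open>An equality, since 2-categories are strict and pseudococones extensional. Hence the
  comparison functor sends the identity of the vertex to \<open>q\<close> itself, as
  \<open>is_bicolimit\<close> demands.\<close>

lemma cocone_post_id1:
  assumes q: "pseudococone J I F L q" and L: "L \<in> Ob J"
  shows "cocone_post J I (id1 J L) q = q"
proof -
  note [simp] = pseudococoneD[OF q]
  have "leg (cocone_post J I (id1 J L) q) = leg q" "legc (cocone_post J I (id1 J L) q) = legc q"
    using q unfolding pseudococone_def by (auto simp: cocone_post_def extensional_def restrict_def fun_eq_iff L)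
  then show ?thesis by (cases q) (simp add: cocone_post_def)
qed

lemma modification_post2:
  assumes q: "pseudococone J I F X q" and g: "\<gamma> \<in> Cl J" "src J (dom2 J \<gamma>) = X" "trg J (dom2 J \<gamma>) = Y"
  shows "modification J I F Y (cocone_post2 J I \<gamma> q)"
proof (rule modificationI)
  note [simp] = pseudococoneD[OF q]
  fix d assume d: "d \<in> Ar I"
  then show "mAt (cocone_post2 J I \<gamma> q) (src I d) \<bullet>\<^bsub>J\<^esub> legc (mDom (cocone_post2 J I \<gamma> q)) d =
    legc (mCod (cocone_post2 J I \<gamma> q)) d \<bullet>\<^bsub>J\<^esub> (mAt (cocone_post2 J I \<gamma> q) (trg I d) \<star>\<^bsub>J\<^esub> id2 J (P1 F d))"
    using J.whisker_exchange[of "legc q d" \<gamma>] g by simp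
qed (use g pseudococone_post[OF q] pseudococoneD(1-3)[OF q] J.src_cod2 J.trg_cod2 in auto)

end

section \<open>Comparison functors given by composition with a pseudococone\<close>

definition cocone_functor :: "('o, 'a, 'c) twocat \<Rightarrow> ('i, 'j, 'k) twocat \<Rightarrow>
    ('i, 'j, 'k, 'o, 'a, 'c) psfun \<Rightarrow> 'o \<Rightarrow> ('i, 'j, 'a, 'c) cocone \<Rightarrow> 'o \<Rightarrow>
    ('a, 'c, ('i, 'j, 'a, 'c) cocone, ('i, 'j, 'a, 'c) modif) funct" where
  "cocone_functor B I F L q X = \<lparr>fDom = hom_cat B L X, fCod = cocone_cat B I F X,
     fOb = (\<lambda>f\<in>cObj (hom_cat B L X). cocone_post B I f q),
     fAr = (\<lambda>\<gamma>\<in>cArr (hom_cat B L X). cocone_post2 B I \<gamma> q)\<rparr>"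

context pseudofunctor
begin

lemma is_functor_cocone_functor:
  assumes q: "pseudococone J I F L q"
  shows "is_functor (cocone_functor J I F L q X)"
proof (rule is_functorI)
  let ?C = "cocone_functor J I F L q X"
  note [simp] = pseudococoneD[OF q]
  show "category (fDom ?C)" "category (fCod ?C)"
    by (simp_all add: cocone_functor_def J.category_hom_cat category_cocone_cat)
  fix f assume "f \<in> cObj (fDom ?C)"
  then show "fAr ?C (cId (fDom ?C) f) = cId (fCod ?C) (fOb ?C f)"
    by (intro modif_eqI) (auto simp: cocone_functor_def)
next
  let ?C = "cocone_functor J I F L q X"
  note [simp] = pseudococoneD[OF q]
  fix f g assume "f \<in> cArr (fDom ?C)" "g \<in> cArr (fDom ?C)" "cDom (fDom ?C) g = cCod (fDom ?C) f"
  then show "fAr ?C (cComp (fDom ?C) g f) = cComp (fCod ?C) (fAr ?C g) (fAr ?C f)"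
    by (intro modif_eqI) (auto simp: cocone_functor_def)
qed (auto simp: cocone_functor_def J.src_cod2 J.trg_cod2 intro: pseudococone_post[OF q] modification_post2[OF q])

text \<open>If inclusions are given, the structure isomorphisms of the equivalences may be taken to be identities.\<close>

lemma is_bicolimitI:
  assumes L: "L \<in> Ob J" and q: "pseudococone J I F L q"
    and eq: "\<And>X. X \<in> Ob J \<Longrightarrow> fully_faithful (cocone_functor J I F L q X) \<and> ess_surj (cocone_functor J I F L q X)"
  shows "is_bicolimit J I F L q"
proof -
  note [simp] = pseudococoneD[OF q]
  note id = cocone_post_id1[OF q L]
  have post: "cocone_post J I g (cocone_post J I f q) = cocone_post J I (g \<cdot>\<^bsub>J\<^esub> f) q"
    if "f \<in> Ar J" "g \<in> Ar J" "src J f = L" "trg J f = src J g" for f g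
    using that by (auto simp: cocone_post_def intro!: restrict_ext)
  define \<sigma> where "\<sigma> = (\<lambda>g f. cId (cocone_cat J I F (trg J g)) (cocone_post J I (g \<cdot>\<^bsub>J\<^esub> f) q))"
  have "bicolimit_equivalence J I F L (cocone_functor J I F L q) \<sigma>"
  proof
    fix X assume X: "X \<in> Ob J"
    show "functor_from_to (hom_cat J L X) (cocone_cat J I F X) (cocone_functor J I F L q X) \<and>
         is_equivalence (cocone_functor J I F L q X)"
      using fully_faithful_is_equivalence[OF is_functor_cocone_functor[OF q]] eq[OF X] is_functor_cocone_functor[OF q]
      by (auto simp: functor_from_to_def cocone_functor_def)
  next
    fix g X Y f assume a: "arr J g X Y" "arr J f L X"
    interpret category "cocone_cat J I F Y" by (rule category_cocone_cat)
    show "cIso (cocone_cat J I F Y) (\<sigma> g f) \<and> mDom (\<sigma> g f) = cocone_post J I g (fOb (cocone_functor J I F L q X) f) \<and>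
       mCod (\<sigma> g f) = fOb (cocone_functor J I F L q Y) (g \<cdot>\<^bsub>J\<^esub> f)"
      using a by (auto simp: arr_def \<sigma>_def cocone_functor_def post pseudococone_post[OF q])
  next
    fix g X Y f \<alpha> f' assume a: "arr J g X Y" "arr J f L X" "cell J \<alpha> f f'"
    then show "cComp (cocone_cat J I F Y) (\<sigma> g f') (modif_post J I g (fAr (cocone_functor J I F L q X) \<alpha>)) =
       cComp (cocone_cat J I F Y) (fAr (cocone_functor J I F L q Y) (id2 J g \<star>\<^bsub>J\<^esub> \<alpha>)) (\<sigma> g f)"
      using J.src_cod2[of \<alpha>] J.trg_cod2[of \<alpha>]
      by (intro modif_eqI) (auto simp: arr_def cell_def \<sigma>_def cocone_functor_def post)
  next
    fix g X Y f \<alpha> g' assume a: "arr J g X Y" "arr J f L X" "cell J \<alpha> g g'"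
    then show "cComp (cocone_cat J I F Y) (\<sigma> g' f) (cocone_post2 J I \<alpha> (fOb (cocone_functor J I F L q X) f)) =
       cComp (cocone_cat J I F Y) (fAr (cocone_functor J I F L q Y) (\<alpha> \<star>\<^bsub>J\<^esub> id2 J f)) (\<sigma> g f)"
      using J.src_cod2[of \<alpha>] J.trg_cod2[of \<alpha>]
      by (intro modif_eqI) (auto simp: arr_def cell_def \<sigma>_def cocone_functor_def post)
  next
    fix g X Y h Z f assume "arr J g X Y" "arr J h Y Z" "arr J f L X"
    then show "\<sigma> (h \<cdot>\<^bsub>J\<^esub> g) f = cComp (cocone_cat J I F Z) (\<sigma> h (g \<cdot>\<^bsub>J\<^esub> f)) (modif_post J I h (\<sigma> g f))"
      by (intro modif_eqI) (auto simp: arr_def \<sigma>_def cocone_functor_def post)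
  next
    fix f X assume "arr J f L X"
    then show "\<sigma> (id1 J X) f = cId (cocone_cat J I F X) (fOb (cocone_functor J I F L q X) f)"
      by (auto simp: arr_def \<sigma>_def cocone_functor_def)
  qed (rule L)
  moreover have "fOb (cocone_functor J I F L q L) (id1 J L) = q"
    using L by (simp add: cocone_functor_def id)
  ultimately show ?thesis unfolding is_bicolimit_def by blast
qed

end

text \<open>The bicategorical Yoneda argument: \<open>\<sigma> f (id1 B L)\<close> is an isomorphism
  from the composite of \<open>f\<close> with \<open>q\<close> to the value of
  \<open>\<Phi> X\<close> at \<open>f\<close>, natural in \<open>f\<close> by
  \<open>natural_cell\<close>. So composition with \<open>q\<close> is isomorphic to the given
  equivalence and shares its full faithfulness and essential surjectivity. From here on bicolimits
  are handled through \<open>q\<close> and no longer through a family \<Phi>.\<close>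

lemma is_bicolimitD:
  assumes "is_bicolimit B I F L q"
  shows "pseudofunctor I B F" "L \<in> Ob B" "pseudococone B I F L q"
    "X \<in> Ob B \<Longrightarrow> fully_faithful (cocone_functor B I F L q X)"
    "X \<in> Ob B \<Longrightarrow> ess_surj (cocone_functor B I F L q X)"
proof -
  from assms obtain \<Phi> \<sigma> where "bicolimit_equivalence B I F L \<Phi> \<sigma>" and q_def: "fOb (\<Phi> L) (id1 B L) = q"
    unfolding is_bicolimit_def by blast
  then interpret \<Phi>: bicolimit_equivalence B I F L \<Phi> \<sigma> by simp
  note J = \<Phi>.J.two_category_axioms
  show "pseudofunctor I B F" ..
  show L: "L \<in> Ob B" by (rule \<Phi>.vertex)
  have \<Phi>f: "is_functor (\<Phi> X)" and [simp]: "fDom (\<Phi> X) = hom_cat B L X" "fCod (\<Phi> X) = cocone_cat B I F X"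
    and \<Phi>ff: "fully_faithful (\<Phi> X)" "ess_surj (\<Phi> X)"
    if "X \<in> Ob B" for X
    using \<Phi>.equiv[OF that] is_equivalence_fully_faithful by (auto simp: functor_from_to_def)
  show q: "pseudococone B I F L q"
    using is_functorD(3)[OF \<Phi>f[OF L], of "id1 B L"] L by (simp add: q_def)
  {
    assume X: "X \<in> Ob B"
    interpret C: category "cocone_cat B I F X" by (rule \<Phi>.category_cocone_cat)
    note F = is_functorD(3-8)[OF \<Phi>f[OF X]]
    have \<sigma>: "cIso (cocone_cat B I F X) (\<sigma> f (id1 B L))" "mDom (\<sigma> f (id1 B L)) = cocone_post B I f q"
      "mCod (\<sigma> f (id1 B L)) = fOb (\<Phi> X) f" if "f \<in> Ar B" "src B f = L" "trg B f = X" for f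
      using \<Phi>.iso[of f L X "id1 B L"] that L by (simp_all add: arr_def q_def)
    have \<sigma>2: "cComp (cocone_cat B I F X) (\<sigma> (cod2 B \<gamma>) (id1 B L)) (cocone_post2 B I \<gamma> q) =
      cComp (cocone_cat B I F X) (fAr (\<Phi> X) \<gamma>) (\<sigma> (dom2 B \<gamma>) (id1 B L))"
      if "\<gamma> \<in> Cl B" "src B (dom2 B \<gamma>) = L" "trg B (dom2 B \<gamma>) = X" for \<gamma>
      using \<Phi>.natural_cell[of "dom2 B \<gamma>" L X "id1 B L" \<gamma> "cod2 B \<gamma>"] that L by (simp add: arr_def cell_def q_def)
    let ?K = "cocone_functor B I F L q X"
    have [simp]: "fDom ?K = hom_cat B L X" "fCod ?K = cocone_cat B I F X"
      "\<And>f. f \<in> Ar B \<Longrightarrow> src B f = L \<Longrightarrow> trg B f = X \<Longrightarrow> fOb ?K f = cocone_post B I f q"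
      "\<And>f. f \<in> Cl B \<Longrightarrow> src B (dom2 B f) = L \<Longrightarrow> trg B (dom2 B f) = X \<Longrightarrow> fAr ?K f = cocone_post2 B I f q"
      by (auto simp: cocone_functor_def)
    show "ess_surj ?K"
      unfolding ess_surj_def
    proof
      fix r assume r: "r \<in> cObj (fCod ?K)"
      then obtain f e where f: "f \<in> Ar B" "src B f = L" "trg B f = X" and e: "cIso (cocone_cat B I F X) e"
         "mDom e = fOb (\<Phi> X) f" "mCod e = r"
        using \<Phi>ff(2)[OF X] X unfolding ess_surj_def by auto
      have "cIso (cocone_cat B I F X) (cComp (cocone_cat B I F X) e (\<sigma> f (id1 B L)))"
        using e \<sigma>[OF f] by (intro C.cIso_cComp) auto
      then show "\<exists>x\<in>cObj (fDom ?K). \<exists>e. cIso (fCod ?K) e \<and> cDom (fCod ?K) e = fOb ?K x \<and> cCod (fCod ?K) e = r"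
        using f e \<sigma>[OF f] by (intro bexI[of _ f] exI[of _ "cComp (cocone_cat B I F X) e (\<sigma> f (id1 B L))"]) auto
    qed
    show "fully_faithful ?K"
      unfolding fully_faithful_def
    proof (intro ballI impI ex_ex1I)
      fix f g h assume "f \<in> cObj (fDom ?K)" "g \<in> cObj (fDom ?K)" "h \<in> cArr (fCod ?K)"
        "cDom (fCod ?K) h = fOb ?K f \<and> cCod (fCod ?K) h = fOb ?K g"
      then have f: "f \<in> Ar B" "src B f = L" "trg B f = X" and g: "g \<in> Ar B" "src B g = L" "trg B g = X" and
        h: "h \<in> cArr (cocone_cat B I F X)" "mDom h = cocone_post B I f q" "mCod h = cocone_post B I g q"
        by auto
      note s [simp] = \<sigma>[OF f] \<sigma>[OF g]
      note [simp] = C.cIso_Arr[OF \<sigma>(1)[OF f]] C.cIso_Arr[OF \<sigma>(1)[OF g]]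
      \<comment> \<open>\<open>h\<close> conjugated by the Yoneda isomorphism, so that fullness of
        \<open>\<Phi> X\<close> applies to it.\<close>
      let ?h = "cComp (cocone_cat B I F X) (\<sigma> g (id1 B L)) (cComp (cocone_cat B I F X) h (cInv (cocone_cat B I F X) (\<sigma> f (id1 B L))))"
      have h': "?h \<in> cArr (cocone_cat B I F X)" "mDom ?h = fOb (\<Phi> X) f" "mCod ?h = fOb (\<Phi> X) g"
        using h C.cIso_Arr[OF s(4)] C.cInv_simps(1-3)[OF s(1)] C.cComp_simps[of "cInv (cocone_cat B I F X) (\<sigma> f (id1 B L))" h]
          C.cComp_simps[of "cComp (cocone_cat B I F X) h (cInv (cocone_cat B I F X) (\<sigma> f (id1 B L)))" "\<sigma> g (id1 B L)"]
        by (auto simp del: C.cInv_simps(1-3) C.cComp_simps)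
      obtain \<gamma> where \<gamma>: "\<gamma> \<in> Cl B" "dom2 B \<gamma> = f" "cod2 B \<gamma> = g" "fAr (\<Phi> X) \<gamma> = ?h"
        by (rule fully_faithful_ex[OF \<Phi>ff(1)[OF X], of f g ?h]) (use X f g h' in auto)
      have m2: "cocone_post2 B I \<gamma> q \<in> cArr (cocone_cat B I F X)"
        using \<Phi>.modification_post2[OF q, of \<gamma>] \<gamma> f by simp
      have "cocone_post2 B I \<gamma> q = h"
      proof (rule C.cComp_left_cancel[of "\<sigma> g (id1 B L)"])
        show "cComp (cocone_cat B I F X) (\<sigma> g (id1 B L)) (cocone_post2 B I \<gamma> q) = cComp (cocone_cat B I F X) (\<sigma> g (id1 B L)) h"
          using \<sigma>2[of \<gamma>] \<gamma> f h C.cInv_simps[OF s(1)] by (simp del: \<Phi>.cocone_cat_simps(2) C.cInv_simps)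
      qed (use h m2 \<gamma> in auto)
      then show "\<exists>k. k \<in> cArr (fDom ?K) \<and> cDom (fDom ?K) k = f \<and> cCod (fDom ?K) k = g \<and> fAr ?K k = h"
        using \<gamma> f by (intro exI[of _ \<gamma>]) auto
    next
      fix f g h \<gamma> \<gamma>' assume *: "f \<in> cObj (fDom ?K)" "g \<in> cObj (fDom ?K)"
        "\<gamma> \<in> cArr (fDom ?K) \<and> cDom (fDom ?K) \<gamma> = f \<and> cCod (fDom ?K) \<gamma> = g \<and> fAr ?K \<gamma> = h"
        "\<gamma>' \<in> cArr (fDom ?K) \<and> cDom (fDom ?K) \<gamma>' = f \<and> cCod (fDom ?K) \<gamma>' = g \<and> fAr ?K \<gamma>' = h"
      then have f: "f \<in> Ar B" "src B f = L" "trg B f = X" and g: "g \<in> Ar B" "src B g = L" "trg B g = X" and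
        \<gamma>: "\<gamma> \<in> Cl B" "dom2 B \<gamma> = f" "cod2 B \<gamma> = g" and \<gamma>': "\<gamma>' \<in> Cl B" "dom2 B \<gamma>' = f" "cod2 B \<gamma>' = g"
        by auto
      have "fAr ?K \<gamma> = cocone_post2 B I \<gamma> q" "fAr ?K \<gamma>' = cocone_post2 B I \<gamma>' q"
        using \<gamma> \<gamma>' f by simp_all
      then have eq: "cocone_post2 B I \<gamma> q = cocone_post2 B I \<gamma>' q"
        using *(3,4) by metis
      have "fAr (\<Phi> X) \<gamma> = fAr (\<Phi> X) \<gamma>'"
      proof (rule C.cComp_right_cancel[of _ "\<sigma> f (id1 B L)"])
        show "cComp (cocone_cat B I F X) (fAr (\<Phi> X) \<gamma>) (\<sigma> f (id1 B L)) = cComp (cocone_cat B I F X) (fAr (\<Phi> X) \<gamma>') (\<sigma> f (id1 B L))"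
          using \<sigma>2[of \<gamma>] \<sigma>2[of \<gamma>'] eq f g \<gamma> \<gamma>' by simp
      qed (use f \<gamma> \<gamma>' \<sigma>[OF f] F(2-4)[of \<gamma>] F(2-4)[of \<gamma>'] X in auto)
      then show "\<gamma> = \<gamma>'"
        by (intro fully_faithful_inj[OF \<Phi>ff(1)[OF X] \<Phi>f[OF X]]) (use X f g \<gamma> \<gamma>' in auto)
    qed
  }
qed

section \<open>Bifiltered 2-categories\<close>

lemma bifiltered_ob:
  assumes "bifiltered I" "i \<in> Ob I" "i' \<in> Ob I"
  obtains f g where "f \<in> Ar I" "g \<in> Ar I" "src I f = i" "src I g = i'" "trg I g = trg I f"
  using assms unfolding bifiltered_def arr_def by metis

lemma bifiltered_ar:
  assumes "bifiltered I" "d \<in> Ar I" "d' \<in> Ar I" "src I d' = src I d" "trg I d' = trg I d"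
  obtains f \<theta> where "f \<in> Ar I" "src I f = trg I d" "iso2 I \<theta>" "dom2 I \<theta> = f \<cdot>\<^bsub>I\<^esub> d" "cod2 I \<theta> = f \<cdot>\<^bsub>I\<^esub> d'"
  using assms unfolding bifiltered_def arr_def inv_cell_iff by metis

lemma bifiltered_cl:
  assumes "bifiltered I" "\<alpha> \<in> Cl I" "\<alpha>' \<in> Cl I" "dom2 I \<alpha>' = dom2 I \<alpha>" "cod2 I \<alpha>' = cod2 I \<alpha>"
  obtains f where "f \<in> Ar I" "src I f = trg I (dom2 I \<alpha>)" "id2 I f \<star>\<^bsub>I\<^esub> \<alpha> = id2 I f \<star>\<^bsub>I\<^esub> \<alpha>'"
proof -
  interpret two_category I using assms(1) by (simp add: bifiltered_def)
  have "arr I (dom2 I \<alpha>) (src I (dom2 I \<alpha>)) (trg I (dom2 I \<alpha>))" "arr I (cod2 I \<alpha>) (src I (dom2 I \<alpha>)) (trg I (dom2 I \<alpha>))"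
    "cell I \<alpha> (dom2 I \<alpha>) (cod2 I \<alpha>)" "cell I \<alpha>' (dom2 I \<alpha>) (cod2 I \<alpha>)"
    using assms by (auto simp: arr_def cell_def src_cod2 trg_cod2)
  then show ?thesis
    using assms(1) that unfolding bifiltered_def by (metis arr_def)
qed

text \<open>An Ore condition up to an invertible 2-cell: condition (1) joins the targets and (2)
  reconciles the two composites.\<close>

lemma bifiltered_span:
  assumes I: "bifiltered I" and d: "d \<in> Ar I" "d' \<in> Ar I" "src I d' = src I d"
  obtains f f' \<theta> where "f \<in> Ar I" "f' \<in> Ar I" "src I f = trg I d" "src I f' = trg I d'" "trg I f' = trg I f"
    "iso2 I \<theta>" "dom2 I \<theta> = f \<cdot>\<^bsub>I\<^esub> d" "cod2 I \<theta> = f' \<cdot>\<^bsub>I\<^esub> d'"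
proof -
  interpret two_category I using I by (simp add: bifiltered_def)
  obtain f f' where f: "f \<in> Ar I" "f' \<in> Ar I" "src I f = trg I d" "src I f' = trg I d'" "trg I f' = trg I f"
    using bifiltered_ob[OF I, of "trg I d" "trg I d'"] d by auto
  obtain g \<theta> where "g \<in> Ar I" "src I g = trg I f" "iso2 I \<theta>" "dom2 I \<theta> = g \<cdot>\<^bsub>I\<^esub> (f \<cdot>\<^bsub>I\<^esub> d)" "cod2 I \<theta> = g \<cdot>\<^bsub>I\<^esub> (f' \<cdot>\<^bsub>I\<^esub> d')"
    using bifiltered_ar[OF I, of "f \<cdot>\<^bsub>I\<^esub> d" "f' \<cdot>\<^bsub>I\<^esub> d'"] d f by auto
  then show thesis
    using that[of "g \<cdot>\<^bsub>I\<^esub> f" "g \<cdot>\<^bsub>I\<^esub> f'" \<theta>] d f by simp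
qed

text \<open>Condition (2) gives some invertible 2-cell parallel to a whiskering of \<delta>, and (3)
  makes the two equal at a later stage.\<close>

lemma bifiltered_iso2:
  assumes I: "bifiltered I" and \<delta>: "\<delta> \<in> Cl I"
  obtains e where "e \<in> Ar I" "src I e = trg I (dom2 I \<delta>)" "iso2 I (id2 I e \<star>\<^bsub>I\<^esub> \<delta>)"
proof -
  interpret two_category I using I by (simp add: bifiltered_def)
  obtain f \<theta> where f: "f \<in> Ar I" "src I f = trg I (dom2 I \<delta>)" "iso2 I \<theta>" "dom2 I \<theta> = f \<cdot>\<^bsub>I\<^esub> dom2 I \<delta>" "cod2 I \<theta> = f \<cdot>\<^bsub>I\<^esub> cod2 I \<delta>"
    using bifiltered_ar[OF I, of "dom2 I \<delta>" "cod2 I \<delta>"] \<delta> by (auto simp: src_cod2 trg_cod2)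
  obtain g where g: "g \<in> Ar I" "src I g = trg I f" "id2 I g \<star>\<^bsub>I\<^esub> \<theta> = id2 I g \<star>\<^bsub>I\<^esub> (id2 I f \<star>\<^bsub>I\<^esub> \<delta>)"
    using bifiltered_cl[OF I, of \<theta> "id2 I f \<star>\<^bsub>I\<^esub> \<delta>"] f \<delta> by auto
  have "iso2 I (id2 I g \<star>\<^bsub>I\<^esub> \<theta>)"
    using f g(1,2) \<delta> by (intro iso2_hcmp) auto
  then show thesis
    using that[of "g \<cdot>\<^bsub>I\<^esub> f"] f \<delta> g by simp
qed

section \<open>Transport of 2-cells along a pseudofunctor\<close>

text \<open>
  For a 1-cell \<open>x\<close> into \<open>F(i)\<close> the 1-cells \<open>F(s) x\<close>, \<open>s : i \<rightarrow> k\<close>, carry an action of the cells of \<open>I\<close>.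
  The 2-cells \<open>F(s) x \<Rightarrow> F(t) y\<close> are the arrows of a strictification of \<open>k \<mapsto> B[K,F(k)]\<close>, and
  \<open>tr a\<close> is its action on arrows. It is strictly functorial in \<open>a\<close>, which removes the coherence
  cells of \<open>F\<close> from the calculations with germs below.
\<close>

locale hom_pseudofunctor = pseudofunctor I J F
  for I :: "('i, 'j, 'k) twocat" and J :: "('o, 'a, 'c) twocat" and F :: "('i, 'j, 'k, 'o, 'a, 'c) psfun" +
  fixes K :: 'o
begin

definition pt :: "'a \<Rightarrow> 'i \<Rightarrow> bool" where
  "pt x i \<longleftrightarrow> x \<in> Ar J \<and> src J x = K \<and> trg J x = P0 F i \<and> i \<in> Ob I"

text \<open>The 1-cells \<open>s\<close> and \<open>t\<close> are recorded along with
  \<open>x\<close> and \<open>y\<close> rather than only the composites \<open>F(s) x\<close> and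
  \<open>F(t) y\<close>: transport composes them in \<open>I\<close>, where composition is strict.
  Their common target is the stage of the cell.\<close>

definition gc :: "'j \<Rightarrow> 'j \<Rightarrow> 'a \<Rightarrow> 'a \<Rightarrow> 'c \<Rightarrow> bool" where
  "gc s t x y \<alpha> \<longleftrightarrow> s \<in> Ar I \<and> t \<in> Ar I \<and> trg I s = trg I t \<and> pt x (src I s) \<and> pt y (src I t) \<and>
     \<alpha> \<in> Cl J \<and> dom2 J \<alpha> = P1 F s \<cdot>\<^bsub>J\<^esub> x \<and> cod2 J \<alpha> = P1 F t \<cdot>\<^bsub>J\<^esub> y"

definition tr :: "'j \<Rightarrow> 'j \<Rightarrow> 'j \<Rightarrow> 'a \<Rightarrow> 'a \<Rightarrow> 'c \<Rightarrow> 'c" where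
  "tr a s t x y \<alpha> = (P2c F a t \<star>\<^bsub>J\<^esub> id2 J y) \<bullet>\<^bsub>J\<^esub> ((id2 J (P1 F a) \<star>\<^bsub>J\<^esub> \<alpha>) \<bullet>\<^bsub>J\<^esub> (inv2 J (P2c F a s) \<star>\<^bsub>J\<^esub> id2 J x))"

text \<open>Compares two ways into one stage: a 2-cell of \<open>I\<close> from \<open>s\<close> to
  \<open>t\<close> gives \<open>F(s) y \<Rightarrow> F(t) y\<close>.\<close>

definition ev :: "'k \<Rightarrow> 'a \<Rightarrow> 'c" where
  "ev \<nu> y = P2 F \<nu> \<star>\<^bsub>J\<^esub> id2 J y"

lemma ptD: "pt x i \<Longrightarrow> x \<in> Ar J" "pt x i \<Longrightarrow> src J x = K" "pt x i \<Longrightarrow> trg J x = P0 F i" "pt x i \<Longrightarrow> i \<in> Ob I"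
  by (auto simp: pt_def)

lemma pt_P1 [simp]: "\<lbrakk>d \<in> Ar I; pt x (src I d)\<rbrakk> \<Longrightarrow> pt (P1 F d \<cdot>\<^bsub>J\<^esub> x) (trg I d)"
  by (simp add: pt_def)

lemma gcD:
  assumes "gc s t x y \<alpha>"
  shows "s \<in> Ar I" "t \<in> Ar I" "pt x (src I s)" "pt y (src I t)"
     "\<alpha> \<in> Cl J" "dom2 J \<alpha> = P1 F s \<cdot>\<^bsub>J\<^esub> x" "cod2 J \<alpha> = P1 F t \<cdot>\<^bsub>J\<^esub> y"
  using assms by (auto simp: gc_def)

lemma gc_pt:
  assumes "gc s t x y \<alpha>"
  shows "x \<in> Ar J" "src J x = K" "trg J x = P0 F (src I s)" "y \<in> Ar J" "src J y = K" "trg J y = P0 F (src I t)"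
  using assms by (auto simp: gc_def pt_def)

lemma gc_trg: "gc s t x y \<alpha> \<Longrightarrow> trg I s = trg I t"
  by (auto simp: gc_def)

lemma gc_vcmp: "\<lbrakk>gc s t x y \<alpha>; gc t u y z \<beta>\<rbrakk> \<Longrightarrow> gc s u x z (\<beta> \<bullet>\<^bsub>J\<^esub> \<alpha>)"
  by (simp add: gc_def)

lemma gc_tr [simp]:
  assumes "gc s t x y \<alpha>" "a \<in> Ar I" "src I a = trg I t"
  shows "gc (a \<cdot>\<^bsub>I\<^esub> s) (a \<cdot>\<^bsub>I\<^esub> t) x y (tr a s t x y \<alpha>)"
proof -
  note [simp] = gc_pt[OF assms(1)] gc_trg[OF assms(1)] assms gcD[OF assms(1)]
  show ?thesis unfolding tr_def gc_def by simp
qed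

lemma gc_ev:
  assumes "\<nu> \<in> Cl I" "pt y (src I (dom2 I \<nu>))" "dom2 I \<nu> = s" "cod2 I \<nu> = t"
  shows "gc s t y y (ev \<nu> y)"
proof -
  have "s \<in> Ar I" "t \<in> Ar I" "src I t = src I s" "trg I t = trg I s"
    using assms(1,3,4) I.src_cod2[of \<nu>] I.trg_cod2[of \<nu>] by auto
  then show ?thesis
    using assms ptD[OF assms(2)] by (simp add: gc_def ev_def)
qed

lemma gc_whisker:
  assumes "pt y (src I t)" "pt y' (src I t)" "t \<in> Ar I" "g \<in> Cl J" "dom2 J g = y" "cod2 J g = y'"
  shows "gc t t y y' (id2 J (P1 F t) \<star>\<^bsub>J\<^esub> g)"
  using assms(3-) ptD[OF assms(1)] ptD[OF assms(2)] assms(1,2) by (simp add: gc_def)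

lemma gc_P2c:
  assumes "d \<in> Ar I" "t \<in> Ar I" "src I t = trg I d" "pt y (src I d)"
  shows "gc t (t \<cdot>\<^bsub>I\<^esub> d) (P1 F d \<cdot>\<^bsub>J\<^esub> y) y (P2c F t d \<star>\<^bsub>J\<^esub> id2 J y)"
  using assms ptD[OF assms(4)] pt_P1[OF assms(1,4)] by (simp add: gc_def)

lemma ev_vcmp:
  "\<lbrakk>\<mu> \<in> Cl I; \<nu> \<in> Cl I; cod2 I \<mu> = dom2 I \<nu>; pt y (src I (dom2 I \<mu>))\<rbrakk> \<Longrightarrow> ev (\<nu> \<bullet>\<^bsub>I\<^esub> \<mu>) y = ev \<nu> y \<bullet>\<^bsub>J\<^esub> ev \<mu> y"
  using ptD[of y "src I (dom2 I \<mu>)"] by (simp add: ev_def)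

lemma ev_id: "\<lbrakk>s \<in> Ar I; pt y (src I s)\<rbrakk> \<Longrightarrow> ev (id2 I s) y = id2 J (P1 F s \<cdot>\<^bsub>J\<^esub> y)"
  using ptD[of y "src I s"] by (simp add: ev_def)

lemma iso2_ev: "\<lbrakk>iso2 I \<nu>; pt y (src I (dom2 I \<nu>))\<rbrakk> \<Longrightarrow> iso2 J (ev \<nu> y)"
  using ptD[of y "src I (dom2 I \<nu>)"] by (simp add: ev_def)

lemma inv2_ev:
  assumes "iso2 I \<nu>" "pt y (src I (dom2 I \<nu>))"
  shows "inv2 J (ev \<nu> y) = ev (inv2 I \<nu>) y"
proof (rule J.inv2_unique)
  note [simp] = ptD[OF assms(2)] assms
  show "iso2 J (ev \<nu> y)" by (simp add: iso2_ev)
  have "src I (cod2 I \<nu>) = src I (dom2 I \<nu>)" by (simp add: I.src_cod2)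
  then show "ev (inv2 I \<nu>) y \<in> Cl J" "dom2 J (ev (inv2 I \<nu>) y) = cod2 J (ev \<nu> y)" "cod2 J (ev (inv2 I \<nu>) y) = dom2 J (ev \<nu> y)"
    by (simp_all add: ev_def)
  show "ev (inv2 I \<nu>) y \<bullet>\<^bsub>J\<^esub> ev \<nu> y = id2 J (dom2 J (ev \<nu> y))"
    by (subst ev_vcmp[symmetric]) (simp_all add: ev_id, simp add: ev_def)
qed

lemma tr_eq:
  assumes "gc s t x y \<alpha>" "a \<in> Ar I" "src I a = trg I t"
  shows "tr a s t x y \<alpha> \<bullet>\<^bsub>J\<^esub> (P2c F a s \<star>\<^bsub>J\<^esub> id2 J x) = (P2c F a t \<star>\<^bsub>J\<^esub> id2 J y) \<bullet>\<^bsub>J\<^esub> (id2 J (P1 F a) \<star>\<^bsub>J\<^esub> \<alpha>)"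
proof -
  note [simp] = gc_pt[OF assms(1)] gc_trg[OF assms(1)] assms gcD[OF assms(1)]
  show ?thesis unfolding tr_def by simp
qed

text \<open>Together with \<open>tr_eq\<close> this characterises transport by a square without
  inverse coherence cells. The laws below are proved by checking that square.\<close>

lemma tr_unique:
  assumes "gc s t x y \<alpha>" "a \<in> Ar I" "src I a = trg I t" "gc (a \<cdot>\<^bsub>I\<^esub> s) (a \<cdot>\<^bsub>I\<^esub> t) x y \<beta>"
    "\<beta> \<bullet>\<^bsub>J\<^esub> (P2c F a s \<star>\<^bsub>J\<^esub> id2 J x) = (P2c F a t \<star>\<^bsub>J\<^esub> id2 J y) \<bullet>\<^bsub>J\<^esub> (id2 J (P1 F a) \<star>\<^bsub>J\<^esub> \<alpha>)"
  shows "tr a s t x y \<alpha> = \<beta>"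
proof -
  note [simp] = gc_pt[OF assms(1)] gc_trg[OF assms(1)] assms(1-3) gcD[OF assms(1)] gcD(5-7)[OF assms(4)]
    gcD(5-7)[OF gc_tr[OF assms(1-3)]]
  show ?thesis
    using tr_eq[OF assms(1-3)] assms(5)
    by (intro iffD1[OF J.vcmp_right_cancel[of "P2c F a s \<star>\<^bsub>J\<^esub> id2 J x" "tr a s t x y \<alpha>" \<beta>]]) simp_all
qed

lemma tr_vcmp:
  assumes "gc s t x y \<alpha>" "gc t u y z \<beta>" "a \<in> Ar I" "src I a = trg I u"
  shows "tr a s u x z (\<beta> \<bullet>\<^bsub>J\<^esub> \<alpha>) = tr a t u y z \<beta> \<bullet>\<^bsub>J\<^esub> tr a s t x y \<alpha>"
proof (rule tr_unique)
  note [simp] = gc_pt[OF assms(1)] gc_pt[OF assms(2)] gc_trg[OF assms(1)] gc_trg[OF assms(2)] assms gcD[OF assms(1)] gcD[OF assms(2)]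
  note [simp] = gcD(5-7)[OF gc_tr[OF assms(1)]] gcD(5-7)[OF gc_tr[OF assms(2)]]
  have "tr a t u y z \<beta> \<bullet>\<^bsub>J\<^esub> (tr a s t x y \<alpha> \<bullet>\<^bsub>J\<^esub> (P2c F a s \<star>\<^bsub>J\<^esub> id2 J x))
    = tr a t u y z \<beta> \<bullet>\<^bsub>J\<^esub> ((P2c F a t \<star>\<^bsub>J\<^esub> id2 J y) \<bullet>\<^bsub>J\<^esub> (id2 J (P1 F a) \<star>\<^bsub>J\<^esub> \<alpha>))"
    using tr_eq[OF assms(1), of a] by simp
  also have "\<dots> = (P2c F a u \<star>\<^bsub>J\<^esub> id2 J z) \<bullet>\<^bsub>J\<^esub> ((id2 J (P1 F a) \<star>\<^bsub>J\<^esub> \<beta>) \<bullet>\<^bsub>J\<^esub> (id2 J (P1 F a) \<star>\<^bsub>J\<^esub> \<alpha>))"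
    by (rule J.vcmp_tail[OF tr_eq[OF assms(2)]]) simp_all
  finally show "(tr a t u y z \<beta> \<bullet>\<^bsub>J\<^esub> tr a s t x y \<alpha>) \<bullet>\<^bsub>J\<^esub> (P2c F a s \<star>\<^bsub>J\<^esub> id2 J x) =
    (P2c F a u \<star>\<^bsub>J\<^esub> id2 J z) \<bullet>\<^bsub>J\<^esub> (id2 J (P1 F a) \<star>\<^bsub>J\<^esub> (\<beta> \<bullet>\<^bsub>J\<^esub> \<alpha>))"
    by simp
qed (use assms gc_trg[OF assms(2)] gc_vcmp[OF assms(1,2)] gc_vcmp[OF gc_tr[OF assms(1)] gc_tr[OF assms(2)], of a] in auto)

text \<open>Strict functoriality although \<open>F\<close> is only a pseudofunctor: by the
  associativity law the coherence cell at \<open>b\<close> and \<open>a\<close> appears on both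
  sides of the defining square and cancels.\<close>

lemma tr_tr:
  assumes "gc s t x y \<alpha>" "a \<in> Ar I" "src I a = trg I t" "b \<in> Ar I" "src I b = trg I a"
  shows "tr b (a \<cdot>\<^bsub>I\<^esub> s) (a \<cdot>\<^bsub>I\<^esub> t) x y (tr a s t x y \<alpha>) = tr (b \<cdot>\<^bsub>I\<^esub> a) s t x y \<alpha>"
proof -
  note [simp] = gc_pt[OF assms(1)] gc_trg[OF assms(1)] assms gcD[OF assms(1)]
  note g [simp] = gc_tr[OF assms(1-3)]
  note [simp] = gcD(5-7)[OF g]
  have g2: "gc (b \<cdot>\<^bsub>I\<^esub> (a \<cdot>\<^bsub>I\<^esub> s)) (b \<cdot>\<^bsub>I\<^esub> (a \<cdot>\<^bsub>I\<^esub> t)) x y (tr b (a \<cdot>\<^bsub>I\<^esub> s) (a \<cdot>\<^bsub>I\<^esub> t) x y (tr a s t x y \<alpha>))"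
    by (rule gc_tr) simp_all
  note [simp] = gcD(5-7)[OF g2]
  let ?l = "tr b (a \<cdot>\<^bsub>I\<^esub> s) (a \<cdot>\<^bsub>I\<^esub> t) x y (tr a s t x y \<alpha>)"
  \<comment> \<open>The associativity law of \<open>F\<close>, whiskered with an arbitrary point
    \<open>z\<close> so as to serve for \<open>s\<close> and \<open>t\<close> alike.\<close>
  have c: "(P2c F b (a \<cdot>\<^bsub>I\<^esub> d) \<star>\<^bsub>J\<^esub> id2 J z) \<bullet>\<^bsub>J\<^esub> (id2 J (P1 F b) \<star>\<^bsub>J\<^esub> (P2c F a d \<star>\<^bsub>J\<^esub> id2 J z)) =
    (P2c F (b \<cdot>\<^bsub>I\<^esub> a) d \<star>\<^bsub>J\<^esub> id2 J z) \<bullet>\<^bsub>J\<^esub> (P2c F b a \<star>\<^bsub>J\<^esub> id2 J (P1 F d \<cdot>\<^bsub>J\<^esub> z))"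
    if [simp]: "d \<in> Ar I" "trg I d = trg I t" "pt z (src I d)" for d z
    using arg_cong[OF coh_assoc'[of d a b], of "\<lambda>w. w \<star>\<^bsub>J\<^esub> id2 J z"] ptD[OF that(3)] by simp
  have "?l \<bullet>\<^bsub>J\<^esub> (P2c F (b \<cdot>\<^bsub>I\<^esub> a) s \<star>\<^bsub>J\<^esub> id2 J x) \<bullet>\<^bsub>J\<^esub> (P2c F b a \<star>\<^bsub>J\<^esub> id2 J (P1 F s \<cdot>\<^bsub>J\<^esub> x))
    = ?l \<bullet>\<^bsub>J\<^esub> ((P2c F b (a \<cdot>\<^bsub>I\<^esub> s) \<star>\<^bsub>J\<^esub> id2 J x) \<bullet>\<^bsub>J\<^esub> (id2 J (P1 F b) \<star>\<^bsub>J\<^esub> (P2c F a s \<star>\<^bsub>J\<^esub> id2 J x)))"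
    by (subst c) simp_all
  also have "\<dots> = (P2c F b (a \<cdot>\<^bsub>I\<^esub> t) \<star>\<^bsub>J\<^esub> id2 J y) \<bullet>\<^bsub>J\<^esub> ((id2 J (P1 F b) \<star>\<^bsub>J\<^esub> tr a s t x y \<alpha>) \<bullet>\<^bsub>J\<^esub> (id2 J (P1 F b) \<star>\<^bsub>J\<^esub> (P2c F a s \<star>\<^bsub>J\<^esub> id2 J x)))"
    by (rule J.vcmp_tail[OF tr_eq[OF g]]) simp_all
  also have "\<dots> = (P2c F b (a \<cdot>\<^bsub>I\<^esub> t) \<star>\<^bsub>J\<^esub> id2 J y) \<bullet>\<^bsub>J\<^esub> (id2 J (P1 F b) \<star>\<^bsub>J\<^esub> (tr a s t x y \<alpha> \<bullet>\<^bsub>J\<^esub> (P2c F a s \<star>\<^bsub>J\<^esub> id2 J x)))"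
    by simp
  also have "\<dots> = (P2c F b (a \<cdot>\<^bsub>I\<^esub> t) \<star>\<^bsub>J\<^esub> id2 J y) \<bullet>\<^bsub>J\<^esub> ((id2 J (P1 F b) \<star>\<^bsub>J\<^esub> (P2c F a t \<star>\<^bsub>J\<^esub> id2 J y)) \<bullet>\<^bsub>J\<^esub> (id2 J (P1 F b \<cdot>\<^bsub>J\<^esub> P1 F a) \<star>\<^bsub>J\<^esub> \<alpha>))"
    unfolding tr_eq[OF assms(1-3)] by simp
  also have "\<dots> = (P2c F (b \<cdot>\<^bsub>I\<^esub> a) t \<star>\<^bsub>J\<^esub> id2 J y) \<bullet>\<^bsub>J\<^esub> ((P2c F b a \<star>\<^bsub>J\<^esub> id2 J (P1 F t \<cdot>\<^bsub>J\<^esub> y)) \<bullet>\<^bsub>J\<^esub> (id2 J (P1 F b \<cdot>\<^bsub>J\<^esub> P1 F a) \<star>\<^bsub>J\<^esub> \<alpha>))"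
    by (rule J.vcmp_tail[OF c]) simp_all
  also have "\<dots> = (P2c F (b \<cdot>\<^bsub>I\<^esub> a) t \<star>\<^bsub>J\<^esub> id2 J y) \<bullet>\<^bsub>J\<^esub> ((id2 J (P1 F (b \<cdot>\<^bsub>I\<^esub> a)) \<star>\<^bsub>J\<^esub> \<alpha>) \<bullet>\<^bsub>J\<^esub> (P2c F b a \<star>\<^bsub>J\<^esub> id2 J (P1 F s \<cdot>\<^bsub>J\<^esub> x)))"
    by (subst J.whisker_exchange'[where f = "P1 F s \<cdot>\<^bsub>J\<^esub> x" and g' = "P1 F (b \<cdot>\<^bsub>I\<^esub> a)"]) simp_all
  finally have "(?l \<bullet>\<^bsub>J\<^esub> (P2c F (b \<cdot>\<^bsub>I\<^esub> a) s \<star>\<^bsub>J\<^esub> id2 J x)) \<bullet>\<^bsub>J\<^esub> (P2c F b a \<star>\<^bsub>J\<^esub> id2 J (P1 F s \<cdot>\<^bsub>J\<^esub> x)) =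
    ((P2c F (b \<cdot>\<^bsub>I\<^esub> a) t \<star>\<^bsub>J\<^esub> id2 J y) \<bullet>\<^bsub>J\<^esub> (id2 J (P1 F (b \<cdot>\<^bsub>I\<^esub> a)) \<star>\<^bsub>J\<^esub> \<alpha>)) \<bullet>\<^bsub>J\<^esub> (P2c F b a \<star>\<^bsub>J\<^esub> id2 J (P1 F s \<cdot>\<^bsub>J\<^esub> x))"
    by simp
  then have "?l \<bullet>\<^bsub>J\<^esub> (P2c F (b \<cdot>\<^bsub>I\<^esub> a) s \<star>\<^bsub>J\<^esub> id2 J x) = (P2c F (b \<cdot>\<^bsub>I\<^esub> a) t \<star>\<^bsub>J\<^esub> id2 J y) \<bullet>\<^bsub>J\<^esub> (id2 J (P1 F (b \<cdot>\<^bsub>I\<^esub> a)) \<star>\<^bsub>J\<^esub> \<alpha>)"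
    by (subst (asm) J.vcmp_right_cancel) simp_all
  then show ?thesis
    using g2 by (intro tr_unique[symmetric]) simp_all
qed

text \<open>Two facts combine: the coherence cells are natural in their first argument, and
  \<open>P2 F \<sigma>\<close> exchanges with \<alpha>.\<close>

lemma tr_2cell:
  assumes "gc s t x y \<alpha>" "\<sigma> \<in> Cl I" "dom2 I \<sigma> = a" "cod2 I \<sigma> = a'" "src I a = trg I t"
  shows "ev (\<sigma> \<star>\<^bsub>I\<^esub> id2 I t) y \<bullet>\<^bsub>J\<^esub> tr a s t x y \<alpha> = tr a' s t x y \<alpha> \<bullet>\<^bsub>J\<^esub> ev (\<sigma> \<star>\<^bsub>I\<^esub> id2 I s) x"
proof -
  have a: "a \<in> Ar I" "a' \<in> Ar I" "src I a' = trg I t" "trg I a' = trg I a"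
    using assms(2-5) I.src_cod2[of \<sigma>] I.trg_cod2[of \<sigma>] by auto
  note [simp] = gc_pt[OF assms(1)] gc_trg[OF assms(1)] assms gcD[OF assms(1)] a
  note [simp] = gcD(5-7)[OF gc_tr[OF assms(1) a(1) assms(5)]] gcD(5-7)[OF gc_tr[OF assms(1) a(2,3)]]
  have e: "ev (\<sigma> \<star>\<^bsub>I\<^esub> id2 I d) z \<bullet>\<^bsub>J\<^esub> (P2c F a d \<star>\<^bsub>J\<^esub> id2 J z) = (P2c F a' d \<star>\<^bsub>J\<^esub> id2 J z) \<bullet>\<^bsub>J\<^esub> (P2 F \<sigma> \<star>\<^bsub>J\<^esub> id2 J (P1 F d \<cdot>\<^bsub>J\<^esub> z))"
    if [simp]: "d \<in> Ar I" "trg I d = trg I t" "pt z (src I d)" for d z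
    using arg_cong[OF P2c_natural'[of "id2 I d" \<sigma>], of "\<lambda>w. w \<star>\<^bsub>J\<^esub> id2 J z"] ptD[OF that(3)] by (simp add: ev_def)
  have [simp]: "ev (\<sigma> \<star>\<^bsub>I\<^esub> id2 I t) y \<in> Cl J" "dom2 J (ev (\<sigma> \<star>\<^bsub>I\<^esub> id2 I t) y) = P1 F (a \<cdot>\<^bsub>I\<^esub> t) \<cdot>\<^bsub>J\<^esub> y" "cod2 J (ev (\<sigma> \<star>\<^bsub>I\<^esub> id2 I t) y) = P1 F (a' \<cdot>\<^bsub>I\<^esub> t) \<cdot>\<^bsub>J\<^esub> y"
    "ev (\<sigma> \<star>\<^bsub>I\<^esub> id2 I s) x \<in> Cl J" "dom2 J (ev (\<sigma> \<star>\<^bsub>I\<^esub> id2 I s) x) = P1 F (a \<cdot>\<^bsub>I\<^esub> s) \<cdot>\<^bsub>J\<^esub> x" "cod2 J (ev (\<sigma> \<star>\<^bsub>I\<^esub> id2 I s) x) = P1 F (a' \<cdot>\<^bsub>I\<^esub> s) \<cdot>\<^bsub>J\<^esub> x"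
    by (auto simp: ev_def)
  have "ev (\<sigma> \<star>\<^bsub>I\<^esub> id2 I t) y \<bullet>\<^bsub>J\<^esub> (tr a s t x y \<alpha> \<bullet>\<^bsub>J\<^esub> (P2c F a s \<star>\<^bsub>J\<^esub> id2 J x))
    = ev (\<sigma> \<star>\<^bsub>I\<^esub> id2 I t) y \<bullet>\<^bsub>J\<^esub> ((P2c F a t \<star>\<^bsub>J\<^esub> id2 J y) \<bullet>\<^bsub>J\<^esub> (id2 J (P1 F a) \<star>\<^bsub>J\<^esub> \<alpha>))"
    by (subst tr_eq[OF assms(1)]) simp_all
  also have "\<dots> = (P2c F a' t \<star>\<^bsub>J\<^esub> id2 J y) \<bullet>\<^bsub>J\<^esub> ((P2 F \<sigma> \<star>\<^bsub>J\<^esub> id2 J (P1 F t \<cdot>\<^bsub>J\<^esub> y)) \<bullet>\<^bsub>J\<^esub> (id2 J (P1 F a) \<star>\<^bsub>J\<^esub> \<alpha>))"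
    by (rule J.vcmp_tail[OF e]) simp_all
  also have "\<dots> = (P2c F a' t \<star>\<^bsub>J\<^esub> id2 J y) \<bullet>\<^bsub>J\<^esub> ((id2 J (P1 F a') \<star>\<^bsub>J\<^esub> \<alpha>) \<bullet>\<^bsub>J\<^esub> (P2 F \<sigma> \<star>\<^bsub>J\<^esub> id2 J (P1 F s \<cdot>\<^bsub>J\<^esub> x)))"
    by (subst J.whisker_exchange'[where f = "P1 F s \<cdot>\<^bsub>J\<^esub> x" and g' = "P1 F a'"]) simp_all
  also have "\<dots> = tr a' s t x y \<alpha> \<bullet>\<^bsub>J\<^esub> ((P2c F a' s \<star>\<^bsub>J\<^esub> id2 J x) \<bullet>\<^bsub>J\<^esub> (P2 F \<sigma> \<star>\<^bsub>J\<^esub> id2 J (P1 F s \<cdot>\<^bsub>J\<^esub> x)))"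
    by (rule J.vcmp_tail[OF tr_eq[OF assms(1) a(2,3), symmetric]]) simp_all
  also have "\<dots> = tr a' s t x y \<alpha> \<bullet>\<^bsub>J\<^esub> (ev (\<sigma> \<star>\<^bsub>I\<^esub> id2 I s) x \<bullet>\<^bsub>J\<^esub> (P2c F a s \<star>\<^bsub>J\<^esub> id2 J x))"
    by (subst e) simp_all
  finally have "(ev (\<sigma> \<star>\<^bsub>I\<^esub> id2 I t) y \<bullet>\<^bsub>J\<^esub> tr a s t x y \<alpha>) \<bullet>\<^bsub>J\<^esub> (P2c F a s \<star>\<^bsub>J\<^esub> id2 J x) =
    (tr a' s t x y \<alpha> \<bullet>\<^bsub>J\<^esub> ev (\<sigma> \<star>\<^bsub>I\<^esub> id2 I s) x) \<bullet>\<^bsub>J\<^esub> (P2c F a s \<star>\<^bsub>J\<^esub> id2 J x)"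
    by simp
  then show ?thesis
    by (subst (asm) J.vcmp_right_cancel) simp_all
qed

text \<open>With \<open>tr_whisker\<close> and \<open>tr_P2c\<close> it computes transport on the
  cells that get composed with germs: comparisons of stages, the action of 2-cells between points,
  and coherence cells. Here the reason is naturality of the coherence cells in their second
  argument.\<close>

lemma tr_ev:
  assumes "\<nu> \<in> Cl I" "dom2 I \<nu> = s" "cod2 I \<nu> = t" "pt y (src I s)" "a \<in> Ar I" "src I a = trg I s"
  shows "tr a s t y y (ev \<nu> y) = ev (id2 I a \<star>\<^bsub>I\<^esub> \<nu>) y"
proof (rule tr_unique)
  have s: "s \<in> Ar I" "t \<in> Ar I" "src I t = src I s" "trg I t = trg I s"
    using assms(1-3) I.src_cod2[of \<nu>] I.trg_cod2[of \<nu>] by auto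
  show "ev (id2 I a \<star>\<^bsub>I\<^esub> \<nu>) y \<bullet>\<^bsub>J\<^esub> (P2c F a s \<star>\<^bsub>J\<^esub> id2 J y) = (P2c F a t \<star>\<^bsub>J\<^esub> id2 J y) \<bullet>\<^bsub>J\<^esub> (id2 J (P1 F a) \<star>\<^bsub>J\<^esub> ev \<nu> y)"
    using arg_cong[OF P2c_natural'[of \<nu> "id2 I a"], of "\<lambda>w. w \<star>\<^bsub>J\<^esub> id2 J y"] assms s ptD[OF assms(4)] by (simp add: ev_def)
qed (use assms I.src_cod2[of \<nu>] I.trg_cod2[of \<nu>] in \<open>auto intro!: gc_ev\<close>)

lemma tr_whisker:
  assumes "pt y (src I t)" "pt y' (src I t)" "t \<in> Ar I" "g \<in> Cl J" "dom2 J g = y" "cod2 J g = y'" "a \<in> Ar I" "src I a = trg I t"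
  shows "tr a t t y y' (id2 J (P1 F t) \<star>\<^bsub>J\<^esub> g) = id2 J (P1 F (a \<cdot>\<^bsub>I\<^esub> t)) \<star>\<^bsub>J\<^esub> g"
proof (rule tr_unique)
  show "(id2 J (P1 F (a \<cdot>\<^bsub>I\<^esub> t)) \<star>\<^bsub>J\<^esub> g) \<bullet>\<^bsub>J\<^esub> (P2c F a t \<star>\<^bsub>J\<^esub> id2 J y) = (P2c F a t \<star>\<^bsub>J\<^esub> id2 J y') \<bullet>\<^bsub>J\<^esub> (id2 J (P1 F a) \<star>\<^bsub>J\<^esub> (id2 J (P1 F t) \<star>\<^bsub>J\<^esub> g))"
    using assms(3-8) ptD[OF assms(1)] ptD[OF assms(2)] J.whisker_exchange[of g "P2c F a t"] by simp
qed (use assms in \<open>auto intro!: gc_whisker\<close>)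

lemma tr_P2c:
  assumes "d \<in> Ar I" "t \<in> Ar I" "src I t = trg I d" "pt y (src I d)" "a \<in> Ar I" "src I a = trg I t"
  shows "tr a t (t \<cdot>\<^bsub>I\<^esub> d) (P1 F d \<cdot>\<^bsub>J\<^esub> y) y (P2c F t d \<star>\<^bsub>J\<^esub> id2 J y) = P2c F (a \<cdot>\<^bsub>I\<^esub> t) d \<star>\<^bsub>J\<^esub> id2 J y"
proof (rule tr_unique)
  show "(P2c F (a \<cdot>\<^bsub>I\<^esub> t) d \<star>\<^bsub>J\<^esub> id2 J y) \<bullet>\<^bsub>J\<^esub> (P2c F a t \<star>\<^bsub>J\<^esub> id2 J (P1 F d \<cdot>\<^bsub>J\<^esub> y)) =
    (P2c F a (t \<cdot>\<^bsub>I\<^esub> d) \<star>\<^bsub>J\<^esub> id2 J y) \<bullet>\<^bsub>J\<^esub> (id2 J (P1 F a) \<star>\<^bsub>J\<^esub> (P2c F t d \<star>\<^bsub>J\<^esub> id2 J y))"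
    using arg_cong[OF coh_assoc'[of d t a], of "\<lambda>w. w \<star>\<^bsub>J\<^esub> id2 J y"] assms ptD[OF assms(4)] by simp
  show "gc (a \<cdot>\<^bsub>I\<^esub> t) (a \<cdot>\<^bsub>I\<^esub> (t \<cdot>\<^bsub>I\<^esub> d)) (P1 F d \<cdot>\<^bsub>J\<^esub> y) y (P2c F (a \<cdot>\<^bsub>I\<^esub> t) d \<star>\<^bsub>J\<^esub> id2 J y)"
    using gc_P2c[of d "a \<cdot>\<^bsub>I\<^esub> t" y] assms by simp
qed (use assms in \<open>auto intro!: gc_P2c\<close>)

end

section \<open>Germs\<close>

locale bifiltered_hom = hom_pseudofunctor I J F K
  for I :: "('i, 'j, 'k) twocat" and J :: "('o, 'a, 'c) twocat" and F :: "('i, 'j, 'k, 'o, 'a, 'c) psfun"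
    and K :: 'o +
  assumes bif: "bifiltered I"
begin

text \<open>
  Cells \<open>\<alpha> : F(s) x \<Rightarrow> F(t) y\<close> and \<open>\<alpha>' : F(s') x \<Rightarrow> F(t') y\<close>, possibly over different objects
  of \<open>I\<close>, have the same germ.
\<close>

definition germ_eq :: "'a \<Rightarrow> 'a \<Rightarrow> 'j \<times> 'j \<times> 'c \<Rightarrow> 'j \<times> 'j \<times> 'c \<Rightarrow> bool" where
  "germ_eq x y = (\<lambda>(s, t, \<alpha>) (s', t', \<alpha>'). gc s t x y \<alpha> \<and> gc s' t' x y \<alpha>' \<and>
     (\<exists>a a' \<mu> \<nu>. a \<in> Ar I \<and> a' \<in> Ar I \<and> src I a = trg I t \<and> src I a' = trg I t' \<and> trg I a' = trg I a \<and>
       iso2 I \<mu> \<and> dom2 I \<mu> = a \<cdot>\<^bsub>I\<^esub> s \<and> cod2 I \<mu> = a' \<cdot>\<^bsub>I\<^esub> s' \<and>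
       iso2 I \<nu> \<and> dom2 I \<nu> = a \<cdot>\<^bsub>I\<^esub> t \<and> cod2 I \<nu> = a' \<cdot>\<^bsub>I\<^esub> t' \<and>
       ev \<nu> y \<bullet>\<^bsub>J\<^esub> tr a s t x y \<alpha> = tr a' s' t' x y \<alpha>' \<bullet>\<^bsub>J\<^esub> ev \<mu> x))"

lemma germ_eqI:
  assumes "gc s t x y \<alpha>" "gc s' t' x y \<alpha>'"
    "a \<in> Ar I" "a' \<in> Ar I" "src I a = trg I t" "src I a' = trg I t'" "trg I a' = trg I a"
    "iso2 I \<mu>" "dom2 I \<mu> = a \<cdot>\<^bsub>I\<^esub> s" "cod2 I \<mu> = a' \<cdot>\<^bsub>I\<^esub> s'"
    "iso2 I \<nu>" "dom2 I \<nu> = a \<cdot>\<^bsub>I\<^esub> t" "cod2 I \<nu> = a' \<cdot>\<^bsub>I\<^esub> t'"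
    "ev \<nu> y \<bullet>\<^bsub>J\<^esub> tr a s t x y \<alpha> = tr a' s' t' x y \<alpha>' \<bullet>\<^bsub>J\<^esub> ev \<mu> x"
  shows "germ_eq x y (s, t, \<alpha>) (s', t', \<alpha>')"
  using assms unfolding germ_eq_def by blast

lemma germ_eqE:
  assumes "germ_eq x y (s, t, \<alpha>) (s', t', \<alpha>')"
  obtains a a' \<mu> \<nu> where "gc s t x y \<alpha>" "gc s' t' x y \<alpha>'"
    "a \<in> Ar I" "a' \<in> Ar I" "src I a = trg I t" "src I a' = trg I t'" "trg I a' = trg I a"
    "iso2 I \<mu>" "dom2 I \<mu> = a \<cdot>\<^bsub>I\<^esub> s" "cod2 I \<mu> = a' \<cdot>\<^bsub>I\<^esub> s'"
    "iso2 I \<nu>" "dom2 I \<nu> = a \<cdot>\<^bsub>I\<^esub> t" "cod2 I \<nu> = a' \<cdot>\<^bsub>I\<^esub> t'"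
    "ev \<nu> y \<bullet>\<^bsub>J\<^esub> tr a s t x y \<alpha> = tr a' s' t' x y \<alpha>' \<bullet>\<^bsub>J\<^esub> ev \<mu> x"
    "src I s' = src I s" "src I t' = src I t"
proof -
  from assms obtain a a' \<mu> \<nu> where *: "gc s t x y \<alpha>" "gc s' t' x y \<alpha>'"
    "a \<in> Ar I" "a' \<in> Ar I" "src I a = trg I t" "src I a' = trg I t'" "trg I a' = trg I a"
    "iso2 I \<mu>" "dom2 I \<mu> = a \<cdot>\<^bsub>I\<^esub> s" "cod2 I \<mu> = a' \<cdot>\<^bsub>I\<^esub> s'"
    "iso2 I \<nu>" "dom2 I \<nu> = a \<cdot>\<^bsub>I\<^esub> t" "cod2 I \<nu> = a' \<cdot>\<^bsub>I\<^esub> t'"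
    "ev \<nu> y \<bullet>\<^bsub>J\<^esub> tr a s t x y \<alpha> = tr a' s' t' x y \<alpha>' \<bullet>\<^bsub>J\<^esub> ev \<mu> x"
    unfolding germ_eq_def by blast
  have "src I (cod2 I \<mu>) = src I (dom2 I \<mu>)" "src I (cod2 I \<nu>) = src I (dom2 I \<nu>)"
    using I.src_cod2[OF iso2_Cl[OF *(8)]] I.src_cod2[OF iso2_Cl[OF *(11)]] by simp_all
  then have "src I s' = src I s" "src I t' = src I t"
    using *(3-7,9,10,12,13) gcD(1,2)[OF *(1)] gcD(1,2)[OF *(2)] gc_trg[OF *(1)] gc_trg[OF *(2)] by simp_all
  with * that show thesis by blast
qed

lemma germ_eq_refl:
  assumes "gc s t x y \<alpha>"
  shows "germ_eq x y (s, t, \<alpha>) (s, t, \<alpha>)"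
proof -
  note [simp] = gcD(1-4)[OF assms] gc_trg[OF assms]
  note g = gc_tr[OF assms, of "id1 I (trg I t)", simplified]
  show ?thesis
    using gcD(5-7)[OF g] assms
    by (intro germ_eqI[of s t x y \<alpha> s t \<alpha> "id1 I (trg I t)" "id1 I (trg I t)" "id2 I s" "id2 I t"]) (simp_all add: ev_id)
qed

text \<open>The reason for asking in \<open>germ_eq\<close> that \<mu> and \<nu> be invertible: the
  witnesses are inverted and the square is read backwards.\<close>

lemma germ_eq_sym:
  assumes "germ_eq x y (s, t, \<alpha>) (s', t', \<alpha>')"
  shows "germ_eq x y (s', t', \<alpha>') (s, t, \<alpha>)"
proof -
  from assms obtain a a' \<mu> \<nu> where *: "gc s t x y \<alpha>" "gc s' t' x y \<alpha>'"
    "a \<in> Ar I" "a' \<in> Ar I" "src I a = trg I t" "src I a' = trg I t'" "trg I a' = trg I a"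
    "iso2 I \<mu>" "dom2 I \<mu> = a \<cdot>\<^bsub>I\<^esub> s" "cod2 I \<mu> = a' \<cdot>\<^bsub>I\<^esub> s'"
    "iso2 I \<nu>" "dom2 I \<nu> = a \<cdot>\<^bsub>I\<^esub> t" "cod2 I \<nu> = a' \<cdot>\<^bsub>I\<^esub> t'"
    and eq: "ev \<nu> y \<bullet>\<^bsub>J\<^esub> tr a s t x y \<alpha> = tr a' s' t' x y \<alpha>' \<bullet>\<^bsub>J\<^esub> ev \<mu> x"
    and sr: "src I s' = src I s" "src I t' = src I t"
    by (rule germ_eqE)
  note gt = gc_tr[OF *(1,3,5)] gc_tr[OF *(2,4,6)]
  note g = gcD[OF gt(1)] gcD[OF gt(2)] gcD(3,4)[OF *(1)] gcD(3,4)[OF *(2)] gcD(1,2)[OF *(1)] gcD(1,2)[OF *(2)] gc_trg[OF *(1)] gc_trg[OF *(2)]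
  have \<mu>: "iso2 J (ev \<mu> x)" "dom2 J (ev \<mu> x) = P1 F (a \<cdot>\<^bsub>I\<^esub> s) \<cdot>\<^bsub>J\<^esub> x" "cod2 J (ev \<mu> x) = P1 F (a' \<cdot>\<^bsub>I\<^esub> s') \<cdot>\<^bsub>J\<^esub> x"
    and \<nu>: "iso2 J (ev \<nu> y)" "dom2 J (ev \<nu> y) = P1 F (a \<cdot>\<^bsub>I\<^esub> t) \<cdot>\<^bsub>J\<^esub> y" "cod2 J (ev \<nu> y) = P1 F (a' \<cdot>\<^bsub>I\<^esub> t') \<cdot>\<^bsub>J\<^esub> y"
    using * g gcD(6,7)[OF gc_ev[of \<mu> x]] gcD(6,7)[OF gc_ev[of \<nu> y]] by (simp_all add: iso2_ev)
  have "inv2 J (ev \<nu> y) \<bullet>\<^bsub>J\<^esub> ((ev \<nu> y \<bullet>\<^bsub>J\<^esub> tr a s t x y \<alpha>) \<bullet>\<^bsub>J\<^esub> inv2 J (ev \<mu> x)) =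
    inv2 J (ev \<nu> y) \<bullet>\<^bsub>J\<^esub> ((tr a' s' t' x y \<alpha>' \<bullet>\<^bsub>J\<^esub> ev \<mu> x) \<bullet>\<^bsub>J\<^esub> inv2 J (ev \<mu> x))"
    using eq by simp
  then have "tr a s t x y \<alpha> \<bullet>\<^bsub>J\<^esub> inv2 J (ev \<mu> x) = inv2 J (ev \<nu> y) \<bullet>\<^bsub>J\<^esub> tr a' s' t' x y \<alpha>'"
    using g \<mu> \<nu> by simp
  moreover have "inv2 J (ev \<mu> x) = ev (inv2 I \<mu>) x" "inv2 J (ev \<nu> y) = ev (inv2 I \<nu>) y"
    using inv2_ev[of \<mu> x] inv2_ev[of \<nu> y] * g by simp_all
  ultimately have e: "ev (inv2 I \<nu>) y \<bullet>\<^bsub>J\<^esub> tr a' s' t' x y \<alpha>' = tr a s t x y \<alpha> \<bullet>\<^bsub>J\<^esub> ev (inv2 I \<mu>) x"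
    by simp
  show ?thesis
    by (rule germ_eqI[of s' t' x y \<alpha>' s t \<alpha> a' a "inv2 I \<mu>" "inv2 I \<nu>"]) (use * e in simp_all)
qed

text \<open>Witnesses may be pushed to any later stage: \<open>tr f\<close> applied to the square
  gives a square of the same shape, because transport is strictly functorial.\<close>

lemma germ_eq_push:
  assumes *: "gc s t x y \<alpha>" "gc s' t' x y \<alpha>'"
    "a \<in> Ar I" "a' \<in> Ar I" "src I a = trg I t" "src I a' = trg I t'" "trg I a' = trg I a"
    "\<mu> \<in> Cl I" "dom2 I \<mu> = a \<cdot>\<^bsub>I\<^esub> s" "cod2 I \<mu> = a' \<cdot>\<^bsub>I\<^esub> s'"
    "\<nu> \<in> Cl I" "dom2 I \<nu> = a \<cdot>\<^bsub>I\<^esub> t" "cod2 I \<nu> = a' \<cdot>\<^bsub>I\<^esub> t'"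
    and eq: "ev \<nu> y \<bullet>\<^bsub>J\<^esub> tr a s t x y \<alpha> = tr a' s' t' x y \<alpha>' \<bullet>\<^bsub>J\<^esub> ev \<mu> x"
    and f: "f \<in> Ar I" "src I f = trg I a"
  shows "ev (id2 I f \<star>\<^bsub>I\<^esub> \<nu>) y \<bullet>\<^bsub>J\<^esub> tr (f \<cdot>\<^bsub>I\<^esub> a) s t x y \<alpha> =
    tr (f \<cdot>\<^bsub>I\<^esub> a') s' t' x y \<alpha>' \<bullet>\<^bsub>J\<^esub> ev (id2 I f \<star>\<^bsub>I\<^esub> \<mu>) x"
proof -
  note gt = gc_tr[OF *(1,3,5)] gc_tr[OF *(2,4,6)]
  note g = gcD(1-4)[OF *(1)] gcD(1-4)[OF *(2)] gc_trg[OF *(1)] gc_trg[OF *(2)]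
  have ge: "gc (a \<cdot>\<^bsub>I\<^esub> s) (a' \<cdot>\<^bsub>I\<^esub> s') x x (ev \<mu> x)" "gc (a \<cdot>\<^bsub>I\<^esub> t) (a' \<cdot>\<^bsub>I\<^esub> t') y y (ev \<nu> y)"
    by (rule gc_ev; use * g in simp)+
  have "tr f (a \<cdot>\<^bsub>I\<^esub> s) (a' \<cdot>\<^bsub>I\<^esub> t') x y (ev \<nu> y \<bullet>\<^bsub>J\<^esub> tr a s t x y \<alpha>) = tr f (a \<cdot>\<^bsub>I\<^esub> s) (a' \<cdot>\<^bsub>I\<^esub> t') x y (tr a' s' t' x y \<alpha>' \<bullet>\<^bsub>J\<^esub> ev \<mu> x)"
    using eq by simp
  then show ?thesis
    using tr_vcmp[OF gt(1) ge(2), of f] tr_vcmp[OF ge(1) gt(2), of f] tr_tr[OF *(1,3,5), of f] tr_tr[OF *(2,4,6), of f]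
      tr_ev[of \<mu> "a \<cdot>\<^bsub>I\<^esub> s" "a' \<cdot>\<^bsub>I\<^esub> s'" x f] tr_ev[of \<nu> "a \<cdot>\<^bsub>I\<^esub> t" "a' \<cdot>\<^bsub>I\<^esub> t'" y f] * g f by simp
qed

lemma germ_eq_trans:
  assumes "germ_eq x y (s, t, \<alpha>) (s', t', \<alpha>')" "germ_eq x y (s', t', \<alpha>') (s'', t'', \<alpha>'')"
  shows "germ_eq x y (s, t, \<alpha>) (s'', t'', \<alpha>'')"
proof -
  from assms(1) obtain a a' \<mu> \<nu> where *: "gc s t x y \<alpha>" "gc s' t' x y \<alpha>'"
    "a \<in> Ar I" "a' \<in> Ar I" "src I a = trg I t" "src I a' = trg I t'" "trg I a' = trg I a"
    "iso2 I \<mu>" "dom2 I \<mu> = a \<cdot>\<^bsub>I\<^esub> s" "cod2 I \<mu> = a' \<cdot>\<^bsub>I\<^esub> s'"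
    "iso2 I \<nu>" "dom2 I \<nu> = a \<cdot>\<^bsub>I\<^esub> t" "cod2 I \<nu> = a' \<cdot>\<^bsub>I\<^esub> t'"
    and eq: "ev \<nu> y \<bullet>\<^bsub>J\<^esub> tr a s t x y \<alpha> = tr a' s' t' x y \<alpha>' \<bullet>\<^bsub>J\<^esub> ev \<mu> x"
    and sr: "src I s' = src I s" "src I t' = src I t"
    by (rule germ_eqE)
  from assms(2) obtain b b' \<mu>' \<nu>' where **: "gc s' t' x y \<alpha>'" "gc s'' t'' x y \<alpha>''"
    "b \<in> Ar I" "b' \<in> Ar I" "src I b = trg I t'" "src I b' = trg I t''" "trg I b' = trg I b"
    "iso2 I \<mu>'" "dom2 I \<mu>' = b \<cdot>\<^bsub>I\<^esub> s'" "cod2 I \<mu>' = b' \<cdot>\<^bsub>I\<^esub> s''"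
    "iso2 I \<nu>'" "dom2 I \<nu>' = b \<cdot>\<^bsub>I\<^esub> t'" "cod2 I \<nu>' = b' \<cdot>\<^bsub>I\<^esub> t''"
    and eq': "ev \<nu>' y \<bullet>\<^bsub>J\<^esub> tr b s' t' x y \<alpha>' = tr b' s'' t'' x y \<alpha>'' \<bullet>\<^bsub>J\<^esub> ev \<mu>' x"
    and sr': "src I s'' = src I s'" "src I t'' = src I t'"
    by (rule germ_eqE)
  \<comment> \<open>One pair of witnesses moves the middle cell along \<open>a'\<close>, the other
    along \<open>b\<close>; \<theta> joins these two stages.\<close>
  obtain f g \<theta> where fg: "f \<in> Ar I" "g \<in> Ar I" "src I f = trg I a'" "src I g = trg I b" "trg I g = trg I f"
    "iso2 I \<theta>" "dom2 I \<theta> = f \<cdot>\<^bsub>I\<^esub> a'" "cod2 I \<theta> = g \<cdot>\<^bsub>I\<^esub> b"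
    by (rule bifiltered_span[OF bif, of a' b]) (use * ** in auto)
  note T = gcD(1-4)[OF *(1)] gcD(1-4)[OF *(2)] gcD(1-4)[OF **(2)] gc_trg[OF *(1)] gc_trg[OF *(2)] gc_trg[OF **(2)]
  note A = *(3-13) **(3-13) fg sr sr' T
  note p1 = germ_eq_push[OF *(1-7) iso2_Cl[OF *(8)] *(9-10) iso2_Cl[OF *(11)] *(12-13) eq, of f]
  note p2 = germ_eq_push[OF **(1-7) iso2_Cl[OF **(8)] **(9-10) iso2_Cl[OF **(11)] **(12-13) eq', of g]
  \<comment> \<open>The middle one of the three squares to be pasted.\<close>
  have p3: "ev (\<theta> \<star>\<^bsub>I\<^esub> id2 I t') y \<bullet>\<^bsub>J\<^esub> tr (f \<cdot>\<^bsub>I\<^esub> a') s' t' x y \<alpha>' = tr (g \<cdot>\<^bsub>I\<^esub> b) s' t' x y \<alpha>' \<bullet>\<^bsub>J\<^esub> ev (\<theta> \<star>\<^bsub>I\<^esub> id2 I s') x"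
    by (rule tr_2cell) (use A *(2) in simp_all)
  define \<mu>1 \<mu>2 \<mu>3 \<nu>1 \<nu>2 \<nu>3 where d: "\<mu>1 = id2 I f \<star>\<^bsub>I\<^esub> \<mu>" "\<mu>2 = \<theta> \<star>\<^bsub>I\<^esub> id2 I s'" "\<mu>3 = id2 I g \<star>\<^bsub>I\<^esub> \<mu>'"
    "\<nu>1 = id2 I f \<star>\<^bsub>I\<^esub> \<nu>" "\<nu>2 = \<theta> \<star>\<^bsub>I\<^esub> id2 I t'" "\<nu>3 = id2 I g \<star>\<^bsub>I\<^esub> \<nu>'"
  have D: "iso2 I \<mu>1" "dom2 I \<mu>1 = f \<cdot>\<^bsub>I\<^esub> (a \<cdot>\<^bsub>I\<^esub> s)" "cod2 I \<mu>1 = f \<cdot>\<^bsub>I\<^esub> (a' \<cdot>\<^bsub>I\<^esub> s')"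
    "iso2 I \<mu>2" "dom2 I \<mu>2 = f \<cdot>\<^bsub>I\<^esub> (a' \<cdot>\<^bsub>I\<^esub> s')" "cod2 I \<mu>2 = g \<cdot>\<^bsub>I\<^esub> (b \<cdot>\<^bsub>I\<^esub> s')"
    "iso2 I \<mu>3" "dom2 I \<mu>3 = g \<cdot>\<^bsub>I\<^esub> (b \<cdot>\<^bsub>I\<^esub> s')" "cod2 I \<mu>3 = g \<cdot>\<^bsub>I\<^esub> (b' \<cdot>\<^bsub>I\<^esub> s'')"
    "iso2 I \<nu>1" "dom2 I \<nu>1 = f \<cdot>\<^bsub>I\<^esub> (a \<cdot>\<^bsub>I\<^esub> t)" "cod2 I \<nu>1 = f \<cdot>\<^bsub>I\<^esub> (a' \<cdot>\<^bsub>I\<^esub> t')"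
    "iso2 I \<nu>2" "dom2 I \<nu>2 = f \<cdot>\<^bsub>I\<^esub> (a' \<cdot>\<^bsub>I\<^esub> t')" "cod2 I \<nu>2 = g \<cdot>\<^bsub>I\<^esub> (b \<cdot>\<^bsub>I\<^esub> t')"
    "iso2 I \<nu>3" "dom2 I \<nu>3 = g \<cdot>\<^bsub>I\<^esub> (b \<cdot>\<^bsub>I\<^esub> t')" "cod2 I \<nu>3 = g \<cdot>\<^bsub>I\<^esub> (b' \<cdot>\<^bsub>I\<^esub> t'')"
    unfolding d using A by simp_all
  let ?A = "tr (f \<cdot>\<^bsub>I\<^esub> a) s t x y \<alpha>" and ?A1 = "tr (f \<cdot>\<^bsub>I\<^esub> a') s' t' x y \<alpha>'" and ?A2 = "tr (g \<cdot>\<^bsub>I\<^esub> b) s' t' x y \<alpha>'"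
    and ?A3 = "tr (g \<cdot>\<^bsub>I\<^esub> b') s'' t'' x y \<alpha>''"
  have E: "ev \<nu>1 y \<bullet>\<^bsub>J\<^esub> ?A = ?A1 \<bullet>\<^bsub>J\<^esub> ev \<mu>1 x" "ev \<nu>2 y \<bullet>\<^bsub>J\<^esub> ?A1 = ?A2 \<bullet>\<^bsub>J\<^esub> ev \<mu>2 x" "ev \<nu>3 y \<bullet>\<^bsub>J\<^esub> ?A2 = ?A3 \<bullet>\<^bsub>J\<^esub> ev \<mu>3 x"
    using p1 p2 p3 A by (simp_all add: d)
  have C: "gc (f \<cdot>\<^bsub>I\<^esub> (a \<cdot>\<^bsub>I\<^esub> s)) (f \<cdot>\<^bsub>I\<^esub> (a \<cdot>\<^bsub>I\<^esub> t)) x y ?A" "gc (f \<cdot>\<^bsub>I\<^esub> (a' \<cdot>\<^bsub>I\<^esub> s')) (f \<cdot>\<^bsub>I\<^esub> (a' \<cdot>\<^bsub>I\<^esub> t')) x y ?A1"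
    "gc (g \<cdot>\<^bsub>I\<^esub> (b \<cdot>\<^bsub>I\<^esub> s')) (g \<cdot>\<^bsub>I\<^esub> (b \<cdot>\<^bsub>I\<^esub> t')) x y ?A2" "gc (g \<cdot>\<^bsub>I\<^esub> (b' \<cdot>\<^bsub>I\<^esub> s'')) (g \<cdot>\<^bsub>I\<^esub> (b' \<cdot>\<^bsub>I\<^esub> t'')) x y ?A3"
    using gc_tr[OF *(1), of "f \<cdot>\<^bsub>I\<^esub> a"] gc_tr[OF *(2), of "f \<cdot>\<^bsub>I\<^esub> a'"] gc_tr[OF *(2), of "g \<cdot>\<^bsub>I\<^esub> b"] gc_tr[OF **(2), of "g \<cdot>\<^bsub>I\<^esub> b'"] A
    by simp_all
  have V: "gc (f \<cdot>\<^bsub>I\<^esub> (a \<cdot>\<^bsub>I\<^esub> s)) (f \<cdot>\<^bsub>I\<^esub> (a' \<cdot>\<^bsub>I\<^esub> s')) x x (ev \<mu>1 x)" "gc (f \<cdot>\<^bsub>I\<^esub> (a' \<cdot>\<^bsub>I\<^esub> s')) (g \<cdot>\<^bsub>I\<^esub> (b \<cdot>\<^bsub>I\<^esub> s')) x x (ev \<mu>2 x)"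
     "gc (g \<cdot>\<^bsub>I\<^esub> (b \<cdot>\<^bsub>I\<^esub> s')) (g \<cdot>\<^bsub>I\<^esub> (b' \<cdot>\<^bsub>I\<^esub> s'')) x x (ev \<mu>3 x)"
     "gc (f \<cdot>\<^bsub>I\<^esub> (a \<cdot>\<^bsub>I\<^esub> t)) (f \<cdot>\<^bsub>I\<^esub> (a' \<cdot>\<^bsub>I\<^esub> t')) y y (ev \<nu>1 y)" "gc (f \<cdot>\<^bsub>I\<^esub> (a' \<cdot>\<^bsub>I\<^esub> t')) (g \<cdot>\<^bsub>I\<^esub> (b \<cdot>\<^bsub>I\<^esub> t')) y y (ev \<nu>2 y)"
     "gc (g \<cdot>\<^bsub>I\<^esub> (b \<cdot>\<^bsub>I\<^esub> t')) (g \<cdot>\<^bsub>I\<^esub> (b' \<cdot>\<^bsub>I\<^esub> t'')) y y (ev \<nu>3 y)"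
    by (rule gc_ev; use A D in simp)+
  note [simp] = gcD(5-7)[OF C(1)] gcD(5-7)[OF C(2)] gcD(5-7)[OF C(3)] gcD(5-7)[OF C(4)]
    gcD(5-7)[OF V(1)] gcD(5-7)[OF V(2)] gcD(5-7)[OF V(3)] gcD(5-7)[OF V(4)] gcD(5-7)[OF V(5)] gcD(5-7)[OF V(6)]
  have "ev (\<nu>3 \<bullet>\<^bsub>I\<^esub> (\<nu>2 \<bullet>\<^bsub>I\<^esub> \<nu>1)) y \<bullet>\<^bsub>J\<^esub> ?A = ev \<nu>3 y \<bullet>\<^bsub>J\<^esub> (ev \<nu>2 y \<bullet>\<^bsub>J\<^esub> (ev \<nu>1 y \<bullet>\<^bsub>J\<^esub> ?A))"
    using A D by (simp add: ev_vcmp)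
  also have "\<dots> = ev \<nu>3 y \<bullet>\<^bsub>J\<^esub> (ev \<nu>2 y \<bullet>\<^bsub>J\<^esub> (?A1 \<bullet>\<^bsub>J\<^esub> ev \<mu>1 x))"
    using E(1) by simp
  also have "ev \<nu>2 y \<bullet>\<^bsub>J\<^esub> (?A1 \<bullet>\<^bsub>J\<^esub> ev \<mu>1 x) = ?A2 \<bullet>\<^bsub>J\<^esub> (ev \<mu>2 x \<bullet>\<^bsub>J\<^esub> ev \<mu>1 x)"
    by (rule J.vcmp_tail[OF E(2)]) simp_all
  also have "ev \<nu>3 y \<bullet>\<^bsub>J\<^esub> (?A2 \<bullet>\<^bsub>J\<^esub> (ev \<mu>2 x \<bullet>\<^bsub>J\<^esub> ev \<mu>1 x)) = ?A3 \<bullet>\<^bsub>J\<^esub> (ev \<mu>3 x \<bullet>\<^bsub>J\<^esub> (ev \<mu>2 x \<bullet>\<^bsub>J\<^esub> ev \<mu>1 x))"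
    by (rule J.vcmp_tail[OF E(3)]) simp_all
  also have "\<dots> = ?A3 \<bullet>\<^bsub>J\<^esub> ev (\<mu>3 \<bullet>\<^bsub>I\<^esub> (\<mu>2 \<bullet>\<^bsub>I\<^esub> \<mu>1)) x"
    using A D by (simp add: ev_vcmp)
  finally show ?thesis
    by (intro germ_eqI[of s t x y \<alpha> s'' t'' \<alpha>'' "f \<cdot>\<^bsub>I\<^esub> a" "g \<cdot>\<^bsub>I\<^esub> b'" "\<mu>3 \<bullet>\<^bsub>I\<^esub> (\<mu>2 \<bullet>\<^bsub>I\<^esub> \<mu>1)" "\<nu>3 \<bullet>\<^bsub>I\<^esub> (\<nu>2 \<bullet>\<^bsub>I\<^esub> \<nu>1)"])
      (use *(1) **(2) A D in simp_all)
qed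

text \<open>The cell \<open>\<nu>\<close> need not be invertible, as 2-cells of \<open>I\<close> become invertible at a later stage.\<close>

lemma germ_eq_ev:
  assumes g: "gc s t x y \<alpha>" and \<nu>: "\<nu> \<in> Cl I" "dom2 I \<nu> = t" "cod2 I \<nu> = t'"
  shows "germ_eq x y (s, t, \<alpha>) (s, t', ev \<nu> y \<bullet>\<^bsub>J\<^esub> \<alpha>)"
proof -
  note T = gcD(1-4)[OF g] gc_trg[OF g]
  have t': "t' \<in> Ar I" "src I t' = src I t" "trg I t' = trg I t"
    using \<nu> I.src_cod2[of \<nu>] I.trg_cod2[of \<nu>] by auto
  have ge: "gc t t' y y (ev \<nu> y)"
    by (rule gc_ev) (use \<nu> T in auto)
  obtain e where e: "e \<in> Ar I" "src I e = trg I t" "iso2 I (id2 I e \<star>\<^bsub>I\<^esub> \<nu>)"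
    using bifiltered_iso2[OF bif \<nu>(1)] \<nu> by metis
  have te: "tr e s t' x y (ev \<nu> y \<bullet>\<^bsub>J\<^esub> \<alpha>) = ev (id2 I e \<star>\<^bsub>I\<^esub> \<nu>) y \<bullet>\<^bsub>J\<^esub> tr e s t x y \<alpha>"
    using tr_vcmp[OF g ge, of e] tr_ev[OF \<nu>, of y e] e T t' by simp
  have gs: "gc (e \<cdot>\<^bsub>I\<^esub> s) (e \<cdot>\<^bsub>I\<^esub> t') x y (tr e s t' x y (ev \<nu> y \<bullet>\<^bsub>J\<^esub> \<alpha>))"
    using gc_tr[OF gc_vcmp[OF g ge], of e] e t' by simp
  show ?thesis
  proof (rule germ_eqI[of s t x y \<alpha> s t' "ev \<nu> y \<bullet>\<^bsub>J\<^esub> \<alpha>" e e "id2 I (e \<cdot>\<^bsub>I\<^esub> s)" "id2 I e \<star>\<^bsub>I\<^esub> \<nu>"])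
    show "ev (id2 I e \<star>\<^bsub>I\<^esub> \<nu>) y \<bullet>\<^bsub>J\<^esub> tr e s t x y \<alpha> = tr e s t' x y (ev \<nu> y \<bullet>\<^bsub>J\<^esub> \<alpha>) \<bullet>\<^bsub>J\<^esub> ev (id2 I (e \<cdot>\<^bsub>I\<^esub> s)) x"
      using te gcD(5-7)[OF gs] T e by (simp add: ev_id)
  qed (use g ge \<nu> T t' e gc_vcmp[OF g ge] in auto)
qed

lemma germ_eq_tr:
  assumes g: "gc s t x y \<alpha>" and a: "a \<in> Ar I" "src I a = trg I t"
  shows "germ_eq x y (s, t, \<alpha>) (a \<cdot>\<^bsub>I\<^esub> s, a \<cdot>\<^bsub>I\<^esub> t, tr a s t x y \<alpha>)"
proof -
  note T = gcD(1-4)[OF g] gc_trg[OF g]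
  note g1 = gc_tr[OF g a]
  let ?e = "id1 I (trg I a)"
  have g2: "gc (a \<cdot>\<^bsub>I\<^esub> s) (a \<cdot>\<^bsub>I\<^esub> t) x y (tr ?e (a \<cdot>\<^bsub>I\<^esub> s) (a \<cdot>\<^bsub>I\<^esub> t) x y (tr a s t x y \<alpha>))"
    using gc_tr[OF g1, of ?e] a T by simp
  show ?thesis
  proof (rule germ_eqI[of s t x y \<alpha> _ _ _ a ?e "id2 I (a \<cdot>\<^bsub>I\<^esub> s)" "id2 I (a \<cdot>\<^bsub>I\<^esub> t)"])
    show "ev (id2 I (a \<cdot>\<^bsub>I\<^esub> t)) y \<bullet>\<^bsub>J\<^esub> tr a s t x y \<alpha> =
      tr ?e (a \<cdot>\<^bsub>I\<^esub> s) (a \<cdot>\<^bsub>I\<^esub> t) x y (tr a s t x y \<alpha>) \<bullet>\<^bsub>J\<^esub> ev (id2 I (a \<cdot>\<^bsub>I\<^esub> s)) x"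
      using tr_tr[OF g a, of ?e] a T gcD(5-7)[OF g1] gcD(5-7)[OF g2] by (simp add: ev_id)
  qed (use g g1 T a in simp_all)
qed

text \<open>Makes the action of \<open>g\<close> on germs well defined. The witnesses stay the same:
  interchange moves \<open>g\<close> past \<open>ev\<close> of \<nu>.\<close>

lemma germ_eq_whisker:
  assumes "germ_eq x y (s, t, \<alpha>) (s', t', \<alpha>')" "g \<in> Cl J" "dom2 J g = y" "cod2 J g = y'" "pt y' (src I t)"
  shows "germ_eq x y' (s, t, (id2 J (P1 F t) \<star>\<^bsub>J\<^esub> g) \<bullet>\<^bsub>J\<^esub> \<alpha>) (s', t', (id2 J (P1 F t') \<star>\<^bsub>J\<^esub> g) \<bullet>\<^bsub>J\<^esub> \<alpha>')"
proof -
  from assms(1) obtain a a' \<mu> \<nu> where *: "gc s t x y \<alpha>" "gc s' t' x y \<alpha>'"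
    "a \<in> Ar I" "a' \<in> Ar I" "src I a = trg I t" "src I a' = trg I t'" "trg I a' = trg I a"
    "iso2 I \<mu>" "dom2 I \<mu> = a \<cdot>\<^bsub>I\<^esub> s" "cod2 I \<mu> = a' \<cdot>\<^bsub>I\<^esub> s'"
    "iso2 I \<nu>" "dom2 I \<nu> = a \<cdot>\<^bsub>I\<^esub> t" "cod2 I \<nu> = a' \<cdot>\<^bsub>I\<^esub> t'"
    and eq: "ev \<nu> y \<bullet>\<^bsub>J\<^esub> tr a s t x y \<alpha> = tr a' s' t' x y \<alpha>' \<bullet>\<^bsub>J\<^esub> ev \<mu> x"
    and sr: "src I s' = src I s" "src I t' = src I t"
    by (rule germ_eqE)
  note T = gcD(1-4)[OF *(1)] gcD(1-4)[OF *(2)] gc_trg[OF *(1)] gc_trg[OF *(2)] ptD[OF assms(5)] ptD[OF gcD(3)[OF *(1)]] ptD[OF gcD(4)[OF *(1)]]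
  have w: "gc t t y y' (id2 J (P1 F t) \<star>\<^bsub>J\<^esub> g)" "gc t' t' y y' (id2 J (P1 F t') \<star>\<^bsub>J\<^esub> g)"
    by (rule gc_whisker; use assms T sr in simp)+
  have gt: "gc (a \<cdot>\<^bsub>I\<^esub> s) (a \<cdot>\<^bsub>I\<^esub> t) x y (tr a s t x y \<alpha>)" "gc (a' \<cdot>\<^bsub>I\<^esub> s') (a' \<cdot>\<^bsub>I\<^esub> t') x y (tr a' s' t' x y \<alpha>')"
    using * by simp_all
  have ge: "gc (a \<cdot>\<^bsub>I\<^esub> s) (a' \<cdot>\<^bsub>I\<^esub> s') x x (ev \<mu> x)" "gc (a \<cdot>\<^bsub>I\<^esub> t) (a' \<cdot>\<^bsub>I\<^esub> t') y y (ev \<nu> y)" "gc (a \<cdot>\<^bsub>I\<^esub> t) (a' \<cdot>\<^bsub>I\<^esub> t') y' y' (ev \<nu> y')"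
    by (rule gc_ev; use * T assms(5) in simp)+
  have t1: "tr a s t x y' ((id2 J (P1 F t) \<star>\<^bsub>J\<^esub> g) \<bullet>\<^bsub>J\<^esub> \<alpha>) = (id2 J (P1 F (a \<cdot>\<^bsub>I\<^esub> t)) \<star>\<^bsub>J\<^esub> g) \<bullet>\<^bsub>J\<^esub> tr a s t x y \<alpha>"
    using tr_vcmp[OF *(1) w(1), of a] tr_whisker[of y t y' g a] assms * T by simp
  have t2: "tr a' s' t' x y' ((id2 J (P1 F t') \<star>\<^bsub>J\<^esub> g) \<bullet>\<^bsub>J\<^esub> \<alpha>') = (id2 J (P1 F (a' \<cdot>\<^bsub>I\<^esub> t')) \<star>\<^bsub>J\<^esub> g) \<bullet>\<^bsub>J\<^esub> tr a' s' t' x y \<alpha>'"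
    using tr_vcmp[OF *(2) w(2), of a'] tr_whisker[of y t' y' g a'] assms * T sr by simp
  note [simp] = gcD(5-7)[OF gt(1)] gcD(5-7)[OF gt(2)] gcD(5-7)[OF ge(1)] gcD(5-7)[OF ge(2)] gcD(5-7)[OF ge(3)]
  have ex: "ev \<nu> y' \<bullet>\<^bsub>J\<^esub> (id2 J (P1 F (a \<cdot>\<^bsub>I\<^esub> t)) \<star>\<^bsub>J\<^esub> g) = (id2 J (P1 F (a' \<cdot>\<^bsub>I\<^esub> t')) \<star>\<^bsub>J\<^esub> g) \<bullet>\<^bsub>J\<^esub> ev \<nu> y"
    unfolding ev_def by (rule J.whisker_exchange') (use assms * T in simp_all)
  have "ev \<nu> y' \<bullet>\<^bsub>J\<^esub> ((id2 J (P1 F (a \<cdot>\<^bsub>I\<^esub> t)) \<star>\<^bsub>J\<^esub> g) \<bullet>\<^bsub>J\<^esub> tr a s t x y \<alpha>) = (id2 J (P1 F (a' \<cdot>\<^bsub>I\<^esub> t')) \<star>\<^bsub>J\<^esub> g) \<bullet>\<^bsub>J\<^esub> (ev \<nu> y \<bullet>\<^bsub>J\<^esub> tr a s t x y \<alpha>)"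
    by (rule J.vcmp_tail[OF ex]) (use * T assms sr in simp_all)
  also have "\<dots> = ((id2 J (P1 F (a' \<cdot>\<^bsub>I\<^esub> t')) \<star>\<^bsub>J\<^esub> g) \<bullet>\<^bsub>J\<^esub> tr a' s' t' x y \<alpha>') \<bullet>\<^bsub>J\<^esub> ev \<mu> x"
    unfolding eq using * T assms sr by simp
  finally show ?thesis
    by (intro germ_eqI[of s t x y' _ s' t' _ a a' \<mu> \<nu>]) (use * gc_vcmp[OF *(1) w(1)] gc_vcmp[OF *(2) w(2)] t1 t2 in simp_all)
qed

text \<open>For the functor of germs this says that the structure map along \<open>d\<close> is well
  defined and injective. Whiskering \<nu> with \<open>d\<close> turns witnesses for the right-hand
  side into witnesses for the left; the converse needs a later stage.\<close>

lemma germ_eq_P2c_iff: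
  assumes g: "gc s t x (P1 F d \<cdot>\<^bsub>J\<^esub> y) \<alpha>" "gc s' t' x (P1 F d \<cdot>\<^bsub>J\<^esub> y) \<alpha>'" and d: "d \<in> Ar I" "src I t = trg I d" "src I t' = trg I d" "pt y (src I d)"
    and s: "src I s' = src I s"
  shows "germ_eq x y (s, t \<cdot>\<^bsub>I\<^esub> d, (P2c F t d \<star>\<^bsub>J\<^esub> id2 J y) \<bullet>\<^bsub>J\<^esub> \<alpha>) (s', t' \<cdot>\<^bsub>I\<^esub> d, (P2c F t' d \<star>\<^bsub>J\<^esub> id2 J y) \<bullet>\<^bsub>J\<^esub> \<alpha>') \<longleftrightarrow>
    germ_eq x (P1 F d \<cdot>\<^bsub>J\<^esub> y) (s, t, \<alpha>) (s', t', \<alpha>')"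
proof -
  note T = gcD(1-4)[OF g(1)] gcD(1-4)[OF g(2)] gc_trg[OF g(1)] gc_trg[OF g(2)] ptD[OF d(4)] ptD[OF gcD(3)[OF g(1)]] pt_P1[OF d(1,4)]
  have P: "gc t (t \<cdot>\<^bsub>I\<^esub> d) (P1 F d \<cdot>\<^bsub>J\<^esub> y) y (P2c F t d \<star>\<^bsub>J\<^esub> id2 J y)" if "t \<in> Ar I" "src I t = trg I d" for t
    using gc_P2c[of d t y] that d by simp
  \<comment> \<open>With \<open>\<nu> \<star> id2 I d\<close> in place of \<nu> the two conditions
    are equivalent, as the coherence cells are natural and invertible.\<close>
  have key: "ev (\<nu> \<star>\<^bsub>I\<^esub> id2 I d) y \<bullet>\<^bsub>J\<^esub> tr a s (t \<cdot>\<^bsub>I\<^esub> d) x y ((P2c F t d \<star>\<^bsub>J\<^esub> id2 J y) \<bullet>\<^bsub>J\<^esub> \<alpha>) =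
      tr a' s' (t' \<cdot>\<^bsub>I\<^esub> d) x y ((P2c F t' d \<star>\<^bsub>J\<^esub> id2 J y) \<bullet>\<^bsub>J\<^esub> \<alpha>') \<bullet>\<^bsub>J\<^esub> ev \<mu> x \<longleftrightarrow>
      ev \<nu> (P1 F d \<cdot>\<^bsub>J\<^esub> y) \<bullet>\<^bsub>J\<^esub> tr a s t x (P1 F d \<cdot>\<^bsub>J\<^esub> y) \<alpha> = tr a' s' t' x (P1 F d \<cdot>\<^bsub>J\<^esub> y) \<alpha>' \<bullet>\<^bsub>J\<^esub> ev \<mu> x"
    if *: "a \<in> Ar I" "a' \<in> Ar I" "src I a = trg I t" "src I a' = trg I t'" "trg I a' = trg I a"
    "iso2 I \<mu>" "dom2 I \<mu> = a \<cdot>\<^bsub>I\<^esub> s" "cod2 I \<mu> = a' \<cdot>\<^bsub>I\<^esub> s'"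
    "iso2 I \<nu>" "dom2 I \<nu> = a \<cdot>\<^bsub>I\<^esub> t" "cod2 I \<nu> = a' \<cdot>\<^bsub>I\<^esub> t'" for a a' \<mu> \<nu>
  proof -
    have gt: "gc (a \<cdot>\<^bsub>I\<^esub> s) (a \<cdot>\<^bsub>I\<^esub> t) x (P1 F d \<cdot>\<^bsub>J\<^esub> y) (tr a s t x (P1 F d \<cdot>\<^bsub>J\<^esub> y) \<alpha>)"
      "gc (a' \<cdot>\<^bsub>I\<^esub> s') (a' \<cdot>\<^bsub>I\<^esub> t') x (P1 F d \<cdot>\<^bsub>J\<^esub> y) (tr a' s' t' x (P1 F d \<cdot>\<^bsub>J\<^esub> y) \<alpha>')"
      using * g by simp_all
    have ge: "gc (a \<cdot>\<^bsub>I\<^esub> s) (a' \<cdot>\<^bsub>I\<^esub> s') x x (ev \<mu> x)" "gc (a \<cdot>\<^bsub>I\<^esub> t) (a' \<cdot>\<^bsub>I\<^esub> t') (P1 F d \<cdot>\<^bsub>J\<^esub> y) (P1 F d \<cdot>\<^bsub>J\<^esub> y) (ev \<nu> (P1 F d \<cdot>\<^bsub>J\<^esub> y))"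
      by (rule gc_ev; use * T in simp)+
    note [simp] = gcD(5-7)[OF gt(1)] gcD(5-7)[OF gt(2)] gcD(5-7)[OF ge(1)] gcD(5-7)[OF ge(2)]
    have t1: "tr a s (t \<cdot>\<^bsub>I\<^esub> d) x y ((P2c F t d \<star>\<^bsub>J\<^esub> id2 J y) \<bullet>\<^bsub>J\<^esub> \<alpha>) = (P2c F (a \<cdot>\<^bsub>I\<^esub> t) d \<star>\<^bsub>J\<^esub> id2 J y) \<bullet>\<^bsub>J\<^esub> tr a s t x (P1 F d \<cdot>\<^bsub>J\<^esub> y) \<alpha>"
      using tr_vcmp[OF g(1) P[of t], of a] tr_P2c[of d t y a] * T d by simp
    have t2: "tr a' s' (t' \<cdot>\<^bsub>I\<^esub> d) x y ((P2c F t' d \<star>\<^bsub>J\<^esub> id2 J y) \<bullet>\<^bsub>J\<^esub> \<alpha>') = (P2c F (a' \<cdot>\<^bsub>I\<^esub> t') d \<star>\<^bsub>J\<^esub> id2 J y) \<bullet>\<^bsub>J\<^esub> tr a' s' t' x (P1 F d \<cdot>\<^bsub>J\<^esub> y) \<alpha>'"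
      using tr_vcmp[OF g(2) P[of t'], of a'] tr_P2c[of d t' y a'] * T d by simp
    have gd: "gc (a \<cdot>\<^bsub>I\<^esub> (t \<cdot>\<^bsub>I\<^esub> d)) (a' \<cdot>\<^bsub>I\<^esub> (t' \<cdot>\<^bsub>I\<^esub> d)) y y (ev (\<nu> \<star>\<^bsub>I\<^esub> id2 I d) y)"
      by (rule gc_ev) (use * d T in simp_all)
    note [simp] = gcD(5-7)[OF gd]
    have ex: "ev (\<nu> \<star>\<^bsub>I\<^esub> id2 I d) y \<bullet>\<^bsub>J\<^esub> (P2c F (a \<cdot>\<^bsub>I\<^esub> t) d \<star>\<^bsub>J\<^esub> id2 J y) =
      (P2c F (a' \<cdot>\<^bsub>I\<^esub> t') d \<star>\<^bsub>J\<^esub> id2 J y) \<bullet>\<^bsub>J\<^esub> ev \<nu> (P1 F d \<cdot>\<^bsub>J\<^esub> y)"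
      using arg_cong[OF P2c_natural'[of "id2 I d" \<nu>], of "\<lambda>w. w \<star>\<^bsub>J\<^esub> id2 J y"] * d T by (simp add: ev_def)
    have "ev (\<nu> \<star>\<^bsub>I\<^esub> id2 I d) y \<bullet>\<^bsub>J\<^esub> ((P2c F (a \<cdot>\<^bsub>I\<^esub> t) d \<star>\<^bsub>J\<^esub> id2 J y) \<bullet>\<^bsub>J\<^esub> tr a s t x (P1 F d \<cdot>\<^bsub>J\<^esub> y) \<alpha>) =
       (P2c F (a' \<cdot>\<^bsub>I\<^esub> t') d \<star>\<^bsub>J\<^esub> id2 J y) \<bullet>\<^bsub>J\<^esub> (ev \<nu> (P1 F d \<cdot>\<^bsub>J\<^esub> y) \<bullet>\<^bsub>J\<^esub> tr a s t x (P1 F d \<cdot>\<^bsub>J\<^esub> y) \<alpha>)"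
      by (rule J.vcmp_tail[OF ex]) (use * T d in simp_all)
    then show ?thesis
      unfolding t1 t2 using * T d
        J.vcmp_left_cancel[of "P2c F (a' \<cdot>\<^bsub>I\<^esub> t') d \<star>\<^bsub>J\<^esub> id2 J y" "ev \<nu> (P1 F d \<cdot>\<^bsub>J\<^esub> y) \<bullet>\<^bsub>J\<^esub> tr a s t x (P1 F d \<cdot>\<^bsub>J\<^esub> y) \<alpha>"
          "tr a' s' t' x (P1 F d \<cdot>\<^bsub>J\<^esub> y) \<alpha>' \<bullet>\<^bsub>J\<^esub> ev \<mu> x"] by simp
  qed
  note gd1 = gc_vcmp[OF g(1) P[of t]] and gd2 = gc_vcmp[OF g(2) P[of t']]
  show ?thesis
  proof
    assume "germ_eq x (P1 F d \<cdot>\<^bsub>J\<^esub> y) (s, t, \<alpha>) (s', t', \<alpha>')"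
    then obtain a a' \<mu> \<nu> where *:
      "a \<in> Ar I" "a' \<in> Ar I" "src I a = trg I t" "src I a' = trg I t'" "trg I a' = trg I a"
      "iso2 I \<mu>" "dom2 I \<mu> = a \<cdot>\<^bsub>I\<^esub> s" "cod2 I \<mu> = a' \<cdot>\<^bsub>I\<^esub> s'"
      "iso2 I \<nu>" "dom2 I \<nu> = a \<cdot>\<^bsub>I\<^esub> t" "cod2 I \<nu> = a' \<cdot>\<^bsub>I\<^esub> t'"
      and eq: "ev \<nu> (P1 F d \<cdot>\<^bsub>J\<^esub> y) \<bullet>\<^bsub>J\<^esub> tr a s t x (P1 F d \<cdot>\<^bsub>J\<^esub> y) \<alpha> = tr a' s' t' x (P1 F d \<cdot>\<^bsub>J\<^esub> y) \<alpha>' \<bullet>\<^bsub>J\<^esub> ev \<mu> x"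
      by (rule germ_eqE)
    show "germ_eq x y (s, t \<cdot>\<^bsub>I\<^esub> d, (P2c F t d \<star>\<^bsub>J\<^esub> id2 J y) \<bullet>\<^bsub>J\<^esub> \<alpha>) (s', t' \<cdot>\<^bsub>I\<^esub> d, (P2c F t' d \<star>\<^bsub>J\<^esub> id2 J y) \<bullet>\<^bsub>J\<^esub> \<alpha>')"
      by (rule germ_eqI[of _ _ _ _ _ _ _ _ a a' \<mu> "\<nu> \<star>\<^bsub>I\<^esub> id2 I d"])
        (use gd1 gd2 * T d key[OF *] eq in simp_all)
  next
    assume "germ_eq x y (s, t \<cdot>\<^bsub>I\<^esub> d, (P2c F t d \<star>\<^bsub>J\<^esub> id2 J y) \<bullet>\<^bsub>J\<^esub> \<alpha>) (s', t' \<cdot>\<^bsub>I\<^esub> d, (P2c F t' d \<star>\<^bsub>J\<^esub> id2 J y) \<bullet>\<^bsub>J\<^esub> \<alpha>')"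
    then obtain a a' \<mu> \<nu> where gg: "gc s (t \<cdot>\<^bsub>I\<^esub> d) x y ((P2c F t d \<star>\<^bsub>J\<^esub> id2 J y) \<bullet>\<^bsub>J\<^esub> \<alpha>)" "gc s' (t' \<cdot>\<^bsub>I\<^esub> d) x y ((P2c F t' d \<star>\<^bsub>J\<^esub> id2 J y) \<bullet>\<^bsub>J\<^esub> \<alpha>')" and *:
      "a \<in> Ar I" "a' \<in> Ar I" "src I a = trg I (t \<cdot>\<^bsub>I\<^esub> d)" "src I a' = trg I (t' \<cdot>\<^bsub>I\<^esub> d)" "trg I a' = trg I a"
      "iso2 I \<mu>" "dom2 I \<mu> = a \<cdot>\<^bsub>I\<^esub> s" "cod2 I \<mu> = a' \<cdot>\<^bsub>I\<^esub> s'"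
      "iso2 I \<nu>" "dom2 I \<nu> = a \<cdot>\<^bsub>I\<^esub> (t \<cdot>\<^bsub>I\<^esub> d)" "cod2 I \<nu> = a' \<cdot>\<^bsub>I\<^esub> (t' \<cdot>\<^bsub>I\<^esub> d)"
      and eq: "ev \<nu> y \<bullet>\<^bsub>J\<^esub> tr a s (t \<cdot>\<^bsub>I\<^esub> d) x y ((P2c F t d \<star>\<^bsub>J\<^esub> id2 J y) \<bullet>\<^bsub>J\<^esub> \<alpha>) =
        tr a' s' (t' \<cdot>\<^bsub>I\<^esub> d) x y ((P2c F t' d \<star>\<^bsub>J\<^esub> id2 J y) \<bullet>\<^bsub>J\<^esub> \<alpha>') \<bullet>\<^bsub>J\<^esub> ev \<mu> x"
      by (rule germ_eqE)
    have td: "trg I (t \<cdot>\<^bsub>I\<^esub> d) = trg I t" "trg I (t' \<cdot>\<^bsub>I\<^esub> d) = trg I t'" using T d by simp_all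
    \<comment> \<open>Here \<nu> compares \<open>a t d\<close> with \<open>a' t' d\<close> and need
      not be a whiskering by \<open>d\<close>. Condition (2) provides an invertible \<theta> between
      the 1-cells without \<open>d\<close>, and (3) makes \<open>\<theta> \<star> id2 I d\<close>
      agree with the whiskered \<nu> at a later stage.\<close>
    obtain f \<theta> where f: "f \<in> Ar I" "src I f = trg I a" "iso2 I \<theta>" "dom2 I \<theta> = f \<cdot>\<^bsub>I\<^esub> (a \<cdot>\<^bsub>I\<^esub> t)" "cod2 I \<theta> = f \<cdot>\<^bsub>I\<^esub> (a' \<cdot>\<^bsub>I\<^esub> t')"
      using bifiltered_ar[OF bif, of "a \<cdot>\<^bsub>I\<^esub> t" "a' \<cdot>\<^bsub>I\<^esub> t'"] * T d td by auto
    obtain h where h: "h \<in> Ar I" "src I h = trg I f" "id2 I h \<star>\<^bsub>I\<^esub> (id2 I f \<star>\<^bsub>I\<^esub> \<nu>) = id2 I h \<star>\<^bsub>I\<^esub> (\<theta> \<star>\<^bsub>I\<^esub> id2 I d)"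
      using bifiltered_cl[OF bif, of "id2 I f \<star>\<^bsub>I\<^esub> \<nu>" "\<theta> \<star>\<^bsub>I\<^esub> id2 I d"] * T d td f by auto
    let ?e = "h \<cdot>\<^bsub>I\<^esub> f"
    have e: "?e \<in> Ar I" "src I ?e = trg I a" using f h by simp_all
    have n: "id2 I ?e \<star>\<^bsub>I\<^esub> \<nu> = (id2 I h \<star>\<^bsub>I\<^esub> \<theta>) \<star>\<^bsub>I\<^esub> id2 I d"
      using h f * T d td by simp
    have i: "iso2 I (id2 I ?e \<star>\<^bsub>I\<^esub> \<mu>)" "dom2 I (id2 I ?e \<star>\<^bsub>I\<^esub> \<mu>) = (?e \<cdot>\<^bsub>I\<^esub> a) \<cdot>\<^bsub>I\<^esub> s" "cod2 I (id2 I ?e \<star>\<^bsub>I\<^esub> \<mu>) = (?e \<cdot>\<^bsub>I\<^esub> a') \<cdot>\<^bsub>I\<^esub> s'"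
      "iso2 I (id2 I h \<star>\<^bsub>I\<^esub> \<theta>)" "dom2 I (id2 I h \<star>\<^bsub>I\<^esub> \<theta>) = (?e \<cdot>\<^bsub>I\<^esub> a) \<cdot>\<^bsub>I\<^esub> t" "cod2 I (id2 I h \<star>\<^bsub>I\<^esub> \<theta>) = (?e \<cdot>\<^bsub>I\<^esub> a') \<cdot>\<^bsub>I\<^esub> t'"
      using h(1,2) f * T d td by simp_all
    have ea: "?e \<cdot>\<^bsub>I\<^esub> a \<in> Ar I" "?e \<cdot>\<^bsub>I\<^esub> a' \<in> Ar I" "src I (?e \<cdot>\<^bsub>I\<^esub> a) = trg I t" "src I (?e \<cdot>\<^bsub>I\<^esub> a') = trg I t'" "trg I (?e \<cdot>\<^bsub>I\<^esub> a') = trg I (?e \<cdot>\<^bsub>I\<^esub> a)"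
      using f h(1,2) * td by simp_all
    have eq2: "ev ((id2 I h \<star>\<^bsub>I\<^esub> \<theta>) \<star>\<^bsub>I\<^esub> id2 I d) y \<bullet>\<^bsub>J\<^esub> tr (?e \<cdot>\<^bsub>I\<^esub> a) s (t \<cdot>\<^bsub>I\<^esub> d) x y ((P2c F t d \<star>\<^bsub>J\<^esub> id2 J y) \<bullet>\<^bsub>J\<^esub> \<alpha>) =
        tr (?e \<cdot>\<^bsub>I\<^esub> a') s' (t' \<cdot>\<^bsub>I\<^esub> d) x y ((P2c F t' d \<star>\<^bsub>J\<^esub> id2 J y) \<bullet>\<^bsub>J\<^esub> \<alpha>') \<bullet>\<^bsub>J\<^esub> ev (id2 I ?e \<star>\<^bsub>I\<^esub> \<mu>) x"
      unfolding n[symmetric]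
      by (rule germ_eq_push[OF gg *(1-5) iso2_Cl[OF *(6)] *(7,8) iso2_Cl[OF *(9)] *(10,11) eq e])
    show "germ_eq x (P1 F d \<cdot>\<^bsub>J\<^esub> y) (s, t, \<alpha>) (s', t', \<alpha>')"
      using key[OF ea i] eq2 by (intro germ_eqI[OF g ea i]) simp
  qed
qed

end

section \<open>Pseudococones under the categories of 1-cells from an object\<close>

text \<open>A pseudococone from \<open>B[K,F(-)]\<close> to a category whose objects and arrows are of any type.\<close>

locale functor_cocone = bifiltered_hom I J F K
  for I :: "('i, 'j, 'k) twocat" and J :: "('o, 'a, 'c) twocat" and F :: "('i, 'j, 'k, 'o, 'a, 'c) psfun"
    and K :: 'o +
  fixes X :: "('x, 'y) cat" and ob :: "'i \<Rightarrow> 'a \<Rightarrow> 'x" and ac :: "'i \<Rightarrow> 'c \<Rightarrow> 'y" and cc :: "'j \<Rightarrow> 'a \<Rightarrow> 'y"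
  assumes X: "category X"
    and ob: "pt x i \<Longrightarrow> ob i x \<in> cObj X"
    and ac: "\<lbrakk>\<alpha> \<in> Cl J; pt (dom2 J \<alpha>) i\<rbrakk> \<Longrightarrow> ac i \<alpha> \<in> cArr X \<and> cDom X (ac i \<alpha>) = ob i (dom2 J \<alpha>) \<and> cCod X (ac i \<alpha>) = ob i (cod2 J \<alpha>)"
    and ac_id: "pt x i \<Longrightarrow> ac i (id2 J x) = cId X (ob i x)"
    and ac_vcmp: "\<lbrakk>\<alpha> \<in> Cl J; \<beta> \<in> Cl J; dom2 J \<beta> = cod2 J \<alpha>; pt (dom2 J \<alpha>) i\<rbrakk> \<Longrightarrow> ac i (\<beta> \<bullet>\<^bsub>J\<^esub> \<alpha>) = cComp X (ac i \<beta>) (ac i \<alpha>)"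
    and cc: "\<lbrakk>d \<in> Ar I; pt x (src I d)\<rbrakk> \<Longrightarrow> cIso X (cc d x) \<and> cDom X (cc d x) = ob (trg I d) (P1 F d \<cdot>\<^bsub>J\<^esub> x) \<and> cCod X (cc d x) = ob (src I d) x"
    and cc_ac: "\<lbrakk>d \<in> Ar I; \<alpha> \<in> Cl J; pt (dom2 J \<alpha>) (src I d)\<rbrakk> \<Longrightarrow>
      cComp X (cc d (cod2 J \<alpha>)) (ac (trg I d) (id2 J (P1 F d) \<star>\<^bsub>J\<^esub> \<alpha>)) = cComp X (ac (src I d) \<alpha>) (cc d (dom2 J \<alpha>))"
    and cc_P2: "\<lbrakk>\<delta> \<in> Cl I; pt x (src I (dom2 I \<delta>))\<rbrakk> \<Longrightarrow>
      cComp X (cc (cod2 I \<delta>) x) (ac (trg I (dom2 I \<delta>)) (P2 F \<delta> \<star>\<^bsub>J\<^esub> id2 J x)) = cc (dom2 I \<delta>) x"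
    and cc_P2c: "\<lbrakk>d \<in> Ar I; e \<in> Ar I; trg I d = src I e; pt x (src I d)\<rbrakk> \<Longrightarrow>
      cComp X (cc (e \<cdot>\<^bsub>I\<^esub> d) x) (ac (trg I e) (P2c F e d \<star>\<^bsub>J\<^esub> id2 J x)) = cComp X (cc d x) (cc e (P1 F d \<cdot>\<^bsub>J\<^esub> x))"
    and cc_P0c: "pt x i \<Longrightarrow> cComp X (cc (id1 I i) x) (ac i (P0c F i \<star>\<^bsub>J\<^esub> id2 J x)) = cId X (ob i x)"
begin

sublocale X: category X by (rule X)

lemma pt_cod: "\<lbrakk>\<alpha> \<in> Cl J; pt (dom2 J \<alpha>) i\<rbrakk> \<Longrightarrow> pt (cod2 J \<alpha>) i"
  unfolding pt_def by (simp add: J.src_cod2 J.trg_cod2)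

text \<open>Reads a cell in \<open>X\<close> at its stage and carries the result back, along the
  structure isomorphisms, to the objects of \<open>I\<close> where \<open>x\<close> and
  \<open>y\<close> live.\<close>

definition germ_map :: "'j \<Rightarrow> 'j \<Rightarrow> 'a \<Rightarrow> 'a \<Rightarrow> 'c \<Rightarrow> 'y" where
  "germ_map s t x y \<alpha> = cComp X (cc t y) (cComp X (ac (trg I t) \<alpha>) (cInv X (cc s x)))"

lemma ac_gc:
  assumes "gc s t x y \<alpha>" "i = trg I t"
  shows "ac i \<alpha> \<in> cArr X" "cDom X (ac i \<alpha>) = ob i (P1 F s \<cdot>\<^bsub>J\<^esub> x)" "cCod X (ac i \<alpha>) = ob i (P1 F t \<cdot>\<^bsub>J\<^esub> y)"
  using ac[of \<alpha> i] gcD[OF assms(1)] gc_trg[OF assms(1)] assms(2) pt_P1[of s x] by simp_all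

lemma germ_map_simps:
  assumes "gc s t x y \<alpha>"
  shows "germ_map s t x y \<alpha> \<in> cArr X" "cDom X (germ_map s t x y \<alpha>) = ob (src I s) x" "cCod X (germ_map s t x y \<alpha>) = ob (src I t) y"
  unfolding germ_map_def using ac_gc[OF assms refl] gcD[OF assms] gc_trg[OF assms] cc[of s x] cc[of t y] by simp_all

lemma germ_map_eq:
  assumes "gc s t x y \<alpha>"
  shows "cComp X (germ_map s t x y \<alpha>) (cc s x) = cComp X (cc t y) (ac (trg I t) \<alpha>)"
  unfolding germ_map_def using ac_gc[OF assms refl] gcD[OF assms] gc_trg[OF assms] cc[of s x] cc[of t y] by simp

lemma germ_map_unique:
  assumes "gc s t x y \<alpha>" "w \<in> cArr X" "cDom X w = ob (src I s) x" "cComp X w (cc s x) = cComp X (cc t y) (ac (trg I t) \<alpha>)"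
  shows "w = germ_map s t x y \<alpha>"
  by (rule X.cComp_right_cancel[of _ "cc s x"])
    (use assms germ_map_simps[OF assms(1)] germ_map_eq[OF assms(1)] gcD[OF assms(1)] cc[of s x] in simp_all)

lemma germ_map_vcmp:
  assumes "gc s t x y \<alpha>" "gc t u y z \<beta>"
  shows "germ_map s u x z (\<beta> \<bullet>\<^bsub>J\<^esub> \<alpha>) = cComp X (germ_map t u y z \<beta>) (germ_map s t x y \<alpha>)"
proof (rule germ_map_unique[symmetric])
  note [simp] = germ_map_simps[OF assms(1)] germ_map_simps[OF assms(2)] gcD[OF assms(1)] gcD[OF assms(2)] gc_trg[OF assms(1)] gc_trg[OF assms(2)]
     ac_gc[OF assms(1)] ac_gc[OF assms(2)]
  have [simp]: "cIso X (cc s x)" "cDom X (cc s x) = ob (trg I u) (P1 F s \<cdot>\<^bsub>J\<^esub> x)" "cCod X (cc s x) = ob (src I s) x"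
    "cIso X (cc t y)" "cDom X (cc t y) = ob (trg I u) (P1 F t \<cdot>\<^bsub>J\<^esub> y)" "cCod X (cc t y) = ob (src I t) y"
    "cIso X (cc u z)" "cDom X (cc u z) = ob (trg I u) (P1 F u \<cdot>\<^bsub>J\<^esub> z)" "cCod X (cc u z) = ob (src I u) z"
    using cc[of s x] cc[of t y] cc[of u z] by simp_all
  have v: "ac (trg I u) (\<beta> \<bullet>\<^bsub>J\<^esub> \<alpha>) = cComp X (ac (trg I u) \<beta>) (ac (trg I u) \<alpha>)"
    using pt_P1[of s x] by (intro ac_vcmp) simp_all
  have "cComp X (germ_map t u y z \<beta>) (cComp X (germ_map s t x y \<alpha>) (cc s x)) = cComp X (cComp X (germ_map t u y z \<beta>) (cc t y)) (ac (trg I u) \<alpha>)"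
    using germ_map_eq[OF assms(1)] by simp
  also have "\<dots> = cComp X (cc u z) (ac (trg I u) (\<beta> \<bullet>\<^bsub>J\<^esub> \<alpha>))"
    unfolding germ_map_eq[OF assms(2)] v by simp
  finally show "cComp X (cComp X (germ_map t u y z \<beta>) (germ_map s t x y \<alpha>)) (cc s x) = cComp X (cc u z) (ac (trg I u) (\<beta> \<bullet>\<^bsub>J\<^esub> \<alpha>))"
    by simp
qed (use assms germ_map_simps[OF assms(1)] germ_map_simps[OF assms(2)] gc_vcmp[OF assms] in simp_all)

text \<open>The axiom \<open>cc_P2\<close> in other words: 2-cells of \<open>I\<close>, invertible
  or not, induce identities. With \<open>germ_map_tr\<close> this makes \<open>germ_map\<close> an
  invariant of germs.\<close>

lemma germ_map_ev:
  assumes "\<nu> \<in> Cl I" "dom2 I \<nu> = s" "cod2 I \<nu> = t" "pt y (src I s)"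
  shows "germ_map s t y y (ev \<nu> y) = cId X (ob (src I s) y)"
proof (rule germ_map_unique[symmetric])
  have s: "s \<in> Ar I" "t \<in> Ar I" "src I t = src I s" "trg I t = trg I s"
    using assms I.src_cod2[of \<nu>] I.trg_cod2[of \<nu>] by auto
  show "gc s t y y (ev \<nu> y)" by (rule gc_ev) (use assms in simp_all)
  show "cComp X (cId X (ob (src I s) y)) (cc s y) = cComp X (cc t y) (ac (trg I t) (ev \<nu> y))"
    using cc_P2[OF assms(1), of y] assms s cc[of s y] by (simp add: ev_def)
qed (use assms ob in auto)

lemma germ_map_id:
  assumes "s \<in> Ar I" "pt x (src I s)"
  shows "germ_map s s x x (id2 J (P1 F s \<cdot>\<^bsub>J\<^esub> x)) = cId X (ob (src I s) x)"
  using germ_map_ev[of "id2 I s" s s x] assms by (simp add: ev_id)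

text \<open>Transport inserts the coherence cells of \<open>F\<close> at \<open>s\<close> and
  \<open>t\<close>; \<open>cc_P2c\<close> trades them for structure isomorphisms at
  \<open>a\<close>, which are natural by \<open>cc_ac\<close> and cancel.\<close>

lemma germ_map_tr:
  assumes g: "gc s t x y \<alpha>" and a: "a \<in> Ar I" "src I a = trg I t"
  shows "germ_map (a \<cdot>\<^bsub>I\<^esub> s) (a \<cdot>\<^bsub>I\<^esub> t) x y (tr a s t x y \<alpha>) = germ_map s t x y \<alpha>"
proof (rule germ_map_unique)
  note g' = gc_tr[OF g a]
  note [simp] = gcD[OF g] gc_trg[OF g] a germ_map_simps[OF g] germ_map_simps[OF g'] ac_gc[OF g] ac_gc[OF g'] gcD(5-7)[OF g'] gc_pt[OF g]
  have C: "cIso X (cc d z)" "cDom X (cc d z) = ob (trg I d) (P1 F d \<cdot>\<^bsub>J\<^esub> z)" "cCod X (cc d z) = ob (src I d) z"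
    if "d \<in> Ar I" "pt z (src I d)" for d z
    using cc[OF that] by simp_all
  have p: "pt (P1 F s \<cdot>\<^bsub>J\<^esub> x) (trg I t)" "pt (P1 F t \<cdot>\<^bsub>J\<^esub> y) (trg I t)" "pt (P1 F a \<cdot>\<^bsub>J\<^esub> (P1 F s \<cdot>\<^bsub>J\<^esub> x)) (trg I a)"
    using pt_P1[of s x] pt_P1[of t y] pt_P1[of a "P1 F s \<cdot>\<^bsub>J\<^esub> x"] by simp_all
  have sa: "gc (a \<cdot>\<^bsub>I\<^esub> s) (a \<cdot>\<^bsub>I\<^esub> t) x y (tr a s t x y \<alpha>)" by (rule g')
  note [simp] = C[of s x] C[of t y] C[of a "P1 F s \<cdot>\<^bsub>J\<^esub> x"] C[of a "P1 F t \<cdot>\<^bsub>J\<^esub> y"] C[of "a \<cdot>\<^bsub>I\<^esub> s" x] C[of "a \<cdot>\<^bsub>I\<^esub> t" y] p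
  let ?m = "trg I a"
  have P: "ac ?m (P2c F a d \<star>\<^bsub>J\<^esub> id2 J z) \<in> cArr X"
     "cDom X (ac ?m (P2c F a d \<star>\<^bsub>J\<^esub> id2 J z)) = ob ?m (P1 F a \<cdot>\<^bsub>J\<^esub> (P1 F d \<cdot>\<^bsub>J\<^esub> z))"
     "cCod X (ac ?m (P2c F a d \<star>\<^bsub>J\<^esub> id2 J z)) = ob ?m (P1 F (a \<cdot>\<^bsub>I\<^esub> d) \<cdot>\<^bsub>J\<^esub> z)"
     if "d \<in> Ar I" "trg I d = trg I t" "pt z (src I d)" for d z
    using ac[of "P2c F a d \<star>\<^bsub>J\<^esub> id2 J z" ?m] that ptD[OF that(3)] pt_P1[OF that(1,3)] pt_P1[of a "P1 F d \<cdot>\<^bsub>J\<^esub> z"] by simp_all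
  have A: "ac ?m (id2 J (P1 F a) \<star>\<^bsub>J\<^esub> \<alpha>) \<in> cArr X"
     "cDom X (ac ?m (id2 J (P1 F a) \<star>\<^bsub>J\<^esub> \<alpha>)) = ob ?m (P1 F a \<cdot>\<^bsub>J\<^esub> (P1 F s \<cdot>\<^bsub>J\<^esub> x))"
     "cCod X (ac ?m (id2 J (P1 F a) \<star>\<^bsub>J\<^esub> \<alpha>)) = ob ?m (P1 F a \<cdot>\<^bsub>J\<^esub> (P1 F t \<cdot>\<^bsub>J\<^esub> y))"
    using ac[of "id2 J (P1 F a) \<star>\<^bsub>J\<^esub> \<alpha>" ?m] by simp_all
  note [simp] = P[of s x] P[of t y] A
  have Qs: "cComp X (cc (a \<cdot>\<^bsub>I\<^esub> s) x) (ac ?m (P2c F a s \<star>\<^bsub>J\<^esub> id2 J x)) = cComp X (cc s x) (cc a (P1 F s \<cdot>\<^bsub>J\<^esub> x))"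
    by (rule cc_P2c) simp_all
  have Qt: "cComp X (cc (a \<cdot>\<^bsub>I\<^esub> t) y) (ac ?m (P2c F a t \<star>\<^bsub>J\<^esub> id2 J y)) = cComp X (cc t y) (cc a (P1 F t \<cdot>\<^bsub>J\<^esub> y))"
    by (rule cc_P2c) simp_all
  have N: "cComp X (cc a (P1 F t \<cdot>\<^bsub>J\<^esub> y)) (ac ?m (id2 J (P1 F a) \<star>\<^bsub>J\<^esub> \<alpha>)) = cComp X (ac (trg I t) \<alpha>) (cc a (P1 F s \<cdot>\<^bsub>J\<^esub> x))"
    using cc_ac[of a \<alpha>] by simp
  have T: "cComp X (ac ?m (tr a s t x y \<alpha>)) (ac ?m (P2c F a s \<star>\<^bsub>J\<^esub> id2 J x)) =
      cComp X (ac ?m (P2c F a t \<star>\<^bsub>J\<^esub> id2 J y)) (ac ?m (id2 J (P1 F a) \<star>\<^bsub>J\<^esub> \<alpha>))"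
    using arg_cong[OF tr_eq[OF g a], of "ac ?m"] by (simp add: ac_vcmp)
  have "cComp X (germ_map (a \<cdot>\<^bsub>I\<^esub> s) (a \<cdot>\<^bsub>I\<^esub> t) x y (tr a s t x y \<alpha>)) (cComp X (cc s x) (cc a (P1 F s \<cdot>\<^bsub>J\<^esub> x)))
    = cComp X (cComp X (germ_map (a \<cdot>\<^bsub>I\<^esub> s) (a \<cdot>\<^bsub>I\<^esub> t) x y (tr a s t x y \<alpha>)) (cc (a \<cdot>\<^bsub>I\<^esub> s) x)) (ac ?m (P2c F a s \<star>\<^bsub>J\<^esub> id2 J x))"
    using Qs by simp
  also have "\<dots> = cComp X (cc (a \<cdot>\<^bsub>I\<^esub> t) y) (cComp X (ac ?m (P2c F a t \<star>\<^bsub>J\<^esub> id2 J y)) (ac ?m (id2 J (P1 F a) \<star>\<^bsub>J\<^esub> \<alpha>)))"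
    unfolding germ_map_eq[OF g'] using T by simp
  also have "\<dots> = cComp X (cComp X (cc (a \<cdot>\<^bsub>I\<^esub> t) y) (ac ?m (P2c F a t \<star>\<^bsub>J\<^esub> id2 J y))) (ac ?m (id2 J (P1 F a) \<star>\<^bsub>J\<^esub> \<alpha>))"
    by simp
  also have "\<dots> = cComp X (cc t y) (cComp X (cc a (P1 F t \<cdot>\<^bsub>J\<^esub> y)) (ac ?m (id2 J (P1 F a) \<star>\<^bsub>J\<^esub> \<alpha>)))"
    unfolding Qt by simp
  also have "\<dots> = cComp X (cComp X (cc t y) (ac (trg I t) \<alpha>)) (cc a (P1 F s \<cdot>\<^bsub>J\<^esub> x))"
    unfolding N by simp
  finally have "cComp X (cComp X (germ_map (a \<cdot>\<^bsub>I\<^esub> s) (a \<cdot>\<^bsub>I\<^esub> t) x y (tr a s t x y \<alpha>)) (cc s x)) (cc a (P1 F s \<cdot>\<^bsub>J\<^esub> x)) =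
      cComp X (cComp X (cc t y) (ac (trg I t) \<alpha>)) (cc a (P1 F s \<cdot>\<^bsub>J\<^esub> x))" by simp
  then show "cComp X (germ_map (a \<cdot>\<^bsub>I\<^esub> s) (a \<cdot>\<^bsub>I\<^esub> t) x y (tr a s t x y \<alpha>)) (cc s x) = cComp X (cc t y) (ac (trg I t) \<alpha>)"
    by (rule X.cComp_right_cancel) simp_all
qed (use g germ_map_simps[OF gc_tr[OF g a]] gcD[OF g] gc_trg[OF g] a in simp_all)

text \<open>As \<open>t\<close> and \<open>s'\<close> leave the same object of \<open>I\<close>,
  \<open>bifiltered_span\<close> brings both cells to one stage, where a comparison cell
  \<open>ev \<theta> y\<close> can be put between them; it induces an identity in
  \<open>X\<close>.\<close>

lemma germ_map_comp_ex:
  assumes "gc s t x y \<alpha>" "gc s' t' y z \<beta>" "src I s' = src I t"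
  obtains u u' \<gamma> where "gc u u' x z \<gamma>" "src I u = src I s" "src I u' = src I t'"
    "cComp X (germ_map s' t' y z \<beta>) (germ_map s t x y \<alpha>) = germ_map u u' x z \<gamma>"
proof -
  note T = gcD(1-4)[OF assms(1)] gc_trg[OF assms(1)] gcD(1-4)[OF assms(2)] gc_trg[OF assms(2)]
  obtain a b \<theta> where ab: "a \<in> Ar I" "b \<in> Ar I" "src I a = trg I t" "src I b = trg I s'" "trg I b = trg I a"
    "iso2 I \<theta>" "dom2 I \<theta> = a \<cdot>\<^bsub>I\<^esub> t" "cod2 I \<theta> = b \<cdot>\<^bsub>I\<^esub> s'"
    by (rule bifiltered_span[OF bif, of t s']) (use T assms(3) in auto)
  have g: "gc (a \<cdot>\<^bsub>I\<^esub> s) (a \<cdot>\<^bsub>I\<^esub> t) x y (tr a s t x y \<alpha>)" "gc (a \<cdot>\<^bsub>I\<^esub> t) (b \<cdot>\<^bsub>I\<^esub> s') y y (ev \<theta> y)"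
    "gc (b \<cdot>\<^bsub>I\<^esub> s') (b \<cdot>\<^bsub>I\<^esub> t') y z (tr b s' t' y z \<beta>)"
    using ab T assms by (auto intro!: gc_tr gc_ev)
  have "germ_map (a \<cdot>\<^bsub>I\<^esub> s) (b \<cdot>\<^bsub>I\<^esub> t') x z (tr b s' t' y z \<beta> \<bullet>\<^bsub>J\<^esub> (ev \<theta> y \<bullet>\<^bsub>J\<^esub> tr a s t x y \<alpha>)) =
     cComp X (germ_map s' t' y z \<beta>) (germ_map s t x y \<alpha>)"
    using germ_map_vcmp[OF gc_vcmp[OF g(1,2)] g(3)] germ_map_vcmp[OF g(1,2)] germ_map_tr[OF assms(1), of a] germ_map_tr[OF assms(2), of b]
      germ_map_ev[of \<theta> "a \<cdot>\<^bsub>I\<^esub> t" "b \<cdot>\<^bsub>I\<^esub> s'" y] germ_map_simps[OF assms(1)] ab T by simp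
  then show thesis
    using that[OF gc_vcmp[OF gc_vcmp[OF g(1,2)] g(3)]] ab T by simp
qed

lemma germ_map_ac:
  assumes "\<alpha> \<in> Cl J" "pt (dom2 J \<alpha>) (src I s)" "s \<in> Ar I"
  shows "gc s s (dom2 J \<alpha>) (cod2 J \<alpha>) (id2 J (P1 F s) \<star>\<^bsub>J\<^esub> \<alpha>)"
    "germ_map s s (dom2 J \<alpha>) (cod2 J \<alpha>) (id2 J (P1 F s) \<star>\<^bsub>J\<^esub> \<alpha>) = ac (src I s) \<alpha>"
proof -
  show g: "gc s s (dom2 J \<alpha>) (cod2 J \<alpha>) (id2 J (P1 F s) \<star>\<^bsub>J\<^esub> \<alpha>)"
    by (rule gc_whisker) (use assms pt_cod in auto)
  show "germ_map s s (dom2 J \<alpha>) (cod2 J \<alpha>) (id2 J (P1 F s) \<star>\<^bsub>J\<^esub> \<alpha>) = ac (src I s) \<alpha>"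
    by (rule germ_map_unique[OF g, symmetric]) (use assms ac[of \<alpha> "src I s"] cc_ac[of s \<alpha>] in simp_all)
qed

text \<open>Structure isomorphisms are germ maps too, namely of the coherence cell
  \<open>F(1) F(d) x \<Rightarrow> F(d) x\<close>; this places them in the germ category.\<close>

lemma germ_map_cc:
  assumes "d \<in> Ar I" "pt x (src I d)"
  shows "gc (id1 I (trg I d)) d (P1 F d \<cdot>\<^bsub>J\<^esub> x) x (P2c F (id1 I (trg I d)) d \<star>\<^bsub>J\<^esub> id2 J x)"
    "germ_map (id1 I (trg I d)) d (P1 F d \<cdot>\<^bsub>J\<^esub> x) x (P2c F (id1 I (trg I d)) d \<star>\<^bsub>J\<^esub> id2 J x) = cc d x"
proof -
  show g: "gc (id1 I (trg I d)) d (P1 F d \<cdot>\<^bsub>J\<^esub> x) x (P2c F (id1 I (trg I d)) d \<star>\<^bsub>J\<^esub> id2 J x)"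
    using gc_P2c[of d "id1 I (trg I d)" x] assms by simp
  show "germ_map (id1 I (trg I d)) d (P1 F d \<cdot>\<^bsub>J\<^esub> x) x (P2c F (id1 I (trg I d)) d \<star>\<^bsub>J\<^esub> id2 J x) = cc d x"
    by (rule germ_map_unique[OF g, symmetric]) (use assms cc[of d x] cc_P2c[of d "id1 I (trg I d)" x] in simp_all)
qed

lemma gc_inv:
  assumes "gc s t x y \<alpha>" "iso2 J \<alpha>"
  shows "gc t s y x (inv2 J \<alpha>)"
  using assms unfolding gc_def by auto

lemma germ_map_inv:
  assumes "gc s t x y \<alpha>" "iso2 J \<alpha>"
  shows "cIso X (germ_map s t x y \<alpha>)" "cInv X (germ_map s t x y \<alpha>) = germ_map t s y x (inv2 J \<alpha>)"
proof -
  note g = gc_inv[OF assms]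
  note T = gcD[OF assms(1)] gc_trg[OF assms(1)] germ_map_simps[OF assms(1)] germ_map_simps[OF g]
  have e: "cComp X (germ_map t s y x (inv2 J \<alpha>)) (germ_map s t x y \<alpha>) = cId X (ob (src I s) x)"
    "cComp X (germ_map s t x y \<alpha>) (germ_map t s y x (inv2 J \<alpha>)) = cId X (ob (src I t) y)"
    using germ_map_vcmp[OF assms(1) g] germ_map_vcmp[OF g assms(1)] germ_map_id assms T by simp_all
  show i: "cIso X (germ_map s t x y \<alpha>)"
    by (rule X.cIsoI[of _ "germ_map t s y x (inv2 J \<alpha>)"]) (use T e in simp_all)
  show "cInv X (germ_map s t x y \<alpha>) = germ_map t s y x (inv2 J \<alpha>)"
    by (rule X.cInv_unique[OF i]) (use T e in simp_all)
qed

text \<open>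
  The category of the objects and arrows that come from germs. The objects of \<open>B[K,F(i)]\<close> are
  kept apart, since arrows of \<open>X\<close> from germs with only their images in \<open>X\<close> composable do not
  compose to a germ.
\<close>

definition germ_cat :: "('i \<times> 'a, ('i \<times> 'a) \<times> ('i \<times> 'a) \<times> 'y) cat" where
  "germ_cat = \<lparr>cObj = {(i, x). pt x i},
     cArr = {((i, x), (j, y), w) |i x j y w. \<exists>s t \<alpha>. gc s t x y \<alpha> \<and> src I s = i \<and> src I t = j \<and> w = germ_map s t x y \<alpha>},
     cDom = fst, cCod = fst \<circ> snd, cId = (\<lambda>(i, x). ((i, x), (i, x), cId X (ob i x))),
     cComp = (\<lambda>(y', z, w') (x, y, w). (x, z, cComp X w' w))\<rparr>"

lemma germ_cat_simps [simp]:
  "(i, x) \<in> cObj germ_cat \<longleftrightarrow> pt x i" "cDom germ_cat (p, p', w) = p" "cCod germ_cat (p, p', w) = p'"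
  "cId germ_cat (i, x) = ((i, x), (i, x), cId X (ob i x))"
  "cComp germ_cat (r, r', w') (p, p', w) = (p, r', cComp X w' w)"
  by (auto simp: germ_cat_def)

lemma germ_cat_Arr: "((i, x), (j, y), w) \<in> cArr germ_cat \<longleftrightarrow>
   (\<exists>s t \<alpha>. gc s t x y \<alpha> \<and> src I s = i \<and> src I t = j \<and> w = germ_map s t x y \<alpha>)"
  by (auto simp: germ_cat_def)

lemma germ_cat_ArrI:
  "\<lbrakk>gc s t x y \<alpha>; germ_map s t x y \<alpha> = w; src I s = i; src I t = j\<rbrakk> \<Longrightarrow> ((i, x), (j, y), w) \<in> cArr germ_cat"
  unfolding germ_cat_Arr by blast

lemma germ_cat_ArrD:
  assumes "((i, x), (j, y), w) \<in> cArr germ_cat"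
  shows "pt x i" "pt y j" "w \<in> cArr X" "cDom X w = ob i x" "cCod X w = ob j y"
proof -
  obtain s t \<alpha> where "gc s t x y \<alpha>" "src I s = i" "src I t = j" "w = germ_map s t x y \<alpha>"
    using assms unfolding germ_cat_Arr by blast
  then show "pt x i" "pt y j" "w \<in> cArr X" "cDom X w = ob i x" "cCod X w = ob j y"
    using germ_map_simps[of s t x y \<alpha>] gcD(3,4)[of s t x y \<alpha>] by simp_all
qed

lemma category_germ_cat: "category germ_cat"
proof
  fix f assume "f \<in> cArr germ_cat"
  then obtain i x j y w where f: "f = ((i, x), (j, y), w)" "((i, x), (j, y), w) \<in> cArr germ_cat"
    by (cases f) auto
  note D = germ_cat_ArrD[OF f(2)]
  show "cDom germ_cat f \<in> cObj germ_cat \<and> cCod germ_cat f \<in> cObj germ_cat" using D f by simp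
  show "cComp germ_cat f (cId germ_cat (cDom germ_cat f)) = f \<and> cComp germ_cat (cId germ_cat (cCod germ_cat f)) f = f"
    using D f by simp
next
  fix p assume "p \<in> cObj germ_cat"
  then obtain i x where p: "p = (i, x)" "pt x i" by (cases p) auto
  have "((i, x), (i, x), cId X (ob i x)) \<in> cArr germ_cat"
    by (rule germ_cat_ArrI[of "id1 I i" "id1 I i" _ _ "id2 J (P1 F (id1 I i) \<cdot>\<^bsub>J\<^esub> x)"])
      (use p ptD[OF p(2)] germ_map_id[of "id1 I i" x] in \<open>simp_all add: gc_def\<close>)
  then show "cId germ_cat p \<in> cArr germ_cat \<and> cDom germ_cat (cId germ_cat p) = p \<and> cCod germ_cat (cId germ_cat p) = p"
    using p by simp
next
  fix f g assume "f \<in> cArr germ_cat" "g \<in> cArr germ_cat" "cDom germ_cat g = cCod germ_cat f"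
  then obtain i x j y w l z w' where f: "f = ((i, x), (j, y), w)" "((i, x), (j, y), w) \<in> cArr germ_cat"
    and g: "g = ((j, y), (l, z), w')" "((j, y), (l, z), w') \<in> cArr germ_cat"
    by (cases f, cases g) auto
  obtain s t \<alpha> s' t' \<beta> where a: "gc s t x y \<alpha>" "src I s = i" "src I t = j" "w = germ_map s t x y \<alpha>"
    and b: "gc s' t' y z \<beta>" "src I s' = j" "src I t' = l" "w' = germ_map s' t' y z \<beta>"
    using f(2) g(2) unfolding germ_cat_Arr by blast
  obtain u u' \<gamma> where "gc u u' x z \<gamma>" "src I u = src I s" "src I u' = src I t'"
    "cComp X (germ_map s' t' y z \<beta>) (germ_map s t x y \<alpha>) = germ_map u u' x z \<gamma>"
    by (rule germ_map_comp_ex[OF a(1) b(1)]) (use a b in auto)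
  then have "((i, x), (l, z), cComp X w' w) \<in> cArr germ_cat"
    by (intro germ_cat_ArrI[of u u' x z \<gamma>]) (use a b in simp_all)
  then show "cComp germ_cat g f \<in> cArr germ_cat \<and> cDom germ_cat (cComp germ_cat g f) = cDom germ_cat f \<and>
      cCod germ_cat (cComp germ_cat g f) = cCod germ_cat g"
    using f g by simp
next
  fix f g h assume "f \<in> cArr germ_cat" "g \<in> cArr germ_cat" "h \<in> cArr germ_cat" "cDom germ_cat g = cCod germ_cat f" "cDom germ_cat h = cCod germ_cat g"
  then obtain i x j y w l z w' k u w'' where f: "f = ((i, x), (j, y), w)" "((i, x), (j, y), w) \<in> cArr germ_cat"
    and g: "g = ((j, y), (l, z), w')" "((j, y), (l, z), w') \<in> cArr germ_cat"
    and h: "h = ((l, z), (k, u), w'')" "((l, z), (k, u), w'') \<in> cArr germ_cat"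
    by (cases f, cases g, cases h) auto
  show "cComp germ_cat (cComp germ_cat h g) f = cComp germ_cat h (cComp germ_cat g f)"
    using germ_cat_ArrD[OF f(2)] germ_cat_ArrD[OF g(2)] germ_cat_ArrD[OF h(2)] f g h by simp
qed

lemma functor_cocone_germ_cat:
  "functor_cocone I J F K germ_cat Pair (\<lambda>i \<alpha>. ((i, dom2 J \<alpha>), (i, cod2 J \<alpha>), ac i \<alpha>))
     (\<lambda>d x. ((trg I d, P1 F d \<cdot>\<^bsub>J\<^esub> x), (src I d, x), cc d x))"
proof (rule functor_cocone.intro, rule bifiltered_hom_axioms, rule functor_cocone_axioms.intro)
  show "category germ_cat" by (rule category_germ_cat)
  interpret G: category germ_cat by (rule category_germ_cat)
  fix \<alpha> i assume a: "\<alpha> \<in> Cl J" "pt (dom2 J \<alpha>) i"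
  have "((i, dom2 J \<alpha>), (i, cod2 J \<alpha>), ac i \<alpha>) \<in> cArr germ_cat"
    using germ_map_ac[of \<alpha> "id1 I i"] a ptD(4)[OF a(2)] by (intro germ_cat_ArrI[OF germ_map_ac(1)[of \<alpha> "id1 I i"]]) simp_all
  then show "((i, dom2 J \<alpha>), (i, cod2 J \<alpha>), ac i \<alpha>) \<in> cArr germ_cat \<and>
       cDom germ_cat ((i, dom2 J \<alpha>), (i, cod2 J \<alpha>), ac i \<alpha>) = (i, dom2 J \<alpha>) \<and>
       cCod germ_cat ((i, dom2 J \<alpha>), (i, cod2 J \<alpha>), ac i \<alpha>) = (i, cod2 J \<alpha>)"
    by simp
next
  interpret G: category germ_cat by (rule category_germ_cat)
  fix d x assume d: "d \<in> Ar I" "pt x (src I d)"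
  note g = germ_map_cc[OF d]
  have i: "iso2 J (P2c F (id1 I (trg I d)) d \<star>\<^bsub>J\<^esub> id2 J x)"
    using d ptD[OF d(2)] by simp
  have a: "((trg I d, P1 F d \<cdot>\<^bsub>J\<^esub> x), (src I d, x), cc d x) \<in> cArr germ_cat"
    by (rule germ_cat_ArrI[OF g]) (use d in simp_all)
  \<comment> \<open>An isomorphism of the germ category needs an inverse that comes from a germ as
    well; the inverse of the coherence cell provides it.\<close>
  have b: "((src I d, x), (trg I d, P1 F d \<cdot>\<^bsub>J\<^esub> x), cInv X (cc d x)) \<in> cArr germ_cat"
    by (rule germ_cat_ArrI[OF gc_inv[OF g(1) i]]) (use d germ_map_inv[OF g(1) i] g(2) in simp_all)
  show "cIso germ_cat ((trg I d, P1 F d \<cdot>\<^bsub>J\<^esub> x), (src I d, x), cc d x) \<and>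
       cDom germ_cat ((trg I d, P1 F d \<cdot>\<^bsub>J\<^esub> x), (src I d, x), cc d x) = (trg I d, P1 F d \<cdot>\<^bsub>J\<^esub> x) \<and>
       cCod germ_cat ((trg I d, P1 F d \<cdot>\<^bsub>J\<^esub> x), (src I d, x), cc d x) = (src I d, x)"
    using G.cIsoI[OF a b] cc[OF d] by simp
qed (use ac_id ac_vcmp cc_ac cc_P2 cc_P2c cc_P0c I.src_cod2 I.trg_cod2 pt_cod ptD in \<open>auto\<close>)

end

section \<open>Relations between sets with a partial equivalence relation\<close>

definition per_cat :: "'k set \<Rightarrow> ('k \<Rightarrow> ('t \<times> 't) set) \<Rightarrow> ('k, 'k \<times> 'k \<times> ('t \<times> 't) set) cat" where
  "per_cat S E = \<lparr>cObj = S, cArr = {(p, p', \<Gamma>). p \<in> S \<and> p' \<in> S \<and> E p O \<Gamma> = \<Gamma> \<and> \<Gamma> O E p' = \<Gamma>},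
     cDom = fst, cCod = fst \<circ> snd, cId = (\<lambda>p. (p, p, E p)), cComp = (\<lambda>(q, q', \<Delta>) (p, p', \<Gamma>). (p, q', \<Gamma> O \<Delta>))\<rparr>"

lemma per_cat_simps [simp]:
  "cObj (per_cat S E) = S" "cDom (per_cat S E) (p, p', \<Gamma>) = p" "cCod (per_cat S E) (p, p', \<Gamma>) = p'"
  "cId (per_cat S E) p = (p, p, E p)" "cComp (per_cat S E) (q, q', \<Delta>) (p, p', \<Gamma>) = (p, q', \<Gamma> O \<Delta>)"
  "(p, p', \<Gamma>) \<in> cArr (per_cat S E) \<longleftrightarrow> p \<in> S \<and> p' \<in> S \<and> E p O \<Gamma> = \<Gamma> \<and> \<Gamma> O E p' = \<Gamma>"
  by (auto simp: per_cat_def)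

lemma per_idem: "\<lbrakk>sym E; trans E\<rbrakk> \<Longrightarrow> E O E = E"
  by (auto dest: symD transD)

lemma category_per_cat:
  assumes "\<And>p. sym (E p)" "\<And>p. trans (E p)"
  shows "category (per_cat S E)"
proof
  fix f assume "f \<in> cArr (per_cat S E)"
  then show "cDom (per_cat S E) f \<in> cObj (per_cat S E) \<and> cCod (per_cat S E) f \<in> cObj (per_cat S E)"
    "cComp (per_cat S E) f (cId (per_cat S E) (cDom (per_cat S E) f)) = f \<and>
     cComp (per_cat S E) (cId (per_cat S E) (cCod (per_cat S E) f)) f = f"
    by (cases f; simp)+
next
  fix p assume "p \<in> cObj (per_cat S E)"
  then show "cId (per_cat S E) p \<in> cArr (per_cat S E) \<and> cDom (per_cat S E) (cId (per_cat S E) p) = p \<and>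
    cCod (per_cat S E) (cId (per_cat S E) p) = p"
    using per_idem[OF assms] by simp
next
  fix f g assume "f \<in> cArr (per_cat S E)" "g \<in> cArr (per_cat S E)" "cDom (per_cat S E) g = cCod (per_cat S E) f"
  then show "cComp (per_cat S E) g f \<in> cArr (per_cat S E) \<and> cDom (per_cat S E) (cComp (per_cat S E) g f) = cDom (per_cat S E) f \<and>
    cCod (per_cat S E) (cComp (per_cat S E) g f) = cCod (per_cat S E) g"
    by (cases f; cases g) (simp add: O_assoc[symmetric], simp add: O_assoc)
next
  fix f g h assume "f \<in> cArr (per_cat S E)" "g \<in> cArr (per_cat S E)" "h \<in> cArr (per_cat S E)"
  then show "cComp (per_cat S E) (cComp (per_cat S E) h g) f = cComp (per_cat S E) h (cComp (per_cat S E) g f)"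
    by (cases f; cases g; cases h) (simp add: O_assoc)
qed

text \<open>The graph of the map of classes induced by \<open>f\<close>. A partial equivalence
  relation need not be reflexive everywhere, hence the clause
  \<open>(\<tau>, \<tau>) \<in> E\<close>, which selects its field.\<close>

definition per_graph :: "('t \<times> 't) set \<Rightarrow> ('t \<times> 't) set \<Rightarrow> ('t \<Rightarrow> 't) \<Rightarrow> ('t \<times> 't) set" where
  "per_graph E E' f = {(\<tau>, \<tau>'). (\<tau>, \<tau>) \<in> E \<and> (f \<tau>, \<tau>') \<in> E'}"

context
  fixes E :: "'k \<Rightarrow> ('t \<times> 't) set"
  assumes sym: "\<And>p. sym (E p)" and trans: "\<And>p. trans (E p)"
begin

lemma per_graph_Arr:
  assumes "p \<in> S" "p' \<in> S" "\<And>\<tau> \<sigma>. (\<tau>, \<sigma>) \<in> E p \<Longrightarrow> (f \<tau>, f \<sigma>) \<in> E p'"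
  shows "(p, p', per_graph (E p) (E p') f) \<in> cArr (per_cat S E)"
proof -
  have "E p O per_graph (E p) (E p') f = per_graph (E p) (E p') f"
  proof (intro set_eqI iffI; clarify)
    fix \<tau> \<sigma> \<tau>' assume "(\<tau>, \<sigma>) \<in> E p" "(\<sigma>, \<tau>') \<in> per_graph (E p) (E p') f"
    then show "(\<tau>, \<tau>') \<in> per_graph (E p) (E p') f"
      unfolding per_graph_def using assms(3) symD[OF sym] transD[OF trans] by blast
  qed (auto simp: per_graph_def)
  moreover have "per_graph (E p) (E p') f O E p' = per_graph (E p) (E p') f"
  proof (intro set_eqI iffI; clarify)
    fix \<tau> \<tau>' assume "(\<tau>, \<tau>') \<in> per_graph (E p) (E p') f"
    moreover from this have "(\<tau>', \<tau>') \<in> E p'"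
      unfolding per_graph_def using symD[OF sym] transD[OF trans] by blast
    ultimately show "(\<tau>, \<tau>') \<in> per_graph (E p) (E p') f O E p'" by blast
  next
    fix \<tau> \<sigma> \<tau>' assume "(\<tau>, \<sigma>) \<in> per_graph (E p) (E p') f" "(\<sigma>, \<tau>') \<in> E p'"
    then show "(\<tau>, \<tau>') \<in> per_graph (E p) (E p') f"
      unfolding per_graph_def using transD[OF trans] by blast
  qed
  ultimately show ?thesis using assms by simp
qed

lemma per_graph_comp:
  assumes "\<And>\<tau> \<sigma>. (\<tau>, \<sigma>) \<in> E p \<Longrightarrow> (f \<tau>, f \<sigma>) \<in> E p'" "\<And>\<tau> \<sigma>. (\<tau>, \<sigma>) \<in> E p' \<Longrightarrow> (g \<tau>, g \<sigma>) \<in> E p''"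
  shows "per_graph (E p) (E p') f O per_graph (E p') (E p'') g = per_graph (E p) (E p'') (g \<circ> f)"
proof (intro set_eqI iffI; clarify)
  fix \<tau> \<sigma> \<tau>' assume "(\<tau>, \<sigma>) \<in> per_graph (E p) (E p') f" "(\<sigma>, \<tau>') \<in> per_graph (E p') (E p'') g"
  then have "(\<tau>, \<tau>) \<in> E p" "(f \<tau>, \<sigma>) \<in> E p'" "(g \<sigma>, \<tau>') \<in> E p''"
    by (auto simp: per_graph_def)
  then show "(\<tau>, \<tau>') \<in> per_graph (E p) (E p'') (g \<circ> f)"
    using transD[OF trans assms(2)[of "f \<tau>" \<sigma>]] by (simp add: per_graph_def)
next
  fix \<tau> \<tau>' assume "(\<tau>, \<tau>') \<in> per_graph (E p) (E p'') (g \<circ> f)"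
  then have "(\<tau>, f \<tau>) \<in> per_graph (E p) (E p') f" "(f \<tau>, \<tau>') \<in> per_graph (E p') (E p'') g"
    unfolding per_graph_def using assms(1) by auto
  then show "(\<tau>, \<tau>') \<in> per_graph (E p) (E p') f O per_graph (E p') (E p'') g" by blast
qed

text \<open>The place where equality of germs turns into equality of arrows: the representatives
  \<open>f \<tau>\<close> and \<open>g \<tau>\<close> may differ.\<close>

lemma per_graph_cong:
  assumes "\<And>\<tau>. (\<tau>, \<tau>) \<in> E p \<Longrightarrow> (f \<tau>, g \<tau>) \<in> E p'"
  shows "per_graph (E p) (E p') f = per_graph (E p) (E p') g"
  unfolding per_graph_def using assms symD[OF sym] transD[OF trans] by blast

lemma per_graph_id: "per_graph (E p) (E p) (\<lambda>\<tau>. \<tau>) = E p"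
  unfolding per_graph_def using symD[OF sym] transD[OF trans] by blast

text \<open>The inverse is the converse relation, so no inverse map on representatives has to be
  chosen; \<open>inj\<close> and \<open>surj\<close> bear only on classes.\<close>

lemma per_graph_iso:
  assumes p: "p \<in> S" "p' \<in> S" and resp: "\<And>\<tau> \<sigma>. (\<tau>, \<sigma>) \<in> E p \<Longrightarrow> (f \<tau>, f \<sigma>) \<in> E p'"
    and inj: "\<And>\<tau> \<sigma>. \<lbrakk>(\<tau>, \<tau>) \<in> E p; (\<sigma>, \<sigma>) \<in> E p; (f \<tau>, f \<sigma>) \<in> E p'\<rbrakk> \<Longrightarrow> (\<tau>, \<sigma>) \<in> E p"
    and surj: "\<And>\<tau>. (\<tau>, \<tau>) \<in> E p' \<Longrightarrow> \<exists>\<sigma>. (\<sigma>, \<sigma>) \<in> E p \<and> (f \<sigma>, \<tau>) \<in> E p'"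
  shows "cIso (per_cat S E) (p, p', per_graph (E p) (E p') f)"
proof -
  interpret category "per_cat S E" by (rule category_per_cat[OF sym trans])
  let ?G = "per_graph (E p) (E p') f"
  have G: "(p, p', ?G) \<in> cArr (per_cat S E)" by (rule per_graph_Arr[OF p resp])
  have "(p', p, ?G\<inverse>) \<in> cArr (per_cat S E)"
  proof -
    have "(E p)\<inverse> = E p" "(E p')\<inverse> = E p'" using sym by (simp_all add: sym_conv_converse_eq)
    then have "E p' O ?G\<inverse> = (?G O E p')\<inverse>" "?G\<inverse> O E p = (E p O ?G)\<inverse>" by (simp_all add: converse_relcomp)
    then show ?thesis using G p by simp
  qed
  moreover have "?G O ?G\<inverse> = E p"
  proof (intro set_eqI iffI; clarify)
    fix \<tau> \<rho> \<sigma> assume "(\<tau>, \<rho>) \<in> ?G" "(\<sigma>, \<rho>) \<in> ?G"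
    then show "(\<tau>, \<sigma>) \<in> E p"
      unfolding per_graph_def using inj symD[OF sym] transD[OF trans] by blast
  next
    fix \<tau> \<sigma> assume "(\<tau>, \<sigma>) \<in> E p"
    then have "(\<tau>, f \<tau>) \<in> ?G" "(\<sigma>, f \<tau>) \<in> ?G"
      unfolding per_graph_def using resp symD[OF sym] transD[OF trans] by blast+
    then show "(\<tau>, \<sigma>) \<in> ?G O ?G\<inverse>" by blast
  qed
  moreover have "?G\<inverse> O ?G = E p'"
  proof (intro set_eqI iffI; clarify)
    fix \<tau> \<rho> \<sigma> assume "(\<rho>, \<tau>) \<in> ?G" "(\<rho>, \<sigma>) \<in> ?G"
    then show "(\<tau>, \<sigma>) \<in> E p'"
      unfolding per_graph_def using symD[OF sym] transD[OF trans] by blast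
  next
    fix \<tau> \<sigma> assume a: "(\<tau>, \<sigma>) \<in> E p'"
    then have "(\<tau>, \<tau>) \<in> E p'" using symD[OF sym] transD[OF trans] by blast
    then obtain \<rho> where "(\<rho>, \<rho>) \<in> E p" "(f \<rho>, \<tau>) \<in> E p'" using surj by blast
    then have "(\<rho>, \<tau>) \<in> ?G" "(\<rho>, \<sigma>) \<in> ?G"
      unfolding per_graph_def using a transD[OF trans] by blast+
    then show "(\<tau>, \<sigma>) \<in> ?G\<inverse> O ?G" by blast
  qed
  ultimately show ?thesis
    by (intro cIsoI[OF G, of "(p', p, ?G\<inverse>)"]) simp_all
qed

end

section \<open>The pseudococone of germs out of a fixed 1-cell\<close>

context bifiltered_hom
begin

text \<open>
  The functor of germs out of \<open>x\<^sub>0\<close>. Sets of germs are replaced by representatives up to a partial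
  equivalence relation and maps between them by relations, which avoids quotients.
\<close>

definition gper :: "'i \<Rightarrow> 'a \<Rightarrow> 'i \<times> 'a \<Rightarrow> (('j \<times> 'j \<times> 'c) \<times> ('j \<times> 'j \<times> 'c)) set" where
  "gper i0 x0 p = {((s, t, \<alpha>), (s', t', \<alpha>')). src I s = i0 \<and> src I t = fst p \<and> germ_eq x0 (snd p) (s, t, \<alpha>) (s', t', \<alpha>')}"

definition gob :: "('i \<times> 'a) set" where
  "gob = {(j, y). pt y j}"

definition gac :: "'i \<Rightarrow> 'a \<Rightarrow> 'i \<Rightarrow> 'c \<Rightarrow> ('i \<times> 'a) \<times> ('i \<times> 'a) \<times> (('j \<times> 'j \<times> 'c) \<times> ('j \<times> 'j \<times> 'c)) set" where
  "gac i0 x0 j g = ((j, dom2 J g), (j, cod2 J g), per_graph (gper i0 x0 (j, dom2 J g)) (gper i0 x0 (j, cod2 J g))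
     (\<lambda>(s, t, \<alpha>). (s, t, (id2 J (P1 F t) \<star>\<^bsub>J\<^esub> g) \<bullet>\<^bsub>J\<^esub> \<alpha>)))"

definition gcc :: "'i \<Rightarrow> 'a \<Rightarrow> 'j \<Rightarrow> 'a \<Rightarrow> ('i \<times> 'a) \<times> ('i \<times> 'a) \<times> (('j \<times> 'j \<times> 'c) \<times> ('j \<times> 'j \<times> 'c)) set" where
  "gcc i0 x0 d y = ((trg I d, P1 F d \<cdot>\<^bsub>J\<^esub> y), (src I d, y),
     per_graph (gper i0 x0 (trg I d, P1 F d \<cdot>\<^bsub>J\<^esub> y)) (gper i0 x0 (src I d, y))
     (\<lambda>(s, t, \<alpha>). (s, t \<cdot>\<^bsub>I\<^esub> d, (P2c F t d \<star>\<^bsub>J\<^esub> id2 J y) \<bullet>\<^bsub>J\<^esub> \<alpha>)))"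

lemma gper_iff: "((s, t, \<alpha>), (s', t', \<alpha>')) \<in> gper i0 x0 (j, y) \<longleftrightarrow>
   src I s = i0 \<and> src I t = j \<and> germ_eq x0 y (s, t, \<alpha>) (s', t', \<alpha>')"
  by (simp add: gper_def)

lemma gper_refl_iff: "((s, t, \<alpha>), (s, t, \<alpha>)) \<in> gper i0 x0 (j, y) \<longleftrightarrow> src I s = i0 \<and> src I t = j \<and> gc s t x0 y \<alpha>"
  using germ_eq_refl germ_eqE unfolding gper_iff by blast

lemma gperD:
  assumes "((s, t, \<alpha>), (s', t', \<alpha>')) \<in> gper i0 x0 (j, y)"
  shows "gc s t x0 y \<alpha>" "gc s' t' x0 y \<alpha>'" "src I s = i0" "src I t = j" "src I s' = i0" "src I t' = j"
  using assms germ_eqE[of x0 y s t \<alpha> s' t' \<alpha>'] unfolding gper_iff by metis+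

lemma sym_gper: "sym (gper i0 x0 p)"
proof (rule symI, cases p)
  fix a b j y assume "(a, b) \<in> gper i0 x0 p" and p: "p = (j, y)"
  moreover obtain s t \<alpha> s' t' \<alpha>' where "a = (s, t, \<alpha>)" "b = (s', t', \<alpha>')" by (metis prod_cases3)
  ultimately show "(b, a) \<in> gper i0 x0 p"
    using gperD(5,6)[of s t \<alpha> s' t' \<alpha>' i0 x0 j y] germ_eq_sym[of x0 y s t \<alpha> s' t' \<alpha>'] by (simp add: gper_iff)
qed

lemma trans_gper: "trans (gper i0 x0 p)"
proof (rule transI, cases p)
  fix a b c j y assume "(a, b) \<in> gper i0 x0 p" "(b, c) \<in> gper i0 x0 p" and p: "p = (j, y)"
  moreover obtain s t \<alpha> s' t' \<alpha>' s'' t'' \<alpha>'' where "a = (s, t, \<alpha>)" "b = (s', t', \<alpha>')" "c = (s'', t'', \<alpha>'')"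
    by (metis prod_cases3)
  ultimately show "(a, c) \<in> gper i0 x0 p"
    using germ_eq_trans[of x0 y s t \<alpha> s' t' \<alpha>' s'' t'' \<alpha>''] by (simp add: gper_iff)
qed

lemma gac_resp:
  assumes "g \<in> Cl J" "pt (dom2 J g) j" "(\<tau>, \<sigma>) \<in> gper i0 x0 (j, dom2 J g)"
  shows "((\<lambda>(s, t, \<alpha>). (s, t, (id2 J (P1 F t) \<star>\<^bsub>J\<^esub> g) \<bullet>\<^bsub>J\<^esub> \<alpha>)) \<tau>, (\<lambda>(s, t, \<alpha>). (s, t, (id2 J (P1 F t) \<star>\<^bsub>J\<^esub> g) \<bullet>\<^bsub>J\<^esub> \<alpha>)) \<sigma>) \<in> gper i0 x0 (j, cod2 J g)"
proof -
  obtain s t \<alpha> s' t' \<alpha>' where e: "\<tau> = (s, t, \<alpha>)" "\<sigma> = (s', t', \<alpha>')" by (metis prod_cases3)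
  have "pt (cod2 J g) j"
    using assms(1,2) unfolding pt_def by (simp add: J.src_cod2 J.trg_cod2)
  then show ?thesis
    using assms e germ_eq_whisker[of x0 "dom2 J g" s t \<alpha> s' t' \<alpha>' g "cod2 J g"] by (simp add: gper_iff)
qed

lemma gcc_iff:
  assumes "d \<in> Ar I" "pt y (src I d)" "((s, t, \<alpha>), (s, t, \<alpha>)) \<in> gper i0 x0 (trg I d, P1 F d \<cdot>\<^bsub>J\<^esub> y)"
    "((s', t', \<alpha>'), (s', t', \<alpha>')) \<in> gper i0 x0 (trg I d, P1 F d \<cdot>\<^bsub>J\<^esub> y)"
  shows "((s, t \<cdot>\<^bsub>I\<^esub> d, (P2c F t d \<star>\<^bsub>J\<^esub> id2 J y) \<bullet>\<^bsub>J\<^esub> \<alpha>), (s', t' \<cdot>\<^bsub>I\<^esub> d, (P2c F t' d \<star>\<^bsub>J\<^esub> id2 J y) \<bullet>\<^bsub>J\<^esub> \<alpha>')) \<in> gper i0 x0 (src I d, y) \<longleftrightarrow>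
    ((s, t, \<alpha>), (s', t', \<alpha>')) \<in> gper i0 x0 (trg I d, P1 F d \<cdot>\<^bsub>J\<^esub> y)"
  using germ_eq_P2c_iff[of s t x0 d y \<alpha> s' t' \<alpha>'] assms gcD(2)[of s t x0 "P1 F d \<cdot>\<^bsub>J\<^esub> y" \<alpha>]
  unfolding gper_refl_iff gper_iff by simp

lemma gcc_resp:
  assumes "d \<in> Ar I" "pt y (src I d)" "(\<tau>, \<sigma>) \<in> gper i0 x0 (trg I d, P1 F d \<cdot>\<^bsub>J\<^esub> y)"
  shows "((\<lambda>(s, t, \<alpha>). (s, t \<cdot>\<^bsub>I\<^esub> d, (P2c F t d \<star>\<^bsub>J\<^esub> id2 J y) \<bullet>\<^bsub>J\<^esub> \<alpha>)) \<tau>, (\<lambda>(s, t, \<alpha>). (s, t \<cdot>\<^bsub>I\<^esub> d, (P2c F t d \<star>\<^bsub>J\<^esub> id2 J y) \<bullet>\<^bsub>J\<^esub> \<alpha>)) \<sigma>)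
    \<in> gper i0 x0 (src I d, y)"
proof -
  obtain s t \<alpha> s' t' \<alpha>' where e: "\<tau> = (s, t, \<alpha>)" "\<sigma> = (s', t', \<alpha>')" by (metis prod_cases3)
  have "(\<tau>, \<tau>) \<in> gper i0 x0 (trg I d, P1 F d \<cdot>\<^bsub>J\<^esub> y)" "(\<sigma>, \<sigma>) \<in> gper i0 x0 (trg I d, P1 F d \<cdot>\<^bsub>J\<^esub> y)"
    using assms(3) symD[OF sym_gper] transD[OF trans_gper] by blast+
  then show ?thesis
    using assms e gcc_iff[of d y s t \<alpha> i0 x0 s' t' \<alpha>'] by simp
qed

text \<open>A 1-cell \<open>t\<close> out of \<open>src I d\<close> need not factor through
  \<open>d\<close>. After \<open>t\<close> and \<open>d\<close> have been joined, the stage is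
  entered through some \<open>b\<close> composed with \<open>d\<close>, and the coherence cell at
  \<open>b\<close> and \<open>d\<close> can be inverted.\<close>

lemma gcc_surj:
  assumes "d \<in> Ar I" "pt y (src I d)" "((s, t, \<alpha>), (s, t, \<alpha>)) \<in> gper i0 x0 (src I d, y)"
  obtains s' t' \<alpha>' where "((s', t', \<alpha>'), (s', t', \<alpha>')) \<in> gper i0 x0 (trg I d, P1 F d \<cdot>\<^bsub>J\<^esub> y)"
    "((s', t' \<cdot>\<^bsub>I\<^esub> d, (P2c F t' d \<star>\<^bsub>J\<^esub> id2 J y) \<bullet>\<^bsub>J\<^esub> \<alpha>'), (s, t, \<alpha>)) \<in> gper i0 x0 (src I d, y)"
proof -
  have g: "gc s t x0 y \<alpha>" and s: "src I s = i0" "src I t = src I d"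
    using assms(3) unfolding gper_refl_iff by auto
  note T = gcD(1-4)[OF g] gc_trg[OF g]
  obtain a b \<theta> where ab: "a \<in> Ar I" "b \<in> Ar I" "src I a = trg I t" "src I b = trg I d" "trg I b = trg I a"
    "iso2 I \<theta>" "dom2 I \<theta> = a \<cdot>\<^bsub>I\<^esub> t" "cod2 I \<theta> = b \<cdot>\<^bsub>I\<^esub> d"
    by (rule bifiltered_span[OF bif, of t d]) (use T s assms(1) in auto)
  note ga = gc_tr[OF g ab(1,3)]
  have ge: "gc (a \<cdot>\<^bsub>I\<^esub> t) (b \<cdot>\<^bsub>I\<^esub> d) y y (ev \<theta> y)"
    by (rule gc_ev) (use ab T s assms in simp_all)
  have gp: "gc b (b \<cdot>\<^bsub>I\<^esub> d) (P1 F d \<cdot>\<^bsub>J\<^esub> y) y (P2c F b d \<star>\<^bsub>J\<^esub> id2 J y)"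
    by (rule gc_P2c) (use ab assms in simp_all)
  have i: "iso2 J (P2c F b d \<star>\<^bsub>J\<^esub> id2 J y)"
    using ab assms(1) ptD[OF assms(2)] by simp
  have gi: "gc (b \<cdot>\<^bsub>I\<^esub> d) b y (P1 F d \<cdot>\<^bsub>J\<^esub> y) (inv2 J (P2c F b d \<star>\<^bsub>J\<^esub> id2 J y))"
    using gp i unfolding gc_def by auto
  \<comment> \<open>The given cell at the joint stage, with its target leg replaced by the composite
    of \<open>b\<close> and \<open>d\<close>; the germ is unchanged.\<close>
  define \<gamma> where "\<gamma> = ev \<theta> y \<bullet>\<^bsub>J\<^esub> tr a s t x0 y \<alpha>"
  have g\<gamma>: "gc (a \<cdot>\<^bsub>I\<^esub> s) (b \<cdot>\<^bsub>I\<^esub> d) x0 y \<gamma>"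
    unfolding \<gamma>_def by (rule gc_vcmp[OF ga ge])
  have g': "gc (a \<cdot>\<^bsub>I\<^esub> s) b x0 (P1 F d \<cdot>\<^bsub>J\<^esub> y) (inv2 J (P2c F b d \<star>\<^bsub>J\<^esub> id2 J y) \<bullet>\<^bsub>J\<^esub> \<gamma>)"
    by (rule gc_vcmp[OF g\<gamma> gi])
  have "germ_eq x0 y (s, t, \<alpha>) (a \<cdot>\<^bsub>I\<^esub> s, b \<cdot>\<^bsub>I\<^esub> d, \<gamma>)"
    unfolding \<gamma>_def by (rule germ_eq_trans[OF germ_eq_tr[OF g ab(1,3)] germ_eq_ev[OF ga]]) (use ab in simp_all)
  moreover have "(P2c F b d \<star>\<^bsub>J\<^esub> id2 J y) \<bullet>\<^bsub>J\<^esub> (inv2 J (P2c F b d \<star>\<^bsub>J\<^esub> id2 J y) \<bullet>\<^bsub>J\<^esub> \<gamma>) = \<gamma>"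
    by (rule J.inv2_tail(2)[OF i]) (use gcD(5-7)[OF g\<gamma>] gcD(5-7)[OF gp] in simp_all)
  ultimately show thesis
    using g' s ab T assms(1) by (intro that[of "a \<cdot>\<^bsub>I\<^esub> s" b "inv2 J (P2c F b d \<star>\<^bsub>J\<^esub> id2 J y) \<bullet>\<^bsub>J\<^esub> \<gamma>"])
      (simp_all only: gper_refl_iff gper_iff germ_eq_sym, simp_all)
qed

text \<open>The structure maps are isomorphisms by \<open>gcc_iff\<close> and
  \<open>gcc_surj\<close>. Of the equations all but one hold already on representatives;
  compatibility with the 2-cells of \<open>I\<close> holds only for germs.\<close>

lemma functor_cocone_per_cat:
  assumes x0: "pt x0 i0"
  shows "functor_cocone I J F K (per_cat gob (gper i0 x0)) Pair (gac i0 x0) (gcc i0 x0)"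
proof (rule functor_cocone.intro, rule bifiltered_hom_axioms, rule functor_cocone_axioms.intro)
  note S = sym_gper[of i0 x0] and T = trans_gper[of i0 x0]
  let ?X = "per_cat gob (gper i0 x0)"
  note gr = per_graph_comp[of "gper i0 x0", OF S T] and gg = per_graph_cong[of "gper i0 x0", OF S T]
  have gobI: "(j, y) \<in> gob \<longleftrightarrow> pt y j" for j y by (simp add: gob_def)
  have ptc: "pt (cod2 J \<alpha>) i" if "\<alpha> \<in> Cl J" "pt (dom2 J \<alpha>) i" for \<alpha> i
    using that unfolding pt_def by (simp add: J.src_cod2 J.trg_cod2)
  show "category ?X" by (rule category_per_cat[OF S T])
  show "\<And>x i. pt x i \<Longrightarrow> (i, x) \<in> cObj ?X" by (simp add: gobI)
  show "gac i0 x0 i \<alpha> \<in> cArr ?X \<and> cDom ?X (gac i0 x0 i \<alpha>) = (i, dom2 J \<alpha>) \<and> cCod ?X (gac i0 x0 i \<alpha>) = (i, cod2 J \<alpha>)"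
    if "\<alpha> \<in> Cl J" "pt (dom2 J \<alpha>) i" for \<alpha> i
    using per_graph_Arr[of "gper i0 x0", OF S T, of "(i, dom2 J \<alpha>)" gob "(i, cod2 J \<alpha>)"] gac_resp[OF that, of _ _ i0 x0] that ptc[OF that]
    by (auto simp: gac_def gobI simp del: per_cat_simps(6))
  show "gac i0 x0 i (id2 J x) = cId ?X (i, x)" if p: "pt x i" for x i
  proof -
    have "per_graph (gper i0 x0 (i, x)) (gper i0 x0 (i, x)) (\<lambda>(s, t, \<alpha>). (s, t, (id2 J (P1 F t) \<star>\<^bsub>J\<^esub> id2 J x) \<bullet>\<^bsub>J\<^esub> \<alpha>)) =
       per_graph (gper i0 x0 (i, x)) (gper i0 x0 (i, x)) (\<lambda>\<tau>. \<tau>)"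
    proof (rule gg)
      fix \<tau> assume \<tau>: "(\<tau>, \<tau>) \<in> gper i0 x0 (i, x)"
      obtain s t \<alpha> where e: "\<tau> = (s, t, \<alpha>)" by (metis prod_cases3)
      have "gc s t x0 x \<alpha>" "src I t = i" using \<tau> e by (simp_all add: gper_refl_iff)
      then have "(id2 J (P1 F t) \<star>\<^bsub>J\<^esub> id2 J x) \<bullet>\<^bsub>J\<^esub> \<alpha> = \<alpha>"
        using gcD[of s t x0 x \<alpha>] ptD[OF p] by simp
      then show "((\<lambda>(s, t, \<alpha>). (s, t, (id2 J (P1 F t) \<star>\<^bsub>J\<^esub> id2 J x) \<bullet>\<^bsub>J\<^esub> \<alpha>)) \<tau>, \<tau>) \<in> gper i0 x0 (i, x)"
        using \<tau> e by simp
    qed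
    then show ?thesis
      using per_graph_id[of "gper i0 x0", OF S T] ptD[OF p] by (simp add: gac_def)
  qed
  show "gac i0 x0 i (\<beta> \<bullet>\<^bsub>J\<^esub> \<alpha>) = cComp ?X (gac i0 x0 i \<beta>) (gac i0 x0 i \<alpha>)"
    if a: "\<alpha> \<in> Cl J" "\<beta> \<in> Cl J" "dom2 J \<beta> = cod2 J \<alpha>" "pt (dom2 J \<alpha>) i" for \<alpha> \<beta> i
  proof -
    have p: "pt (dom2 J \<beta>) i" using ptc a by simp
    have "per_graph (gper i0 x0 (i, dom2 J \<alpha>)) (gper i0 x0 (i, cod2 J \<beta>)) (\<lambda>(s, t, \<gamma>). (s, t, (id2 J (P1 F t) \<star>\<^bsub>J\<^esub> (\<beta> \<bullet>\<^bsub>J\<^esub> \<alpha>)) \<bullet>\<^bsub>J\<^esub> \<gamma>)) =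
      per_graph (gper i0 x0 (i, dom2 J \<alpha>)) (gper i0 x0 (i, cod2 J \<beta>))
       ((\<lambda>(s, t, \<gamma>). (s, t, (id2 J (P1 F t) \<star>\<^bsub>J\<^esub> \<beta>) \<bullet>\<^bsub>J\<^esub> \<gamma>)) \<circ> (\<lambda>(s, t, \<gamma>). (s, t, (id2 J (P1 F t) \<star>\<^bsub>J\<^esub> \<alpha>) \<bullet>\<^bsub>J\<^esub> \<gamma>)))"
    proof (rule gg)
      fix \<tau> assume \<tau>: "(\<tau>, \<tau>) \<in> gper i0 x0 (i, dom2 J \<alpha>)"
      obtain s t \<gamma> where e: "\<tau> = (s, t, \<gamma>)" by (metis prod_cases3)
      have *: "gc s t x0 (dom2 J \<alpha>) \<gamma>" "src I t = i" using \<tau> e by (simp_all add: gper_refl_iff)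
      have "(id2 J (P1 F t) \<star>\<^bsub>J\<^esub> (\<beta> \<bullet>\<^bsub>J\<^esub> \<alpha>)) \<bullet>\<^bsub>J\<^esub> \<gamma> = (id2 J (P1 F t) \<star>\<^bsub>J\<^esub> \<beta>) \<bullet>\<^bsub>J\<^esub> ((id2 J (P1 F t) \<star>\<^bsub>J\<^esub> \<alpha>) \<bullet>\<^bsub>J\<^esub> \<gamma>)"
        using gcD[OF *(1)] ptD[OF a(4)] ptD[OF p] a *(2) by simp
      moreover have "(\<lambda>(s, t, \<gamma>). (s, t, (id2 J (P1 F t) \<star>\<^bsub>J\<^esub> (\<beta> \<bullet>\<^bsub>J\<^esub> \<alpha>)) \<bullet>\<^bsub>J\<^esub> \<gamma>)) \<tau> \<in> {\<tau>. (\<tau>, \<tau>) \<in> gper i0 x0 (i, cod2 J \<beta>)}"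
        using gac_resp[of "\<beta> \<bullet>\<^bsub>J\<^esub> \<alpha>" i \<tau> \<tau> i0 x0] a \<tau> by simp
      ultimately show "((\<lambda>(s, t, \<gamma>). (s, t, (id2 J (P1 F t) \<star>\<^bsub>J\<^esub> (\<beta> \<bullet>\<^bsub>J\<^esub> \<alpha>)) \<bullet>\<^bsub>J\<^esub> \<gamma>)) \<tau>,
         ((\<lambda>(s, t, \<gamma>). (s, t, (id2 J (P1 F t) \<star>\<^bsub>J\<^esub> \<beta>) \<bullet>\<^bsub>J\<^esub> \<gamma>)) \<circ> (\<lambda>(s, t, \<gamma>). (s, t, (id2 J (P1 F t) \<star>\<^bsub>J\<^esub> \<alpha>) \<bullet>\<^bsub>J\<^esub> \<gamma>))) \<tau>) \<in> gper i0 x0 (i, cod2 J \<beta>)"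
        by (simp add: e del: J.whisker_left_vcmp)
    qed
    moreover have "per_graph (gper i0 x0 (i, dom2 J \<alpha>)) (gper i0 x0 (i, cod2 J \<alpha>)) (\<lambda>(s, t, \<gamma>). (s, t, (id2 J (P1 F t) \<star>\<^bsub>J\<^esub> \<alpha>) \<bullet>\<^bsub>J\<^esub> \<gamma>)) O
        per_graph (gper i0 x0 (i, cod2 J \<alpha>)) (gper i0 x0 (i, cod2 J \<beta>)) (\<lambda>(s, t, \<gamma>). (s, t, (id2 J (P1 F t) \<star>\<^bsub>J\<^esub> \<beta>) \<bullet>\<^bsub>J\<^esub> \<gamma>)) =
      per_graph (gper i0 x0 (i, dom2 J \<alpha>)) (gper i0 x0 (i, cod2 J \<beta>))
       ((\<lambda>(s, t, \<gamma>). (s, t, (id2 J (P1 F t) \<star>\<^bsub>J\<^esub> \<beta>) \<bullet>\<^bsub>J\<^esub> \<gamma>)) \<circ> (\<lambda>(s, t, \<gamma>). (s, t, (id2 J (P1 F t) \<star>\<^bsub>J\<^esub> \<alpha>) \<bullet>\<^bsub>J\<^esub> \<gamma>)))"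
      by (rule gr) (use gac_resp[OF a(1,4), of _ _ i0 x0] gac_resp[OF a(2) p, of _ _ i0 x0] a(3) in auto)
    ultimately show ?thesis using a by (simp add: gac_def)
  qed
  show "cIso ?X (gcc i0 x0 d y) \<and> cDom ?X (gcc i0 x0 d y) = (trg I d, P1 F d \<cdot>\<^bsub>J\<^esub> y) \<and> cCod ?X (gcc i0 x0 d y) = (src I d, y)"
    if d: "d \<in> Ar I" "pt y (src I d)" for d y
  proof -
    let ?h = "\<lambda>(s, t, \<alpha>). (s, t \<cdot>\<^bsub>I\<^esub> d, (P2c F t d \<star>\<^bsub>J\<^esub> id2 J y) \<bullet>\<^bsub>J\<^esub> \<alpha>)"
    have "cIso ?X ((trg I d, P1 F d \<cdot>\<^bsub>J\<^esub> y), (src I d, y), per_graph (gper i0 x0 (trg I d, P1 F d \<cdot>\<^bsub>J\<^esub> y)) (gper i0 x0 (src I d, y)) ?h)"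
    proof (rule per_graph_iso[of "gper i0 x0", OF S T])
      fix \<tau> \<sigma> assume a: "(\<tau>, \<tau>) \<in> gper i0 x0 (trg I d, P1 F d \<cdot>\<^bsub>J\<^esub> y)" "(\<sigma>, \<sigma>) \<in> gper i0 x0 (trg I d, P1 F d \<cdot>\<^bsub>J\<^esub> y)"
        "(?h \<tau>, ?h \<sigma>) \<in> gper i0 x0 (src I d, y)"
      obtain s t \<alpha> s' t' \<alpha>' where e: "\<tau> = (s, t, \<alpha>)" "\<sigma> = (s', t', \<alpha>')" by (metis prod_cases3)
      then show "(\<tau>, \<sigma>) \<in> gper i0 x0 (trg I d, P1 F d \<cdot>\<^bsub>J\<^esub> y)"
        using gcc_iff[OF d, of s t \<alpha> i0 x0 s' t' \<alpha>'] a by simp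
    next
      fix \<tau> assume "(\<tau>, \<tau>) \<in> gper i0 x0 (src I d, y)"
      moreover obtain s t \<alpha> where e: "\<tau> = (s, t, \<alpha>)" by (metis prod_cases3)
      ultimately obtain s' t' \<alpha>' where "((s', t', \<alpha>'), (s', t', \<alpha>')) \<in> gper i0 x0 (trg I d, P1 F d \<cdot>\<^bsub>J\<^esub> y)"
        "((s', t' \<cdot>\<^bsub>I\<^esub> d, (P2c F t' d \<star>\<^bsub>J\<^esub> id2 J y) \<bullet>\<^bsub>J\<^esub> \<alpha>'), (s, t, \<alpha>)) \<in> gper i0 x0 (src I d, y)"
        using gcc_surj[OF d, of s t \<alpha> i0 x0] by metis
      then show "\<exists>\<sigma>. (\<sigma>, \<sigma>) \<in> gper i0 x0 (trg I d, P1 F d \<cdot>\<^bsub>J\<^esub> y) \<and> (?h \<sigma>, \<tau>) \<in> gper i0 x0 (src I d, y)"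
        using e by (intro exI[of _ "(s', t', \<alpha>')"]) simp
    qed (use d gcc_resp[OF d, of _ _ i0 x0] pt_P1 in \<open>auto simp: gobI\<close>)
    then show ?thesis by (simp add: gcc_def)
  qed
  show "cComp ?X (gcc i0 x0 d (cod2 J g)) (gac i0 x0 (trg I d) (id2 J (P1 F d) \<star>\<^bsub>J\<^esub> g)) = cComp ?X (gac i0 x0 (src I d) g) (gcc i0 x0 d (dom2 J g))"
    if d: "d \<in> Ar I" "g \<in> Cl J" "pt (dom2 J g) (src I d)" for d g
  proof -
    let ?y = "dom2 J g" and ?y' = "cod2 J g" and ?w = "id2 J (P1 F d) \<star>\<^bsub>J\<^esub> g"
    have y: "pt ?y (src I d)" "pt ?y' (src I d)" using d ptc by simp_all
    have w: "?w \<in> Cl J" "dom2 J ?w = P1 F d \<cdot>\<^bsub>J\<^esub> ?y" "cod2 J ?w = P1 F d \<cdot>\<^bsub>J\<^esub> ?y'" "pt (dom2 J ?w) (trg I d)"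
      using d ptD[OF y(1)] pt_P1[OF d(1) y(1)] by simp_all
    let ?c = "\<lambda>y (s, t, \<alpha>). (s, t \<cdot>\<^bsub>I\<^esub> d, (P2c F t d \<star>\<^bsub>J\<^esub> id2 J y) \<bullet>\<^bsub>J\<^esub> \<alpha>)" and ?a = "\<lambda>g (s, t, \<alpha>). (s, t, (id2 J (P1 F t) \<star>\<^bsub>J\<^esub> g) \<bullet>\<^bsub>J\<^esub> \<alpha>)"
    let ?E = "gper i0 x0"
    have "per_graph (?E (trg I d, P1 F d \<cdot>\<^bsub>J\<^esub> ?y)) (?E (src I d, ?y')) (?c ?y' \<circ> ?a ?w) =
      per_graph (?E (trg I d, P1 F d \<cdot>\<^bsub>J\<^esub> ?y)) (?E (src I d, ?y')) (?a g \<circ> ?c ?y)"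
    proof (rule gg)
      fix \<tau> assume \<tau>: "(\<tau>, \<tau>) \<in> gper i0 x0 (trg I d, P1 F d \<cdot>\<^bsub>J\<^esub> ?y)"
      obtain s t \<alpha> where e: "\<tau> = (s, t, \<alpha>)" by (metis prod_cases3)
      have *: "gc s t x0 (P1 F d \<cdot>\<^bsub>J\<^esub> ?y) \<alpha>" "src I t = trg I d" using \<tau> e by (simp_all add: gper_refl_iff)
      have "(P2c F t d \<star>\<^bsub>J\<^esub> id2 J ?y') \<bullet>\<^bsub>J\<^esub> ((id2 J (P1 F t) \<star>\<^bsub>J\<^esub> ?w) \<bullet>\<^bsub>J\<^esub> \<alpha>) = (id2 J (P1 F (t \<cdot>\<^bsub>I\<^esub> d)) \<star>\<^bsub>J\<^esub> g) \<bullet>\<^bsub>J\<^esub> ((P2c F t d \<star>\<^bsub>J\<^esub> id2 J ?y) \<bullet>\<^bsub>J\<^esub> \<alpha>)"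
        by (rule J.vcmp_tail) (use J.whisker_exchange[of g "P2c F t d"] d *(2) gcD[OF *(1)] ptD[OF y(1)] ptD[OF y(2)] in simp_all)
      then have "(?c ?y' \<circ> ?a ?w) \<tau> = (?a g \<circ> ?c ?y) \<tau>" by (simp add: e del: J.whisker_left_left)
      moreover have "((?a g \<circ> ?c ?y) \<tau>, (?a g \<circ> ?c ?y) \<tau>) \<in> ?E (src I d, ?y')"
        using gac_resp[OF d(2,3)] gcc_resp[OF d(1) y(1) \<tau>] unfolding comp_def by blast
      ultimately show "((?c ?y' \<circ> ?a ?w) \<tau>, (?a g \<circ> ?c ?y) \<tau>) \<in> ?E (src I d, ?y')" by metis
    qed
    moreover have "per_graph (?E (trg I d, P1 F d \<cdot>\<^bsub>J\<^esub> ?y)) (?E (trg I d, P1 F d \<cdot>\<^bsub>J\<^esub> ?y')) (?a ?w) O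
        per_graph (?E (trg I d, P1 F d \<cdot>\<^bsub>J\<^esub> ?y')) (?E (src I d, ?y')) (?c ?y') =
        per_graph (?E (trg I d, P1 F d \<cdot>\<^bsub>J\<^esub> ?y)) (?E (src I d, ?y')) (?c ?y' \<circ> ?a ?w)"
      by (rule gr) (use gac_resp[OF w(1,4), of _ _ i0 x0] gcc_resp[OF d(1) y(2), of _ _ i0 x0] w in auto)
    moreover have "per_graph (?E (trg I d, P1 F d \<cdot>\<^bsub>J\<^esub> ?y)) (?E (src I d, ?y)) (?c ?y) O
        per_graph (?E (src I d, ?y)) (?E (src I d, ?y')) (?a g) =
        per_graph (?E (trg I d, P1 F d \<cdot>\<^bsub>J\<^esub> ?y)) (?E (src I d, ?y')) (?a g \<circ> ?c ?y)"
      by (rule gr) (use gac_resp[OF d(2,3), of _ _ i0 x0] gcc_resp[OF d(1) y(1), of _ _ i0 x0] in auto)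
    ultimately show ?thesis using w by (simp add: gac_def gcc_def del: J.whisker_left_left)
  qed
  show "cComp ?X (gcc i0 x0 (cod2 I \<delta>) y) (gac i0 x0 (trg I (dom2 I \<delta>)) (P2 F \<delta> \<star>\<^bsub>J\<^esub> id2 J y)) = gcc i0 x0 (dom2 I \<delta>) y"
    if d: "\<delta> \<in> Cl I" "pt y (src I (dom2 I \<delta>))" for \<delta> y
  proof -
    let ?d = "dom2 I \<delta>" and ?d' = "cod2 I \<delta>" and ?w = "P2 F \<delta> \<star>\<^bsub>J\<^esub> id2 J y"
    have d': "?d \<in> Ar I" "?d' \<in> Ar I" "src I ?d' = src I ?d" "trg I ?d' = trg I ?d" using d I.src_cod2 I.trg_cod2 by simp_all
    have w: "?w \<in> Cl J" "dom2 J ?w = P1 F ?d \<cdot>\<^bsub>J\<^esub> y" "cod2 J ?w = P1 F ?d' \<cdot>\<^bsub>J\<^esub> y" "pt (dom2 J ?w) (trg I ?d)"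
      using d d' ptD[OF d(2)] pt_P1[OF d'(1), of y] by simp_all
    let ?c = "\<lambda>d (s, t, \<alpha>). (s, t \<cdot>\<^bsub>I\<^esub> d, (P2c F t d \<star>\<^bsub>J\<^esub> id2 J y) \<bullet>\<^bsub>J\<^esub> \<alpha>)" and ?a = "\<lambda>g (s, t, \<alpha>). (s, t, (id2 J (P1 F t) \<star>\<^bsub>J\<^esub> g) \<bullet>\<^bsub>J\<^esub> \<alpha>)"
    let ?E = "gper i0 x0"
    have "per_graph (?E (trg I ?d, P1 F ?d \<cdot>\<^bsub>J\<^esub> y)) (?E (src I ?d, y)) (?c ?d' \<circ> ?a ?w) =
      per_graph (?E (trg I ?d, P1 F ?d \<cdot>\<^bsub>J\<^esub> y)) (?E (src I ?d, y)) (?c ?d)"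
    proof (rule gg)
      fix \<tau> assume \<tau>: "(\<tau>, \<tau>) \<in> gper i0 x0 (trg I ?d, P1 F ?d \<cdot>\<^bsub>J\<^esub> y)"
      obtain s t \<alpha> where e: "\<tau> = (s, t, \<alpha>)" by (metis prod_cases3)
      have *: "gc s t x0 (P1 F ?d \<cdot>\<^bsub>J\<^esub> y) \<alpha>" "src I t = trg I ?d" "src I s = i0" using \<tau> e by (simp_all add: gper_refl_iff)
      have n: "(P2c F t ?d' \<star>\<^bsub>J\<^esub> id2 J y) \<bullet>\<^bsub>J\<^esub> (id2 J (P1 F t) \<star>\<^bsub>J\<^esub> ?w) = ev (id2 I t \<star>\<^bsub>I\<^esub> \<delta>) y \<bullet>\<^bsub>J\<^esub> (P2c F t ?d \<star>\<^bsub>J\<^esub> id2 J y)"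
        using arg_cong[OF P2c_natural'[of \<delta> "id2 I t"], of "\<lambda>w. w \<star>\<^bsub>J\<^esub> id2 J y"] d d' *(2) gcD[OF *(1)] ptD[OF d(2)] by (simp add: ev_def)
      have gp: "gc t (t \<cdot>\<^bsub>I\<^esub> ?d) (P1 F ?d \<cdot>\<^bsub>J\<^esub> y) y (P2c F t ?d \<star>\<^bsub>J\<^esub> id2 J y)"
        by (rule gc_P2c) (use d d' *(2) gcD[OF *(1)] in simp_all)
      have ge: "gc (t \<cdot>\<^bsub>I\<^esub> ?d) (t \<cdot>\<^bsub>I\<^esub> ?d') y y (ev (id2 I t \<star>\<^bsub>I\<^esub> \<delta>) y)"
        by (rule gc_ev) (use d d' *(2) gcD[OF *(1)] in simp_all)
      have n': "(P2c F t ?d' \<star>\<^bsub>J\<^esub> id2 J y) \<bullet>\<^bsub>J\<^esub> ((id2 J (P1 F t) \<star>\<^bsub>J\<^esub> ?w) \<bullet>\<^bsub>J\<^esub> \<alpha>) = ev (id2 I t \<star>\<^bsub>I\<^esub> \<delta>) y \<bullet>\<^bsub>J\<^esub> ((P2c F t ?d \<star>\<^bsub>J\<^esub> id2 J y) \<bullet>\<^bsub>J\<^esub> \<alpha>)"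
        by (rule J.vcmp_tail[OF n]) (use d d' *(2) gcD[OF *(1)] gcD(5-7)[OF gp] gcD(5-7)[OF ge] w ptD[OF d(2)] in \<open>simp_all del: J.whisker_left_left J.hcmp_assoc'\<close>)
      \<comment> \<open>Representatives differ here by a comparison cell; \<open>germ_eq_ev\<close>
        identifies their germs even if \<delta> is not invertible.\<close>
      have "germ_eq x0 y (s, t \<cdot>\<^bsub>I\<^esub> ?d, (P2c F t ?d \<star>\<^bsub>J\<^esub> id2 J y) \<bullet>\<^bsub>J\<^esub> \<alpha>) (s, t \<cdot>\<^bsub>I\<^esub> ?d', ev (id2 I t \<star>\<^bsub>I\<^esub> \<delta>) y \<bullet>\<^bsub>J\<^esub> ((P2c F t ?d \<star>\<^bsub>J\<^esub> id2 J y) \<bullet>\<^bsub>J\<^esub> \<alpha>))"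
        by (rule germ_eq_ev[OF gc_vcmp[OF *(1) gp]]) (use d d' *(2) gcD[OF *(1)] in simp_all)
      then have "((s, t \<cdot>\<^bsub>I\<^esub> ?d, (P2c F t ?d \<star>\<^bsub>J\<^esub> id2 J y) \<bullet>\<^bsub>J\<^esub> \<alpha>), (s, t \<cdot>\<^bsub>I\<^esub> ?d', ev (id2 I t \<star>\<^bsub>I\<^esub> \<delta>) y \<bullet>\<^bsub>J\<^esub> ((P2c F t ?d \<star>\<^bsub>J\<^esub> id2 J y) \<bullet>\<^bsub>J\<^esub> \<alpha>))) \<in> ?E (src I ?d, y)"
        unfolding gper_iff using *(2,3) d' gcD[OF *(1)] by simp
      then have "((s, t \<cdot>\<^bsub>I\<^esub> ?d', ev (id2 I t \<star>\<^bsub>I\<^esub> \<delta>) y \<bullet>\<^bsub>J\<^esub> ((P2c F t ?d \<star>\<^bsub>J\<^esub> id2 J y) \<bullet>\<^bsub>J\<^esub> \<alpha>)), (s, t \<cdot>\<^bsub>I\<^esub> ?d, (P2c F t ?d \<star>\<^bsub>J\<^esub> id2 J y) \<bullet>\<^bsub>J\<^esub> \<alpha>)) \<in> ?E (src I ?d, y)"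
        by (rule symD[OF S])
      then show "((?c ?d' \<circ> ?a ?w) \<tau>, ?c ?d \<tau>) \<in> ?E (src I ?d, y)"
        unfolding e comp_def case_prod_conv n' .
    qed
    moreover have "per_graph (?E (trg I ?d, P1 F ?d \<cdot>\<^bsub>J\<^esub> y)) (?E (trg I ?d, P1 F ?d' \<cdot>\<^bsub>J\<^esub> y)) (?a ?w) O
        per_graph (?E (trg I ?d, P1 F ?d' \<cdot>\<^bsub>J\<^esub> y)) (?E (src I ?d, y)) (?c ?d') =
        per_graph (?E (trg I ?d, P1 F ?d \<cdot>\<^bsub>J\<^esub> y)) (?E (src I ?d, y)) (?c ?d' \<circ> ?a ?w)"
      by (rule gr) (use gac_resp[OF w(1,4), of _ _ i0 x0] gcc_resp[OF d'(2), of y _ _ i0 x0] d' d w in auto)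
    ultimately show ?thesis using w d' by (simp add: gac_def gcc_def)
  qed
  show "cComp ?X (gcc i0 x0 (e \<cdot>\<^bsub>I\<^esub> d) y) (gac i0 x0 (trg I e) (P2c F e d \<star>\<^bsub>J\<^esub> id2 J y)) = cComp ?X (gcc i0 x0 d y) (gcc i0 x0 e (P1 F d \<cdot>\<^bsub>J\<^esub> y))"
    if d: "d \<in> Ar I" "e \<in> Ar I" "trg I d = src I e" "pt y (src I d)" for d e y
  proof -
    let ?w = "P2c F e d \<star>\<^bsub>J\<^esub> id2 J y" and ?z = "P1 F e \<cdot>\<^bsub>J\<^esub> (P1 F d \<cdot>\<^bsub>J\<^esub> y)"
    have z: "pt (P1 F d \<cdot>\<^bsub>J\<^esub> y) (src I e)" using pt_P1[OF d(1,4)] d(3) by simp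
    have w: "?w \<in> Cl J" "dom2 J ?w = ?z" "cod2 J ?w = P1 F (e \<cdot>\<^bsub>I\<^esub> d) \<cdot>\<^bsub>J\<^esub> y" "pt (dom2 J ?w) (trg I e)"
      using d ptD[OF d(4)] pt_P1[OF d(2) z] by simp_all
    let ?c = "\<lambda>d y (s, t, \<alpha>). (s, t \<cdot>\<^bsub>I\<^esub> d, (P2c F t d \<star>\<^bsub>J\<^esub> id2 J y) \<bullet>\<^bsub>J\<^esub> \<alpha>)" and ?a = "\<lambda>g (s, t, \<alpha>). (s, t, (id2 J (P1 F t) \<star>\<^bsub>J\<^esub> g) \<bullet>\<^bsub>J\<^esub> \<alpha>)"
    let ?E = "gper i0 x0"
    have "per_graph (?E (trg I e, ?z)) (?E (src I d, y)) (?c (e \<cdot>\<^bsub>I\<^esub> d) y \<circ> ?a ?w) =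
      per_graph (?E (trg I e, ?z)) (?E (src I d, y)) (?c d y \<circ> ?c e (P1 F d \<cdot>\<^bsub>J\<^esub> y))"
    proof (rule gg)
      fix \<tau> assume \<tau>: "(\<tau>, \<tau>) \<in> ?E (trg I e, ?z)"
      obtain s t \<alpha> where e: "\<tau> = (s, t, \<alpha>)" by (metis prod_cases3)
      have *: "gc s t x0 ?z \<alpha>" "src I t = trg I e" using \<tau> e by (simp_all add: gper_refl_iff)
      have n: "(P2c F t (e \<cdot>\<^bsub>I\<^esub> d) \<star>\<^bsub>J\<^esub> id2 J y) \<bullet>\<^bsub>J\<^esub> (id2 J (P1 F t) \<star>\<^bsub>J\<^esub> ?w) = (P2c F (t \<cdot>\<^bsub>I\<^esub> e) d \<star>\<^bsub>J\<^esub> id2 J y) \<bullet>\<^bsub>J\<^esub> (P2c F t e \<star>\<^bsub>J\<^esub> id2 J (P1 F d \<cdot>\<^bsub>J\<^esub> y))"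
        using arg_cong[OF coh_assoc'[of d e t], of "\<lambda>w. w \<star>\<^bsub>J\<^esub> id2 J y"] d *(2) gcD[OF *(1)] ptD[OF d(4)] by simp
      have "(P2c F t (e \<cdot>\<^bsub>I\<^esub> d) \<star>\<^bsub>J\<^esub> id2 J y) \<bullet>\<^bsub>J\<^esub> ((id2 J (P1 F t) \<star>\<^bsub>J\<^esub> ?w) \<bullet>\<^bsub>J\<^esub> \<alpha>) = (P2c F (t \<cdot>\<^bsub>I\<^esub> e) d \<star>\<^bsub>J\<^esub> id2 J y) \<bullet>\<^bsub>J\<^esub> ((P2c F t e \<star>\<^bsub>J\<^esub> id2 J (P1 F d \<cdot>\<^bsub>J\<^esub> y)) \<bullet>\<^bsub>J\<^esub> \<alpha>)"
        by (rule J.vcmp_tail[OF n]) (use d *(2) gcD[OF *(1)] ptD[OF d(4)] in simp_all)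
      then have "(?c (e \<cdot>\<^bsub>I\<^esub> d) y \<circ> ?a ?w) \<tau> = (?c d y \<circ> ?c e (P1 F d \<cdot>\<^bsub>J\<^esub> y)) \<tau>"
        using d *(2) gcD[OF *(1)] by (simp add: e del: J.whisker_left_left J.hcmp_assoc')
      moreover have "((?c d y \<circ> ?c e (P1 F d \<cdot>\<^bsub>J\<^esub> y)) \<tau>, (?c d y \<circ> ?c e (P1 F d \<cdot>\<^bsub>J\<^esub> y)) \<tau>) \<in> ?E (src I d, y)"
        using gcc_resp[OF d(1,4)] gcc_resp[OF d(2) z \<tau>] unfolding comp_def d(3) by blast
      ultimately show "((?c (e \<cdot>\<^bsub>I\<^esub> d) y \<circ> ?a ?w) \<tau>, (?c d y \<circ> ?c e (P1 F d \<cdot>\<^bsub>J\<^esub> y)) \<tau>) \<in> ?E (src I d, y)" by metis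
    qed
    moreover have "per_graph (?E (trg I e, ?z)) (?E (trg I e, P1 F (e \<cdot>\<^bsub>I\<^esub> d) \<cdot>\<^bsub>J\<^esub> y)) (?a ?w) O
        per_graph (?E (trg I e, P1 F (e \<cdot>\<^bsub>I\<^esub> d) \<cdot>\<^bsub>J\<^esub> y)) (?E (src I d, y)) (?c (e \<cdot>\<^bsub>I\<^esub> d) y) =
        per_graph (?E (trg I e, ?z)) (?E (src I d, y)) (?c (e \<cdot>\<^bsub>I\<^esub> d) y \<circ> ?a ?w)"
      by (rule gr) (use gac_resp[OF w(1,4), of _ _ i0 x0] gcc_resp[of "e \<cdot>\<^bsub>I\<^esub> d" y _ _ i0 x0] d w in auto)
    moreover have "per_graph (?E (trg I e, ?z)) (?E (src I e, P1 F d \<cdot>\<^bsub>J\<^esub> y)) (?c e (P1 F d \<cdot>\<^bsub>J\<^esub> y)) O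
        per_graph (?E (src I e, P1 F d \<cdot>\<^bsub>J\<^esub> y)) (?E (src I d, y)) (?c d y) =
        per_graph (?E (trg I e, ?z)) (?E (src I d, y)) (?c d y \<circ> ?c e (P1 F d \<cdot>\<^bsub>J\<^esub> y))"
      by (rule gr) (use gcc_resp[OF d(2) z, of _ _ i0 x0] gcc_resp[OF d(1,4), of _ _ i0 x0] d(3) in auto)
    ultimately show ?thesis using w d by (simp add: gac_def gcc_def)
  qed
  show "cComp ?X (gcc i0 x0 (id1 I i) y) (gac i0 x0 i (P0c F i \<star>\<^bsub>J\<^esub> id2 J y)) = cId ?X (i, y)" if p: "pt y i" for y i
  proof -
    have i: "i \<in> Ob I" using ptD[OF p] by simp
    let ?w = "P0c F i \<star>\<^bsub>J\<^esub> id2 J y" and ?d = "id1 I i"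
    have w: "?w \<in> Cl J" "dom2 J ?w = y" "cod2 J ?w = P1 F ?d \<cdot>\<^bsub>J\<^esub> y" "pt (dom2 J ?w) i"
      using i ptD[OF p] p by simp_all
    let ?c = "\<lambda>(s, t, \<alpha>). (s, t \<cdot>\<^bsub>I\<^esub> ?d, (P2c F t ?d \<star>\<^bsub>J\<^esub> id2 J y) \<bullet>\<^bsub>J\<^esub> \<alpha>)" and ?a = "\<lambda>(s, t, \<alpha>). (s, t, (id2 J (P1 F t) \<star>\<^bsub>J\<^esub> ?w) \<bullet>\<^bsub>J\<^esub> \<alpha>)"
    let ?E = "gper i0 x0"
    have "per_graph (?E (i, y)) (?E (i, y)) (?c \<circ> ?a) = per_graph (?E (i, y)) (?E (i, y)) (\<lambda>\<tau>. \<tau>)"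
    proof (rule gg)
      fix \<tau> assume \<tau>: "(\<tau>, \<tau>) \<in> ?E (i, y)"
      obtain s t \<alpha> where e: "\<tau> = (s, t, \<alpha>)" by (metis prod_cases3)
      have *: "gc s t x0 y \<alpha>" "src I t = i" using \<tau> e by (simp_all add: gper_refl_iff)
      have n: "(P2c F t ?d \<star>\<^bsub>J\<^esub> id2 J y) \<bullet>\<^bsub>J\<^esub> (id2 J (P1 F t) \<star>\<^bsub>J\<^esub> ?w) = id2 J (P1 F t \<cdot>\<^bsub>J\<^esub> y)"
        using arg_cong[OF coh_unit'(1)[of t], of "\<lambda>w. w \<star>\<^bsub>J\<^esub> id2 J y"] *(2) gcD[OF *(1)] ptD[OF p] i by simp
      have "(P2c F t ?d \<star>\<^bsub>J\<^esub> id2 J y) \<bullet>\<^bsub>J\<^esub> ((id2 J (P1 F t) \<star>\<^bsub>J\<^esub> ?w) \<bullet>\<^bsub>J\<^esub> \<alpha>) = ((P2c F t ?d \<star>\<^bsub>J\<^esub> id2 J y) \<bullet>\<^bsub>J\<^esub> (id2 J (P1 F t) \<star>\<^bsub>J\<^esub> ?w)) \<bullet>\<^bsub>J\<^esub> \<alpha>"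
        by (rule J.vcmp_assoc'[symmetric]) (use *(2) gcD[OF *(1)] ptD[OF p] i in simp_all)
      also have "\<dots> = \<alpha>" unfolding n using gcD[OF *(1)] by simp
      finally have "(?c \<circ> ?a) \<tau> = \<tau>"
        using *(2) gcD[OF *(1)] by (simp add: e del: J.whisker_left_left J.hcmp_assoc')
      then show "((?c \<circ> ?a) \<tau>, \<tau>) \<in> ?E (i, y)" using \<tau> by metis
    qed
    moreover have "per_graph (?E (i, y)) (?E (i, P1 F ?d \<cdot>\<^bsub>J\<^esub> y)) ?a O
        per_graph (?E (i, P1 F ?d \<cdot>\<^bsub>J\<^esub> y)) (?E (i, y)) ?c = per_graph (?E (i, y)) (?E (i, y)) (?c \<circ> ?a)"
      by (rule gr) (use gac_resp[OF w(1,4), of _ _ i0 x0] gcc_resp[of ?d y _ _ i0 x0] p i w in auto)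
    ultimately show ?thesis using w i per_graph_id[of ?E, OF S T] by (simp add: gac_def gcc_def)
  qed
qed

text \<open>In the manner of Yoneda: the action of \<open>g\<close> is evaluated on the germ of the
  identity of its source, where it returns the germ of \<open>g\<close>. Equality of germs then
  yields an equation between 2-cells at a later stage.\<close>

lemma gac_eqD:
  assumes g: "g \<in> Cl J" "g' \<in> Cl J" "dom2 J g' = dom2 J g" "cod2 J g' = cod2 J g" "pt (dom2 J g) i"
    and eq: "gac i (dom2 J g) i g = gac i (dom2 J g) i g'"
  obtains f where "f \<in> Ar I" "src I f = i" "id2 J (P1 F f) \<star>\<^bsub>J\<^esub> g = id2 J (P1 F f) \<star>\<^bsub>J\<^esub> g'"
proof -
  let ?x = "dom2 J g" and ?y = "cod2 J g" and ?e = "id1 I i"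
  have i: "i \<in> Ob I" and x: "?x \<in> Ar J" "src J ?x = K" "trg J ?x = P0 F i" using ptD[OF g(5)] by simp_all
  have y: "pt ?y i" using g(1,5) unfolding pt_def by (simp add: J.src_cod2 J.trg_cod2)
  \<comment> \<open>The representative of the identity germ of \<open>?x\<close>; both legs are the
    identity of \<open>i\<close>.\<close>
  let ?\<tau> = "(?e, ?e, id2 J (P1 F ?e \<cdot>\<^bsub>J\<^esub> ?x))"
  have t: "(?\<tau>, ?\<tau>) \<in> gper i ?x (i, ?x)"
    using i x g(5) by (simp add: gper_refl_iff gc_def)
  have W: "id2 J (P1 F ?e) \<star>\<^bsub>J\<^esub> g \<bullet>\<^bsub>J\<^esub> id2 J (P1 F ?e \<cdot>\<^bsub>J\<^esub> ?x) = id2 J (P1 F ?e) \<star>\<^bsub>J\<^esub> g"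
    "id2 J (P1 F ?e) \<star>\<^bsub>J\<^esub> g' \<bullet>\<^bsub>J\<^esub> id2 J (P1 F ?e \<cdot>\<^bsub>J\<^esub> ?x) = id2 J (P1 F ?e) \<star>\<^bsub>J\<^esub> g'"
    using i x g by simp_all
  have "(?\<tau>, (?e, ?e, id2 J (P1 F ?e) \<star>\<^bsub>J\<^esub> g)) \<in> per_graph (gper i ?x (i, ?x)) (gper i ?x (i, ?y)) (\<lambda>(s, t, \<alpha>). (s, t, (id2 J (P1 F t) \<star>\<^bsub>J\<^esub> g) \<bullet>\<^bsub>J\<^esub> \<alpha>))"
    using gac_resp[OF g(1,5) t] t W by (simp add: per_graph_def)
  then have "(?\<tau>, (?e, ?e, id2 J (P1 F ?e) \<star>\<^bsub>J\<^esub> g)) \<in> per_graph (gper i ?x (i, ?x)) (gper i ?x (i, ?y)) (\<lambda>(s, t, \<alpha>). (s, t, (id2 J (P1 F t) \<star>\<^bsub>J\<^esub> g') \<bullet>\<^bsub>J\<^esub> \<alpha>))"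
    using eq g by (simp add: gac_def)
  then have "germ_eq ?x ?y (?e, ?e, id2 J (P1 F ?e) \<star>\<^bsub>J\<^esub> g') (?e, ?e, id2 J (P1 F ?e) \<star>\<^bsub>J\<^esub> g)"
    using W by (simp add: per_graph_def gper_iff)
  then obtain a a' \<mu> \<nu> where *: "gc ?e ?e ?x ?y (id2 J (P1 F ?e) \<star>\<^bsub>J\<^esub> g')" "gc ?e ?e ?x ?y (id2 J (P1 F ?e) \<star>\<^bsub>J\<^esub> g)"
    "a \<in> Ar I" "a' \<in> Ar I" "src I a = trg I ?e" "src I a' = trg I ?e" "trg I a' = trg I a"
    "iso2 I \<mu>" "dom2 I \<mu> = a \<cdot>\<^bsub>I\<^esub> ?e" "cod2 I \<mu> = a' \<cdot>\<^bsub>I\<^esub> ?e"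
    "iso2 I \<nu>" "dom2 I \<nu> = a \<cdot>\<^bsub>I\<^esub> ?e" "cod2 I \<nu> = a' \<cdot>\<^bsub>I\<^esub> ?e"
    "ev \<nu> ?y \<bullet>\<^bsub>J\<^esub> tr a ?e ?e ?x ?y (id2 J (P1 F ?e) \<star>\<^bsub>J\<^esub> g') = tr a' ?e ?e ?x ?y (id2 J (P1 F ?e) \<star>\<^bsub>J\<^esub> g) \<bullet>\<^bsub>J\<^esub> ev \<mu> ?x"
    by (rule germ_eqE)
  have s: "src I a = i" "src I a' = i" "dom2 I \<mu> = a" "cod2 I \<mu> = a'" "dom2 I \<nu> = a" "cod2 I \<nu> = a'" using * i by simp_all
  \<comment> \<open>Equality of germs supplies two unrelated cells \<mu> and \<nu>. They are
    parallel, since all legs are identities, so condition (3) makes them equal; the common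
    comparison cell can then be exchanged with \<open>g\<close> and cancelled.\<close>
  obtain f where f: "f \<in> Ar I" "src I f = trg I a" "id2 I f \<star>\<^bsub>I\<^esub> \<mu> = id2 I f \<star>\<^bsub>I\<^esub> \<nu>"
    using bifiltered_cl[OF bif, of \<mu> \<nu>] * s by auto
  have P: "ev (id2 I f \<star>\<^bsub>I\<^esub> \<nu>) ?y \<bullet>\<^bsub>J\<^esub> tr (f \<cdot>\<^bsub>I\<^esub> a) ?e ?e ?x ?y (id2 J (P1 F ?e) \<star>\<^bsub>J\<^esub> g') =
    tr (f \<cdot>\<^bsub>I\<^esub> a') ?e ?e ?x ?y (id2 J (P1 F ?e) \<star>\<^bsub>J\<^esub> g) \<bullet>\<^bsub>J\<^esub> ev (id2 I f \<star>\<^bsub>I\<^esub> \<mu>) ?x"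
    by (rule germ_eq_push[OF *(1-7) iso2_Cl[OF *(8)] *(9,10) iso2_Cl[OF *(11)] *(12,13,14) f(1,2)])
  have R: "tr (f \<cdot>\<^bsub>I\<^esub> a) ?e ?e ?x ?y (id2 J (P1 F ?e) \<star>\<^bsub>J\<^esub> g') = id2 J (P1 F (f \<cdot>\<^bsub>I\<^esub> a)) \<star>\<^bsub>J\<^esub> g'"
    "tr (f \<cdot>\<^bsub>I\<^esub> a') ?e ?e ?x ?y (id2 J (P1 F ?e) \<star>\<^bsub>J\<^esub> g) = id2 J (P1 F (f \<cdot>\<^bsub>I\<^esub> a')) \<star>\<^bsub>J\<^esub> g"
    using tr_whisker[of ?x ?e ?y g' "f \<cdot>\<^bsub>I\<^esub> a"] tr_whisker[of ?x ?e ?y g "f \<cdot>\<^bsub>I\<^esub> a'"] g y i f s * by simp_all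
  let ?\<nu> = "id2 I f \<star>\<^bsub>I\<^esub> \<nu>"
  have \<nu>: "iso2 I ?\<nu>" "dom2 I ?\<nu> = f \<cdot>\<^bsub>I\<^esub> a" "cod2 I ?\<nu> = f \<cdot>\<^bsub>I\<^esub> a'" using f(1,2) s * by simp_all
  have "ev ?\<nu> ?y \<bullet>\<^bsub>J\<^esub> (id2 J (P1 F (f \<cdot>\<^bsub>I\<^esub> a)) \<star>\<^bsub>J\<^esub> g') = (id2 J (P1 F (f \<cdot>\<^bsub>I\<^esub> a')) \<star>\<^bsub>J\<^esub> g) \<bullet>\<^bsub>J\<^esub> ev ?\<nu> ?x"
    using P unfolding R f(3) .
  also have "\<dots> = ev ?\<nu> ?y \<bullet>\<^bsub>J\<^esub> (id2 J (P1 F (f \<cdot>\<^bsub>I\<^esub> a)) \<star>\<^bsub>J\<^esub> g)"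
    unfolding ev_def by (rule J.whisker_exchange'[symmetric]) (use \<nu> g f(1,2) s * x in simp_all)
  finally have "id2 J (P1 F (f \<cdot>\<^bsub>I\<^esub> a)) \<star>\<^bsub>J\<^esub> g' = id2 J (P1 F (f \<cdot>\<^bsub>I\<^esub> a)) \<star>\<^bsub>J\<^esub> g"
    by (rule iffD1[OF J.vcmp_left_cancel, rotated -1])
      (use \<nu> iso2_ev[of ?\<nu> ?y] g f(1,2) s * x ptD[OF y] y in \<open>simp_all add: ev_def\<close>)
  then show thesis
    using that[of "f \<cdot>\<^bsub>I\<^esub> a"] f s * by simp
qed

end

section \<open>Small sets\<close>

lemma small_lepoll: "\<lbrakk>small U B; A \<lesssim> B\<rbrakk> \<Longrightarrow> small U A"
  unfolding small_def by (rule lesspoll_trans1)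

lemma small_subset: "\<lbrakk>small U B; A \<subseteq> B\<rbrakk> \<Longrightarrow> small U A"
  by (rule small_lepoll[OF _ subset_imp_lepoll])

lemma small_image: "small U A \<Longrightarrow> small U (f ` A)"
  by (rule small_lepoll[OF _ image_lepoll])

lemma small_encode:
  assumes "small (TYPE('u)) A"
  obtains e :: "'a \<Rightarrow> 'u" where "inj_on e A"
  using lesspoll_imp_lepoll[of A "UNIV :: 'u set"] assms unfolding small_def lepoll_def by blast

lemma small_Pow:
  assumes "universe TYPE('u)" "small TYPE('u) A"
  shows "small TYPE('u) (Pow A)"
proof -
  obtain e :: "'a \<Rightarrow> 'u" where e: "inj_on e A" by (rule small_encode[OF assms(2)])
  have "small TYPE('u) (Pow (e ` A))"
    using assms(1) small_image[OF assms(2), of e] unfolding universe_def by blast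
  moreover have "Pow A \<lesssim> Pow (e ` A)"
    unfolding lepoll_def by (rule exI[of _ "image e"]) (use inj_on_image_Pow[OF e] in auto)
  ultimately show ?thesis by (rule small_lepoll)
qed

text \<open>Regularity in \<open>universe\<close> concerns families of subsets of \<open>'u\<close>
  indexed by a subset of \<open>'u\<close>. Index set and fibres are encoded by injections, and a
  pairing function, which exists as \<open>'u\<close> is infinite, keeps the fibres apart.\<close>

lemma small_Sigma:
  assumes U: "universe TYPE('u)" and A: "small TYPE('u) A" and f: "\<And>a. a \<in> A \<Longrightarrow> small TYPE('u) (f a)"
  shows "small TYPE('u) (Sigma A f)"
proof -
  obtain e :: "'a \<Rightarrow> 'u" where e: "inj_on e A" by (rule small_encode[OF A])
  have "\<forall>a. \<exists>g :: 'b \<Rightarrow> 'u. a \<in> A \<longrightarrow> inj_on g (f a)"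
    using small_encode[OF f] by metis
  then obtain g :: "'a \<Rightarrow> 'b \<Rightarrow> 'u" where g: "\<And>a. a \<in> A \<Longrightarrow> inj_on (g a) (f a)" by metis
  have "(UNIV :: 'u set) \<times> (UNIV :: 'u set) \<approx> (UNIV :: 'u set)"
    using U card_of_Times_same_infinite unfolding universe_def eqpoll_iff_card_of_ordIso by blast
  then obtain h :: "'u \<times> 'u \<Rightarrow> 'u" where h: "inj h"
    unfolding eqpoll_def bij_betw_def by auto
  let ?B = "\<lambda>u. (\<lambda>b. h (u, g (inv_into A e u) b)) ` f (inv_into A e u)"
  have B: "\<forall>u\<in>e ` A. small TYPE('u) (?B u)"
    using f small_image e by (auto simp: inv_into_f_f)
  have union: "small TYPE('u) (\<Union>a\<in>M. B a)" if "small TYPE('u) M" "\<forall>a\<in>M. small TYPE('u) (B a)"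
    for M :: "'u set" and B :: "'u \<Rightarrow> 'u set"
    using U that unfolding universe_def by simp
  have "small TYPE('u) (\<Union>u\<in>e ` A. ?B u)"
    by (rule union[OF small_image[OF A] B])
  moreover have "Sigma A f \<lesssim> (\<Union>u\<in>e ` A. ?B u)"
    unfolding lepoll_def
  proof (intro exI[of _ "\<lambda>(a, b). h (e a, g a b)"] conjI)
    show "inj_on (\<lambda>(a, b). h (e a, g a b)) (Sigma A f)"
    proof (rule inj_onI, clarify)
      fix a b a' b' assume ab: "a \<in> A" "b \<in> f a" "a' \<in> A" "b' \<in> f a'" "h (e a, g a b) = h (e a', g a' b')"
      then have "a = a'" "g a b = g a' b'" using injD[OF h ab(5)] inj_onD[OF e] by auto
      then show "a = a' \<and> b = b'" using inj_onD[OF g[OF ab(1)]] ab by blast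
    qed
    show "(\<lambda>(a, b). h (e a, g a b)) ` Sigma A f \<subseteq> (\<Union>u\<in>e ` A. ?B u)"
    proof clarify
      fix a b assume "a \<in> A" "b \<in> f a"
      then show "h (e a, g a b) \<in> (\<Union>u\<in>e ` A. ?B u)"
        using inv_into_f_f[OF e, of a] by (intro UN_I[of "e a"]) simp_all
    qed
  qed
  ultimately show ?thesis by (rule small_lepoll)
qed

lemma small_UN:
  assumes "universe TYPE('u)" "small TYPE('u) A" "\<And>a. a \<in> A \<Longrightarrow> small TYPE('u) (f a)"
  shows "small TYPE('u) (\<Union>a\<in>A. f a)"
proof -
  have "(\<Union>a\<in>A. f a) = snd ` Sigma A f" by force
  then show ?thesis using small_image[OF small_Sigma[OF assms]] by simp
qed

section \<open>Categories as a 2-category\<close>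

lemma Cat_simps [simp]:
  "C \<in> Ob (Cat :: (('u, 'u) cat, ('u, 'u, 'u, 'u) funct, ('u, 'u, 'u, 'u) nattr) twocat) \<longleftrightarrow>
     category C \<and> small TYPE('u) (cObj C) \<and> small TYPE('u) (cArr C)"
  "F \<in> Ar (Cat :: (('u, 'u) cat, ('u, 'u, 'u, 'u) funct, ('u, 'u, 'u, 'u) nattr) twocat) \<longleftrightarrow>
     is_functor F \<and> fDom F \<in> Ob Cat \<and> fCod F \<in> Ob Cat"
  "\<alpha> \<in> Cl (Cat :: (('u, 'u) cat, ('u, 'u, 'u, 'u) funct, ('u, 'u, 'u, 'u) nattr) twocat) \<longleftrightarrow>
     is_nattr \<alpha> \<and> fDom (nDom \<alpha>) \<in> Ob Cat \<and> fCod (nDom \<alpha>) \<in> Ob Cat"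
  "src Cat = fDom" "trg Cat = fCod" "dom2 Cat = nDom" "cod2 Cat = nCod" "id1 Cat = fId" "cmp1 Cat = fComp"
  by (auto simp: Cat_def Let_def)

lemma Cat_cells [simp]:
  "nDom (id2 Cat F) = F" "nCod (id2 Cat F) = F"
  "x \<in> cObj (fDom F) \<Longrightarrow> nAt (id2 Cat F) x = cId (fCod F) (fOb F x)"
  "nDom (vcmp Cat \<beta> \<alpha>) = nDom \<alpha>" "nCod (vcmp Cat \<beta> \<alpha>) = nCod \<beta>"
  "x \<in> cObj (fDom (nDom \<alpha>)) \<Longrightarrow> nAt (vcmp Cat \<beta> \<alpha>) x = cComp (fCod (nDom \<alpha>)) (nAt \<beta> x) (nAt \<alpha> x)"
  "nDom (hcmp Cat \<beta> \<alpha>) = fComp (nDom \<beta>) (nDom \<alpha>)" "nCod (hcmp Cat \<beta> \<alpha>) = fComp (nCod \<beta>) (nCod \<alpha>)"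
  "x \<in> cObj (fDom (nDom \<alpha>)) \<Longrightarrow> nAt (hcmp Cat \<beta> \<alpha>) x = cComp (fCod (nDom \<beta>))
         (nAt \<beta> (fOb (nCod \<alpha>) x)) (fAr (nDom \<beta>) (nAt \<alpha> x))"
  by (auto simp: Cat_def Let_def)

lemma nattrD:
  assumes "is_nattr \<alpha>"
  shows "is_functor (nDom \<alpha>)" "is_functor (nCod \<alpha>)" "fDom (nCod \<alpha>) = fDom (nDom \<alpha>)" "fCod (nCod \<alpha>) = fCod (nDom \<alpha>)"
    "x \<in> cObj (fDom (nDom \<alpha>)) \<Longrightarrow> nAt \<alpha> x \<in> cArr (fCod (nDom \<alpha>))"
    "x \<in> cObj (fDom (nDom \<alpha>)) \<Longrightarrow> cDom (fCod (nDom \<alpha>)) (nAt \<alpha> x) = fOb (nDom \<alpha>) x"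
    "x \<in> cObj (fDom (nDom \<alpha>)) \<Longrightarrow> cCod (fCod (nDom \<alpha>)) (nAt \<alpha> x) = fOb (nCod \<alpha>) x"
    "f \<in> cArr (fDom (nDom \<alpha>)) \<Longrightarrow> cComp (fCod (nDom \<alpha>)) (nAt \<alpha> (cCod (fDom (nDom \<alpha>)) f)) (fAr (nDom \<alpha>) f) =
       cComp (fCod (nDom \<alpha>)) (fAr (nCod \<alpha>) f) (nAt \<alpha> (cDom (fDom (nDom \<alpha>)) f))"
    "nAt \<alpha> \<in> extensional (cObj (fDom (nDom \<alpha>)))"
  using assms by (auto simp: is_nattr_def Let_def functor_from_to_def PiE_def)

lemma nattrI:
  assumes "is_functor (nDom \<alpha>)" "is_functor (nCod \<alpha>)" "fDom (nCod \<alpha>) = fDom (nDom \<alpha>)" "fCod (nCod \<alpha>) = fCod (nDom \<alpha>)"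
    "\<And>x. x \<in> cObj (fDom (nDom \<alpha>)) \<Longrightarrow> nAt \<alpha> x \<in> cArr (fCod (nDom \<alpha>))"
    "\<And>x. x \<in> cObj (fDom (nDom \<alpha>)) \<Longrightarrow> cDom (fCod (nDom \<alpha>)) (nAt \<alpha> x) = fOb (nDom \<alpha>) x"
    "\<And>x. x \<in> cObj (fDom (nDom \<alpha>)) \<Longrightarrow> cCod (fCod (nDom \<alpha>)) (nAt \<alpha> x) = fOb (nCod \<alpha>) x"
    "\<And>f. f \<in> cArr (fDom (nDom \<alpha>)) \<Longrightarrow> cComp (fCod (nDom \<alpha>)) (nAt \<alpha> (cCod (fDom (nDom \<alpha>)) f)) (fAr (nDom \<alpha>) f) =
       cComp (fCod (nDom \<alpha>)) (fAr (nCod \<alpha>) f) (nAt \<alpha> (cDom (fDom (nDom \<alpha>)) f))"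
    "nAt \<alpha> \<in> extensional (cObj (fDom (nDom \<alpha>)))"
  shows "is_nattr \<alpha>"
  using assms by (auto simp: is_nattr_def Let_def functor_from_to_def PiE_def)

lemma nattr_eqI:
  assumes "is_nattr \<alpha>" "is_nattr \<beta>" "nDom \<alpha> = nDom \<beta>" "nCod \<alpha> = nCod \<beta>"
    "\<And>x. x \<in> cObj (fDom (nDom \<beta>)) \<Longrightarrow> nAt \<alpha> x = nAt \<beta> x"
  shows "\<alpha> = (\<beta> :: ('o, 'a, 'p, 'b) nattr)"
proof -
  have "nAt \<alpha> = nAt \<beta>"
    using assms nattrD(9)[OF assms(1)] nattrD(9)[OF assms(2)] by (intro extensionalityI) auto
  then show ?thesis using assms(3,4) by (cases \<alpha>, cases \<beta>) simp
qed

lemma iso2_Cat_component: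
  assumes "iso2 Cat \<alpha>" "x \<in> cObj (fDom (nDom \<alpha>))"
  shows "cIso (fCod (nDom \<alpha>)) (nAt \<alpha> x)"
proof -
  obtain \<beta> where b: "is_nattr \<alpha>" "is_nattr \<beta>" "nDom \<beta> = nCod \<alpha>" "nCod \<beta> = nDom \<alpha>" "vcmp Cat \<beta> \<alpha> = id2 Cat (nDom \<alpha>)" "vcmp Cat \<alpha> \<beta> = id2 Cat (nCod \<alpha>)"
    using assms(1) unfolding iso2_def inv_cell_def cell_def by auto
  note a = nattrD[OF b(1)] and b' = nattrD[OF b(2)]
  interpret category "fCod (nDom \<alpha>)" by (rule is_functorD(2)[OF a(1)])
  show ?thesis
  proof (rule cIsoI[of _ "nAt \<beta> x"])
    show "cComp (fCod (nDom \<alpha>)) (nAt \<beta> x) (nAt \<alpha> x) = cId (fCod (nDom \<alpha>)) (cDom (fCod (nDom \<alpha>)) (nAt \<alpha> x))"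
      using arg_cong[OF b(5), of "\<lambda>k. nAt k x"] assms(2) a by simp
    show "cComp (fCod (nDom \<alpha>)) (nAt \<alpha> x) (nAt \<beta> x) = cId (fCod (nDom \<alpha>)) (cCod (fCod (nDom \<alpha>)) (nAt \<alpha> x))"
      using arg_cong[OF b(6), of "\<lambda>k. nAt k x"] assms(2) a b(1-4) by simp
  qed (use a b' b(3,4) assms(2) in simp_all)
qed

lemma iso2_CatI:
  assumes n: "is_nattr \<alpha>" and O: "fDom (nDom \<alpha>) \<in> Ob Cat" "fCod (nDom \<alpha>) \<in> Ob Cat"
    and i: "\<And>x. x \<in> cObj (fDom (nDom \<alpha>)) \<Longrightarrow> cIso (fCod (nDom \<alpha>)) (nAt \<alpha> x)"
  shows "iso2 Cat \<alpha>"
proof -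
  note a = nattrD[OF n]
  let ?C = "fDom (nDom \<alpha>)" and ?D = "fCod (nDom \<alpha>)"
  interpret C: category ?C by (rule is_functorD(1)[OF a(1)])
  interpret D: category ?D by (rule is_functorD(2)[OF a(1)])
  let ?b = "\<lparr>nDom = nCod \<alpha>, nCod = nDom \<alpha>, nAt = (\<lambda>x\<in>cObj ?C. cInv ?D (nAt \<alpha> x))\<rparr>"
  have b: "is_nattr ?b"
  proof (rule nattrI)
    fix f assume "f \<in> cArr (fDom (nDom ?b))"
    then have f: "f \<in> cArr ?C" using a by simp
    note [simp] = a(5-7)[of "cDom ?C f"] a(5-7)[of "cCod ?C f"] i[of "cDom ?C f"] i[of "cCod ?C f"] is_functorD(4-6)[OF a(1) f]
      is_functorD(4-6)[OF a(2), unfolded a(3,4), OF f]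
    have "cComp ?D (cInv ?D (nAt \<alpha> (cCod ?C f))) (cComp ?D (cComp ?D (nAt \<alpha> (cCod ?C f)) (fAr (nDom \<alpha>) f)) (cInv ?D (nAt \<alpha> (cDom ?C f)))) =
      cComp ?D (cInv ?D (nAt \<alpha> (cCod ?C f))) (cComp ?D (cComp ?D (fAr (nCod \<alpha>) f) (nAt \<alpha> (cDom ?C f))) (cInv ?D (nAt \<alpha> (cDom ?C f))))"
      using a(8)[OF f] by simp
    then have "cComp ?D (fAr (nDom \<alpha>) f) (cInv ?D (nAt \<alpha> (cDom ?C f))) = cComp ?D (cInv ?D (nAt \<alpha> (cCod ?C f))) (fAr (nCod \<alpha>) f)"
      using f by simp
    then show "cComp (fCod (nDom ?b)) (nAt ?b (cCod (fDom (nDom ?b)) f)) (fAr (nDom ?b) f) =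
      cComp (fCod (nDom ?b)) (fAr (nCod ?b) f) (nAt ?b (cDom (fDom (nDom ?b)) f))"
      using f a(3,4) by simp
  qed (use a i in simp_all)
  \<comment> \<open>Identities and composites of transformations are checked by hand, since this
    lemma does not suppose \<open>Cat\<close> to be a \<open>two_category\<close>; later that fact
    comes with the pseudofunctor into \<open>Cat\<close>.\<close>
  have id: "is_nattr (id2 Cat F)" if "is_functor F" for F :: "('u, 'u, 'u, 'u) funct"
  proof -
    interpret category "fCod F" by (rule is_functorD(2)[OF that])
    interpret C: category "fDom F" by (rule is_functorD(1)[OF that])
    show ?thesis by (rule nattrI) (use is_functorD(3-6)[OF that] that in \<open>auto simp: Cat_def Let_def\<close>)
  qed
  have v: "is_nattr (vcmp Cat \<gamma> \<delta>)" if g: "is_nattr \<gamma>" "is_nattr \<delta>" "nDom \<gamma> = nCod \<delta>" for \<gamma> \<delta> :: "('u, 'u, 'u, 'u) nattr"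
  proof (rule nattrI)
    note c = nattrD[OF g(1)] and d = nattrD[OF g(2)]
    interpret X: category "fDom (nDom \<delta>)" by (rule is_functorD(1)[OF d(1)])
    interpret Y: category "fCod (nDom \<delta>)" by (rule is_functorD(2)[OF d(1)])
    fix f assume "f \<in> cArr (fDom (nDom (vcmp Cat \<gamma> \<delta>)))"
    then have f: "f \<in> cArr (fDom (nDom \<delta>))" by simp
    note [simp] = c(5-7)[unfolded g(3) d(3,4)] d(5-7) is_functorD(4-6)[OF d(1)] is_functorD(4-6)[OF d(2), unfolded d(3,4)] is_functorD(4-6)[OF c(2), unfolded c(3,4) g(3) d(3,4)]
    have "cComp (fCod (nDom \<delta>)) (nAt \<gamma> (cCod (fDom (nDom \<delta>)) f)) (cComp (fCod (nDom \<delta>)) (nAt \<delta> (cCod (fDom (nDom \<delta>)) f)) (fAr (nDom \<delta>) f)) =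
      cComp (fCod (nDom \<delta>)) (cComp (fCod (nDom \<delta>)) (nAt \<gamma> (cCod (fDom (nDom \<delta>)) f)) (fAr (nCod \<delta>) f)) (nAt \<delta> (cDom (fDom (nDom \<delta>)) f))"
      using d(8)[OF f] f by simp
    also have "\<dots> = cComp (fCod (nDom \<delta>)) (fAr (nCod \<gamma>) f) (cComp (fCod (nDom \<delta>)) (nAt \<gamma> (cDom (fDom (nDom \<delta>)) f)) (nAt \<delta> (cDom (fDom (nDom \<delta>)) f)))"
      using c(8)[unfolded g(3) d(3,4), OF f] f by simp
    finally show "cComp (fCod (nDom (vcmp Cat \<gamma> \<delta>))) (nAt (vcmp Cat \<gamma> \<delta>) (cCod (fDom (nDom (vcmp Cat \<gamma> \<delta>))) f)) (fAr (nDom (vcmp Cat \<gamma> \<delta>)) f) =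
      cComp (fCod (nDom (vcmp Cat \<gamma> \<delta>))) (fAr (nCod (vcmp Cat \<gamma> \<delta>)) f) (nAt (vcmp Cat \<gamma> \<delta>) (cDom (fDom (nDom (vcmp Cat \<gamma> \<delta>))) f))"
      using f by simp
  next
    note c = nattrD[OF g(1)] and d = nattrD[OF g(2)]
    interpret Y: category "fCod (nDom \<delta>)" by (rule is_functorD(2)[OF d(1)])
    note [simp] = c(5-7)[unfolded g(3) d(3,4)] d(5-7)
    fix x assume "x \<in> cObj (fDom (nDom (vcmp Cat \<gamma> \<delta>)))"
    then show "nAt (vcmp Cat \<gamma> \<delta>) x \<in> cArr (fCod (nDom (vcmp Cat \<gamma> \<delta>)))"
      "cDom (fCod (nDom (vcmp Cat \<gamma> \<delta>))) (nAt (vcmp Cat \<gamma> \<delta>) x) = fOb (nDom (vcmp Cat \<gamma> \<delta>)) x"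
      "cCod (fCod (nDom (vcmp Cat \<gamma> \<delta>))) (nAt (vcmp Cat \<gamma> \<delta>) x) = fOb (nCod (vcmp Cat \<gamma> \<delta>)) x"
      using g(3) by simp_all
  qed (use nattrD[OF g(1)] nattrD[OF g(2)] g(3) in \<open>simp_all add: Cat_def Let_def\<close>)
  show ?thesis
    unfolding iso2_def inv_cell_def cell_def
  proof (intro conjI exI[of _ ?b])
    show "?b \<bullet>\<^bsub>Cat\<^esub> \<alpha> = id2 Cat (dom2 Cat \<alpha>)"
      by (rule nattr_eqI) (use v[OF b n] id[OF a(1)] a i in simp_all)
    show "\<alpha> \<bullet>\<^bsub>Cat\<^esub> ?b = id2 Cat (cod2 Cat \<alpha>)"
      by (rule nattr_eqI) (use v[OF n b] id[OF a(2)] a i in simp_all)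
  qed (use n b O a in simp_all)
qed

text \<open>Objects of \<open>Cat\<close> have their cells in \<open>'u\<close>, whereas the test
  categories consist of tuples and relations. \<open>E\<close> copies such a category into
  \<open>'u\<close>, and \<open>D\<close>, which undoes \<open>E\<close>, brings factorizations
  back.\<close>

lemma encode_category:
  assumes X: "category X" and s: "small TYPE('u) (cObj X)" "small TYPE('u) (cArr X)"
  obtains X' :: "('u, 'u) cat" and E D where "X' \<in> Ob Cat" "is_functor E" "fDom E = X" "fCod E = X'"
    "is_functor D" "fDom D = X'" "fCod D = X" "\<And>x. x \<in> cObj X \<Longrightarrow> fOb D (fOb E x) = x" "\<And>f. f \<in> cArr X \<Longrightarrow> fAr D (fAr E f) = f"
proof -
  interpret X: category X by (rule X)
  obtain eo :: "'a \<Rightarrow> 'u" where eo: "inj_on eo (cObj X)" by (rule small_encode[OF s(1)])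
  obtain ea :: "'b \<Rightarrow> 'u" where ea: "inj_on ea (cArr X)" by (rule small_encode[OF s(2)])
  define d1 where "d1 = inv_into (cObj X) eo"
  define d2 where "d2 = inv_into (cArr X) ea"
  have d [simp]: "\<And>x. x \<in> cObj X \<Longrightarrow> d1 (eo x) = x" "\<And>f. f \<in> cArr X \<Longrightarrow> d2 (ea f) = f"
    using eo ea by (simp_all add: d1_def d2_def)
  define X' where "X' = \<lparr>cObj = eo ` cObj X, cArr = ea ` cArr X, cDom = (\<lambda>f. eo (cDom X (d2 f))), cCod = (\<lambda>f. eo (cCod X (d2 f))),
    cId = (\<lambda>x. ea (cId X (d1 x))), cComp = (\<lambda>g f. ea (cComp X (d2 g) (d2 f)))\<rparr>"
  have X'_simps [simp]: "cObj X' = eo ` cObj X" "cArr X' = ea ` cArr X" "\<And>f. cDom X' f = eo (cDom X (d2 f))" "\<And>f. cCod X' f = eo (cCod X (d2 f))"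
    "\<And>x. cId X' x = ea (cId X (d1 x))" "\<And>g f. cComp X' g f = ea (cComp X (d2 g) (d2 f))"
    by (simp_all add: X'_def)
  have eo_eq [simp]: "eo x = eo y \<longleftrightarrow> x = y" if "x \<in> cObj X" "y \<in> cObj X" for x y
    using inj_onD[OF eo] that by blast
  have ea_eq [simp]: "ea f = ea g \<longleftrightarrow> f = g" if "f \<in> cArr X" "g \<in> cArr X" for f g
    using inj_onD[OF ea] that by blast
  have cX': "category X'"
  proof
    fix f g assume "f \<in> cArr X'" "g \<in> cArr X'" "cDom X' g = cCod X' f"
    then obtain f' g' where *: "f = ea f'" "g = ea g'" "f' \<in> cArr X" "g' \<in> cArr X" "cDom X g' = cCod X f'" by auto
    then show "cComp X' g f \<in> cArr X' \<and> cDom X' (cComp X' g f) = cDom X' f \<and> cCod X' (cComp X' g f) = cCod X' g"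
      by simp
  next
    fix f g h assume "f \<in> cArr X'" "g \<in> cArr X'" "h \<in> cArr X'" "cDom X' g = cCod X' f" "cDom X' h = cCod X' g"
    then obtain f' g' h' where *: "f = ea f'" "g = ea g'" "h = ea h'" "f' \<in> cArr X" "g' \<in> cArr X" "h' \<in> cArr X" "cDom X g' = cCod X f'" "cDom X h' = cCod X g'"
      by auto
    then show "cComp X' (cComp X' h g) f = cComp X' h (cComp X' g f)" by simp
  qed auto
  define E where "E = \<lparr>fDom = X, fCod = X', fOb = restrict eo (cObj X), fAr = restrict ea (cArr X)\<rparr>"
  define D where "D = \<lparr>fDom = X', fCod = X, fOb = restrict d1 (cObj X'), fAr = restrict d2 (cArr X')\<rparr>"
  show thesis
  proof (rule that[of X' E D])
    show "X' \<in> Ob Cat"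
      using cX' small_image[OF s(1), of eo] small_image[OF s(2), of ea] by simp
    show "is_functor E"
      by (rule is_functorI) (use X cX' in \<open>auto simp: E_def\<close>)
    show "is_functor D"
      by (rule is_functorI) (use X cX' in \<open>auto simp: D_def\<close>)
  qed (auto simp: E_def D_def)
qed

section \<open>Pseudococones in \<open>Cat\<close> under the composite of a pseudofunctor with a
  representable, in components\<close>

lemma hom_psfun_simps [simp]:
  "P0 (hom_psfun B K F) i = hom_cat B K (P0 F i)" "P1 (hom_psfun B K F) d = post1 B K (P1 F d)"
  "P2 (hom_psfun B K F) \<alpha> = post2 B K (P2 F \<alpha>)" "P2c (hom_psfun B K F) e d = post2 B K (P2c F e d)"
  "P0c (hom_psfun B K F) i = post2 B K (P0c F i)"
  by (auto simp: hom_psfun_def)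

context two_category
begin

lemma post1_simps [simp]:
  "fDom (post1 B K g) = hom_cat B K (src B g)" "fCod (post1 B K g) = hom_cat B K (trg B g)"
  "\<lbrakk>f \<in> Ar B; src B f = K; trg B f = src B g\<rbrakk> \<Longrightarrow> fOb (post1 B K g) f = g \<cdot> f"
  "\<lbrakk>\<alpha> \<in> Cl B; src B (dom2 B \<alpha>) = K; trg B (dom2 B \<alpha>) = src B g\<rbrakk> \<Longrightarrow> fAr (post1 B K g) \<alpha> = id2 B g \<star> \<alpha>"
  by (auto simp: post1_def)

lemma post2_simps [simp]:
  "nDom (post2 B K \<gamma>) = post1 B K (dom2 B \<gamma>)" "nCod (post2 B K \<gamma>) = post1 B K (cod2 B \<gamma>)"
  "\<lbrakk>f \<in> Ar B; src B f = K; trg B f = src B (dom2 B \<gamma>)\<rbrakk> \<Longrightarrow> nAt (post2 B K \<gamma>) f = \<gamma> \<star> id2 B f"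
  by (auto simp: post2_def)

end

lemma (in functor_cocone) functor_cocone_functor:
  assumes E: "is_functor E" and D: "fDom E = X"
  shows "functor_cocone I J F K (fCod E) (\<lambda>i x. fOb E (ob i x)) (\<lambda>i \<alpha>. fAr E (ac i \<alpha>)) (\<lambda>d x. fAr E (cc d x))"
proof (rule functor_cocone.intro, rule bifiltered_hom_axioms, rule functor_cocone_axioms.intro)
  note [simp] = is_functorD(3-7)[OF E, unfolded D]
  note c = is_functorD(8)[OF E, unfolded D, symmetric]
  show "category (fCod E)" using E by (rule is_functorD)
  show "\<And>x i. pt x i \<Longrightarrow> fOb E (ob i x) \<in> cObj (fCod E)" using ob by simp
  show "fAr E (ac i \<alpha>) \<in> cArr (fCod E) \<and> cDom (fCod E) (fAr E (ac i \<alpha>)) = fOb E (ob i (dom2 J \<alpha>)) \<and>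
       cCod (fCod E) (fAr E (ac i \<alpha>)) = fOb E (ob i (cod2 J \<alpha>))" if "\<alpha> \<in> Cl J" "pt (dom2 J \<alpha>) i" for \<alpha> i
    using ac[OF that] by simp
  show "\<And>x i. pt x i \<Longrightarrow> fAr E (ac i (id2 J x)) = cId (fCod E) (fOb E (ob i x))" using ac_id ob by simp
  show "fAr E (ac i (\<beta> \<bullet>\<^bsub>J\<^esub> \<alpha>)) = cComp (fCod E) (fAr E (ac i \<beta>)) (fAr E (ac i \<alpha>))"
    if "\<alpha> \<in> Cl J" "\<beta> \<in> Cl J" "dom2 J \<beta> = cod2 J \<alpha>" "pt (dom2 J \<alpha>) i" for \<alpha> \<beta> i
    using ac[of \<alpha> i] ac[of \<beta> i] pt_cod[of \<alpha> i] that by (simp add: ac_vcmp c)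
  show "cIso (fCod E) (fAr E (cc d x)) \<and> cDom (fCod E) (fAr E (cc d x)) = fOb E (ob (trg I d) (P1 F d \<cdot>\<^bsub>J\<^esub> x)) \<and>
       cCod (fCod E) (fAr E (cc d x)) = fOb E (ob (src I d) x)" if "d \<in> Ar I" "pt x (src I d)" for d x
    using cc[OF that] functor_cIso[OF E, of "cc d x"] D by simp
  show "cComp (fCod E) (fAr E (cc d (cod2 J \<alpha>))) (fAr E (ac (trg I d) (id2 J (P1 F d) \<star>\<^bsub>J\<^esub> \<alpha>))) =
       cComp (fCod E) (fAr E (ac (src I d) \<alpha>)) (fAr E (cc d (dom2 J \<alpha>)))"
    if d: "d \<in> Ar I" "\<alpha> \<in> Cl J" "pt (dom2 J \<alpha>) (src I d)" for d \<alpha>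
    using cc_ac[OF d] cc[OF d(1,3)] cc[OF d(1) pt_cod[OF d(2,3)]] ac[OF d(2,3)] ac[of "id2 J (P1 F d) \<star>\<^bsub>J\<^esub> \<alpha>" "trg I d"] d
      ptD[OF d(3)] pt_P1[OF d(1,3)] by (simp add: c)
  show "cComp (fCod E) (fAr E (cc (cod2 I \<delta>) x)) (fAr E (ac (trg I (dom2 I \<delta>)) (P2 F \<delta> \<star>\<^bsub>J\<^esub> id2 J x))) = fAr E (cc (dom2 I \<delta>) x)"
    if d: "\<delta> \<in> Cl I" "pt x (src I (dom2 I \<delta>))" for \<delta> x
    using cc_P2[OF d] cc[of "cod2 I \<delta>" x] ac[of "P2 F \<delta> \<star>\<^bsub>J\<^esub> id2 J x" "trg I (dom2 I \<delta>)"] d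
      ptD[OF d(2)] pt_P1[of "dom2 I \<delta>" x] by (simp add: c I.src_cod2 I.trg_cod2)
  show "cComp (fCod E) (fAr E (cc (e \<cdot>\<^bsub>I\<^esub> d) x)) (fAr E (ac (trg I e) (P2c F e d \<star>\<^bsub>J\<^esub> id2 J x))) =
       cComp (fCod E) (fAr E (cc d x)) (fAr E (cc e (P1 F d \<cdot>\<^bsub>J\<^esub> x)))"
    if d: "d \<in> Ar I" "e \<in> Ar I" "trg I d = src I e" "pt x (src I d)" for d e x
    using cc_P2c[OF d] cc[of "e \<cdot>\<^bsub>I\<^esub> d" x] cc[of e "P1 F d \<cdot>\<^bsub>J\<^esub> x"] cc[of d x] ac[of "P2c F e d \<star>\<^bsub>J\<^esub> id2 J x" "trg I e"] d
      ptD[OF d(4)] pt_P1[OF d(1,4)] pt_P1[of e "P1 F d \<cdot>\<^bsub>J\<^esub> x"] by (simp add: c)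
  show "cComp (fCod E) (fAr E (cc (id1 I i) x)) (fAr E (ac i (P0c F i \<star>\<^bsub>J\<^esub> id2 J x))) = cId (fCod E) (fOb E (ob i x))"
    if p: "pt x i" for x i
    using cc_P0c[OF p] cc[of "id1 I i" x] ac[of "P0c F i \<star>\<^bsub>J\<^esub> id2 J x" i] ob[OF p] p ptD[OF p] by (simp add: c)
qed

text \<open>Bicompactness delivers this pseudofunctor along with its bicolimit. It carries with it
  that \<open>Cat\<close> is a 2-category and that the hom-categories from \<open>K\<close> to the
  objects \<open>P0 F i\<close> are small.\<close>

locale hom_cat_pseudofunctor = bifiltered_hom I J F K
  for I :: "('i, 'j, 'k) twocat" and J :: "('o, 'u, 'u) twocat" and F :: "('i, 'j, 'k, 'o, 'u, 'u) psfun"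
    and K :: 'o +
  assumes G: "pseudofunctor I Cat (hom_psfun J K F)"
begin

sublocale G: pseudofunctor I Cat "hom_psfun J K F" by (rule G)

lemma hom_cat_pt: "i \<in> Ob I \<Longrightarrow> x \<in> cObj (hom_cat J K (P0 F i)) \<longleftrightarrow> pt x i"
  by (auto simp: pt_def)

lemma cat_cocone_leg:
  assumes p: "pseudococone Cat I (hom_psfun J K F) C p" and i: "i \<in> Ob I"
  shows "is_functor (leg p i)" "fDom (leg p i) = hom_cat J K (P0 F i)" "fCod (leg p i) = C"
    "pt x i \<Longrightarrow> fOb (leg p i) x \<in> cObj C"
    "\<lbrakk>\<alpha> \<in> Cl J; pt (dom2 J \<alpha>) i\<rbrakk> \<Longrightarrow> fAr (leg p i) \<alpha> \<in> cArr C"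
    "\<lbrakk>\<alpha> \<in> Cl J; pt (dom2 J \<alpha>) i\<rbrakk> \<Longrightarrow> cDom C (fAr (leg p i) \<alpha>) = fOb (leg p i) (dom2 J \<alpha>)"
    "\<lbrakk>\<alpha> \<in> Cl J; pt (dom2 J \<alpha>) i\<rbrakk> \<Longrightarrow> cCod C (fAr (leg p i) \<alpha>) = fOb (leg p i) (cod2 J \<alpha>)"
    "pt x i \<Longrightarrow> fAr (leg p i) (id2 J x) = cId C (fOb (leg p i) x)"
    "\<lbrakk>\<alpha> \<in> Cl J; \<beta> \<in> Cl J; dom2 J \<beta> = cod2 J \<alpha>; pt (dom2 J \<alpha>) i\<rbrakk> \<Longrightarrow>
       fAr (leg p i) (\<beta> \<bullet>\<^bsub>J\<^esub> \<alpha>) = cComp C (fAr (leg p i) \<beta>) (fAr (leg p i) \<alpha>)"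
proof -
  show f: "is_functor (leg p i)" and D: "fDom (leg p i) = hom_cat J K (P0 F i)" "fCod (leg p i) = C"
    using G.pseudococoneD(1-3)[OF p i] by simp_all
  note F = is_functorD(3-8)[OF f, unfolded D, simplified]
  show "pt x i \<Longrightarrow> fOb (leg p i) x \<in> cObj C" "pt x i \<Longrightarrow> fAr (leg p i) (id2 J x) = cId C (fOb (leg p i) x)"
    using F(1,5)[of x] ptD[of x i] by simp_all
  have s: "src J (dom2 J \<alpha>) = K \<and> trg J (dom2 J \<alpha>) = P0 F i" if "pt (dom2 J \<alpha>) i" for \<alpha>
    using ptD[OF that] by simp
  show "\<lbrakk>\<alpha> \<in> Cl J; pt (dom2 J \<alpha>) i\<rbrakk> \<Longrightarrow> fAr (leg p i) \<alpha> \<in> cArr C"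
    "\<lbrakk>\<alpha> \<in> Cl J; pt (dom2 J \<alpha>) i\<rbrakk> \<Longrightarrow> cDom C (fAr (leg p i) \<alpha>) = fOb (leg p i) (dom2 J \<alpha>)"
    "\<lbrakk>\<alpha> \<in> Cl J; pt (dom2 J \<alpha>) i\<rbrakk> \<Longrightarrow> cCod C (fAr (leg p i) \<alpha>) = fOb (leg p i) (cod2 J \<alpha>)"
    using F(2-4)[of \<alpha>] s[of \<alpha>] by simp_all
  show "fAr (leg p i) (\<beta> \<bullet>\<^bsub>J\<^esub> \<alpha>) = cComp C (fAr (leg p i) \<beta>) (fAr (leg p i) \<alpha>)"
    if "\<alpha> \<in> Cl J" "\<beta> \<in> Cl J" "dom2 J \<beta> = cod2 J \<alpha>" "pt (dom2 J \<alpha>) i"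
    using F(6)[of \<alpha> \<beta>] s[of \<alpha>] that by (simp add: J.src_cod2 J.trg_cod2)
qed

lemma cat_cocone_legc:
  assumes p: "pseudococone Cat I (hom_psfun J K F) C p" and d: "d \<in> Ar I"
  shows "is_nattr (legc p d)" "nDom (legc p d) = fComp (leg p (trg I d)) (post1 J K (P1 F d))" "nCod (legc p d) = leg p (src I d)"
    "pt x (src I d) \<Longrightarrow> cIso C (nAt (legc p d) x)"
    "pt x (src I d) \<Longrightarrow> cDom C (nAt (legc p d) x) = fOb (leg p (trg I d)) (P1 F d \<cdot>\<^bsub>J\<^esub> x)"
    "pt x (src I d) \<Longrightarrow> cCod C (nAt (legc p d) x) = fOb (leg p (src I d)) x"
proof -
  note l = G.pseudococoneD(4-6)[OF p d]
  show n: "is_nattr (legc p d)" and D: "nDom (legc p d) = fComp (leg p (trg I d)) (post1 J K (P1 F d))" "nCod (legc p d) = leg p (src I d)"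
    using l iso2_Cl[OF l(1)] by simp_all
  note L = cat_cocone_leg(2,3)[OF p I.src_Ob[OF d]] cat_cocone_leg(2,3)[OF p I.trg_Ob[OF d]]
  note N = nattrD(6,7)[OF n, unfolded D, simplified]
  show "cIso C (nAt (legc p d) x)" if "pt x (src I d)"
    using iso2_Cat_component[OF l(1), of x] D d L ptD[OF that] by simp
  show "cDom C (nAt (legc p d) x) = fOb (leg p (trg I d)) (P1 F d \<cdot>\<^bsub>J\<^esub> x)" "cCod C (nAt (legc p d) x) = fOb (leg p (src I d)) x"
    if "pt x (src I d)"
    using N[of x] L d ptD[OF that] by simp_all
qed

text \<open>The laws of a pseudococone in \<open>Cat\<close>, evaluated at each 1-cell
  \<open>x\<close>, are the axioms of \<open>functor_cocone\<close>, except that whiskering by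
  identity transformations leaves identity arrows behind, which have to be removed.\<close>

lemma functor_cocone_of_cat_cocone:
  assumes p: "pseudococone Cat I (hom_psfun J K F) C p" and C: "C \<in> Ob Cat"
  shows "functor_cocone I J F K C (\<lambda>i x. fOb (leg p i) x) (\<lambda>i. fAr (leg p i)) (\<lambda>d. nAt (legc p d))"
proof (rule functor_cocone.intro, rule bifiltered_hom_axioms, rule functor_cocone_axioms.intro)
  note leg = cat_cocone_leg[OF p] and legc = cat_cocone_legc[OF p]
  interpret C: category C using C by simp
  show "category C" by (rule C.category_axioms)
  show "\<And>x i. pt x i \<Longrightarrow> fOb (leg p i) x \<in> cObj C" "\<And>x i. pt x i \<Longrightarrow> fAr (leg p i) (id2 J x) = cId C (fOb (leg p i) x)"
    using leg ptD(4) by blast+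
  show "fAr (leg p i) \<alpha> \<in> cArr C \<and> cDom C (fAr (leg p i) \<alpha>) = fOb (leg p i) (dom2 J \<alpha>) \<and> cCod C (fAr (leg p i) \<alpha>) = fOb (leg p i) (cod2 J \<alpha>)"
    if "\<alpha> \<in> Cl J" "pt (dom2 J \<alpha>) i" for \<alpha> i
    using leg(5-7)[OF ptD(4)[OF that(2)] that] by simp
  show "fAr (leg p i) (\<beta> \<bullet>\<^bsub>J\<^esub> \<alpha>) = cComp C (fAr (leg p i) \<beta>) (fAr (leg p i) \<alpha>)"
    if "\<alpha> \<in> Cl J" "\<beta> \<in> Cl J" "dom2 J \<beta> = cod2 J \<alpha>" "pt (dom2 J \<alpha>) i" for \<alpha> \<beta> i
    using leg(9)[OF ptD(4)[OF that(4)] that] .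
  show "cIso C (nAt (legc p d) x) \<and> cDom C (nAt (legc p d) x) = fOb (leg p (trg I d)) (P1 F d \<cdot>\<^bsub>J\<^esub> x) \<and> cCod C (nAt (legc p d) x) = fOb (leg p (src I d)) x"
    if "d \<in> Ar I" "pt x (src I d)" for d x
    using legc(4-6)[OF that] by simp
  show "cComp C (nAt (legc p d) (cod2 J \<alpha>)) (fAr (leg p (trg I d)) (id2 J (P1 F d) \<star>\<^bsub>J\<^esub> \<alpha>)) = cComp C (fAr (leg p (src I d)) \<alpha>) (nAt (legc p d) (dom2 J \<alpha>))"
    if d: "d \<in> Ar I" "\<alpha> \<in> Cl J" "pt (dom2 J \<alpha>) (src I d)" for d \<alpha>
    using nattrD(8)[OF legc(1)[OF d(1)], of \<alpha>] legc(2,3)[OF d(1)] leg(2,3)[OF I.src_Ob[OF d(1)]] leg(2,3)[OF I.trg_Ob[OF d(1)]] d ptD[OF d(3)]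
    by simp
  have id: "cComp C (cId C (fOb (leg p k) y)) (fAr (leg p k) \<gamma>) = fAr (leg p k) \<gamma>"
    if "k \<in> Ob I" "\<gamma> \<in> Cl J" "pt (dom2 J \<gamma>) k" "cod2 J \<gamma> = y" for k y \<gamma>
    using leg(5-7)[OF that(1-3)] that(4) by simp
  show "cComp C (nAt (legc p (cod2 I \<delta>)) x) (fAr (leg p (trg I (dom2 I \<delta>))) (P2 F \<delta> \<star>\<^bsub>J\<^esub> id2 J x)) = nAt (legc p (dom2 I \<delta>)) x"
    if d: "\<delta> \<in> Cl I" "pt x (src I (dom2 I \<delta>))" for \<delta> x
  proof -
    have "dom2 I \<delta> \<in> Ar I" using d by simp
    note L = leg(2,3)[OF I.trg_Ob[OF this]] leg(2,3)[OF I.src_Ob[OF this]]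
    show ?thesis
      using arg_cong[OF G.pseudococone_eqs(1)[OF p d(1)], of "\<lambda>k. nAt k x"] L d ptD[OF d(2)] pt_P1[of "dom2 I \<delta>" x]
        id[of "trg I (dom2 I \<delta>)" "P2 F \<delta> \<star>\<^bsub>J\<^esub> id2 J x"] by (simp add: I.src_cod2 I.trg_cod2)
  qed
  show "cComp C (nAt (legc p (e \<cdot>\<^bsub>I\<^esub> d)) x) (fAr (leg p (trg I e)) (P2c F e d \<star>\<^bsub>J\<^esub> id2 J x)) =
       cComp C (nAt (legc p d) x) (nAt (legc p e) (P1 F d \<cdot>\<^bsub>J\<^esub> x))"
    if d: "d \<in> Ar I" "e \<in> Ar I" "trg I d = src I e" "pt x (src I d)" for d e x
  proof -
    have y: "pt (P1 F d \<cdot>\<^bsub>J\<^esub> x) (src I e)" using pt_P1[OF d(1,4)] d(3) by simp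
    note L = leg(2,3)[OF I.trg_Ob[OF d(2)]] leg(2,3)[OF I.src_Ob[OF d(1)]] leg(2,3)[OF I.trg_Ob[OF d(1)]] legc(2,3)[OF d(1)] legc(2,3)[OF d(2)]
    have c: "cComp C (nAt (legc p e) (P1 F d \<cdot>\<^bsub>J\<^esub> x)) (cId C (fOb (leg p (trg I e)) (P1 F e \<cdot>\<^bsub>J\<^esub> (P1 F d \<cdot>\<^bsub>J\<^esub> x)))) = nAt (legc p e) (P1 F d \<cdot>\<^bsub>J\<^esub> x)"
      using legc(4,5)[OF d(2) y] by simp
    show ?thesis
      using arg_cong[OF G.pseudococone_eqs(2)[OF p d(1-3)], of "\<lambda>k. nAt k x"] L d ptD[OF d(4)] ptD[OF y] pt_P1[OF d(2) y]
        id[of "trg I e" "P2c F e d \<star>\<^bsub>J\<^esub> id2 J x"] leg(8)[OF I.trg_Ob[OF d(2)] pt_P1[OF d(2) y]] c by simp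
  qed
  show "cComp C (nAt (legc p (id1 I i)) x) (fAr (leg p i) (P0c F i \<star>\<^bsub>J\<^esub> id2 J x)) = cId C (fOb (leg p i) x)" if q: "pt x i" for x i
  proof -
    note i = ptD[OF q]
    note L = leg(2,3)[OF i(4)]
    show ?thesis
      using arg_cong[OF G.pseudococone_eqs(3)[OF p i(4)], of "\<lambda>k. nAt k x"] L q i id[of i "P0c F i \<star>\<^bsub>J\<^esub> id2 J x"] by simp
  qed
qed

definition cat_cocone :: "('u, 'u) cat \<Rightarrow> ('i \<Rightarrow> 'u \<Rightarrow> 'u) \<Rightarrow> ('i \<Rightarrow> 'u \<Rightarrow> 'u) \<Rightarrow> ('j \<Rightarrow> 'u \<Rightarrow> 'u) \<Rightarrow>
    ('i, 'j, ('u, 'u, 'u, 'u) funct, ('u, 'u, 'u, 'u) nattr) cocone" where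
  "cat_cocone X ob ac cc = (let L = (\<lambda>i. \<lparr>fDom = hom_cat J K (P0 F i), fCod = X,
      fOb = restrict (ob i) (cObj (hom_cat J K (P0 F i))), fAr = restrict (ac i) (cArr (hom_cat J K (P0 F i)))\<rparr>) in
    \<lparr>leg = restrict L (Ob I), legc = (\<lambda>d\<in>Ar I. \<lparr>nDom = fComp (L (trg I d)) (post1 J K (P1 F d)), nCod = L (src I d),
      nAt = restrict (cc d) (cObj (hom_cat J K (P0 F (src I d))))\<rparr>)\<rparr>)"

lemma cat_cocone_simps [simp]:
  "i \<in> Ob I \<Longrightarrow> fDom (leg (cat_cocone X ob ac cc) i) = hom_cat J K (P0 F i)"
  "i \<in> Ob I \<Longrightarrow> fCod (leg (cat_cocone X ob ac cc) i) = X"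
  "\<lbrakk>i \<in> Ob I; x \<in> Ar J; src J x = K; trg J x = P0 F i\<rbrakk> \<Longrightarrow> fOb (leg (cat_cocone X ob ac cc) i) x = ob i x"
  "\<lbrakk>i \<in> Ob I; \<alpha> \<in> Cl J; src J (dom2 J \<alpha>) = K; trg J (dom2 J \<alpha>) = P0 F i\<rbrakk> \<Longrightarrow> fAr (leg (cat_cocone X ob ac cc) i) \<alpha> = ac i \<alpha>"
  "d \<in> Ar I \<Longrightarrow> nDom (legc (cat_cocone X ob ac cc) d) = fComp (leg (cat_cocone X ob ac cc) (trg I d)) (post1 J K (P1 F d))"
  "d \<in> Ar I \<Longrightarrow> nCod (legc (cat_cocone X ob ac cc) d) = leg (cat_cocone X ob ac cc) (src I d)"
  "\<lbrakk>d \<in> Ar I; x \<in> Ar J; src J x = K; trg J x = P0 F (src I d)\<rbrakk> \<Longrightarrow> nAt (legc (cat_cocone X ob ac cc) d) x = cc d x"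
  by (auto simp: cat_cocone_def Let_def)

text \<open>The converse passage, from pointwise data to functors and transformations. An equation
  between composite transformations is checked on components once both sides are known to be
  parallel.\<close>

lemma pseudococone_cat_cocone:
  assumes h: "functor_cocone I J F K X ob ac cc" and XO: "X \<in> Ob Cat"
  shows "pseudococone Cat I (hom_psfun J K F) X (cat_cocone X ob ac cc)"
proof -
  interpret functor_cocone I J F K X ob ac cc by (rule h)
  let ?r = "cat_cocone X ob ac cc"
  have leg: "is_functor (leg ?r i)" if i: "i \<in> Ob I" for i
  proof (rule is_functorI)
    show "fOb (leg ?r i) \<in> extensional (cObj (fDom (leg ?r i)))" "fAr (leg ?r i) \<in> extensional (cArr (fDom (leg ?r i)))"
      using i by (simp_all add: cat_cocone_def Let_def)
    fix f assume "f \<in> cArr (fDom (leg ?r i))"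
    then have "f \<in> Cl J" "pt (dom2 J f) i" using i by (auto simp: pt_def)
    then show "fAr (leg ?r i) f \<in> cArr (fCod (leg ?r i))"
      "cDom (fCod (leg ?r i)) (fAr (leg ?r i) f) = fOb (leg ?r i) (cDom (fDom (leg ?r i)) f)"
      "cCod (fCod (leg ?r i)) (fAr (leg ?r i) f) = fOb (leg ?r i) (cCod (fDom (leg ?r i)) f)"
      using ac[of f i] i ptD[of "dom2 J f" i] ptD[OF pt_cod[of f i]] by simp_all
  next
    fix x assume "x \<in> cObj (fDom (leg ?r i))"
    then have "pt x i" using i by (auto simp: pt_def)
    then show "fOb (leg ?r i) x \<in> cObj (fCod (leg ?r i))" "fAr (leg ?r i) (cId (fDom (leg ?r i)) x) = cId (fCod (leg ?r i)) (fOb (leg ?r i) x)"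
      using ob[of x i] ac_id[of x i] i ptD[of x i] by simp_all
  next
    fix f g assume *: "f \<in> cArr (fDom (leg ?r i))" "g \<in> cArr (fDom (leg ?r i))" "cDom (fDom (leg ?r i)) g = cCod (fDom (leg ?r i)) f"
    then have "f \<in> Cl J" "pt (dom2 J f) i" "g \<in> Cl J" "dom2 J g = cod2 J f" using i by (auto simp: pt_def)
    then show "fAr (leg ?r i) (cComp (fDom (leg ?r i)) g f) = cComp (fCod (leg ?r i)) (fAr (leg ?r i) g) (fAr (leg ?r i) f)"
      using ac_vcmp[of f g i] i ptD[of "dom2 J f" i] ptD[OF pt_cod[of f i]] by simp
  next
    show "category (fDom (leg ?r i))" "category (fCod (leg ?r i))" using i J.category_hom_cat XO by simp_all
  qed
  have hO: "hom_cat J K (P0 F i) \<in> Ob Cat" if "i \<in> Ob I" for i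
    using G.P0_Ob[OF that] by simp
  have legA: "leg ?r i \<in> Ar Cat" if "i \<in> Ob I" for i
    using leg[OF that] hO[OF that] XO that by simp
  have postA: "is_functor (post1 J K (P1 F d))" if "d \<in> Ar I" for d
    using G.P1_simps(1)[OF that] by simp
  have legc: "iso2 Cat (legc ?r d)" if d: "d \<in> Ar I" for d
  proof (rule iso2_CatI)
    note s = I.src_Ob[OF d] I.trg_Ob[OF d]
    show "is_nattr (legc ?r d)"
    proof (rule nattrI)
      show "is_functor (nDom (legc ?r d))"
        using d s leg[OF s(2)] postA[OF d] by (simp add: is_functor_fComp)
      show "nAt (legc ?r d) \<in> extensional (cObj (fDom (nDom (legc ?r d))))"
        using d by (simp add: cat_cocone_def Let_def)
      fix x assume "x \<in> cObj (fDom (nDom (legc ?r d)))"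
      then have x: "pt x (src I d)" using d s by (simp add: pt_def)
      then show "nAt (legc ?r d) x \<in> cArr (fCod (nDom (legc ?r d)))"
        "cDom (fCod (nDom (legc ?r d))) (nAt (legc ?r d) x) = fOb (nDom (legc ?r d)) x"
        "cCod (fCod (nDom (legc ?r d))) (nAt (legc ?r d) x) = fOb (nCod (legc ?r d)) x"
        using cc[OF d x] ptD[OF x] d s by simp_all
    next
      fix f assume "f \<in> cArr (fDom (nDom (legc ?r d)))"
      then have f: "f \<in> Cl J" "pt (dom2 J f) (src I d)" using d s by (simp_all add: pt_def)
      show "cComp (fCod (nDom (legc ?r d))) (nAt (legc ?r d) (cCod (fDom (nDom (legc ?r d))) f)) (fAr (nDom (legc ?r d)) f) =
         cComp (fCod (nDom (legc ?r d))) (fAr (nCod (legc ?r d)) f) (nAt (legc ?r d) (cDom (fDom (nDom (legc ?r d))) f))"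
        using cc_ac[OF d f] f ptD[OF f(2)] ptD[OF pt_cod[OF f]] d s by simp
    qed (use d s leg in simp_all)
    show "fDom (nDom (legc ?r d)) \<in> Ob Cat" "fCod (nDom (legc ?r d)) \<in> Ob Cat"
      using d s hO[OF s(1)] XO by simp_all
    fix x assume "x \<in> cObj (fDom (nDom (legc ?r d)))"
    then have x: "pt x (src I d)" using d s by (simp add: pt_def)
    then show "cIso (fCod (nDom (legc ?r d))) (nAt (legc ?r d) x)"
      using cc[OF d x] ptD[OF x] d s by simp
  qed
  have id: "cComp X (cId X (ob k y)) (ac k \<gamma>) = ac k \<gamma>"
    if "\<gamma> \<in> Cl J" "pt (dom2 J \<gamma>) k" "cod2 J \<gamma> = y" for k y \<gamma>
    using ac[OF that(1,2)] that(3) by simp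
  have nat: "is_nattr \<alpha>" if "\<alpha> \<in> Cl Cat" for \<alpha> :: "('u, 'u, 'u, 'u) nattr" using that by simp
  have dcod: "dom2 Cat (legc ?r d) = leg ?r (trg I d) \<cdot>\<^bsub>Cat\<^esub> P1 (hom_psfun J K F) d" "cod2 Cat (legc ?r d) = leg ?r (src I d)" if "d \<in> Ar I" for d
    using that by simp_all
  have src: "src Cat (leg ?r i) = P0 (hom_psfun J K F) i" "trg Cat (leg ?r i) = X" if "i \<in> Ob I" for i
    using that by simp_all
  \<comment> \<open>Typing of the composites is settled with the laws of an abstract 2-category;
    only their components are computed in \<open>Cat\<close>.\<close>
  note ty = legA legc iso2_Cl[OF legc] dcod src
  note cs = Cat_simps hom_psfun_simps
  show ?thesis
  proof (rule G.pseudococoneI)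
    show "leg ?r \<in> extensional (Ob I)" "legc ?r \<in> extensional (Ar I)"
      by (simp_all add: cat_cocone_def Let_def)
    fix \<delta> assume d: "\<delta> \<in> Cl I"
    have ar: "dom2 I \<delta> \<in> Ar I" "cod2 I \<delta> \<in> Ar I" "src I (cod2 I \<delta>) = src I (dom2 I \<delta>)" "trg I (cod2 I \<delta>) = trg I (dom2 I \<delta>)"
      using d by (simp_all add: I.src_cod2 I.trg_cod2)
    show "legc ?r (cod2 I \<delta>) \<bullet>\<^bsub>Cat\<^esub> (id2 Cat (leg ?r (trg I (dom2 I \<delta>))) \<star>\<^bsub>Cat\<^esub> P2 (hom_psfun J K F) \<delta>) = legc ?r (dom2 I \<delta>)"
    proof (rule nattr_eqI)
      show "is_nattr (legc ?r (cod2 I \<delta>) \<bullet>\<^bsub>Cat\<^esub> (id2 Cat (leg ?r (trg I (dom2 I \<delta>))) \<star>\<^bsub>Cat\<^esub> P2 (hom_psfun J K F) \<delta>))"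
        by (rule nat) (use d ar ty in \<open>simp del: cs\<close>)
      show "is_nattr (legc ?r (dom2 I \<delta>))" by (rule nat) (use d ty in \<open>simp del: cs\<close>)
      fix x assume "x \<in> cObj (fDom (nDom (legc ?r (dom2 I \<delta>))))"
      then have x: "pt x (src I (dom2 I \<delta>))" using d by (simp add: pt_def)
      show "nAt (legc ?r (cod2 I \<delta>) \<bullet>\<^bsub>Cat\<^esub> (id2 Cat (leg ?r (trg I (dom2 I \<delta>))) \<star>\<^bsub>Cat\<^esub> P2 (hom_psfun J K F) \<delta>)) x = nAt (legc ?r (dom2 I \<delta>)) x"
        using cc_P2[OF d x] id[of "P2 F \<delta> \<star>\<^bsub>J\<^esub> id2 J x" "trg I (dom2 I \<delta>)"] pt_P1[of "dom2 I \<delta>" x] x d ar ptD[OF x] by simp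
    qed (use d ar in simp_all)
  next
    fix d e assume d: "d \<in> Ar I" "e \<in> Ar I" "trg I d = src I e"
    show "legc ?r (e \<cdot>\<^bsub>I\<^esub> d) \<bullet>\<^bsub>Cat\<^esub> (id2 Cat (leg ?r (trg I e)) \<star>\<^bsub>Cat\<^esub> P2c (hom_psfun J K F) e d) =
      legc ?r d \<bullet>\<^bsub>Cat\<^esub> (legc ?r e \<star>\<^bsub>Cat\<^esub> id2 Cat (P1 (hom_psfun J K F) d))"
    proof (rule nattr_eqI)
      show "is_nattr (legc ?r (e \<cdot>\<^bsub>I\<^esub> d) \<bullet>\<^bsub>Cat\<^esub> (id2 Cat (leg ?r (trg I e)) \<star>\<^bsub>Cat\<^esub> P2c (hom_psfun J K F) e d))"
        "is_nattr (legc ?r d \<bullet>\<^bsub>Cat\<^esub> (legc ?r e \<star>\<^bsub>Cat\<^esub> id2 Cat (P1 (hom_psfun J K F) d)))"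
        by (rule nat; use d ty in \<open>simp del: cs\<close>)+
      show "nDom (legc ?r (e \<cdot>\<^bsub>I\<^esub> d) \<bullet>\<^bsub>Cat\<^esub> (id2 Cat (leg ?r (trg I e)) \<star>\<^bsub>Cat\<^esub> P2c (hom_psfun J K F) e d)) =
        nDom (legc ?r d \<bullet>\<^bsub>Cat\<^esub> (legc ?r e \<star>\<^bsub>Cat\<^esub> id2 Cat (P1 (hom_psfun J K F) d)))"
      proof -
        have "dom2 Cat (legc ?r (e \<cdot>\<^bsub>I\<^esub> d) \<bullet>\<^bsub>Cat\<^esub> (id2 Cat (leg ?r (trg I e)) \<star>\<^bsub>Cat\<^esub> P2c (hom_psfun J K F) e d)) =
          dom2 Cat (legc ?r d \<bullet>\<^bsub>Cat\<^esub> (legc ?r e \<star>\<^bsub>Cat\<^esub> id2 Cat (P1 (hom_psfun J K F) d)))"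
          using d ty by (simp del: cs)
        then show ?thesis by (simp only: Cat_simps)
      qed
      fix x assume "x \<in> cObj (fDom (nDom (legc ?r d \<bullet>\<^bsub>Cat\<^esub> (legc ?r e \<star>\<^bsub>Cat\<^esub> id2 Cat (P1 (hom_psfun J K F) d)))))"
      then have x: "pt x (src I d)" using d by (simp add: pt_def)
      have y: "pt (P1 F d \<cdot>\<^bsub>J\<^esub> x) (src I e)" using pt_P1[OF d(1) x] d(3) by simp
      have c: "cComp X (cc e (P1 F d \<cdot>\<^bsub>J\<^esub> x)) (cId X (ob (trg I e) (P1 F e \<cdot>\<^bsub>J\<^esub> (P1 F d \<cdot>\<^bsub>J\<^esub> x)))) = cc e (P1 F d \<cdot>\<^bsub>J\<^esub> x)"
        using cc[OF d(2) y] by simp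
      show "nAt (legc ?r (e \<cdot>\<^bsub>I\<^esub> d) \<bullet>\<^bsub>Cat\<^esub> (id2 Cat (leg ?r (trg I e)) \<star>\<^bsub>Cat\<^esub> P2c (hom_psfun J K F) e d)) x =
        nAt (legc ?r d \<bullet>\<^bsub>Cat\<^esub> (legc ?r e \<star>\<^bsub>Cat\<^esub> id2 Cat (P1 (hom_psfun J K F) d))) x"
        using cc_P2c[OF d x] id[of "P2c F e d \<star>\<^bsub>J\<^esub> id2 J x" "trg I e"] pt_P1[OF d(2) y] ac_id[OF pt_P1[OF d(2) y]] c x d ptD[OF x] ptD[OF y] by simp
    qed (use d in simp_all)
  next
    fix i assume i: "i \<in> Ob I"
    show "legc ?r (id1 I i) \<bullet>\<^bsub>Cat\<^esub> (id2 Cat (leg ?r i) \<star>\<^bsub>Cat\<^esub> P0c (hom_psfun J K F) i) = id2 Cat (leg ?r i)"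
    proof (rule nattr_eqI)
      show "is_nattr (legc ?r (id1 I i) \<bullet>\<^bsub>Cat\<^esub> (id2 Cat (leg ?r i) \<star>\<^bsub>Cat\<^esub> P0c (hom_psfun J K F) i))" "is_nattr (id2 Cat (leg ?r i))"
        by (rule nat; use i ty in \<open>simp del: cs\<close>)+
      show "nDom (legc ?r (id1 I i) \<bullet>\<^bsub>Cat\<^esub> (id2 Cat (leg ?r i) \<star>\<^bsub>Cat\<^esub> P0c (hom_psfun J K F) i)) = nDom (id2 Cat (leg ?r i))"
      proof -
        have "dom2 Cat (legc ?r (id1 I i) \<bullet>\<^bsub>Cat\<^esub> (id2 Cat (leg ?r i) \<star>\<^bsub>Cat\<^esub> P0c (hom_psfun J K F) i)) = dom2 Cat (id2 Cat (leg ?r i))"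
          using i ty by (simp del: cs)
        then show ?thesis by (simp only: Cat_simps)
      qed
      fix x assume "x \<in> cObj (fDom (nDom (id2 Cat (leg ?r i))))"
      then have x: "pt x i" using i by (simp add: pt_def)
      show "nAt (legc ?r (id1 I i) \<bullet>\<^bsub>Cat\<^esub> (id2 Cat (leg ?r i) \<star>\<^bsub>Cat\<^esub> P0c (hom_psfun J K F) i)) x = nAt (id2 Cat (leg ?r i)) x"
        using cc_P0c[OF x] id[of "P0c F i \<star>\<^bsub>J\<^esub> id2 J x" i] x i ptD[OF x] by simp
    qed (use i in simp_all)
  qed (use ty in \<open>simp_all del: cs\<close>)
qed

end

section \<open>Bifiltered bicolimits of categories\<close>

locale cat_bicolimit = hom_cat_pseudofunctor I J F K
  for I :: "('i, 'j, 'k) twocat" and J :: "('o, 'u, 'u) twocat" and F :: "('i, 'j, 'k, 'o, 'u, 'u) psfun"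
    and K :: 'o +
  fixes C and p
  assumes bic: "is_bicolimit Cat I (hom_psfun J K F) C p"
    and U: "universe TYPE('u)" and I_small: "small TYPE('u) (Ob I)" "small TYPE('u) (Ar I)"
begin

lemma C_Ob: "C \<in> Ob Cat" and pc: "pseudococone Cat I (hom_psfun J K F) C p"
  using is_bicolimitD[OF bic] by blast+

sublocale P: functor_cocone I J F K C "\<lambda>i x. fOb (leg p i) x" "\<lambda>i. fAr (leg p i)" "\<lambda>d. nAt (legc p d)"
  by (rule functor_cocone_of_cat_cocone[OF pc C_Ob])

text \<open>Splits an invertible modification into isomorphisms of \<open>X'\<close>, one for each
  point. It serves twice: for factorizations through test categories and for the isomorphism that
  defines the canonical functor.\<close>

lemma post_iso_components:
  assumes X': "X' \<in> Ob Cat" and vf: "is_functor v" "fDom v = C" "fCod v = X'"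
    and e: "cIso (cocone_cat Cat I (hom_psfun J K F) X') e" "mDom e = cocone_post Cat I v p" "mCod e = r"
  shows "pt x i \<Longrightarrow> cIso X' (nAt (mAt e i) x) \<and> cDom X' (nAt (mAt e i) x) = fOb v (fOb (leg p i) x) \<and>
      cCod X' (nAt (mAt e i) x) = fOb (leg r i) x"
    "\<lbrakk>\<alpha> \<in> Cl J; pt (dom2 J \<alpha>) i\<rbrakk> \<Longrightarrow> cComp X' (nAt (mAt e i) (cod2 J \<alpha>)) (fAr v (fAr (leg p i) \<alpha>)) =
      cComp X' (fAr (leg r i) \<alpha>) (nAt (mAt e i) (dom2 J \<alpha>))"
    "\<lbrakk>d \<in> Ar I; pt x (src I d)\<rbrakk> \<Longrightarrow> cComp X' (nAt (mAt e (src I d)) x) (fAr v (nAt (legc p d) x)) =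
      cComp X' (nAt (legc r d) x) (nAt (mAt e (trg I d)) (P1 F d \<cdot>\<^bsub>J\<^esub> x))"
proof -
  interpret X': category X' using X' by simp
  note V = is_functorD(3-8)[OF vf(1), unfolded vf]
  have em: "modification Cat I (hom_psfun J K F) X' e"
    using e(1) by (auto simp: cIso_def)
  have r: "pseudococone Cat I (hom_psfun J K F) X' r"
    using G.modificationD(5)[OF em] e(3) by simp
  have ei: "iso2 Cat (mAt e i)" if "i \<in> Ob I" for i
    using G.cocone_cat_cIso[OF em] e(1) that by blast
  have en: "is_nattr (mAt e i)" "nDom (mAt e i) = fComp v (leg p i)" "nCod (mAt e i) = leg r i" if "i \<in> Ob I" for i
    using G.modificationD(1-3)[OF em that] e that by simp_all
  note leg = cat_cocone_leg[OF pc] and legc = cat_cocone_legc[OF pc] and legr = cat_cocone_leg[OF r] and legcr = cat_cocone_legc[OF r]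
  have n: "cIso X' (nAt (mAt e i) x) \<and> cDom X' (nAt (mAt e i) x) = fOb v (fOb (leg p i) x) \<and> cCod X' (nAt (mAt e i) x) = fOb (leg r i) x"
    if x: "pt x i" for i x
  proof -
    note i = ptD[OF x]
    note L = leg(2,3)[OF i(4)] en[OF i(4)]
    show ?thesis
      using iso2_Cat_component[OF ei[OF i(4)], of x] nattrD(6,7)[OF L(3), of x] L vf i by simp
  qed
  show "cIso X' (nAt (mAt e i) x) \<and> cDom X' (nAt (mAt e i) x) = fOb v (fOb (leg p i) x) \<and>
      cCod X' (nAt (mAt e i) x) = fOb (leg r i) x" if "pt x i"
    using n that .
  show "cComp X' (nAt (mAt e i) (cod2 J \<alpha>)) (fAr v (fAr (leg p i) \<alpha>)) = cComp X' (fAr (leg r i) \<alpha>) (nAt (mAt e i) (dom2 J \<alpha>))"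
    if a: "\<alpha> \<in> Cl J" "pt (dom2 J \<alpha>) i"
  proof -
    note i = ptD[OF a(2)]
    note L = leg(2,3)[OF i(4)] en[OF i(4)]
    show ?thesis
      using nattrD(8)[OF L(3), of \<alpha>] L vf i a by simp
  qed
  show "cComp X' (nAt (mAt e (src I d)) x) (fAr v (nAt (legc p d) x)) =
      cComp X' (nAt (legc r d) x) (nAt (mAt e (trg I d)) (P1 F d \<cdot>\<^bsub>J\<^esub> x))"
    if d: "d \<in> Ar I" "pt x (src I d)"
  proof -
    note x = ptD[OF d(2)] and y = pt_P1[OF d]
    note L = leg(2,3)[OF I.src_Ob[OF d(1)]] leg(2,3)[OF I.trg_Ob[OF d(1)]] en[OF I.src_Ob[OF d(1)]] en[OF I.trg_Ob[OF d(1)]] legc(1-3)[OF d(1)]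
      legr(2,3)[OF I.src_Ob[OF d(1)]] legr(2,3)[OF I.trg_Ob[OF d(1)]] legcr(1-3)[OF d(1)]
    have c: "cComp X' (cId X' (fOb v (fOb (leg p (src I d)) x))) (fAr v (nAt (legc p d) x)) = fAr v (nAt (legc p d) x)"
      "cComp X' (nAt (mAt e (trg I d)) (P1 F d \<cdot>\<^bsub>J\<^esub> x)) (fAr v (fAr (leg p (trg I d)) (id2 J (P1 F d \<cdot>\<^bsub>J\<^esub> x)))) = nAt (mAt e (trg I d)) (P1 F d \<cdot>\<^bsub>J\<^esub> x)"
      using P.cc[OF d] V n[OF y] P.ac_id[OF y] P.ob[OF y] by simp_all
    show ?thesis
      using arg_cong[OF G.modification_eq[OF em d(1)], of "\<lambda>k. nAt k x"] L e vf d(1) x ptD[OF y] c P.ob[OF d(2)] by simp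
  qed
qed

text \<open>The one-dimensional universal property against a small category with cells of any type:
  \<open>X\<close> is copied into \<open>'u\<close>, the comparison functor gives \<open>v\<close>,
  and \<open>v\<close> is followed by the decoding functor.\<close>

lemma factor:
  assumes h: "functor_cocone I J F K X ob ac cc" and s: "small TYPE('u) (cObj X)" "small TYPE('u) (cArr X)"
  obtains u m where "is_functor u" "fDom u = C" "fCod u = X"
    "\<And>i x. pt x i \<Longrightarrow> cIso X (m i x) \<and> cDom X (m i x) = fOb u (fOb (leg p i) x) \<and> cCod X (m i x) = ob i x"
    "\<And>i \<alpha>. \<lbrakk>\<alpha> \<in> Cl J; pt (dom2 J \<alpha>) i\<rbrakk> \<Longrightarrow> cComp X (m i (cod2 J \<alpha>)) (fAr u (fAr (leg p i) \<alpha>)) = cComp X (ac i \<alpha>) (m i (dom2 J \<alpha>))"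
    "\<And>d x. \<lbrakk>d \<in> Ar I; pt x (src I d)\<rbrakk> \<Longrightarrow> cComp X (m (src I d) x) (fAr u (nAt (legc p d) x)) = cComp X (cc d x) (m (trg I d) (P1 F d \<cdot>\<^bsub>J\<^esub> x))"
proof -
  interpret X: functor_cocone I J F K X ob ac cc by (rule h)
  obtain X' :: "('u, 'u) cat" and E D where X': "X' \<in> Ob Cat" and E: "is_functor E" "fDom E = X" "fCod E = X'"
    and D: "is_functor D" "fDom D = X'" "fCod D = X" and DE: "\<And>x. x \<in> cObj X \<Longrightarrow> fOb D (fOb E x) = x" "\<And>f. f \<in> cArr X \<Longrightarrow> fAr D (fAr E f) = f"
    by (rule encode_category[OF X.X s]) blast
  interpret X': category X' using X' by simp
  let ?ob = "\<lambda>i x. fOb E (ob i x)" and ?ac = "\<lambda>i \<alpha>. fAr E (ac i \<alpha>)" and ?cc = "\<lambda>d x. fAr E (cc d x)"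
  have h': "functor_cocone I J F K X' ?ob ?ac ?cc"
    using X.functor_cocone_functor[OF E(1,2)] E(3) by simp
  interpret Y: functor_cocone I J F K X' ?ob ?ac ?cc by (rule h')
  let ?r = "cat_cocone X' ?ob ?ac ?cc"
  have r: "pseudococone Cat I (hom_psfun J K F) X' ?r" by (rule pseudococone_cat_cocone[OF h' X'])
  \<comment> \<open>Essential surjectivity: the pseudococone is reached only up to the isomorphism
    \<open>e\<close>, whose components become the \<open>m i x\<close>.\<close>
  obtain v e where v: "v \<in> Ar Cat" "src Cat v = C" "trg Cat v = X'"
    and e: "cIso (cocone_cat Cat I (hom_psfun J K F) X') e" "mDom e = cocone_post Cat I v p" "mCod e = ?r"
    using is_bicolimitD(5)[OF bic X'] r unfolding ess_surj_def by (auto simp: cocone_functor_def simp del: Cat_simps)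
  have vf: "is_functor v" "fDom v = C" "fCod v = X'" using v by simp_all
  note V = is_functorD(3-8)[OF vf(1), unfolded vf]
  note e' = post_iso_components[OF X' vf e]
  have n: "cIso X' (nAt (mAt e i) x)" "cDom X' (nAt (mAt e i) x) = fOb v (fOb (leg p i) x)" "cCod X' (nAt (mAt e i) x) = ?ob i x"
    if x: "pt x i" for i x
    using e'(1)[OF x] ptD[OF x] by simp_all
  let ?u = "fComp D v" and ?m = "\<lambda>i x. fAr D (nAt (mAt e i) x)"
  note Df = is_functorD(3-6)[OF D(1), unfolded D] and Dc = is_functorD(8)[OF D(1), unfolded D, symmetric]
  show thesis
  proof (rule that[of ?u ?m])
    show "is_functor ?u" by (rule is_functor_fComp) (use vf D in simp_all)
    fix i x assume x: "pt x i"
    show "cIso X (?m i x) \<and> cDom X (?m i x) = fOb ?u (fOb (leg p i) x) \<and> cCod X (?m i x) = ob i x"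
      using functor_cIso[OF D(1), of "nAt (mAt e i) x"] n[OF x] D Df vf DE X.ob[OF x] P.ob[OF x] by simp
  next
    fix i \<alpha> assume a: "\<alpha> \<in> Cl J" "pt (dom2 J \<alpha>) i"
    have N: "cComp X' (nAt (mAt e i) (cod2 J \<alpha>)) (fAr v (fAr (leg p i) \<alpha>)) = cComp X' (?ac i \<alpha>) (nAt (mAt e i) (dom2 J \<alpha>))"
      using e'(2)[OF a] ptD[OF a(2)] a by simp
    have "cComp X (?m i (cod2 J \<alpha>)) (fAr D (fAr v (fAr (leg p i) \<alpha>))) = cComp X (fAr D (?ac i \<alpha>)) (?m i (dom2 J \<alpha>))"
      using arg_cong[OF N, of "fAr D"] n[OF a(2)] n[OF P.pt_cod[OF a]] P.ac[OF a] V Y.ac[OF a] by (simp add: Dc)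
    then show "cComp X (?m i (cod2 J \<alpha>)) (fAr ?u (fAr (leg p i) \<alpha>)) = cComp X (ac i \<alpha>) (?m i (dom2 J \<alpha>))"
      using DE X.ac[OF a] P.ac[OF a] vf by simp
  next
    fix d x assume d: "d \<in> Ar I" "pt x (src I d)"
    note x = ptD[OF d(2)] and y = pt_P1[OF d]
    have N: "cComp X' (nAt (mAt e (src I d)) x) (fAr v (nAt (legc p d) x)) = cComp X' (?cc d x) (nAt (mAt e (trg I d)) (P1 F d \<cdot>\<^bsub>J\<^esub> x))"
      using e'(3)[OF d] d(1) x by simp
    have "cComp X (?m (src I d) x) (fAr D (fAr v (nAt (legc p d) x))) = cComp X (fAr D (?cc d x)) (?m (trg I d) (P1 F d \<cdot>\<^bsub>J\<^esub> x))"
      using arg_cong[OF N, of "fAr D"] n[OF d(2)] n[OF y] P.cc[OF d] V Y.cc[OF d] by (simp add: Dc)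
    then show "cComp X (?m (src I d) x) (fAr ?u (nAt (legc p d) x)) = cComp X (cc d x) (?m (trg I d) (P1 F d \<cdot>\<^bsub>J\<^esub> x))"
      using DE X.cc[OF d] P.cc[OF d] vf by simp
  qed (use vf D in simp_all)
qed

text \<open>The two-dimensional universal property: the \<open>n i x\<close> form an isomorphism
  from the composite of \<open>f\<close> with \<open>p\<close> to \<open>p\<close>, and full
  faithfulness of composition with \<open>p\<close> lifts it to one between \<open>f\<close> and the
  identity.\<close>

lemma lift_to_identity:
  assumes f: "is_functor f" "fDom f = C" "fCod f = C"
    and n: "\<And>i x. pt x i \<Longrightarrow> cIso C (n i x) \<and> cDom C (n i x) = fOb f (fOb (leg p i) x) \<and> cCod C (n i x) = fOb (leg p i) x"
    and n_ac: "\<And>i \<alpha>. \<lbrakk>\<alpha> \<in> Cl J; pt (dom2 J \<alpha>) i\<rbrakk> \<Longrightarrow> cComp C (n i (cod2 J \<alpha>)) (fAr f (fAr (leg p i) \<alpha>)) = cComp C (fAr (leg p i) \<alpha>) (n i (dom2 J \<alpha>))"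
    and n_cc: "\<And>d x. \<lbrakk>d \<in> Ar I; pt x (src I d)\<rbrakk> \<Longrightarrow> cComp C (n (src I d) x) (fAr f (nAt (legc p d) x)) = cComp C (nAt (legc p d) x) (n (trg I d) (P1 F d \<cdot>\<^bsub>J\<^esub> x))"
  obtains \<gamma> where "is_nattr \<gamma>" "nDom \<gamma> = f" "nCod \<gamma> = fId C" "\<And>c. c \<in> cObj C \<Longrightarrow> cIso C (nAt \<gamma> c)"
    "\<And>i x. pt x i \<Longrightarrow> nAt \<gamma> (fOb (leg p i) x) = n i x"
proof -
  note leg = cat_cocone_leg[OF pc] and legc = cat_cocone_legc[OF pc]
  note fD = is_functorD(3-8)[OF f(1), unfolded f]
  have fA: "f \<in> Ar Cat" "src Cat f = C" "trg Cat f = C" using f C_Ob by simp_all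
  \<comment> \<open>The arrows \<open>n i x\<close>, assembled into a modification between two
    pseudococones that are images of \<open>f\<close> and of the identity under the comparison
    functor.\<close>
  define m where "m = \<lparr>mDom = cocone_post Cat I f p, mCod = p, mAt = (\<lambda>i\<in>Ob I. \<lparr>nDom = fComp f (leg p i), nCod = leg p i,
    nAt = restrict (n i) (cObj (hom_cat J K (P0 F i)))\<rparr>)\<rparr>"
  have m_simps [simp]: "mDom m = cocone_post Cat I f p" "mCod m = p" "mAt m \<in> extensional (Ob I)"
    "\<And>i. i \<in> Ob I \<Longrightarrow> nDom (mAt m i) = fComp f (leg p i)" "\<And>i. i \<in> Ob I \<Longrightarrow> nCod (mAt m i) = leg p i"
    "\<And>i x. pt x i \<Longrightarrow> nAt (mAt m i) x = n i x"
    by (auto simp: m_def pt_def)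
  have mn: "is_nattr (mAt m i)" if i: "i \<in> Ob I" for i
  proof (rule nattrI)
    note L = leg(2,3)[OF i]
    show "is_functor (nDom (mAt m i))" using i f leg(1-3)[OF i] by (simp add: is_functor_fComp)
    show "is_functor (nCod (mAt m i))" using i leg(1)[OF i] by simp
    show "nAt (mAt m i) \<in> extensional (cObj (fDom (nDom (mAt m i))))" using i L by (simp add: m_def)
    fix x assume "x \<in> cObj (fDom (nDom (mAt m i)))"
    then have x: "pt x i" using i L by (simp add: pt_def)
    then show "nAt (mAt m i) x \<in> cArr (fCod (nDom (mAt m i)))" "cDom (fCod (nDom (mAt m i))) (nAt (mAt m i) x) = fOb (nDom (mAt m i)) x"
      "cCod (fCod (nDom (mAt m i))) (nAt (mAt m i) x) = fOb (nCod (mAt m i)) x"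
      using n[OF x] ptD[OF x] i L f by simp_all
  next
    note L = leg(2,3)[OF i]
    fix \<alpha> assume "\<alpha> \<in> cArr (fDom (nDom (mAt m i)))"
    then have a: "\<alpha> \<in> Cl J" "pt (dom2 J \<alpha>) i" using i L by (simp_all add: pt_def)
    show "cComp (fCod (nDom (mAt m i))) (nAt (mAt m i) (cCod (fDom (nDom (mAt m i))) \<alpha>)) (fAr (nDom (mAt m i)) \<alpha>) =
       cComp (fCod (nDom (mAt m i))) (fAr (nCod (mAt m i)) \<alpha>) (nAt (mAt m i) (cDom (fDom (nDom (mAt m i))) \<alpha>))"
      using n_ac[OF a] a i L f ptD[OF a(2)] P.pt_cod[OF a] by simp
  qed (use i leg(2,3)[OF i] f in simp_all)
  have hO: "hom_cat J K (P0 F i) \<in> Ob Cat" if "i \<in> Ob I" for i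
    using G.P0_Ob[OF that] by simp
  have mi: "iso2 Cat (mAt m i)" if i: "i \<in> Ob I" for i
    by (rule iso2_CatI[OF mn[OF i]]) (use i hO[OF i] C_Ob f leg(2,3)[OF i] n hom_cat_pt[OF i] in \<open>auto simp: pt_def\<close>)
  have mm: "modification Cat I (hom_psfun J K F) C m"
  proof (rule G.modificationI)
    show "pseudococone Cat I (hom_psfun J K F) C (mDom m)"
      using G.pseudococone_post[OF pc fA(1,2), of C] fA(3) by simp
    show "pseudococone Cat I (hom_psfun J K F) C (mCod m)" using pc by simp
    show "mAt m i \<in> Cl Cat" "dom2 Cat (mAt m i) = leg (mDom m) i" "cod2 Cat (mAt m i) = leg (mCod m) i" if i: "i \<in> Ob I" for i
      using iso2_Cl[OF mi[OF i]] i by simp_all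
    fix d assume d: "d \<in> Ar I"
    note s = I.src_Ob[OF d] I.trg_Ob[OF d]
    note L = leg(2,3)[OF s(1)] leg(2,3)[OF s(2)] legc(1-3)[OF d]
    have typ1: "mAt m (src I d) \<bullet>\<^bsub>Cat\<^esub> legc (mDom m) d \<in> Cl Cat" "legc (mCod m) d \<bullet>\<^bsub>Cat\<^esub> (mAt m (trg I d) \<star>\<^bsub>Cat\<^esub> id2 Cat (P1 (hom_psfun J K F) d)) \<in> Cl Cat"
      "dom2 Cat (mAt m (src I d) \<bullet>\<^bsub>Cat\<^esub> legc (mDom m) d) = dom2 Cat (legc (mCod m) d \<bullet>\<^bsub>Cat\<^esub> (mAt m (trg I d) \<star>\<^bsub>Cat\<^esub> id2 Cat (P1 (hom_psfun J K F) d)))"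
      "cod2 Cat (mAt m (src I d) \<bullet>\<^bsub>Cat\<^esub> legc (mDom m) d) = cod2 Cat (legc (mCod m) d \<bullet>\<^bsub>Cat\<^esub> (mAt m (trg I d) \<star>\<^bsub>Cat\<^esub> id2 Cat (P1 (hom_psfun J K F) d)))"
    proof -
      have [simp]: "dom2 Cat (mAt m i) = f \<cdot>\<^bsub>Cat\<^esub> leg p i" "cod2 Cat (mAt m i) = leg p i" if "i \<in> Ob I" for i using that by simp_all
      note [simp] = G.pseudococoneD[OF pc] fA mi iso2_Cl[OF mi]
      show "mAt m (src I d) \<bullet>\<^bsub>Cat\<^esub> legc (mDom m) d \<in> Cl Cat" "legc (mCod m) d \<bullet>\<^bsub>Cat\<^esub> (mAt m (trg I d) \<star>\<^bsub>Cat\<^esub> id2 Cat (P1 (hom_psfun J K F) d)) \<in> Cl Cat"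
        "dom2 Cat (mAt m (src I d) \<bullet>\<^bsub>Cat\<^esub> legc (mDom m) d) = dom2 Cat (legc (mCod m) d \<bullet>\<^bsub>Cat\<^esub> (mAt m (trg I d) \<star>\<^bsub>Cat\<^esub> id2 Cat (P1 (hom_psfun J K F) d)))"
        "cod2 Cat (mAt m (src I d) \<bullet>\<^bsub>Cat\<^esub> legc (mDom m) d) = cod2 Cat (legc (mCod m) d \<bullet>\<^bsub>Cat\<^esub> (mAt m (trg I d) \<star>\<^bsub>Cat\<^esub> id2 Cat (P1 (hom_psfun J K F) d)))"
        using d s by (simp_all del: Cat_simps hom_psfun_simps)
    qed
    show "mAt m (src I d) \<bullet>\<^bsub>Cat\<^esub> legc (mDom m) d = legc (mCod m) d \<bullet>\<^bsub>Cat\<^esub> (mAt m (trg I d) \<star>\<^bsub>Cat\<^esub> id2 Cat (P1 (hom_psfun J K F) d))"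
    proof (rule nattr_eqI)
      show "is_nattr (mAt m (src I d) \<bullet>\<^bsub>Cat\<^esub> legc (mDom m) d)"
        "is_nattr (legc (mCod m) d \<bullet>\<^bsub>Cat\<^esub> (mAt m (trg I d) \<star>\<^bsub>Cat\<^esub> id2 Cat (P1 (hom_psfun J K F) d)))"
        using typ1(1,2) unfolding Cat_simps by blast+
      show "nDom (mAt m (src I d) \<bullet>\<^bsub>Cat\<^esub> legc (mDom m) d) = nDom (legc (mCod m) d \<bullet>\<^bsub>Cat\<^esub> (mAt m (trg I d) \<star>\<^bsub>Cat\<^esub> id2 Cat (P1 (hom_psfun J K F) d)))"
        "nCod (mAt m (src I d) \<bullet>\<^bsub>Cat\<^esub> legc (mDom m) d) = nCod (legc (mCod m) d \<bullet>\<^bsub>Cat\<^esub> (mAt m (trg I d) \<star>\<^bsub>Cat\<^esub> id2 Cat (P1 (hom_psfun J K F) d)))"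
        using typ1(3,4) unfolding Cat_simps by blast+
      fix x assume "x \<in> cObj (fDom (nDom (legc (mCod m) d \<bullet>\<^bsub>Cat\<^esub> (mAt m (trg I d) \<star>\<^bsub>Cat\<^esub> id2 Cat (P1 (hom_psfun J K F) d)))))"
      then have x: "pt x (src I d)" using d s L by (simp add: pt_def)
      note y = pt_P1[OF d x]
      have c: "cComp C (cId C (fOb f (fOb (leg p (src I d)) x))) (fAr f (nAt (legc p d) x)) = fAr f (nAt (legc p d) x)"
        "cComp C (n (trg I d) (P1 F d \<cdot>\<^bsub>J\<^esub> x)) (fAr f (fAr (leg p (trg I d)) (id2 J (P1 F d \<cdot>\<^bsub>J\<^esub> x)))) = n (trg I d) (P1 F d \<cdot>\<^bsub>J\<^esub> x)"
        using P.cc[OF d x] fD n[OF y] P.ac_id[OF y] P.ob[OF y] by simp_all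
      show "nAt (mAt m (src I d) \<bullet>\<^bsub>Cat\<^esub> legc (mDom m) d) x = nAt (legc (mCod m) d \<bullet>\<^bsub>Cat\<^esub> (mAt m (trg I d) \<star>\<^bsub>Cat\<^esub> id2 Cat (P1 (hom_psfun J K F) d))) x"
        using n_cc[OF d x] c d s L f x y ptD[OF x] ptD[OF y] P.ob[OF x] by simp
    qed
  qed simp
  let ?K = "cocone_functor Cat I (hom_psfun J K F) C p C"
  have idA: "id1 Cat C \<in> Ar Cat" "src Cat (id1 Cat C) = C" "trg Cat (id1 Cat C) = C"
    using G.J.id1_simps[OF C_Ob] by blast+
  have Kf: "is_functor ?K" by (rule G.is_functor_cocone_functor[OF pc])
  have ff: "fully_faithful ?K" by (rule is_bicolimitD(4)[OF bic C_Ob])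
  have KD: "fDom ?K = hom_cat Cat C C" "fCod ?K = cocone_cat Cat I (hom_psfun J K F) C"
     "\<And>g. \<lbrakk>g \<in> Ar Cat; src Cat g = C; trg Cat g = C\<rbrakk> \<Longrightarrow> fOb ?K g = cocone_post Cat I g p"
     "\<And>g. \<lbrakk>g \<in> Cl Cat; src Cat (dom2 Cat g) = C; trg Cat (dom2 Cat g) = C\<rbrakk> \<Longrightarrow> fAr ?K g = cocone_post2 Cat I g p"
    by (simp_all add: cocone_functor_def del: Cat_simps)
  obtain \<gamma> where \<gamma>: "\<gamma> \<in> cArr (hom_cat Cat C C)" "cDom (hom_cat Cat C C) \<gamma> = f" "cCod (hom_cat Cat C C) \<gamma> = id1 Cat C" "fAr ?K \<gamma> = m"
  proof (rule fully_faithful_ex[OF ff, of f "id1 Cat C" m, unfolded KD(1,2)])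
    show "f \<in> cObj (hom_cat Cat C C)" "id1 Cat C \<in> cObj (hom_cat Cat C C)"
      using fA idA by (simp_all del: Cat_simps)
    show "m \<in> cArr (cocone_cat Cat I (hom_psfun J K F) C)" using mm by simp
    show "cDom (cocone_cat Cat I (hom_psfun J K F) C) m = fOb ?K f" using KD(3)[OF fA] by simp
    show "cCod (cocone_cat Cat I (hom_psfun J K F) C) m = fOb ?K (id1 Cat C)"
      using KD(3)[OF idA] G.cocone_post_id1[OF pc C_Ob] by (simp del: Cat_simps)
  qed
  have mI: "cIso (cocone_cat Cat I (hom_psfun J K F) C) m"
    using G.cocone_cat_cIso[OF mm] mi by blast
  \<comment> \<open>Fully faithful functors reflect isomorphisms, and isomorphy of \<open>m\<close>
    is seen on components.\<close>
  have "cIso (hom_cat Cat C C) \<gamma>"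
    by (rule fully_faithful_cIso[OF ff Kf, unfolded KD(1,2)]) (use \<gamma>(1) mI in \<open>simp_all only: \<gamma>(4)\<close>)
  then have \<gamma>i: "iso2 Cat \<gamma>" by (rule G.J.cIso_hom_cat)
  have \<gamma>n: "is_nattr \<gamma>" "nDom \<gamma> = f" "nCod \<gamma> = fId C" using \<gamma> by simp_all
  show thesis
  proof (rule that[of \<gamma>])
    show "cIso C (nAt \<gamma> c)" if "c \<in> cObj C" for c
      using iso2_Cat_component[OF \<gamma>i, of c] that \<gamma>n f by simp
    fix i x assume x: "pt x i"
    note i = ptD[OF x]
    have "fAr ?K \<gamma> = cocone_post2 Cat I \<gamma> p"
      using \<gamma> by (intro KD(4)) (simp_all del: Cat_simps)
    then have "cocone_post2 Cat I \<gamma> p = m" using \<gamma>(4) by simp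
    then have "nAt (mAt (cocone_post2 Cat I \<gamma> p) i) x = n i x"
      using m_simps(6)[OF x] by (simp only:)
    then have "cComp C (nAt \<gamma> (fOb (leg p i) x)) (fAr f (cId C (fOb (leg p i) x))) = n i x"
      using i(4) leg(2,3)[OF i(4)] \<gamma>n f i by simp
    then show "nAt \<gamma> (fOb (leg p i) x) = n i x"
      using P.ob[OF x] fD nattrD(5-7)[OF \<gamma>n(1), of "fOb (leg p i) x"] \<gamma>n f by simp
  qed (use \<gamma>n in simp_all)
qed

lemma small_gob: "small TYPE('u) gob"
proof -
  have "gob \<subseteq> Sigma (Ob I) (\<lambda>i. cObj (hom_cat J K (P0 F i)))"
    by (auto simp: gob_def pt_def)
  moreover have "small TYPE('u) (Sigma (Ob I) (\<lambda>i. cObj (hom_cat J K (P0 F i))))"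
    using G.P0_Ob by (intro small_Sigma[OF U I_small(1)]) simp
  ultimately show ?thesis by (rule small_subset[rotated])
qed

lemma small_germ_cat: "small TYPE('u) (cObj P.germ_cat)" "small TYPE('u) (cArr P.germ_cat)"
proof -
  have "cObj P.germ_cat = gob" by (auto simp: gob_def P.germ_cat_def)
  then show "small TYPE('u) (cObj P.germ_cat)" using small_gob by simp
  have "cArr P.germ_cat \<subseteq> gob \<times> gob \<times> cArr C"
  proof
    fix f assume "f \<in> cArr P.germ_cat"
    then obtain i x j y w where "f = ((i, x), (j, y), w)" "((i, x), (j, y), w) \<in> cArr P.germ_cat"
      by (cases f) auto
    then show "f \<in> gob \<times> gob \<times> cArr C"
      using P.germ_cat_ArrD[of i x j y w] by (simp add: gob_def)
  qed
  moreover have "small TYPE('u) (gob \<times> gob \<times> cArr C)"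
    using C_Ob by (intro small_Sigma[OF U] small_gob) simp
  ultimately show "small TYPE('u) (cArr P.germ_cat)" by (rule small_subset[rotated])
qed

text \<open>A saturated relation lives on representatives of germs, which form a small set; the
  arrows therefore embed into a product with a small power set.\<close>

lemma small_per_cat: "small TYPE('u) (cObj (per_cat gob (gper i0 x0)))" "small TYPE('u) (cArr (per_cat gob (gper i0 x0)))"
proof -
  show "small TYPE('u) (cObj (per_cat gob (gper i0 x0)))" using small_gob by simp
  \<comment> \<open>Contains all representatives \<open>(s, t, \<alpha>)\<close>: such a cell is
    found in the hom-category at its stage, so the 2-cells are collected by stage.\<close>
  define T where "T = Ar I \<times> Ar I \<times> (\<Union>k\<in>Ob I. cArr (hom_cat J K (P0 F k)))"
  have T: "small TYPE('u) T"
    unfolding T_def using G.P0_Ob by (intro small_Sigma[OF U] small_UN[OF U] I_small) simp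
  have g: "(s, t, \<alpha>) \<in> T" if "gc s t x y \<alpha>" for s t x y \<alpha>
    using gcD[OF that] gc_pt[OF that] unfolding T_def by (auto intro!: bexI[of _ "trg I s"])
  have E: "gper i0 x0 q \<subseteq> T \<times> T" for q
  proof
    fix z assume z: "z \<in> gper i0 x0 q"
    obtain s t \<alpha> s' t' \<alpha>' j y where "z = ((s, t, \<alpha>), (s', t', \<alpha>'))" "q = (j, y)"
      by (metis prod_cases3 surj_pair)
    then show "z \<in> T \<times> T"
      using z gperD(1,2)[of s t \<alpha> s' t' \<alpha>' i0 x0 j y] g by simp
  qed
  have "cArr (per_cat gob (gper i0 x0)) \<subseteq> gob \<times> gob \<times> Pow (T \<times> T)"
  proof
    fix f assume "f \<in> cArr (per_cat gob (gper i0 x0))"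
    then obtain q q' \<Gamma> where f: "f = (q, q', \<Gamma>)" "q \<in> gob" "q' \<in> gob" "gper i0 x0 q O \<Gamma> = \<Gamma>" "\<Gamma> O gper i0 x0 q' = \<Gamma>"
      by (cases f) auto
    have "\<Gamma> \<subseteq> T \<times> T"
    proof clarify
      fix a b assume "(a, b) \<in> \<Gamma>"
      then have "(a, b) \<in> gper i0 x0 q O \<Gamma>" "(a, b) \<in> \<Gamma> O gper i0 x0 q'" using f(4,5) by simp_all
      then show "a \<in> T \<and> b \<in> T" using E[of q] E[of q'] by blast
    qed
    then show "f \<in> gob \<times> gob \<times> Pow (T \<times> T)" using f by simp
  qed
  moreover have "small TYPE('u) (gob \<times> gob \<times> Pow (T \<times> T))"
    by (intro small_Sigma[OF U] small_gob small_Pow[OF U] T)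
  ultimately show "small TYPE('u) (cArr (per_cat gob (gper i0 x0)))" by (rule small_subset[rotated])
qed

text \<open>
  Since the pseudococone factors through the category of germs, the identity of \<open>C\<close> does so up
  to isomorphism.
\<close>

lemma germ_factorization:
  obtains \<gamma> u m where "is_nattr \<gamma>" "fDom (nDom \<gamma>) = C" "nCod \<gamma> = fId C" "\<And>c. c \<in> cObj C \<Longrightarrow> cIso C (nAt \<gamma> c)"
    "is_functor u" "fDom u = C" "fCod u = P.germ_cat"
    "\<And>c. c \<in> cObj C \<Longrightarrow> fOb (nDom \<gamma>) c = (\<lambda>(i, x). fOb (leg p i) x) (fOb u c)"
    "\<And>w. w \<in> cArr C \<Longrightarrow> fAr (nDom \<gamma>) w = snd (snd (fAr u w))"
    "\<And>i x. pt x i \<Longrightarrow> cIso P.germ_cat (m i x) \<and> cDom P.germ_cat (m i x) = fOb u (fOb (leg p i) x) \<and> cCod P.germ_cat (m i x) = (i, x) \<and>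
       nAt \<gamma> (fOb (leg p i) x) = snd (snd (m i x))"
proof -
  interpret Gc: category P.germ_cat by (rule P.category_germ_cat)
  obtain u m where u: "is_functor u" "fDom u = C" "fCod u = P.germ_cat" and
    m: "\<And>i x. pt x i \<Longrightarrow> cIso P.germ_cat (m i x) \<and> cDom P.germ_cat (m i x) = fOb u (fOb (leg p i) x) \<and> cCod P.germ_cat (m i x) = (i, x)" and
    m_ac: "\<And>i \<alpha>. \<lbrakk>\<alpha> \<in> Cl J; pt (dom2 J \<alpha>) i\<rbrakk> \<Longrightarrow> cComp P.germ_cat (m i (cod2 J \<alpha>)) (fAr u (fAr (leg p i) \<alpha>)) =
      cComp P.germ_cat ((i, dom2 J \<alpha>), (i, cod2 J \<alpha>), fAr (leg p i) \<alpha>) (m i (dom2 J \<alpha>))" and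
    m_cc: "\<And>d x. \<lbrakk>d \<in> Ar I; pt x (src I d)\<rbrakk> \<Longrightarrow> cComp P.germ_cat (m (src I d) x) (fAr u (nAt (legc p d) x)) =
      cComp P.germ_cat ((trg I d, P1 F d \<cdot>\<^bsub>J\<^esub> x), (src I d, x), nAt (legc p d) x) (m (trg I d) (P1 F d \<cdot>\<^bsub>J\<^esub> x))"
    by (rule factor[OF P.functor_cocone_germ_cat small_germ_cat]) blast
  \<comment> \<open>From the germ category back to \<open>C\<close>. After \<open>u\<close> it gives
    an endofunctor of \<open>C\<close> that is compatible with the inclusions up to
    \<open>m\<close>, which is what \<open>lift_to_identity\<close> asks for.\<close>
  define inc where "inc = \<lparr>fDom = P.germ_cat, fCod = C, fOb = (\<lambda>q\<in>cObj P.germ_cat. (\<lambda>(i, x). fOb (leg p i) x) q),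
    fAr = (\<lambda>w\<in>cArr P.germ_cat. snd (snd w))\<rparr>"
  have inc_simps: "fDom inc = P.germ_cat" "fCod inc = C" "\<And>q. q \<in> cObj P.germ_cat \<Longrightarrow> fOb inc q = (\<lambda>(i, x). fOb (leg p i) x) q"
    "\<And>w. w \<in> cArr P.germ_cat \<Longrightarrow> fAr inc w = snd (snd w)"
    by (simp_all add: inc_def)
  have inc: "is_functor inc"
  proof (rule is_functorI)
    show "category (fDom inc)" "category (fCod inc)" using P.category_germ_cat C_Ob by (simp_all add: inc_simps)
    show "fOb inc \<in> extensional (cObj (fDom inc))" "fAr inc \<in> extensional (cArr (fDom inc))" by (simp_all add: inc_def)
    fix q assume "q \<in> cObj (fDom inc)"
    then show "fOb inc q \<in> cObj (fCod inc)" "fAr inc (cId (fDom inc) q) = cId (fCod inc) (fOb inc q)"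
      using P.ob Gc.cId_simps(1)[of q] by (cases q; simp add: inc_simps)+
  next
    fix w assume "w \<in> cArr (fDom inc)"
    then obtain i x j y w' where w: "w = ((i, x), (j, y), w')" "((i, x), (j, y), w') \<in> cArr P.germ_cat"
      by (cases w) (auto simp: inc_simps)
    then show "fAr inc w \<in> cArr (fCod inc)" "cDom (fCod inc) (fAr inc w) = fOb inc (cDom (fDom inc) w)" "cCod (fCod inc) (fAr inc w) = fOb inc (cCod (fDom inc) w)"
      using P.germ_cat_ArrD[OF w(2)] by (simp_all add: inc_simps)
  next
    fix v w assume a: "v \<in> cArr (fDom inc)" "w \<in> cArr (fDom inc)" "cDom (fDom inc) w = cCod (fDom inc) v"
    then show "fAr inc (cComp (fDom inc) w v) = cComp (fCod inc) (fAr inc w) (fAr inc v)"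
      using Gc.cComp_simps(1)[of v w] by (cases v, cases w) (simp add: inc_simps)
  qed
  note inc_D = is_functorD(4-6)[OF inc, unfolded inc_simps(1,2)]
  note inc_C = is_functorD(8)[OF inc, unfolded inc_simps(1,2)]
  note u_D = is_functorD(3-6)[OF u(1), unfolded u(2,3)]
  let ?f = "fComp inc u"
  have f: "is_functor ?f" "fDom ?f = C" "fCod ?f = C"
    using is_functor_fComp[OF u(1) inc] u inc_simps by simp_all
  let ?n = "\<lambda>i x. fAr inc (m i x)"
  have n1: "cIso C (?n i x) \<and> cDom C (?n i x) = fOb ?f (fOb (leg p i) x) \<and> cCod C (?n i x) = fOb (leg p i) x" if x: "pt x i" for i x
    using functor_cIso[OF inc, unfolded inc_simps(1,2), of "m i x"] m[OF x] inc_D inc_simps(3) u u_D(1) P.ob[OF x] x by simp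
  have n2: "cComp C (?n i (cod2 J \<alpha>)) (fAr ?f (fAr (leg p i) \<alpha>)) = cComp C (fAr (leg p i) \<alpha>) (?n i (dom2 J \<alpha>))"
    if a: "\<alpha> \<in> Cl J" "pt (dom2 J \<alpha>) i" for i \<alpha>
  proof -
    let ?w = "((i, dom2 J \<alpha>), (i, cod2 J \<alpha>), fAr (leg p i) \<alpha>)"
    interpret Q: functor_cocone I J F K P.germ_cat Pair "\<lambda>i \<alpha>. ((i, dom2 J \<alpha>), (i, cod2 J \<alpha>), fAr (leg p i) \<alpha>)"
      "\<lambda>d x. ((trg I d, P1 F d \<cdot>\<^bsub>J\<^esub> x), (src I d, x), nAt (legc p d) x)" by (rule P.functor_cocone_germ_cat)
    have "fAr inc (cComp P.germ_cat (m i (cod2 J \<alpha>)) (fAr u (fAr (leg p i) \<alpha>))) = fAr inc (cComp P.germ_cat ?w (m i (dom2 J \<alpha>)))"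
      using m_ac[OF a] by simp
    then show ?thesis
      using inc_C[of "fAr u (fAr (leg p i) \<alpha>)" "m i (cod2 J \<alpha>)"] inc_C[of "m i (dom2 J \<alpha>)" ?w] m[OF a(2)] m[OF P.pt_cod[OF a]] Q.ac[OF a] P.ac[OF a] u_D
       inc_simps(4)[of ?w] u by simp
  qed
  have n3: "cComp C (?n (src I d) x) (fAr ?f (nAt (legc p d) x)) = cComp C (nAt (legc p d) x) (?n (trg I d) (P1 F d \<cdot>\<^bsub>J\<^esub> x))"
    if d: "d \<in> Ar I" "pt x (src I d)" for d x
  proof -
    let ?w = "((trg I d, P1 F d \<cdot>\<^bsub>J\<^esub> x), (src I d, x), nAt (legc p d) x)"
    interpret Q: functor_cocone I J F K P.germ_cat Pair "\<lambda>i \<alpha>. ((i, dom2 J \<alpha>), (i, cod2 J \<alpha>), fAr (leg p i) \<alpha>)"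
      "\<lambda>d x. ((trg I d, P1 F d \<cdot>\<^bsub>J\<^esub> x), (src I d, x), nAt (legc p d) x)" by (rule P.functor_cocone_germ_cat)
    have "fAr inc (cComp P.germ_cat (m (src I d) x) (fAr u (nAt (legc p d) x))) = fAr inc (cComp P.germ_cat ?w (m (trg I d) (P1 F d \<cdot>\<^bsub>J\<^esub> x)))"
      using m_cc[OF d] by simp
    then show ?thesis
      using inc_C[of "fAr u (nAt (legc p d) x)" "m (src I d) x"] inc_C[of "m (trg I d) (P1 F d \<cdot>\<^bsub>J\<^esub> x)" ?w] m[OF d(2)] m[OF pt_P1[OF d]] Q.cc[OF d] P.cc[OF d] u_D
       inc_simps(4)[of ?w] Gc.cIso_Arr[of ?w] u by simp
  qed
  obtain \<gamma> where \<gamma>: "is_nattr \<gamma>" "nDom \<gamma> = ?f" "nCod \<gamma> = fId C" "\<And>c. c \<in> cObj C \<Longrightarrow> cIso C (nAt \<gamma> c)"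
    "\<And>i x. pt x i \<Longrightarrow> nAt \<gamma> (fOb (leg p i) x) = ?n i x"
    by (rule lift_to_identity[OF f n1 n2 n3]) blast+
  show thesis
    by (rule that[of \<gamma> u m]) (use \<gamma> u u_D m inc_simps in simp_all)
qed

text \<open>The component at \<open>c\<close> of the isomorphism between the endofunctor and the
  identity starts at the image of the pair \<open>fOb u c\<close>.\<close>

lemma bicolimit_ob:
  assumes "c \<in> cObj C"
  obtains i x e where "pt x i" "cIso C e" "cDom C e = fOb (leg p i) x" "cCod C e = c"
proof -
  obtain \<gamma> u m where g: "is_nattr \<gamma>" "fDom (nDom \<gamma>) = C" "nCod \<gamma> = fId C" "\<And>c. c \<in> cObj C \<Longrightarrow> cIso C (nAt \<gamma> c)"
    "is_functor u" "fDom u = C" "fCod u = P.germ_cat"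
    "\<And>c. c \<in> cObj C \<Longrightarrow> fOb (nDom \<gamma>) c = (\<lambda>(i, x). fOb (leg p i) x) (fOb u c)"
    by (rule germ_factorization) blast
  have "fOb u c \<in> cObj P.germ_cat" using is_functorD(3)[OF g(5)] g assms by simp
  then obtain i x where x: "fOb u c = (i, x)" "pt x i" by (cases "fOb u c") simp
  have "fCod (nDom \<gamma>) = C" using nattrD(4)[OF g(1)] g(3) by simp
  then show thesis
    using that[OF x(2), of "nAt \<gamma> c"] g(4)[OF assms] nattrD(6,7)[OF g(1), of c] g(2,3,8) assms x by simp
qed

text \<open>By construction \<open>u\<close> sends \<beta> to an arrow coming from a germ, but
  between the pairs chosen by \<open>u\<close>. Conjugation with \<open>m\<close> corrects the
  endpoints, and naturality of \<gamma> identifies the resulting arrow of \<open>C\<close> with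
  \<beta>.\<close>

lemma bicolimit_ar:
  assumes "\<beta> \<in> cArr C" "cDom C \<beta> = fOb (leg p i) x" "cCod C \<beta> = fOb (leg p j) y" "pt x i" "pt y j"
  obtains s t \<alpha> where "gc s t x y \<alpha>" "src I s = i" "src I t = j" "\<beta> = P.germ_map s t x y \<alpha>"
proof -
  obtain \<gamma> u m where g: "is_nattr \<gamma>" "fDom (nDom \<gamma>) = C" "nCod \<gamma> = fId C" "\<And>c. c \<in> cObj C \<Longrightarrow> cIso C (nAt \<gamma> c)"
    "is_functor u" "fDom u = C" "fCod u = P.germ_cat"
    "\<And>w. w \<in> cArr C \<Longrightarrow> fAr (nDom \<gamma>) w = snd (snd (fAr u w))"
    "\<And>i x. pt x i \<Longrightarrow> cIso P.germ_cat (m i x) \<and> cDom P.germ_cat (m i x) = fOb u (fOb (leg p i) x) \<and> cCod P.germ_cat (m i x) = (i, x) \<and>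
       nAt \<gamma> (fOb (leg p i) x) = snd (snd (m i x))"
    by (rule germ_factorization) blast
  interpret Gc: category P.germ_cat by (rule P.category_germ_cat)
  have gC: "fCod (nDom \<gamma>) = C" using nattrD(4)[OF g(1)] g(3) by simp
  note m = g(9)[OF assms(4)] g(9)[OF assms(5)] and uD = is_functorD(4-6)[OF g(5), unfolded g(6,7), OF assms(1)]
  define w where "w = cComp P.germ_cat (m j y) (cComp P.germ_cat (fAr u \<beta>) (cInv P.germ_cat (m i x)))"
  have w: "w \<in> cArr P.germ_cat" "cDom P.germ_cat w = (i, x)" "cCod P.germ_cat w = (j, y)"
    unfolding w_def using m uD assms by simp_all
  have wm: "cComp P.germ_cat w (m i x) = cComp P.germ_cat (m j y) (fAr u \<beta>)"
    unfolding w_def using m uD assms by simp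
  have ss: "snd (snd (cComp P.germ_cat a b)) = cComp C (snd (snd a)) (snd (snd b))" for a b
    by (cases a, cases b) simp
  obtain w' where w': "w = ((i, x), (j, y), w')" using w by (cases w) auto
  have wA: "w' \<in> cArr C" "cDom C w' = fOb (leg p i) x" "cCod C w' = fOb (leg p j) y"
    using P.germ_cat_ArrD[of i x j y w'] w w' by simp_all
  have n: "nAt \<gamma> (fOb (leg p i) x) = snd (snd (m i x))" "nAt \<gamma> (fOb (leg p j) y) = snd (snd (m j y))" using m by simp_all
  have "cComp C (snd (snd (m j y))) (fAr (nDom \<gamma>) \<beta>) = cComp C \<beta> (snd (snd (m i x)))"
    using nattrD(8)[OF g(1), of \<beta>] gC g(2,3) assms n by simp
  moreover have "cComp C w' (snd (snd (m i x))) = cComp C (snd (snd (m j y))) (fAr (nDom \<gamma>) \<beta>)"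
    using arg_cong[OF wm, of "\<lambda>w. snd (snd w)"] g(8)[OF assms(1)] w' unfolding ss by simp
  ultimately have eq: "cComp C w' (snd (snd (m i x))) = cComp C \<beta> (snd (snd (m i x)))" by simp
  have "w' = \<beta>"
    by (rule P.X.cComp_right_cancel[OF eq])
      (use g(4)[OF P.ob[OF assms(4)]] nattrD(7)[OF g(1), of "fOb (leg p i) x"] n gC g(2,3) wA assms P.ob[OF assms(4)] in simp_all)
  then show thesis
    using w(1) that unfolding w' P.germ_cat_Arr by blast
qed

text \<open>The functor of germs out of the source of \<open>g\<close> factors through
  \<open>C\<close> up to the isomorphisms \<open>m\<close>. Equal images in \<open>C\<close> thus
  give equal actions on germs, and \<open>gac_eqD\<close> applies.\<close>

lemma bicolimit_eq:
  assumes g: "g \<in> Cl J" "g' \<in> Cl J" "dom2 J g' = dom2 J g" "cod2 J g' = cod2 J g" "pt (dom2 J g) i"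
    and eq: "fAr (leg p i) g = fAr (leg p i) g'"
  obtains f where "f \<in> Ar I" "src I f = i" "id2 J (P1 F f) \<star>\<^bsub>J\<^esub> g = id2 J (P1 F f) \<star>\<^bsub>J\<^esub> g'"
proof -
  let ?X = "per_cat gob (gper i (dom2 J g))"
  have h: "functor_cocone I J F K ?X Pair (gac i (dom2 J g)) (gcc i (dom2 J g))" by (rule functor_cocone_per_cat[OF g(5)])
  interpret X: functor_cocone I J F K ?X Pair "gac i (dom2 J g)" "gcc i (dom2 J g)" by (rule h)
  obtain u m where u: "is_functor u" "fDom u = C" "fCod u = ?X" and
    m: "\<And>i x. pt x i \<Longrightarrow> cIso ?X (m i x) \<and> cDom ?X (m i x) = fOb u (fOb (leg p i) x) \<and> cCod ?X (m i x) = (i, x)" and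
    m_ac: "\<And>j \<alpha>. \<lbrakk>\<alpha> \<in> Cl J; pt (dom2 J \<alpha>) j\<rbrakk> \<Longrightarrow> cComp ?X (m j (cod2 J \<alpha>)) (fAr u (fAr (leg p j) \<alpha>)) =
      cComp ?X (gac i (dom2 J g) j \<alpha>) (m j (dom2 J \<alpha>))"
    by (rule factor[OF h small_per_cat]) blast
  have g': "pt (dom2 J g') i" using g by simp
  have e: "cComp ?X (gac i (dom2 J g) i g) (m i (dom2 J g)) = cComp ?X (gac i (dom2 J g) i g') (m i (dom2 J g))"
    using m_ac[OF g(1,5)] m_ac[OF g(2) g'] eq g by simp
  have "gac i (dom2 J g) i g = gac i (dom2 J g) i g'"
    by (rule X.X.cComp_right_cancel[OF e]) (use m[OF g(5)] X.ac[OF g(1,5)] X.ac[OF g(2) g'] g in simp_all)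
  then show thesis
    using gac_eqD[OF g] that by blast
qed

end

section \<open>Factorizations through bifiltered bicolimits\<close>

locale bicompact_bicolimit =
  fixes B :: "('o, 'u, 'u) twocat" and I :: "('u, 'u, 'u) twocat" and F :: "('u, 'u, 'u, 'o, 'u, 'u) psfun"
    and L :: 'o and q :: "('u, 'u, 'u, 'u) cocone" and K :: 'o
  assumes U: "universe TYPE('u)" and I_small: "small_twocat TYPE('u) I" and I_bif: "bifiltered I"
    and bic: "is_bicolimit B I F L q" and K: "bicompact B K"
begin

sublocale bifiltered_hom I B F K
proof -
  interpret pseudofunctor I B F by (rule is_bicolimitD(1)[OF bic])
  show "bifiltered_hom I B F" by unfold_locales (rule I_bif)
qed

lemma q: "pseudococone B I F L q"
  using is_bicolimitD(3)[OF bic] .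

text \<open>What bicompactness of \<open>K\<close> provides, unpacked: the equivalence
  \<open>H\<close> and the components \<open>n\<close> of its isomorphism from the composite with
  \<open>p\<close> to \<open>B[K,q]\<close>, natural and compatible with the structure
  cells.\<close>

lemma canonical:
  obtains C p H n where "cat_bicolimit I B F K C p" "is_functor H" "fDom H = C" "fCod H = hom_cat B K L" "fully_faithful H" "ess_surj H"
    "\<And>i x. pt x i \<Longrightarrow> iso2 B (n i x) \<and> dom2 B (n i x) = fOb H (fOb (leg p i) x) \<and> cod2 B (n i x) = leg q i \<cdot>\<^bsub>B\<^esub> x"
    "\<And>i \<alpha>. \<lbrakk>\<alpha> \<in> Cl B; pt (dom2 B \<alpha>) i\<rbrakk> \<Longrightarrow> n i (cod2 B \<alpha>) \<bullet>\<^bsub>B\<^esub> fAr H (fAr (leg p i) \<alpha>) = (id2 B (leg q i) \<star>\<^bsub>B\<^esub> \<alpha>) \<bullet>\<^bsub>B\<^esub> n i (dom2 B \<alpha>)"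
    "\<And>d x. \<lbrakk>d \<in> Ar I; pt x (src I d)\<rbrakk> \<Longrightarrow> n (src I d) x \<bullet>\<^bsub>B\<^esub> fAr H (nAt (legc p d) x) =
      (legc q d \<star>\<^bsub>B\<^esub> id2 B x) \<bullet>\<^bsub>B\<^esub> n (trg I d) (P1 F d \<cdot>\<^bsub>B\<^esub> x)"
proof -
  obtain C p H where C: "is_bicolimit Cat I (hom_psfun B K F) C p" and can: "canonical_functor B I F K L q C p H" and eq: "is_equivalence H"
    using K I_small I_bif bic is_bicolimitD(1)[OF bic] unfolding bicompact_def by blast
  interpret cat_bicolimit I B F K C p
  proof (intro cat_bicolimit.intro hom_cat_pseudofunctor.intro hom_cat_pseudofunctor_axioms.intro cat_bicolimit_axioms.intro)
    show "bifiltered_hom I B F" by (rule bifiltered_hom_axioms)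
    show "pseudofunctor I Cat (hom_psfun B K F)" by (rule is_bicolimitD(1)[OF C])
  qed (use C U I_small in \<open>simp_all add: small_twocat_def\<close>)
  obtain m where m: "cIso (cocone_cat Cat I (hom_psfun B K F) (hom_cat B K L)) m" "mDom m = cocone_post Cat I H p" "mCod m = hom_cocone B I K q"
    and H: "is_functor H" "fDom H = C" "fCod H = hom_cat B K L" "hom_cat B K L \<in> Ob Cat"
    using can unfolding canonical_functor_def arr_def by auto
  note c = post_iso_components[OF H(4,1-3) m]
  note qD = pseudococoneD[OF q]
  have D: "category (hom_cat B K L)" by (rule J.category_hom_cat)
  show thesis
  proof (rule that[of C p H "\<lambda>i x. nAt (mAt m i) x"])
    show "cat_bicolimit I B F K C p" by (rule cat_bicolimit_axioms)
    show "fully_faithful H" "ess_surj H" using is_equivalence_fully_faithful[OF eq] by simp_all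
    fix i x assume x: "pt x i"
    note i = ptD[OF x]
    have "iso2 B (nAt (mAt m i) x)"
      using J.cIso_hom_cat(1)[of K L "nAt (mAt m i) x"] c(1)[OF x] by blast
    then show "iso2 B (nAt (mAt m i) x) \<and> dom2 B (nAt (mAt m i) x) = fOb H (fOb (leg p i) x) \<and> cod2 B (nAt (mAt m i) x) = leg q i \<cdot>\<^bsub>B\<^esub> x"
      using c(1)[OF x] i qD(1-3)[OF i(4)] by (simp add: hom_cocone_def)
  next
    fix i \<alpha> assume a: "\<alpha> \<in> Cl B" "pt (dom2 B \<alpha>) i"
    note i = ptD[OF a(2)]
    show "nAt (mAt m i) (cod2 B \<alpha>) \<bullet>\<^bsub>B\<^esub> fAr H (fAr (leg p i) \<alpha>) = (id2 B (leg q i) \<star>\<^bsub>B\<^esub> \<alpha>) \<bullet>\<^bsub>B\<^esub> nAt (mAt m i) (dom2 B \<alpha>)"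
      using c(2)[OF a] a i qD(1-3)[OF i(4)] by (simp add: hom_cocone_def)
  next
    fix d x assume d: "d \<in> Ar I" "pt x (src I d)"
    show "nAt (mAt m (src I d)) x \<bullet>\<^bsub>B\<^esub> fAr H (nAt (legc p d) x) =
      (legc q d \<star>\<^bsub>B\<^esub> id2 B x) \<bullet>\<^bsub>B\<^esub> nAt (mAt m (trg I d)) (P1 F d \<cdot>\<^bsub>B\<^esub> x)"
      using c(3)[OF d] d ptD[OF d(2)] qD(1-3)[of "trg I d"] qD(4-6)[OF d(1)] by (simp add: hom_cocone_def)
  qed (use H in simp_all)
qed

text \<open>Three isomorphisms compose: \<open>n\<close> inverted, the image under \<open>H\<close>
  of the one from \<open>bicolimit_ob\<close>, and the one from essential surjectivity of
  \<open>H\<close>.\<close>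

lemma factor_ob:
  assumes "a \<in> Ar B" "src B a = K" "trg B a = L"
  obtains i x \<theta> where "pt x i" "iso2 B \<theta>" "dom2 B \<theta> = leg q i \<cdot>\<^bsub>B\<^esub> x" "cod2 B \<theta> = a"
proof -
  obtain C p H n where cb: "cat_bicolimit I B F K C p" and H: "is_functor H" "fDom H = C" "fCod H = hom_cat B K L" "ess_surj H"
    and n: "\<And>i x. pt x i \<Longrightarrow> iso2 B (n i x) \<and> dom2 B (n i x) = fOb H (fOb (leg p i) x) \<and> cod2 B (n i x) = leg q i \<cdot>\<^bsub>B\<^esub> x"
    by (rule canonical) blast
  interpret cat_bicolimit I B F K C p by (rule cb)
  have "\<exists>c\<in>cObj C. \<exists>e. cIso (hom_cat B K L) e \<and> cDom (hom_cat B K L) e = fOb H c \<and> cCod (hom_cat B K L) e = a"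
    using H(4) assms unfolding ess_surj_def H(2,3) by simp
  then obtain c e where c: "c \<in> cObj C" and e: "cIso (hom_cat B K L) e" "dom2 B e = fOb H c" "cod2 B e = a"
    by auto
  obtain i x e' where x: "pt x i" and e': "cIso C e'" "cDom C e' = fOb (leg p i) x" "cCod C e' = c"
    by (rule bicolimit_ob[OF c])
  have He: "cIso (hom_cat B K L) (fAr H e')" using functor_cIso[OF H(1)] e' H by simp
  have i1: "iso2 B e" "iso2 B (fAr H e')" using J.cIso_hom_cat(1)[OF e(1)] J.cIso_hom_cat(1)[OF He] .
  have "dom2 B (fAr H e') = fOb H (fOb (leg p i) x)" "cod2 B (fAr H e') = fOb H c"
    using is_functorD(5,6)[OF H(1), of e'] e' H by simp_all
  then show thesis
    using that[OF x, of "e \<bullet>\<^bsub>B\<^esub> (fAr H e' \<bullet>\<^bsub>B\<^esub> inv2 B (n i x))"] i1 n[OF x] e by simp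
qed

text \<open>Through \<open>n\<close> and \<open>H\<close> the cell \<beta> becomes an arrow of
  \<open>C\<close>, hence the germ map of some cell; the defining equation of that germ map is then
  translated back to \<open>B\<close>.\<close>

lemma factor_cell:
  assumes x: "pt x i" and y: "pt y i" and \<beta>: "\<beta> \<in> Cl B" "dom2 B \<beta> = leg q i \<cdot>\<^bsub>B\<^esub> x" "cod2 B \<beta> = leg q i \<cdot>\<^bsub>B\<^esub> y"
  obtains s \<gamma> where "s \<in> Ar I" "src I s = i" "\<gamma> \<in> Cl B" "dom2 B \<gamma> = P1 F s \<cdot>\<^bsub>B\<^esub> x" "cod2 B \<gamma> = P1 F s \<cdot>\<^bsub>B\<^esub> y"
    "(legc q s \<star>\<^bsub>B\<^esub> id2 B y) \<bullet>\<^bsub>B\<^esub> (id2 B (leg q (trg I s)) \<star>\<^bsub>B\<^esub> \<gamma>) = \<beta> \<bullet>\<^bsub>B\<^esub> (legc q s \<star>\<^bsub>B\<^esub> id2 B x)"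
proof -
  obtain C p H n where cb: "cat_bicolimit I B F K C p" and H: "is_functor H" "fDom H = C" "fCod H = hom_cat B K L" "fully_faithful H"
    and n: "\<And>i x. pt x i \<Longrightarrow> iso2 B (n i x) \<and> dom2 B (n i x) = fOb H (fOb (leg p i) x) \<and> cod2 B (n i x) = leg q i \<cdot>\<^bsub>B\<^esub> x"
    and n_ac: "\<And>i \<alpha>. \<lbrakk>\<alpha> \<in> Cl B; pt (dom2 B \<alpha>) i\<rbrakk> \<Longrightarrow> n i (cod2 B \<alpha>) \<bullet>\<^bsub>B\<^esub> fAr H (fAr (leg p i) \<alpha>) = (id2 B (leg q i) \<star>\<^bsub>B\<^esub> \<alpha>) \<bullet>\<^bsub>B\<^esub> n i (dom2 B \<alpha>)"
    and n_cc: "\<And>d x. \<lbrakk>d \<in> Ar I; pt x (src I d)\<rbrakk> \<Longrightarrow> n (src I d) x \<bullet>\<^bsub>B\<^esub> fAr H (nAt (legc p d) x) =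
      (legc q d \<star>\<^bsub>B\<^esub> id2 B x) \<bullet>\<^bsub>B\<^esub> n (trg I d) (P1 F d \<cdot>\<^bsub>B\<^esub> x)"
    by (rule canonical) blast
  interpret cat_bicolimit I B F K C p by (rule cb)
  note ix = ptD[OF x] and iy = ptD[OF y] and qi = pseudococoneD(1-3)[OF q ptD(4)[OF x]]
  have HD: "\<And>f. f \<in> cArr C \<Longrightarrow> fAr H f \<in> Cl B" "\<And>f. f \<in> cArr C \<Longrightarrow> dom2 B (fAr H f) = fOb H (cDom C f)"
    "\<And>f. f \<in> cArr C \<Longrightarrow> cod2 B (fAr H f) = fOb H (cCod C f)"
    "\<And>f g. \<lbrakk>f \<in> cArr C; g \<in> cArr C; cDom C g = cCod C f\<rbrakk> \<Longrightarrow> fAr H (cComp C g f) = fAr H g \<bullet>\<^bsub>B\<^esub> fAr H f"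
    using is_functorD(4-6,8)[OF H(1)] H(2,3) by simp_all
  \<comment> \<open>\<beta> conjugated by \<open>n\<close>, so that both ends are values of
    \<open>H\<close> and fullness applies.\<close>
  let ?\<beta> = "inv2 B (n i y) \<bullet>\<^bsub>B\<^esub> (\<beta> \<bullet>\<^bsub>B\<^esub> n i x)"
  have b1: "?\<beta> \<in> Cl B" "dom2 B ?\<beta> = fOb H (fOb (leg p i) x)" "cod2 B ?\<beta> = fOb H (fOb (leg p i) y)"
    using n[OF x] n[OF y] \<beta> by simp_all
  have "src B (dom2 B ?\<beta>) = K" "trg B (dom2 B ?\<beta>) = L"
    using is_functorD(3)[OF H(1), of "fOb (leg p i) x"] P.ob[OF x] H(2,3) b1 by simp_all
  note b2 = this b1
  obtain w where w: "w \<in> cArr C" "cDom C w = fOb (leg p i) x" "cCod C w = fOb (leg p i) y" "fAr H w = ?\<beta>"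
    by (rule fully_faithful_ex[OF H(4), unfolded H(2,3), of "fOb (leg p i) x" "fOb (leg p i) y" ?\<beta>])
      (use b2 P.ob[OF x] P.ob[OF y] in simp_all)
  obtain s t \<alpha> where g: "gc s t x y \<alpha>" "src I s = i" "src I t = i" "w = P.germ_map s t x y \<alpha>"
    by (rule bicolimit_ar[OF w(1-3) x y])
  note T = gcD(1-4)[OF g(1)] gc_trg[OF g(1)]
  \<comment> \<open>The legs \<open>s\<close> and \<open>t\<close> of the germ are parallel but may
    differ. Condition (2) lets \<open>t\<close> be replaced by \<open>s\<close> at a later
    stage.\<close>
  obtain f \<theta> where f: "f \<in> Ar I" "src I f = trg I t" "iso2 I \<theta>" "dom2 I \<theta> = f \<cdot>\<^bsub>I\<^esub> t" "cod2 I \<theta> = f \<cdot>\<^bsub>I\<^esub> s"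
    by (rule bifiltered_ar[OF bif, of t s]) (use T g in auto)
  let ?u = "f \<cdot>\<^bsub>I\<^esub> s" and ?\<gamma> = "ev \<theta> y \<bullet>\<^bsub>B\<^esub> tr f s t x y \<alpha>"
  note gt = gc_tr[OF g(1) f(1,2)]
  have ge: "gc (f \<cdot>\<^bsub>I\<^esub> t) ?u y y (ev \<theta> y)" by (rule gc_ev) (use f T g in simp_all)
  note g\<gamma> = gc_vcmp[OF gt ge]
  have u: "?u \<in> Ar I" "src I ?u = i" "trg I ?u = trg I f" using f T g by simp_all
  have wm: "w = P.germ_map ?u ?u x y ?\<gamma>"
    using P.germ_map_vcmp[OF gt ge] P.germ_map_tr[OF g(1) f(1,2)] P.germ_map_ev[of \<theta> "f \<cdot>\<^bsub>I\<^esub> t" ?u y] g(4) w f T g by simp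
  have px: "pt x (src I ?u)" "pt y (src I ?u)" using x y u by simp_all
  note cx = P.cc[OF u(1) px(1)] and cy = P.cc[OF u(1) px(2)] and A = P.ac_gc[OF g\<gamma> refl]
  have "cComp C w (nAt (legc p ?u) x) = cComp C (nAt (legc p ?u) y) (fAr (leg p (trg I ?u)) ?\<gamma>)"
    unfolding wm by (rule P.germ_map_eq[OF g\<gamma>])
  then have h: "?\<beta> \<bullet>\<^bsub>B\<^esub> fAr H (nAt (legc p ?u) x) = fAr H (nAt (legc p ?u) y) \<bullet>\<^bsub>B\<^esub> fAr H (fAr (leg p (trg I ?u)) ?\<gamma>)"
    using HD(4)[of "nAt (legc p ?u) x" w] HD(4)[of "fAr (leg p (trg I ?u)) ?\<gamma>" "nAt (legc p ?u) y"] w cx cy A u by simp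
  let ?k = "trg I ?u"
  have kx: "pt (P1 F ?u \<cdot>\<^bsub>B\<^esub> x) ?k" "pt (P1 F ?u \<cdot>\<^bsub>B\<^esub> y) ?k" using pt_P1[OF u(1) px(1)] pt_P1[OF u(1) px(2)] .
  note nk = n[OF kx(1)] n[OF kx(2)]
  note qk = pseudococoneD(1-3)[OF q I.trg_Ob[OF u(1)]] pseudococoneD(4-6)[OF q u(1)]
  note G = gcD(5-7)[OF g\<gamma>]
  have hc: "fAr H (nAt (legc p ?u) x) \<in> Cl B" "dom2 B (fAr H (nAt (legc p ?u) x)) = fOb H (fOb (leg p ?k) (P1 F ?u \<cdot>\<^bsub>B\<^esub> x))"
    "cod2 B (fAr H (nAt (legc p ?u) x)) = fOb H (fOb (leg p i) x)"
    "fAr H (nAt (legc p ?u) y) \<in> Cl B" "dom2 B (fAr H (nAt (legc p ?u) y)) = fOb H (fOb (leg p ?k) (P1 F ?u \<cdot>\<^bsub>B\<^esub> y))"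
    "cod2 B (fAr H (nAt (legc p ?u) y)) = fOb H (fOb (leg p i) y)"
    "fAr H (fAr (leg p ?k) ?\<gamma>) \<in> Cl B" "dom2 B (fAr H (fAr (leg p ?k) ?\<gamma>)) = fOb H (fOb (leg p ?k) (P1 F ?u \<cdot>\<^bsub>B\<^esub> x))"
    "cod2 B (fAr H (fAr (leg p ?k) ?\<gamma>)) = fOb H (fOb (leg p ?k) (P1 F ?u \<cdot>\<^bsub>B\<^esub> y))"
    using HD(1-3) cx cy A u P.X.cIso_Arr by simp_all
  have e1: "n i x \<bullet>\<^bsub>B\<^esub> fAr H (nAt (legc p ?u) x) = (legc q ?u \<star>\<^bsub>B\<^esub> id2 B x) \<bullet>\<^bsub>B\<^esub> n ?k (P1 F ?u \<cdot>\<^bsub>B\<^esub> x)"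
    "n i y \<bullet>\<^bsub>B\<^esub> fAr H (nAt (legc p ?u) y) = (legc q ?u \<star>\<^bsub>B\<^esub> id2 B y) \<bullet>\<^bsub>B\<^esub> n ?k (P1 F ?u \<cdot>\<^bsub>B\<^esub> y)"
    using n_cc[OF u(1) px(1)] n_cc[OF u(1) px(2)] u(2) by simp_all
  have e2: "n ?k (P1 F ?u \<cdot>\<^bsub>B\<^esub> y) \<bullet>\<^bsub>B\<^esub> fAr H (fAr (leg p ?k) ?\<gamma>) = (id2 B (leg q ?k) \<star>\<^bsub>B\<^esub> ?\<gamma>) \<bullet>\<^bsub>B\<^esub> n ?k (P1 F ?u \<cdot>\<^bsub>B\<^esub> x)"
    using n_ac[OF G(1), of ?k] G kx by simp
  have ty: "legc q ?u \<star>\<^bsub>B\<^esub> id2 B x \<in> Cl B" "dom2 B (legc q ?u \<star>\<^bsub>B\<^esub> id2 B x) = leg q ?k \<cdot>\<^bsub>B\<^esub> (P1 F ?u \<cdot>\<^bsub>B\<^esub> x)" "cod2 B (legc q ?u \<star>\<^bsub>B\<^esub> id2 B x) = leg q i \<cdot>\<^bsub>B\<^esub> x"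
    "legc q ?u \<star>\<^bsub>B\<^esub> id2 B y \<in> Cl B" "dom2 B (legc q ?u \<star>\<^bsub>B\<^esub> id2 B y) = leg q ?k \<cdot>\<^bsub>B\<^esub> (P1 F ?u \<cdot>\<^bsub>B\<^esub> y)" "cod2 B (legc q ?u \<star>\<^bsub>B\<^esub> id2 B y) = leg q i \<cdot>\<^bsub>B\<^esub> y"
    "id2 B (leg q ?k) \<star>\<^bsub>B\<^esub> ?\<gamma> \<in> Cl B" "dom2 B (id2 B (leg q ?k) \<star>\<^bsub>B\<^esub> ?\<gamma>) = leg q ?k \<cdot>\<^bsub>B\<^esub> (P1 F ?u \<cdot>\<^bsub>B\<^esub> x)"
    "cod2 B (id2 B (leg q ?k) \<star>\<^bsub>B\<^esub> ?\<gamma>) = leg q ?k \<cdot>\<^bsub>B\<^esub> (P1 F ?u \<cdot>\<^bsub>B\<^esub> y)"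
    using qk G u ix iy ptD[OF kx(1)] by (simp_all del: J.whisker_left_vcmp)
  note N = n[OF x] n[OF y] nk
  \<comment> \<open>Compatibility of \<open>n\<close> with arrows and structure cells carries the
    equation from \<open>C\<close> to \<open>B\<close>; the remaining component of \<open>n\<close>
    is cancelled on the right.\<close>
  have "(\<beta> \<bullet>\<^bsub>B\<^esub> (legc q ?u \<star>\<^bsub>B\<^esub> id2 B x)) \<bullet>\<^bsub>B\<^esub> n ?k (P1 F ?u \<cdot>\<^bsub>B\<^esub> x) = \<beta> \<bullet>\<^bsub>B\<^esub> (n i x \<bullet>\<^bsub>B\<^esub> fAr H (nAt (legc p ?u) x))"
    unfolding e1(1) using N ty \<beta> by (simp del: J.whisker_left_vcmp)
  also have "\<dots> = n i y \<bullet>\<^bsub>B\<^esub> (?\<beta> \<bullet>\<^bsub>B\<^esub> fAr H (nAt (legc p ?u) x))"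
    using N \<beta> hc by simp
  also have "\<dots> = (n i y \<bullet>\<^bsub>B\<^esub> fAr H (nAt (legc p ?u) y)) \<bullet>\<^bsub>B\<^esub> fAr H (fAr (leg p ?k) ?\<gamma>)"
    unfolding h using N hc by simp
  also have "\<dots> = (legc q ?u \<star>\<^bsub>B\<^esub> id2 B y) \<bullet>\<^bsub>B\<^esub> (n ?k (P1 F ?u \<cdot>\<^bsub>B\<^esub> y) \<bullet>\<^bsub>B\<^esub> fAr H (fAr (leg p ?k) ?\<gamma>))"
    unfolding e1(2) using N hc ty by simp
  also have "\<dots> = ((legc q ?u \<star>\<^bsub>B\<^esub> id2 B y) \<bullet>\<^bsub>B\<^esub> (id2 B (leg q ?k) \<star>\<^bsub>B\<^esub> ?\<gamma>)) \<bullet>\<^bsub>B\<^esub> n ?k (P1 F ?u \<cdot>\<^bsub>B\<^esub> x)"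
    unfolding e2 using N ty by (simp del: J.whisker_left_vcmp)
  finally have e: "(\<beta> \<bullet>\<^bsub>B\<^esub> (legc q ?u \<star>\<^bsub>B\<^esub> id2 B x)) \<bullet>\<^bsub>B\<^esub> n ?k (P1 F ?u \<cdot>\<^bsub>B\<^esub> x) =
    ((legc q ?u \<star>\<^bsub>B\<^esub> id2 B y) \<bullet>\<^bsub>B\<^esub> (id2 B (leg q ?k) \<star>\<^bsub>B\<^esub> ?\<gamma>)) \<bullet>\<^bsub>B\<^esub> n ?k (P1 F ?u \<cdot>\<^bsub>B\<^esub> x)" .
  have fin: "(legc q ?u \<star>\<^bsub>B\<^esub> id2 B y) \<bullet>\<^bsub>B\<^esub> (id2 B (leg q ?k) \<star>\<^bsub>B\<^esub> ?\<gamma>) = \<beta> \<bullet>\<^bsub>B\<^esub> (legc q ?u \<star>\<^bsub>B\<^esub> id2 B x)"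
    by (rule J.vcmp_right_cancel[THEN iffD1, OF _ _ _ _ _ e, symmetric]) (use N ty \<beta> in \<open>simp_all del: J.whisker_left_vcmp\<close>)
  show thesis by (rule that[OF u(1,2) G fin])
qed

text \<open>Cancelling \<open>n\<close> and faithfulness of \<open>H\<close> leave an equality in
  \<open>C\<close>, which \<open>bicolimit_eq\<close> turns into one at a later stage.\<close>

lemma faithful_cell:
  assumes g: "g \<in> Cl B" "g' \<in> Cl B" "dom2 B g' = dom2 B g" "cod2 B g' = cod2 B g" "pt (dom2 B g) i"
    and eq: "id2 B (leg q i) \<star>\<^bsub>B\<^esub> g = id2 B (leg q i) \<star>\<^bsub>B\<^esub> g'"
  obtains s where "s \<in> Ar I" "src I s = i" "id2 B (P1 F s) \<star>\<^bsub>B\<^esub> g = id2 B (P1 F s) \<star>\<^bsub>B\<^esub> g'"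
proof -
  obtain C p H n where cb: "cat_bicolimit I B F K C p" and H: "is_functor H" "fDom H = C" "fCod H = hom_cat B K L" "fully_faithful H"
    and n: "\<And>i x. pt x i \<Longrightarrow> iso2 B (n i x) \<and> dom2 B (n i x) = fOb H (fOb (leg p i) x) \<and> cod2 B (n i x) = leg q i \<cdot>\<^bsub>B\<^esub> x"
    and n_ac: "\<And>i \<alpha>. \<lbrakk>\<alpha> \<in> Cl B; pt (dom2 B \<alpha>) i\<rbrakk> \<Longrightarrow> n i (cod2 B \<alpha>) \<bullet>\<^bsub>B\<^esub> fAr H (fAr (leg p i) \<alpha>) = (id2 B (leg q i) \<star>\<^bsub>B\<^esub> \<alpha>) \<bullet>\<^bsub>B\<^esub> n i (dom2 B \<alpha>)"
    by (rule canonical) blast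
  interpret cat_bicolimit I B F K C p by (rule cb)
  have HD: "\<And>f. f \<in> cArr C \<Longrightarrow> fAr H f \<in> Cl B" "\<And>f. f \<in> cArr C \<Longrightarrow> dom2 B (fAr H f) = fOb H (cDom C f)"
    "\<And>f. f \<in> cArr C \<Longrightarrow> cod2 B (fAr H f) = fOb H (cCod C f)"
    using is_functorD(4-6)[OF H(1)] H(2,3) by simp_all
  have p': "pt (dom2 B g') i" using g by simp
  note A = P.ac[OF g(1,5)] P.ac[OF g(2) p']
  have e: "n i (cod2 B g) \<bullet>\<^bsub>B\<^esub> fAr H (fAr (leg p i) g) = n i (cod2 B g) \<bullet>\<^bsub>B\<^esub> fAr H (fAr (leg p i) g')"
    using n_ac[OF g(1,5)] n_ac[OF g(2) p'] eq g by simp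
  have e2: "fAr H (fAr (leg p i) g) = fAr H (fAr (leg p i) g')"
    by (rule J.vcmp_left_cancel[THEN iffD1, OF _ _ _ _ _ e]) (use n[OF P.pt_cod[OF g(1,5)]] A HD g in simp_all)
  have "fAr (leg p i) g = fAr (leg p i) g'"
    by (rule fully_faithful_inj[OF H(4,1) _ _ _ _ e2]) (use A g H(2) in simp_all)
  then show thesis
    using bicolimit_eq[OF g] that by blast
qed

end

section \<open>Invertibility of 2-cells at a later stage\<close>

lemma (in two_category) conjugate_inverse:
  assumes C: "iso2 B c" and a: "iso2 B a" and b: "iso2 B b" and \<epsilon>: "\<epsilon> \<in> Cl B" and \<delta>: "\<delta> \<in> Cl B"
    and ty: "cod2 B a = dom2 B c" "cod2 B b = cod2 B c" "dom2 B \<epsilon> = dom2 B b" "cod2 B \<epsilon> = dom2 B a"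
      "dom2 B \<delta> = dom2 B a" "cod2 B \<delta> = dom2 B b"
    and e: "a \<bullet> \<epsilon> = inv2 B c \<bullet> b" and d: "b \<bullet> \<delta> = c \<bullet> a"
  shows "\<epsilon> \<bullet> \<delta> = id2 B (dom2 B a) \<and> \<delta> \<bullet> \<epsilon> = id2 B (dom2 B b)"
proof -
  have "\<epsilon> = inv2 B a \<bullet> (inv2 B c \<bullet> b)" unfolding e[symmetric] using a \<epsilon> ty by simp
  moreover have "\<delta> = inv2 B b \<bullet> (c \<bullet> a)" unfolding d[symmetric] using b \<delta> ty by simp
  ultimately show ?thesis using a b C ty by simp
qed

context bicompact_bicolimit
begin

text \<open>Turns the bicolimit inclusions of \<open>L\<close> into data of the kind that germs act
  on. The equation in \<open>factor_cell\<close> then reads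
  \<open>\<beta> = Q.germ_map s s x y \<gamma>\<close> and is seen to be independent of the
  stage.\<close>

lemma functor_cocone_leg:
  "functor_cocone I B F K (hom_cat B K L) (\<lambda>i x. leg q i \<cdot>\<^bsub>B\<^esub> x) (\<lambda>i \<alpha>. id2 B (leg q i) \<star>\<^bsub>B\<^esub> \<alpha>) (\<lambda>d x. legc q d \<star>\<^bsub>B\<^esub> id2 B x)"
proof (rule functor_cocone.intro, rule bifiltered_hom_axioms, rule functor_cocone_axioms.intro)
  note Q = pseudococoneD[OF q] and E = pseudococone_eqs[OF q]
  show "category (hom_cat B K L)" by (rule J.category_hom_cat)
  show "leg q i \<cdot>\<^bsub>B\<^esub> x \<in> cObj (hom_cat B K L)" if "pt x i" for x i
    using ptD[OF that] Q(1-3)[OF ptD(4)[OF that]] by simp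
  show "id2 B (leg q i) \<star>\<^bsub>B\<^esub> \<alpha> \<in> cArr (hom_cat B K L) \<and> cDom (hom_cat B K L) (id2 B (leg q i) \<star>\<^bsub>B\<^esub> \<alpha>) = leg q i \<cdot>\<^bsub>B\<^esub> dom2 B \<alpha> \<and>
      cCod (hom_cat B K L) (id2 B (leg q i) \<star>\<^bsub>B\<^esub> \<alpha>) = leg q i \<cdot>\<^bsub>B\<^esub> cod2 B \<alpha>" if "\<alpha> \<in> Cl B" "pt (dom2 B \<alpha>) i" for \<alpha> i
    using ptD[OF that(2)] Q(1-3)[OF ptD(4)[OF that(2)]] that by simp
  show "id2 B (leg q i) \<star>\<^bsub>B\<^esub> id2 B x = cId (hom_cat B K L) (leg q i \<cdot>\<^bsub>B\<^esub> x)" if "pt x i" for x i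
    using ptD[OF that] Q(1-3)[OF ptD(4)[OF that]] by simp
  show "id2 B (leg q i) \<star>\<^bsub>B\<^esub> (\<beta> \<bullet>\<^bsub>B\<^esub> \<alpha>) = cComp (hom_cat B K L) (id2 B (leg q i) \<star>\<^bsub>B\<^esub> \<beta>) (id2 B (leg q i) \<star>\<^bsub>B\<^esub> \<alpha>)"
    if "\<alpha> \<in> Cl B" "\<beta> \<in> Cl B" "dom2 B \<beta> = cod2 B \<alpha>" "pt (dom2 B \<alpha>) i" for \<alpha> \<beta> i
    using ptD[OF that(4)] Q(1-3)[OF ptD(4)[OF that(4)]] that by simp
  show "cIso (hom_cat B K L) (legc q d \<star>\<^bsub>B\<^esub> id2 B x) \<and>
      cDom (hom_cat B K L) (legc q d \<star>\<^bsub>B\<^esub> id2 B x) = leg q (trg I d) \<cdot>\<^bsub>B\<^esub> (P1 F d \<cdot>\<^bsub>B\<^esub> x) \<and>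
      cCod (hom_cat B K L) (legc q d \<star>\<^bsub>B\<^esub> id2 B x) = leg q (src I d) \<cdot>\<^bsub>B\<^esub> x" if "d \<in> Ar I" "pt x (src I d)" for d x
  proof -
    note [simp] = ptD[OF that(2)] Q(1-3)[OF I.src_Ob[OF that(1)]] Q(1-3)[OF I.trg_Ob[OF that(1)]] Q(4-6)[OF that(1)] that(1)
    have "cIso (hom_cat B K L) (legc q d \<star>\<^bsub>B\<^esub> id2 B x)"
      by (rule category.cIsoI[OF J.category_hom_cat, where g = "inv2 B (legc q d) \<star>\<^bsub>B\<^esub> id2 B x"]) simp_all
    then show ?thesis by simp
  qed
  show "cComp (hom_cat B K L) (legc q d \<star>\<^bsub>B\<^esub> id2 B (cod2 B \<alpha>)) (id2 B (leg q (trg I d)) \<star>\<^bsub>B\<^esub> (id2 B (P1 F d) \<star>\<^bsub>B\<^esub> \<alpha>)) =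
      cComp (hom_cat B K L) (id2 B (leg q (src I d)) \<star>\<^bsub>B\<^esub> \<alpha>) (legc q d \<star>\<^bsub>B\<^esub> id2 B (dom2 B \<alpha>))"
    if "d \<in> Ar I" "\<alpha> \<in> Cl B" "pt (dom2 B \<alpha>) (src I d)" for d \<alpha>
    using J.whisker_exchange[of \<alpha> "legc q d"] that ptD[OF that(3)] Q(1-3)[OF I.trg_Ob[OF that(1)]] Q(4-6)[OF that(1)] by simp
  show "cComp (hom_cat B K L) (legc q (cod2 I \<delta>) \<star>\<^bsub>B\<^esub> id2 B x) (id2 B (leg q (trg I (dom2 I \<delta>))) \<star>\<^bsub>B\<^esub> (P2 F \<delta> \<star>\<^bsub>B\<^esub> id2 B x)) = legc q (dom2 I \<delta>) \<star>\<^bsub>B\<^esub> id2 B x"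
    if "\<delta> \<in> Cl I" "pt x (src I (dom2 I \<delta>))" for \<delta> x
    using arg_cong[OF E(1)[OF that(1)], of "\<lambda>c. c \<star>\<^bsub>B\<^esub> id2 B x"] that ptD[OF that(2)]
      Q(1-3)[of "trg I (dom2 I \<delta>)"] Q(4-6)[of "dom2 I \<delta>"] Q(4-6)[of "cod2 I \<delta>"] by (simp add: I.src_cod2 I.trg_cod2)
  show "cComp (hom_cat B K L) (legc q (e \<cdot>\<^bsub>I\<^esub> d) \<star>\<^bsub>B\<^esub> id2 B x) (id2 B (leg q (trg I e)) \<star>\<^bsub>B\<^esub> (P2c F e d \<star>\<^bsub>B\<^esub> id2 B x)) =
      cComp (hom_cat B K L) (legc q d \<star>\<^bsub>B\<^esub> id2 B x) (legc q e \<star>\<^bsub>B\<^esub> id2 B (P1 F d \<cdot>\<^bsub>B\<^esub> x))"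
    if "d \<in> Ar I" "e \<in> Ar I" "trg I d = src I e" "pt x (src I d)" for d e x
    using arg_cong[OF E(2)[OF that(1-3)], of "\<lambda>c. c \<star>\<^bsub>B\<^esub> id2 B x"] that ptD[OF that(4)]
      Q(1-3)[of "trg I e"] Q(4-6)[of d] Q(4-6)[of e] Q(4-6)[of "e \<cdot>\<^bsub>I\<^esub> d"] by simp
  show "cComp (hom_cat B K L) (legc q (id1 I i) \<star>\<^bsub>B\<^esub> id2 B x) (id2 B (leg q i) \<star>\<^bsub>B\<^esub> (P0c F i \<star>\<^bsub>B\<^esub> id2 B x)) = cId (hom_cat B K L) (leg q i \<cdot>\<^bsub>B\<^esub> x)"
    if "pt x i" for x i
    using arg_cong[OF E(3)[OF ptD(4)[OF that]], of "\<lambda>c. c \<star>\<^bsub>B\<^esub> id2 B x"] that ptD[OF that]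
      Q(1-3)[of i] Q(4-6)[of "id1 I i"] by simp
qed

interpretation Q: functor_cocone I B F K "hom_cat B K L" "\<lambda>i x. leg q i \<cdot>\<^bsub>B\<^esub> x" "\<lambda>i \<alpha>. id2 B (leg q i) \<star>\<^bsub>B\<^esub> \<alpha>" "\<lambda>d x. legc q d \<star>\<^bsub>B\<^esub> id2 B x"
  by (rule functor_cocone_leg)

lemma iso2_tr:
  assumes "gc s t x y \<alpha>" "a \<in> Ar I" "src I a = trg I t" "iso2 B (id2 B (P1 F a) \<star>\<^bsub>B\<^esub> \<alpha>)"
  shows "iso2 B (tr a s t x y \<alpha>)"
  unfolding tr_def using assms gcD[OF assms(1)] gc_trg[OF assms(1)] gc_pt[OF assms(1)] by simp

text \<open>The 1-cells \<open>F(v u)\<close> and \<open>F(v) F(u)\<close> differ by an invertible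
  coherence cell, so whiskering by one is conjugate to whiskering by the other; transport expresses
  this.\<close>

lemma iso2_P1_cmp1:
  assumes "u \<in> Ar I" "v \<in> Ar I" "trg I u = src I v" "c \<in> Cl B" "pt (dom2 B c) (src I u)"
    and iso: "iso2 B (id2 B (P1 F v) \<star>\<^bsub>B\<^esub> (id2 B (P1 F u) \<star>\<^bsub>B\<^esub> c))"
  shows "iso2 B (id2 B (P1 F (v \<cdot>\<^bsub>I\<^esub> u)) \<star>\<^bsub>B\<^esub> c)"
proof -
  have p: "pt (cod2 B c) (src I u)" by (rule Q.pt_cod[OF assms(4,5)])
  have "gc u u (dom2 B c) (cod2 B c) (id2 B (P1 F u) \<star>\<^bsub>B\<^esub> c)"
    using assms(1-5) ptD[OF assms(5)] p by (simp add: gc_def)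
  from iso2_tr[OF this assms(2) assms(3)[symmetric] iso] show ?thesis
    using tr_whisker[OF assms(5) p assms(1,4) refl refl assms(2)] assms(3) by simp
qed

text \<open>The structure cell of \<open>t\<close> conjugates whiskering by \<open>F(t)\<close> and
  then by the inclusion at the target of \<open>t\<close> to whiskering by the inclusion at its
  source.\<close>

lemma leg_P1_eq:
  assumes t: "t \<in> Ar I" and g: "g \<in> Cl B" "g' \<in> Cl B" "dom2 B g' = dom2 B g" "cod2 B g' = cod2 B g" "pt (dom2 B g) (src I t)"
    and eq: "id2 B (leg q (src I t)) \<star>\<^bsub>B\<^esub> g = id2 B (leg q (src I t)) \<star>\<^bsub>B\<^esub> g'"
  shows "id2 B (leg q (trg I t)) \<star>\<^bsub>B\<^esub> (id2 B (P1 F t) \<star>\<^bsub>B\<^esub> g) = id2 B (leg q (trg I t)) \<star>\<^bsub>B\<^esub> (id2 B (P1 F t) \<star>\<^bsub>B\<^esub> g')"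
proof -
  note [simp] = ptD[OF g(5)] t g(1-4) pseudococoneD(1-3)[OF q I.trg_Ob[OF t]] pseudococoneD(4-6)[OF q t] J.src_cod2 J.trg_cod2
  have p': "pt (dom2 B g') (src I t)" using g by simp
  have e: "(legc q t \<star>\<^bsub>B\<^esub> id2 B (cod2 B g)) \<bullet>\<^bsub>B\<^esub> (id2 B (leg q (trg I t)) \<star>\<^bsub>B\<^esub> (id2 B (P1 F t) \<star>\<^bsub>B\<^esub> g)) =
    (legc q t \<star>\<^bsub>B\<^esub> id2 B (cod2 B g)) \<bullet>\<^bsub>B\<^esub> (id2 B (leg q (trg I t)) \<star>\<^bsub>B\<^esub> (id2 B (P1 F t) \<star>\<^bsub>B\<^esub> g'))"
    using Q.cc_ac[OF t g(1,5)] Q.cc_ac[OF t g(2) p'] eq g(3,4) by simp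
  show ?thesis
    by (rule J.vcmp_left_cancel[THEN iffD1, OF _ _ _ _ _ e]) simp_all
qed

lemma eventually_iso2:
  assumes c: "c \<in> Cl B" "pt (dom2 B c) k" and iso: "iso2 B (id2 B (leg q k) \<star>\<^bsub>B\<^esub> c)"
  obtains t where "t \<in> Ar I" "src I t = k" "iso2 B (id2 B (P1 F t) \<star>\<^bsub>B\<^esub> c)"
proof -
  let ?x = "dom2 B c" and ?y = "cod2 B c" and ?i = "inv2 B (id2 B (leg q k) \<star>\<^bsub>B\<^esub> c)"
  have y: "pt ?y k" by (rule Q.pt_cod[OF c])
  note X = ptD[OF c(2)] and Y = ptD[OF y] and qk = pseudococoneD(1-3)[OF q ptD(4)[OF y]]
  have i: "?i \<in> Cl B" "dom2 B ?i = leg q k \<cdot>\<^bsub>B\<^esub> ?y" "cod2 B ?i = leg q k \<cdot>\<^bsub>B\<^esub> ?x"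
    using iso c X qk by simp_all
  obtain t \<epsilon> where t: "t \<in> Ar I" "src I t = k" and \<epsilon>: "\<epsilon> \<in> Cl B" "dom2 B \<epsilon> = P1 F t \<cdot>\<^bsub>B\<^esub> ?y" "cod2 B \<epsilon> = P1 F t \<cdot>\<^bsub>B\<^esub> ?x"
    and e: "(legc q t \<star>\<^bsub>B\<^esub> id2 B ?x) \<bullet>\<^bsub>B\<^esub> (id2 B (leg q (trg I t)) \<star>\<^bsub>B\<^esub> \<epsilon>) = ?i \<bullet>\<^bsub>B\<^esub> (legc q t \<star>\<^bsub>B\<^esub> id2 B ?y)"
    by (rule factor_cell[OF y c(2) i])
  let ?l = "trg I t" and ?c = "id2 B (P1 F t) \<star>\<^bsub>B\<^esub> c"
  note ql = pseudococoneD(1-3)[OF q I.trg_Ob[OF t(1)]] pseudococoneD(4-6)[OF q t(1)]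
  have c': "?c \<in> Cl B" "dom2 B ?c = P1 F t \<cdot>\<^bsub>B\<^esub> ?x" "cod2 B ?c = P1 F t \<cdot>\<^bsub>B\<^esub> ?y"
    using c X t by simp_all
  have px: "pt (P1 F t \<cdot>\<^bsub>B\<^esub> ?x) ?l" "pt (P1 F t \<cdot>\<^bsub>B\<^esub> ?y) ?l" using pt_P1[of t] t c y by simp_all
  note PX = ptD[OF px(1)] ptD[OF px(2)]
  have n: "(legc q t \<star>\<^bsub>B\<^esub> id2 B ?y) \<bullet>\<^bsub>B\<^esub> (id2 B (leg q ?l) \<star>\<^bsub>B\<^esub> ?c) = (id2 B (leg q k) \<star>\<^bsub>B\<^esub> c) \<bullet>\<^bsub>B\<^esub> (legc q t \<star>\<^bsub>B\<^esub> id2 B ?x)"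
    using Q.cc_ac[OF t(1) c(1)] c t by simp
  let ?a = "legc q t \<star>\<^bsub>B\<^esub> id2 B ?x" and ?b = "legc q t \<star>\<^bsub>B\<^esub> id2 B ?y" and ?C = "id2 B (leg q k) \<star>\<^bsub>B\<^esub> c"
    and ?E = "id2 B (leg q ?l) \<star>\<^bsub>B\<^esub> \<epsilon>" and ?D = "id2 B (leg q ?l) \<star>\<^bsub>B\<^esub> ?c"
  have C: "iso2 B ?C" "dom2 B ?C = leg q k \<cdot>\<^bsub>B\<^esub> ?x" "cod2 B ?C = leg q k \<cdot>\<^bsub>B\<^esub> ?y"
    using iso c X qk by simp_all
  have ab: "iso2 B ?a" "dom2 B ?a = leg q ?l \<cdot>\<^bsub>B\<^esub> (P1 F t \<cdot>\<^bsub>B\<^esub> ?x)" "cod2 B ?a = leg q k \<cdot>\<^bsub>B\<^esub> ?x"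
    "iso2 B ?b" "dom2 B ?b = leg q ?l \<cdot>\<^bsub>B\<^esub> (P1 F t \<cdot>\<^bsub>B\<^esub> ?y)" "cod2 B ?b = leg q k \<cdot>\<^bsub>B\<^esub> ?y"
    using ql X Y t by simp_all
  have ED: "?E \<in> Cl B" "dom2 B ?E = leg q ?l \<cdot>\<^bsub>B\<^esub> (P1 F t \<cdot>\<^bsub>B\<^esub> ?y)" "cod2 B ?E = leg q ?l \<cdot>\<^bsub>B\<^esub> (P1 F t \<cdot>\<^bsub>B\<^esub> ?x)"
    using \<epsilon> ql PX by simp_all
  have DD: "?D \<in> Cl B" "dom2 B ?D = leg q ?l \<cdot>\<^bsub>B\<^esub> (P1 F t \<cdot>\<^bsub>B\<^esub> ?x)" "cod2 B ?D = leg q ?l \<cdot>\<^bsub>B\<^esub> (P1 F t \<cdot>\<^bsub>B\<^esub> ?y)"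
    using c' ql PX by (simp_all del: J.whisker_left_left)
  \<comment> \<open>Both cells are determined by their squares: \<open>?D\<close> is
    \<open>?C\<close> and \<open>?E\<close> is the inverse of \<open>?C\<close>, each conjugated by
    the structure cells \<open>?a\<close> and \<open>?b\<close>. So they are mutually inverse,
    though as yet only after whiskering with the inclusion.\<close>
  have cal: "?E \<bullet>\<^bsub>B\<^esub> ?D = id2 B (leg q ?l \<cdot>\<^bsub>B\<^esub> (P1 F t \<cdot>\<^bsub>B\<^esub> ?x)) \<and> ?D \<bullet>\<^bsub>B\<^esub> ?E = id2 B (leg q ?l \<cdot>\<^bsub>B\<^esub> (P1 F t \<cdot>\<^bsub>B\<^esub> ?y))"
    by (rule J.conjugate_inverse[OF C(1) ab(1,4) ED(1) DD(1), unfolded ab(2,5)]) (use C ab ED DD e n in simp_all)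
  have id: "id2 B (leg q ?l) \<star>\<^bsub>B\<^esub> (\<epsilon> \<bullet>\<^bsub>B\<^esub> ?c) = id2 B (leg q ?l) \<star>\<^bsub>B\<^esub> id2 B (P1 F t \<cdot>\<^bsub>B\<^esub> ?x)"
    "id2 B (leg q ?l) \<star>\<^bsub>B\<^esub> (?c \<bullet>\<^bsub>B\<^esub> \<epsilon>) = id2 B (leg q ?l) \<star>\<^bsub>B\<^esub> id2 B (P1 F t \<cdot>\<^bsub>B\<^esub> ?y)"
    using cal c' \<epsilon> ql PX by (simp_all del: J.whisker_left_left)
  have g: "\<epsilon> \<bullet>\<^bsub>B\<^esub> ?c \<in> Cl B" "dom2 B (\<epsilon> \<bullet>\<^bsub>B\<^esub> ?c) = P1 F t \<cdot>\<^bsub>B\<^esub> ?x" "cod2 B (\<epsilon> \<bullet>\<^bsub>B\<^esub> ?c) = P1 F t \<cdot>\<^bsub>B\<^esub> ?x"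
    "?c \<bullet>\<^bsub>B\<^esub> \<epsilon> \<in> Cl B" "dom2 B (?c \<bullet>\<^bsub>B\<^esub> \<epsilon>) = P1 F t \<cdot>\<^bsub>B\<^esub> ?y" "cod2 B (?c \<bullet>\<^bsub>B\<^esub> \<epsilon>) = P1 F t \<cdot>\<^bsub>B\<^esub> ?y"
    using c' \<epsilon> by simp_all
  \<comment> \<open>The two inverse laws are reached one after the other. This stage settles the
    first of them.\<close>
  obtain u where u: "u \<in> Ar I" "src I u = ?l" "id2 B (P1 F u) \<star>\<^bsub>B\<^esub> (\<epsilon> \<bullet>\<^bsub>B\<^esub> ?c) = id2 B (P1 F u) \<star>\<^bsub>B\<^esub> id2 B (P1 F t \<cdot>\<^bsub>B\<^esub> ?x)"
    by (rule faithful_cell[OF g(1) _ _ _ _ id(1)]) (use g px PX in simp_all)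
  let ?m = "trg I u" and ?g = "id2 B (P1 F u) \<star>\<^bsub>B\<^esub> (?c \<bullet>\<^bsub>B\<^esub> \<epsilon>)" and ?g' = "id2 B (P1 F u) \<star>\<^bsub>B\<^esub> id2 B (P1 F t \<cdot>\<^bsub>B\<^esub> ?y)"
  have lu: "id2 B (leg q ?m) \<star>\<^bsub>B\<^esub> ?g = id2 B (leg q ?m) \<star>\<^bsub>B\<^esub> ?g'"
    by (rule leg_P1_eq[OF u(1) g(4)]) (use g px PX id(2) u in simp_all)
  have G: "?g \<in> Cl B" "?g' \<in> Cl B" "dom2 B ?g' = dom2 B ?g" "cod2 B ?g' = cod2 B ?g" "pt (dom2 B ?g) ?m"
    using g u PX pt_P1[of u "P1 F t \<cdot>\<^bsub>B\<^esub> ?y"] px by (simp_all del: J.whisker_left_vcmp J.cmp1_assoc')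
  \<comment> \<open>The second law is obtained beyond \<open>u\<close>, so that the first one
    persists.\<close>
  obtain v where v: "v \<in> Ar I" "src I v = ?m" "id2 B (P1 F v) \<star>\<^bsub>B\<^esub> ?g = id2 B (P1 F v) \<star>\<^bsub>B\<^esub> ?g'"
    by (rule faithful_cell[OF G lu])
  let ?w = "\<lambda>c. id2 B (P1 F v) \<star>\<^bsub>B\<^esub> (id2 B (P1 F u) \<star>\<^bsub>B\<^esub> c)"
  have w: "?w \<epsilon> \<in> Cl B" "dom2 B (?w \<epsilon>) = cod2 B (?w ?c)" "cod2 B (?w \<epsilon>) = dom2 B (?w ?c)" "?w ?c \<in> Cl B"
    using c' \<epsilon> u(1,2) v(1,2) PX by (simp_all del: J.whisker_left_left)
  have we: "?w \<epsilon> \<bullet>\<^bsub>B\<^esub> ?w ?c = ?w (\<epsilon> \<bullet>\<^bsub>B\<^esub> ?c)" "?w ?c \<bullet>\<^bsub>B\<^esub> ?w \<epsilon> = ?w (?c \<bullet>\<^bsub>B\<^esub> \<epsilon>)"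
    using c' \<epsilon> u(1,2) v(1,2) PX by (simp_all del: J.whisker_left_left)
  have wi: "?w \<epsilon> \<bullet>\<^bsub>B\<^esub> ?w ?c = id2 B (dom2 B (?w ?c))" "?w ?c \<bullet>\<^bsub>B\<^esub> ?w \<epsilon> = id2 B (cod2 B (?w ?c))"
    by (rule trans[OF we(1)], subst u(3), use c' u(1,2) v(1,2) PX in \<open>simp del: J.whisker_left_left\<close>)
      (rule trans[OF we(2)], subst v(3), use c' u(1,2) v(1,2) PX in \<open>simp del: J.whisker_left_left\<close>)
  have iso_w: "iso2 B (?w ?c)"
    by (rule J.iso2I[OF w(4,1-3)]) (use wi in simp_all)
  \<comment> \<open>So far the whiskering is by three values of \<open>F\<close> in succession; they
    are merged into the value at one composite 1-cell.\<close>
  have "iso2 B (id2 B (P1 F (v \<cdot>\<^bsub>I\<^esub> u)) \<star>\<^bsub>B\<^esub> ?c)"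
    by (rule iso2_P1_cmp1[OF u(1) v(1)]) (use u(1,2) v(1,2) c' px iso_w in \<open>simp_all del: J.whisker_left_left\<close>)
  then have "iso2 B (id2 B (P1 F (v \<cdot>\<^bsub>I\<^esub> u \<cdot>\<^bsub>I\<^esub> t)) \<star>\<^bsub>B\<^esub> c)"
    by (rule iso2_P1_cmp1[OF t(1), rotated -1]) (use u(1,2) v(1,2) t c in simp_all)
  then show thesis
    using that[of "v \<cdot>\<^bsub>I\<^esub> u \<cdot>\<^bsub>I\<^esub> t"] u(1,2) v(1,2) t by simp
qed

lemma factor_iso2:
  assumes x: "pt x i" and y: "pt y i" and \<beta>: "iso2 B \<beta>" "dom2 B \<beta> = leg q i \<cdot>\<^bsub>B\<^esub> x" "cod2 B \<beta> = leg q i \<cdot>\<^bsub>B\<^esub> y"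
  obtains s \<gamma> where "s \<in> Ar I" "src I s = i" "iso2 B \<gamma>" "dom2 B \<gamma> = P1 F s \<cdot>\<^bsub>B\<^esub> x" "cod2 B \<gamma> = P1 F s \<cdot>\<^bsub>B\<^esub> y"
    "(legc q s \<star>\<^bsub>B\<^esub> id2 B y) \<bullet>\<^bsub>B\<^esub> (id2 B (leg q (trg I s)) \<star>\<^bsub>B\<^esub> \<gamma>) = \<beta> \<bullet>\<^bsub>B\<^esub> (legc q s \<star>\<^bsub>B\<^esub> id2 B x)"
proof -
  obtain s \<gamma> where s: "s \<in> Ar I" "src I s = i" and \<gamma>: "\<gamma> \<in> Cl B" "dom2 B \<gamma> = P1 F s \<cdot>\<^bsub>B\<^esub> x" "cod2 B \<gamma> = P1 F s \<cdot>\<^bsub>B\<^esub> y"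
    and e: "(legc q s \<star>\<^bsub>B\<^esub> id2 B y) \<bullet>\<^bsub>B\<^esub> (id2 B (leg q (trg I s)) \<star>\<^bsub>B\<^esub> \<gamma>) = \<beta> \<bullet>\<^bsub>B\<^esub> (legc q s \<star>\<^bsub>B\<^esub> id2 B x)"
    by (rule factor_cell[OF x y iso2_Cl[OF \<beta>(1)] \<beta>(2,3)])
  let ?k = "trg I s" and ?a = "legc q s \<star>\<^bsub>B\<^esub> id2 B x" and ?b = "legc q s \<star>\<^bsub>B\<^esub> id2 B y"
  have p: "pt (P1 F s \<cdot>\<^bsub>B\<^esub> x) ?k" "pt (P1 F s \<cdot>\<^bsub>B\<^esub> y) ?k" using pt_P1[of s] s x y by simp_all
  note Q = pseudococoneD(1-3)[OF q I.trg_Ob[OF s(1)]] pseudococoneD(4-6)[OF q s(1)]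
  have g: "gc s s x y \<gamma>" using s x y \<gamma> by (simp add: gc_def)
  have ab: "iso2 B ?a" "cod2 B ?a = leg q i \<cdot>\<^bsub>B\<^esub> x" "iso2 B ?b" "cod2 B ?b = leg q i \<cdot>\<^bsub>B\<^esub> y"
      "dom2 B ?b = leg q ?k \<cdot>\<^bsub>B\<^esub> (P1 F s \<cdot>\<^bsub>B\<^esub> y)"
    using Q ptD[OF x] ptD[OF y] s by simp_all
  have C: "id2 B (leg q ?k) \<star>\<^bsub>B\<^esub> \<gamma> \<in> Cl B" "cod2 B (id2 B (leg q ?k) \<star>\<^bsub>B\<^esub> \<gamma>) = leg q ?k \<cdot>\<^bsub>B\<^esub> (P1 F s \<cdot>\<^bsub>B\<^esub> y)"
    using \<gamma> Q ptD[OF p(1)] by simp_all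
  \<comment> \<open>Up to structure cells the image of \<gamma> is \<beta>, hence invertible;
    \<gamma> itself becomes so only at a later stage.\<close>
  have "id2 B (leg q ?k) \<star>\<^bsub>B\<^esub> \<gamma> = inv2 B ?b \<bullet>\<^bsub>B\<^esub> (\<beta> \<bullet>\<^bsub>B\<^esub> ?a)"
    unfolding e[symmetric] using ab C by simp
  moreover have "iso2 B (inv2 B ?b \<bullet>\<^bsub>B\<^esub> (\<beta> \<bullet>\<^bsub>B\<^esub> ?a))" using ab \<beta> by simp
  ultimately have iso: "iso2 B (id2 B (leg q ?k) \<star>\<^bsub>B\<^esub> \<gamma>)" by simp
  obtain t where t: "t \<in> Ar I" "src I t = ?k" "iso2 B (id2 B (P1 F t) \<star>\<^bsub>B\<^esub> \<gamma>)"
    by (rule eventually_iso2[OF \<gamma>(1) _ iso]) (use \<gamma> p in simp_all)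
  let ?\<gamma> = "tr t s s x y \<gamma>"
  note g' = gc_tr[OF g t(1,2)]
  \<comment> \<open>Germ maps do not change under transport, so the equation found at the stage of
    \<open>s\<close> survives the passage to the stage where the cell is invertible.\<close>
  have "\<beta> = Q.germ_map s s x y \<gamma>"
    by (rule Q.germ_map_unique[OF g]) (use \<beta> ptD[OF x] pseudococoneD(1-3)[OF q ptD(4)[OF x]] s e in simp_all)
  then have "\<beta> = Q.germ_map (t \<cdot>\<^bsub>I\<^esub> s) (t \<cdot>\<^bsub>I\<^esub> s) x y ?\<gamma>"
    using Q.germ_map_tr[OF g t(1,2)] by simp
  then have "(legc q (t \<cdot>\<^bsub>I\<^esub> s) \<star>\<^bsub>B\<^esub> id2 B y) \<bullet>\<^bsub>B\<^esub> (id2 B (leg q (trg I (t \<cdot>\<^bsub>I\<^esub> s))) \<star>\<^bsub>B\<^esub> ?\<gamma>) = \<beta> \<bullet>\<^bsub>B\<^esub> (legc q (t \<cdot>\<^bsub>I\<^esub> s) \<star>\<^bsub>B\<^esub> id2 B x)"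
    using Q.germ_map_eq[OF g'] by simp
  then show thesis
    using that[of "t \<cdot>\<^bsub>I\<^esub> s" ?\<gamma>] iso2_tr[OF g t] gcD(6,7)[OF g'] s t by simp
qed

end

section \<open>The pseudoslice\<close>

lemma pseudoslice_Ob [simp]: "(K, a) \<in> Ob (pseudoslice B S b) \<longleftrightarrow> K \<in> S \<and> a \<in> Ar B \<and> src B a = K \<and> trg B a = b"
  by (auto simp: pseudoslice_def Let_def arr_def)

lemma pseudoslice_Ar [simp]: "((K, a), (L, c), k, \<phi>) \<in> Ar (pseudoslice B S b) \<longleftrightarrow>
  (K, a) \<in> Ob (pseudoslice B S b) \<and> (L, c) \<in> Ob (pseudoslice B S b) \<and>
  k \<in> Ar B \<and> src B k = K \<and> trg B k = L \<and> iso2 B \<phi> \<and> dom2 B \<phi> = c \<cdot>\<^bsub>B\<^esub> k \<and> cod2 B \<phi> = a"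
  unfolding pseudoslice_def Let_def arr_def by (simp add: inv_cell_iff)

lemma pseudoslice_Cl [simp]: "(((K, a), (L, c), k, \<phi>), ((K', a'), (L', c'), k', \<phi>'), \<theta>) \<in> Cl (pseudoslice B S b) \<longleftrightarrow>
  ((K, a), (L, c), k, \<phi>) \<in> Ar (pseudoslice B S b) \<and> ((K, a), (L, c), k', \<phi>') \<in> Ar (pseudoslice B S b) \<and>
  K' = K \<and> a' = a \<and> L' = L \<and> c' = c \<and>
  \<theta> \<in> Cl B \<and> dom2 B \<theta> = k \<and> cod2 B \<theta> = k' \<and> \<phi>' \<bullet>\<^bsub>B\<^esub> (id2 B c \<star>\<^bsub>B\<^esub> \<theta>) = \<phi>"
  unfolding pseudoslice_def Let_def by (auto simp: inv_cell_iff cell_def arr_def)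

lemma pseudoslice_simps [simp]:
  "src (pseudoslice B S b) (x, y, k, \<phi>) = x" "trg (pseudoslice B S b) (x, y, k, \<phi>) = y"
  "dom2 (pseudoslice B S b) (u, v, \<theta>) = u" "cod2 (pseudoslice B S b) (u, v, \<theta>) = v"
  "id1 (pseudoslice B S b) (K, a) = ((K, a), (K, a), id1 B K, id2 B a)"
  "cmp1 (pseudoslice B S b) (y', z, l, \<psi>) (x, y, k, \<phi>) = (x, z, l \<cdot>\<^bsub>B\<^esub> k, \<phi> \<bullet>\<^bsub>B\<^esub> (\<psi> \<star>\<^bsub>B\<^esub> id2 B k))"
  "id2 (pseudoslice B S b) (x, y, k, \<phi>) = ((x, y, k, \<phi>), (x, y, k, \<phi>), id2 B k)"
  "vcmp (pseudoslice B S b) (v', w, \<theta>') (u, v, \<theta>) = (u, w, \<theta>' \<bullet>\<^bsub>B\<^esub> \<theta>)"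
  "hcmp (pseudoslice B S b) (u1, v1, \<theta>') (u, v, \<theta>) =
     (cmp1 (pseudoslice B S b) u1 u, cmp1 (pseudoslice B S b) v1 v, \<theta>' \<star>\<^bsub>B\<^esub> \<theta>)"
  by (simp_all add: pseudoslice_def Let_def)

lemma pseudoslice_ObE:
  assumes "x \<in> Ob (pseudoslice B S b)"
  obtains K a where "x = (K, a)" "K \<in> S" "a \<in> Ar B" "src B a = K" "trg B a = b"
  using assms by (cases x) auto

lemma pseudoslice_ArE:
  assumes "f \<in> Ar (pseudoslice B S b)"
  obtains K a L c k \<phi> where "f = ((K, a), (L, c), k, \<phi>)" "K \<in> S" "a \<in> Ar B" "src B a = K" "trg B a = b"
    "L \<in> S" "c \<in> Ar B" "src B c = L" "trg B c = b"
    "k \<in> Ar B" "src B k = K" "trg B k = L" "iso2 B \<phi>" "dom2 B \<phi> = c \<cdot>\<^bsub>B\<^esub> k" "cod2 B \<phi> = a"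
proof -
  obtain K a L c k \<phi> where "f = ((K, a), (L, c), k, \<phi>)" by (metis surj_pair)
  then show thesis using assms that by auto
qed

lemma pseudoslice_ClE:
  assumes "\<alpha> \<in> Cl (pseudoslice B S b)"
  obtains K a L c k \<phi> k' \<phi>' \<theta> where "\<alpha> = (((K, a), (L, c), k, \<phi>), ((K, a), (L, c), k', \<phi>'), \<theta>)"
    "K \<in> S" "a \<in> Ar B" "src B a = K" "trg B a = b" "L \<in> S" "c \<in> Ar B" "src B c = L" "trg B c = b"
    "k \<in> Ar B" "src B k = K" "trg B k = L" "iso2 B \<phi>" "dom2 B \<phi> = c \<cdot>\<^bsub>B\<^esub> k" "cod2 B \<phi> = a"
    "k' \<in> Ar B" "src B k' = K" "trg B k' = L" "iso2 B \<phi>'" "dom2 B \<phi>' = c \<cdot>\<^bsub>B\<^esub> k'" "cod2 B \<phi>' = a"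
    "\<theta> \<in> Cl B" "dom2 B \<theta> = k" "cod2 B \<theta> = k'" "\<phi>' \<bullet>\<^bsub>B\<^esub> (id2 B c \<star>\<^bsub>B\<^esub> \<theta>) = \<phi>"
proof -
  obtain K a L c k \<phi> K' a' L' c' k' \<phi>' \<theta> where "\<alpha> = (((K, a), (L, c), k, \<phi>), ((K', a'), (L', c'), k', \<phi>'), \<theta>)"
    by (metis surj_pair)
  then show thesis using assms that by auto
qed

text \<open>For laws in which the triangle equation of \<theta> is not involved; leaving it out
  keeps \<phi> an independent variable.\<close>

lemma pseudoslice_ClE':
  assumes "\<alpha> \<in> Cl (pseudoslice B S b)"
  obtains K a L c k \<phi> k' \<phi>' \<theta> where "\<alpha> = (((K, a), (L, c), k, \<phi>), ((K, a), (L, c), k', \<phi>'), \<theta>)"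
    "K \<in> S" "a \<in> Ar B" "src B a = K" "trg B a = b" "L \<in> S" "c \<in> Ar B" "src B c = L" "trg B c = b"
    "k \<in> Ar B" "src B k = K" "trg B k = L" "iso2 B \<phi>" "dom2 B \<phi> = c \<cdot>\<^bsub>B\<^esub> k" "cod2 B \<phi> = a"
    "k' \<in> Ar B" "src B k' = K" "trg B k' = L" "iso2 B \<phi>'" "dom2 B \<phi>' = c \<cdot>\<^bsub>B\<^esub> k'" "cod2 B \<phi>' = a"
    "\<theta> \<in> Cl B" "dom2 B \<theta> = k" "cod2 B \<theta> = k'"
  using assms by (rule pseudoslice_ClE)

context two_category
begin

text \<open>Cells compose as in \<open>B\<close> and inherit its laws. What has to be shown is that
  the triangle equations survive vertical and horizontal composition.\<close>

lemma two_category_pseudoslice: "two_category (pseudoslice B S b)"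
proof
  let ?S = "pseudoslice B S b"
  show "src ?S f \<in> Ob ?S \<and> trg ?S f \<in> Ob ?S" if "f \<in> Ar ?S" for f
    using that by (elim pseudoslice_ArE) simp
  show "dom2 ?S \<alpha> \<in> Ar ?S \<and> cod2 ?S \<alpha> \<in> Ar ?S \<and> src ?S (dom2 ?S \<alpha>) = src ?S (cod2 ?S \<alpha>) \<and> trg ?S (dom2 ?S \<alpha>) = trg ?S (cod2 ?S \<alpha>)"
    if "\<alpha> \<in> Cl ?S" for \<alpha>
    using that by (elim pseudoslice_ClE) simp
  show "arr ?S (id1 ?S X) X X" if "X \<in> Ob ?S" for X
    using that by (elim pseudoslice_ObE) (use src_Ob in \<open>auto simp: arr_def\<close>)
  show "arr ?S (cmp1 ?S g f) X Z" if "arr ?S f X Y" "arr ?S g Y Z" for f X Y g Z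
    using that unfolding arr_def by (auto elim!: pseudoslice_ArE)
  show "cmp1 ?S (cmp1 ?S h g) f = cmp1 ?S h (cmp1 ?S g f)" if "arr ?S f W X" "arr ?S g X Y" "arr ?S h Y Z" for f W X g Y h Z
    using that unfolding arr_def by (auto elim!: pseudoslice_ArE)
  show "cmp1 ?S f (id1 ?S X) = f \<and> cmp1 ?S (id1 ?S Y) f = f" if "arr ?S f X Y" for f X Y
    using that unfolding arr_def by (auto elim!: pseudoslice_ArE)
  show "cell ?S (id2 ?S f) f f" if "f \<in> Ar ?S" for f
    using that unfolding cell_def by (elim pseudoslice_ArE) simp
  show "cell ?S (vcmp ?S \<beta> \<alpha>) f h" if "cell ?S \<alpha> f g" "cell ?S \<beta> g h" for \<alpha> \<beta> f g h
  proof -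
    from that have ab: "\<alpha> \<in> Cl ?S" "\<beta> \<in> Cl ?S" "dom2 ?S \<alpha> = f" "cod2 ?S \<alpha> = g" "dom2 ?S \<beta> = g" "cod2 ?S \<beta> = h"
      by (simp_all add: cell_def)
    obtain K a L c k \<phi> k' \<phi>' \<theta> where A: "\<alpha> = (((K, a), (L, c), k, \<phi>), ((K, a), (L, c), k', \<phi>'), \<theta>)"
      by (rule pseudoslice_ClE[OF ab(1)])
    obtain K2 a2 L2 c2 k2 \<phi>2 k'' \<phi>'' \<theta>' where C: "\<beta> = (((K2, a2), (L2, c2), k2, \<phi>2), ((K2, a2), (L2, c2), k'', \<phi>''), \<theta>')"
      by (rule pseudoslice_ClE[OF ab(2)])
    have f: "f = ((K, a), (L, c), k, \<phi>)" "h = ((K, a), (L, c), k'', \<phi>'')" and C: "\<beta> = (((K, a), (L, c), k', \<phi>'), ((K, a), (L, c), k'', \<phi>''), \<theta>')"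
      using ab(3-6) A C by auto
    note A' = ab(1)[unfolded A] and C' = ab(2)[unfolded C]
    have "\<phi>'' \<bullet> (id2 B c \<star> (\<theta>' \<bullet> \<theta>)) = \<phi>'' \<bullet> ((id2 B c \<star> \<theta>') \<bullet> (id2 B c \<star> \<theta>))"
      using A' C' by simp
    also have "\<dots> = (\<phi>'' \<bullet> (id2 B c \<star> \<theta>')) \<bullet> (id2 B c \<star> \<theta>)"
      by (rule vcmp_assoc'[symmetric]) (use A' C' in simp_all)
    also have "\<dots> = \<phi>" using A' C' by (simp only: pseudoslice_Cl)
    finally have e: "\<phi>'' \<bullet> (id2 B c \<star> (\<theta>' \<bullet> \<theta>)) = \<phi>" .
    show ?thesis unfolding f A C cell_def using A' C' e by (simp del: whisker_left_vcmp)
  qed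
  show "vcmp ?S (vcmp ?S \<gamma> \<beta>) \<alpha> = vcmp ?S \<gamma> (vcmp ?S \<beta> \<alpha>)" if "cell ?S \<alpha> f g" "cell ?S \<beta> g h" "cell ?S \<gamma> h k" for \<alpha> \<beta> \<gamma> f g h k
    using that unfolding cell_def by (auto elim!: pseudoslice_ClE')
  show "vcmp ?S \<alpha> (id2 ?S f) = \<alpha> \<and> vcmp ?S (id2 ?S g) \<alpha> = \<alpha>" if "cell ?S \<alpha> f g" for \<alpha> f g
    using that unfolding cell_def by (auto elim!: pseudoslice_ClE')
  show "cell ?S (hcmp ?S \<beta> \<alpha>) (cmp1 ?S g f) (cmp1 ?S g' f')" if ab: "cell ?S \<alpha> f f'" "cell ?S \<beta> g g'" "trg ?S f = src ?S g" for \<alpha> \<beta> f f' g g'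
  proof -
    from ab have ab': "\<alpha> \<in> Cl ?S" "\<beta> \<in> Cl ?S" by (simp_all add: cell_def)
    obtain K a L c k \<phi> k' \<phi>' \<theta> where A: "\<alpha> = (((K, a), (L, c), k, \<phi>), ((K, a), (L, c), k', \<phi>'), \<theta>)" and
      A': "K \<in> S" "a \<in> Ar B" "src B a = K" "trg B a = b" "L \<in> S" "c \<in> Ar B" "src B c = L" "trg B c = b"
      "k \<in> Ar B" "src B k = K" "trg B k = L" "iso2 B \<phi>" "dom2 B \<phi> = c \<cdot> k" "cod2 B \<phi> = a"
      "k' \<in> Ar B" "src B k' = K" "trg B k' = L" "iso2 B \<phi>'" "dom2 B \<phi>' = c \<cdot> k'" "cod2 B \<phi>' = a"
      "\<theta> \<in> Cl B" "dom2 B \<theta> = k" "cod2 B \<theta> = k'" "\<phi>' \<bullet> (id2 B c \<star> \<theta>) = \<phi>"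
      by (rule pseudoslice_ClE[OF ab'(1)])
    obtain L' c' M d l \<psi> l' \<psi>' \<eta> where C: "\<beta> = (((L', c'), (M, d), l, \<psi>), ((L', c'), (M, d), l', \<psi>'), \<eta>)" and
      C': "L' \<in> S" "c' \<in> Ar B" "src B c' = L'" "trg B c' = b" "M \<in> S" "d \<in> Ar B" "src B d = M" "trg B d = b"
      "l \<in> Ar B" "src B l = L'" "trg B l = M" "iso2 B \<psi>" "dom2 B \<psi> = d \<cdot> l" "cod2 B \<psi> = c'"
      "l' \<in> Ar B" "src B l' = L'" "trg B l' = M" "iso2 B \<psi>'" "dom2 B \<psi>' = d \<cdot> l'" "cod2 B \<psi>' = c'"
      "\<eta> \<in> Cl B" "dom2 B \<eta> = l" "cod2 B \<eta> = l'" "\<psi>' \<bullet> (id2 B d \<star> \<eta>) = \<psi>"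
      by (rule pseudoslice_ClE[OF ab'(2)])
    have f: "f = ((K, a), (L, c), k, \<phi>)" "f' = ((K, a), (L, c), k', \<phi>')" "g = ((L', c'), (M, d), l, \<psi>)" "g' = ((L', c'), (M, d), l', \<psi>')"
      using ab A C by (simp_all add: cell_def)
    then have L: "L' = L" "c' = c" using ab(3) by simp_all
    note A' = A' and C' = C'[unfolded L]
    \<comment> \<open>Splitting the horizontal composite lets the two triangle equations be used in
      turn: that of \<eta> first and, after an exchange, that of \<theta>.\<close>
    have hc: "\<eta> \<star> \<theta> = (\<eta> \<star> id2 B k') \<bullet> (id2 B l \<star> \<theta>)"
      using interchange'[of \<theta> "id2 B k'" "id2 B l" \<eta>] A'(1-23) C'(1-23) by simp
    have "\<phi>' \<bullet> (\<psi>' \<star> id2 B k') \<bullet> (id2 B d \<star> (\<eta> \<star> \<theta>)) = \<phi>' \<bullet> (((\<psi>' \<bullet> (id2 B d \<star> \<eta>)) \<star> id2 B k') \<bullet> (id2 B (d \<cdot> l) \<star> \<theta>))"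
      unfolding hc using A'(1-23) C'(1-23) by simp
    also have "\<dots> = \<phi>' \<bullet> ((id2 B c \<star> \<theta>) \<bullet> (\<psi> \<star> id2 B k))"
      unfolding C'(24) using whisker_exchange'[of \<theta> \<psi> k k' "d \<cdot> l" c] A'(1-23) C'(1-23) by simp
    also have "\<dots> = (\<phi>' \<bullet> (id2 B c \<star> \<theta>)) \<bullet> (\<psi> \<star> id2 B k)"
      using A'(1-23) C'(1-23) by simp
    also have "\<dots> = \<phi> \<bullet> (\<psi> \<star> id2 B k)" unfolding A'(24) ..
    finally have e: "(\<phi>' \<bullet> (\<psi>' \<star> id2 B k')) \<bullet> (id2 B d \<star> (\<eta> \<star> \<theta>)) = \<phi> \<bullet> (\<psi> \<star> id2 B k)" .
    show ?thesis
      unfolding f A C cell_def L using A'(1-23) C'(1-23) e by (simp del: vcmp_assoc')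
  qed
  show "hcmp ?S (hcmp ?S \<gamma> \<beta>) \<alpha> = hcmp ?S \<gamma> (hcmp ?S \<beta> \<alpha>)"
    if "cell ?S \<alpha> f f'" "cell ?S \<beta> g g'" "cell ?S \<gamma> h h'" "trg ?S f = src ?S g" "trg ?S g = src ?S h" for \<alpha> \<beta> \<gamma> f f' g g' h h'
    using that unfolding cell_def by (auto elim!: pseudoslice_ClE')
  show "hcmp ?S \<alpha> (id2 ?S (id1 ?S (src ?S f))) = \<alpha> \<and> hcmp ?S (id2 ?S (id1 ?S (trg ?S f))) \<alpha> = \<alpha>" if "cell ?S \<alpha> f g" for \<alpha> f g
    using that unfolding cell_def by (auto elim!: pseudoslice_ClE')
  show "hcmp ?S (id2 ?S g) (id2 ?S f) = id2 ?S (cmp1 ?S g f)" if "arr ?S f X Y" "arr ?S g Y Z" for f X Y g Z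
    using that unfolding arr_def by (auto elim!: pseudoslice_ArE)
  show "hcmp ?S (vcmp ?S \<beta>' \<beta>) (vcmp ?S \<alpha>' \<alpha>) = vcmp ?S (hcmp ?S \<beta>' \<alpha>') (hcmp ?S \<beta> \<alpha>)"
    if "cell ?S \<alpha> f f'" "cell ?S \<alpha>' f' f''" "cell ?S \<beta> g g'" "cell ?S \<beta>' g' g''" "trg ?S f = src ?S g" for \<alpha> \<alpha>' \<beta> \<beta>' f f' f'' g g' g''
    using that unfolding cell_def by (auto simp: interchange' elim!: pseudoslice_ClE')
qed

lemma pseudofunctor_slice_proj: "pseudofunctor (pseudoslice B S b) B (slice_proj B)"
proof -
  let ?S = "pseudoslice B S b"
  interpret S: two_category ?S by (rule two_category_pseudoslice)
  have p [simp]: "P0 (slice_proj B) (K, a) = K" "P1 (slice_proj B) (x, y, k, \<phi>) = k" "P2 (slice_proj B) (u, v, \<theta>) = \<theta>"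
    "P2c (slice_proj B) (y', z, l, \<psi>) (x, y, k, \<phi>) = id2 B (l \<cdot> k)" "P0c (slice_proj B) (K, a) = id2 B (id1 B K)" for K a x y k \<phi> u v \<theta> y' z l \<psi>
    by (simp_all add: slice_proj_def)
  show ?thesis
  proof
    show "P0 (slice_proj B) i \<in> Ob B" if "i \<in> Ob ?S" for i
      using that by (elim pseudoslice_ObE) (use src_Ob in auto)
    show "arr B (P1 (slice_proj B) d) (P0 (slice_proj B) i) (P0 (slice_proj B) i')" if "arr ?S d i i'" for d i i'
      using that unfolding arr_def by (auto elim!: pseudoslice_ArE)
    show "cell B (P2 (slice_proj B) \<alpha>) (P1 (slice_proj B) d) (P1 (slice_proj B) d')" if "cell ?S \<alpha> d d'" for \<alpha> d d'
      using that unfolding cell_def by (auto elim!: pseudoslice_ClE')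
    show "P2 (slice_proj B) (id2 ?S d) = id2 B (P1 (slice_proj B) d)" if "d \<in> Ar ?S" for d
      using that by (elim pseudoslice_ArE) auto
    show "P2 (slice_proj B) (vcmp ?S \<beta> \<alpha>) = P2 (slice_proj B) \<beta> \<bullet> P2 (slice_proj B) \<alpha>" for \<alpha> \<beta>
      by (cases \<alpha>; cases \<beta>) simp
    show "inv_cell B (P2c (slice_proj B) e d) (P1 (slice_proj B) e \<cdot> P1 (slice_proj B) d) (P1 (slice_proj B) (cmp1 ?S e d))"
      if "arr ?S d i i'" "arr ?S e i' i''" for d e i i' i''
      using that unfolding arr_def inv_cell_iff by (auto elim!: pseudoslice_ArE)
    show "P2c (slice_proj B) e' d' \<bullet> (P2 (slice_proj B) \<beta> \<star> P2 (slice_proj B) \<alpha>) = P2 (slice_proj B) (hcmp ?S \<beta> \<alpha>) \<bullet> P2c (slice_proj B) e d"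
      if "cell ?S \<alpha> d d'" "cell ?S \<beta> e e'" "trg ?S d = src ?S e" for \<alpha> \<beta> d d' e e'
      using that unfolding cell_def by (auto elim!: pseudoslice_ClE')
    show "inv_cell B (P0c (slice_proj B) i) (id1 B (P0 (slice_proj B) i)) (P1 (slice_proj B) (id1 ?S i))" if "i \<in> Ob ?S" for i
      using that unfolding inv_cell_iff by (elim pseudoslice_ObE) (use src_Ob in auto)
    show "P2c (slice_proj B) f (cmp1 ?S e d) \<bullet> (id2 B (P1 (slice_proj B) f) \<star> P2c (slice_proj B) e d) =
        P2c (slice_proj B) (cmp1 ?S f e) d \<bullet> (P2c (slice_proj B) f e \<star> id2 B (P1 (slice_proj B) d))"
      if "arr ?S d i i'" "arr ?S e i' i''" "arr ?S f i'' i'''" for d e f i i' i'' i'''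
      using that unfolding arr_def by (auto elim!: pseudoslice_ArE)
    show "P2c (slice_proj B) d (id1 ?S i) \<bullet> (id2 B (P1 (slice_proj B) d) \<star> P0c (slice_proj B) i) = id2 B (P1 (slice_proj B) d) \<and>
        P2c (slice_proj B) (id1 ?S i') d \<bullet> (P0c (slice_proj B) i' \<star> id2 B (P1 (slice_proj B) d)) = id2 B (P1 (slice_proj B) d)"
      if "arr ?S d i i'" for d i i'
      using that unfolding arr_def by (elim conjE pseudoslice_ArE) (use src_Ob in auto)
  qed
qed

text \<open>Holds by the design of the slice: compatibility with 2-cells is their triangle equation,
  and the composition law is the formula for composing 1-cells.\<close>

lemma pseudococone_slice_cocone: "pseudococone B (pseudoslice B S b) (slice_proj B) b (slice_cocone B S b)"
proof -
  let ?S = "pseudoslice B S b"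
  interpret S: two_category ?S by (rule two_category_pseudoslice)
  interpret P: pseudofunctor ?S B "slice_proj B" by (rule pseudofunctor_slice_proj)
  have p [simp]: "P0 (slice_proj B) (K, a) = K" "P1 (slice_proj B) (x, y, k, \<phi>) = k" "P2 (slice_proj B) (u, v, \<theta>) = \<theta>"
    "P2c (slice_proj B) (y', z, l, \<psi>) (x, y, k, \<phi>) = id2 B (l \<cdot> k)" "P0c (slice_proj B) (K, a) = id2 B (id1 B K)" for K a x y k \<phi> u v \<theta> y' z l \<psi>
    by (simp_all add: slice_proj_def)
  have l [simp]: "leg (slice_cocone B S b) (K, a) = a" if "(K, a) \<in> Ob ?S" for K a
    using that by (simp add: slice_cocone_def)
  have c [simp]: "legc (slice_cocone B S b) (x, y, k, \<phi>) = \<phi>" if "(x, y, k, \<phi>) \<in> Ar ?S" for x y k \<phi>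
    using that by (simp add: slice_cocone_def)
  show ?thesis
  proof (rule P.pseudococoneI)
    show "leg (slice_cocone B S b) \<in> extensional (Ob ?S)" "legc (slice_cocone B S b) \<in> extensional (Ar ?S)"
      by (simp_all add: slice_cocone_def)
    fix i assume i: "i \<in> Ob ?S"
    show "leg (slice_cocone B S b) i \<in> Ar B" "src B (leg (slice_cocone B S b) i) = P0 (slice_proj B) i" "trg B (leg (slice_cocone B S b) i) = b"
      using i by (elim pseudoslice_ObE; simp)+
    show "legc (slice_cocone B S b) (id1 ?S i) \<bullet> (id2 B (leg (slice_cocone B S b) i) \<star> P0c (slice_proj B) i) = id2 B (leg (slice_cocone B S b) i)"
    proof -
      obtain K a where a: "i = (K, a)" "K \<in> S" "a \<in> Ar B" "src B a = K" "trg B a = b" by (rule pseudoslice_ObE[OF i])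
      moreover have "K \<in> Ob B" using src_Ob[of a] a by simp
      ultimately show ?thesis by simp
    qed
  next
    fix d assume d: "d \<in> Ar ?S"
    show "iso2 B (legc (slice_cocone B S b) d)" "dom2 B (legc (slice_cocone B S b) d) = leg (slice_cocone B S b) (trg ?S d) \<cdot> P1 (slice_proj B) d"
      "cod2 B (legc (slice_cocone B S b) d) = leg (slice_cocone B S b) (src ?S d)"
      using d by (elim pseudoslice_ArE; simp)+
  next
    fix \<alpha> assume "\<alpha> \<in> Cl ?S"
    then show "legc (slice_cocone B S b) (cod2 ?S \<alpha>) \<bullet> (id2 B (leg (slice_cocone B S b) (trg ?S (dom2 ?S \<alpha>))) \<star> P2 (slice_proj B) \<alpha>) =
      legc (slice_cocone B S b) (dom2 ?S \<alpha>)"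
      by (elim pseudoslice_ClE) simp
  next
    fix d e assume "d \<in> Ar ?S" "e \<in> Ar ?S" "trg ?S d = src ?S e"
    then show "legc (slice_cocone B S b) (cmp1 ?S e d) \<bullet> (id2 B (leg (slice_cocone B S b) (trg ?S e)) \<star> P2c (slice_proj B) e d) =
      legc (slice_cocone B S b) d \<bullet> (legc (slice_cocone B S b) e \<star> id2 B (P1 (slice_proj B) d))"
      by (elim pseudoslice_ArE) simp
  qed
qed

text \<open>The inverse of the underlying 2-cell satisfies the triangle equation
  automatically.\<close>

lemma iso2_pseudoslice:
  assumes "\<alpha> \<in> Cl (pseudoslice B S b)" "iso2 B (snd (snd \<alpha>))"
  shows "iso2 (pseudoslice B S b) \<alpha>"
proof -
  let ?S = "pseudoslice B S b"
  interpret S: two_category ?S by (rule two_category_pseudoslice)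
  obtain K a L c k \<phi> k' \<phi>' \<theta> where A: "\<alpha> = (((K, a), (L, c), k, \<phi>), ((K, a), (L, c), k', \<phi>'), \<theta>)" and
      A': "K \<in> S" "a \<in> Ar B" "src B a = K" "trg B a = b" "L \<in> S" "c \<in> Ar B" "src B c = L" "trg B c = b"
      "k \<in> Ar B" "src B k = K" "trg B k = L" "iso2 B \<phi>" "dom2 B \<phi> = c \<cdot> k" "cod2 B \<phi> = a"
      "k' \<in> Ar B" "src B k' = K" "trg B k' = L" "iso2 B \<phi>'" "dom2 B \<phi>' = c \<cdot> k'" "cod2 B \<phi>' = a"
      "\<theta> \<in> Cl B" "dom2 B \<theta> = k" "cod2 B \<theta> = k'" "\<phi>' \<bullet> (id2 B c \<star> \<theta>) = \<phi>"
    by (rule pseudoslice_ClE[OF assms(1)])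
  have i: "iso2 B \<theta>" using assms(2) A by simp
  have "\<phi> \<bullet> (id2 B c \<star> inv2 B \<theta>) = (\<phi>' \<bullet> (id2 B c \<star> \<theta>)) \<bullet> (id2 B c \<star> inv2 B \<theta>)" unfolding A'(24) ..
  also have "\<dots> = \<phi>'" using A'(1-23) i by simp
  finally have e: "\<phi> \<bullet> (id2 B c \<star> inv2 B \<theta>) = \<phi>'" .
  show ?thesis
    by (rule S.iso2I[OF assms(1), of "(((K, a), (L, c), k', \<phi>'), ((K, a), (L, c), k, \<phi>), inv2 B \<theta>)"])
      (use A'(1-23) i e in \<open>simp_all add: A\<close>)
qed

end

lemma slice_incl_simps [simp]:
  "P0 (slice_incl B I S b F q) i = (P0 F i, leg q i)"
  "P1 (slice_incl B I S b F q) d = ((P0 F (src I d), leg q (src I d)), (P0 F (trg I d), leg q (trg I d)), P1 F d, legc q d)"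
  "P2 (slice_incl B I S b F q) \<alpha> = (P1 (slice_incl B I S b F q) (dom2 I \<alpha>), P1 (slice_incl B I S b F q) (cod2 I \<alpha>), P2 F \<alpha>)"
  "P2c (slice_incl B I S b F q) e d = (cmp1 (pseudoslice B S b) (P1 (slice_incl B I S b F q) e) (P1 (slice_incl B I S b F q) d),
     P1 (slice_incl B I S b F q) (cmp1 I e d), P2c F e d)"
  "P0c (slice_incl B I S b F q) i = (id1 (pseudoslice B S b) (P0 F i, leg q i), P1 (slice_incl B I S b F q) (id1 I i), P0c F i)"
  by (simp_all add: slice_incl_def Let_def)

text \<open>The three laws of the pseudococone \<open>q\<close> say exactly that the 2-cells of
  \<open>F\<close>, its composition cells and its unit cells satisfy the triangle equations of the
  slice.\<close>

lemma (in pseudofunctor) pseudofunctor_slice_incl: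
  assumes q: "pseudococone J I F b q" and S: "\<And>i. i \<in> Ob I \<Longrightarrow> P0 F i \<in> S"
  shows "pseudofunctor I (pseudoslice J S b) (slice_incl J I S b F q)"
proof -
  let ?S = "pseudoslice J S b" and ?G = "slice_incl J I S b F q"
  interpret S: two_category ?S by (rule J.two_category_pseudoslice)
  note Q = pseudococoneD[OF q] and E = pseudococone_eqs[OF q]
  have ob: "P0 ?G i \<in> Ob ?S" if "i \<in> Ob I" for i
    using Q(1-3)[OF that] S[OF that] by simp
  have ar: "P1 ?G d \<in> Ar ?S" "src ?S (P1 ?G d) = P0 ?G (src I d)" "trg ?S (P1 ?G d) = P0 ?G (trg I d)" if "d \<in> Ar I" for d
    using ob[OF I.src_Ob[OF that]] ob[OF I.trg_Ob[OF that]] Q(4-6)[OF that] that by simp_all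
  have P2G: "P2 ?G \<alpha> \<in> Cl ?S" "dom2 ?S (P2 ?G \<alpha>) = P1 ?G (dom2 I \<alpha>)" "cod2 ?S (P2 ?G \<alpha>) = P1 ?G (cod2 I \<alpha>)" if a: "\<alpha> \<in> Cl I" for \<alpha>
    using ar[of "dom2 I \<alpha>"] ar[of "cod2 I \<alpha>"] E(1)[OF a] a by (auto simp: I.src_cod2 I.trg_cod2)
  have P2cG: "iso2 ?S (P2c ?G e d)" "dom2 ?S (P2c ?G e d) = cmp1 ?S (P1 ?G e) (P1 ?G d)" "cod2 ?S (P2c ?G e d) = P1 ?G (cmp1 I e d)"
    if d: "d \<in> Ar I" "e \<in> Ar I" "trg I d = src I e" for d e
  proof -
    have "cmp1 ?S (P1 ?G e) (P1 ?G d) \<in> Ar ?S"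
      using S.cmp1_simps(1)[of "P1 ?G d" "P1 ?G e"] ar[OF d(1)] ar[OF d(2)] d(3) by (simp del: slice_incl_simps(2))
    then have "P2c ?G e d \<in> Cl ?S"
      using ar[of "cmp1 I e d"] E(2)[OF d] d by simp
    then show "iso2 ?S (P2c ?G e d)"
      using d by (intro J.iso2_pseudoslice) simp_all
  qed simp_all
  have P0cG: "iso2 ?S (P0c ?G i)" if i: "i \<in> Ob I" for i
  proof -
    have "id1 ?S (P0 ?G i) \<in> Ar ?S" using S.id1_simps(1)[OF ob[OF i]] .
    then have "P0c ?G i \<in> Cl ?S"
      using ar[of "id1 I i"] E(3)[OF i] i by simp
    then show ?thesis using i by (intro J.iso2_pseudoslice) simp_all
  qed
  show ?thesis
  proof
    show "\<And>i. i \<in> Ob I \<Longrightarrow> P0 ?G i \<in> Ob ?S" by (rule ob)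
    show "\<And>d i i'. arr I d i i' \<Longrightarrow> arr ?S (P1 ?G d) (P0 ?G i) (P0 ?G i')" using ar unfolding arr_def by blast
    show "\<And>\<alpha> d d'. cell I \<alpha> d d' \<Longrightarrow> cell ?S (P2 ?G \<alpha>) (P1 ?G d) (P1 ?G d')" using P2G unfolding cell_def by blast
    show "P2 ?G (id2 I d) = id2 ?S (P1 ?G d)" if "d \<in> Ar I" for d using that by simp
    show "P2 ?G (vcmp I \<beta> \<alpha>) = vcmp ?S (P2 ?G \<beta>) (P2 ?G \<alpha>)" if "cell I \<alpha> d d'" "cell I \<beta> d' d''" for \<alpha> \<beta> d d' d''
      using that by (auto simp: cell_def)
    show "inv_cell ?S (P2c ?G e d) (cmp1 ?S (P1 ?G e) (P1 ?G d)) (P1 ?G (cmp1 I e d))" if "arr I d i i'" "arr I e i' i''" for d e i i' i''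
      using P2cG[of d e] that unfolding inv_cell_iff arr_def by metis
    show "inv_cell ?S (P0c ?G i) (id1 ?S (P0 ?G i)) (P1 ?G (id1 I i))" if "i \<in> Ob I" for i
      using P0cG[OF that] unfolding inv_cell_iff by simp
    show "vcmp ?S (P2c ?G e' d') (hcmp ?S (P2 ?G \<beta>) (P2 ?G \<alpha>)) = vcmp ?S (P2 ?G (hcmp I \<beta> \<alpha>)) (P2c ?G e d)"
      if "cell I \<alpha> d d'" "cell I \<beta> e e'" "trg I d = src I e" for \<alpha> \<beta> d d' e e'
      using P2c_natural'[of \<alpha> \<beta>] that by (auto simp: cell_def)
    show "vcmp ?S (P2c ?G f (cmp1 I e d)) (hcmp ?S (id2 ?S (P1 ?G f)) (P2c ?G e d)) =
       vcmp ?S (P2c ?G (cmp1 I f e) d) (hcmp ?S (P2c ?G f e) (id2 ?S (P1 ?G d)))"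
      if d: "arr I d i i'" "arr I e i' i''" "arr I f i'' i'''" for d e f i i' i'' i'''
    proof -
      have d': "d \<in> Ar I" "e \<in> Ar I" "f \<in> Ar I" "trg I d = src I e" "trg I e = src I f" using d by (auto simp: arr_def)
      have "cmp1 ?S (P1 ?G f) (cmp1 ?S (P1 ?G e) (P1 ?G d)) = cmp1 ?S (cmp1 ?S (P1 ?G f) (P1 ?G e)) (P1 ?G d)"
        using S.cmp1_assoc'[of "P1 ?G d" "P1 ?G e" "P1 ?G f"] ar[OF d'(1)] ar[OF d'(2)] ar[OF d'(3)] d' by (simp del: slice_incl_simps(2))
      then show ?thesis
        using coh_assoc'[of d e f] d' by simp
    qed
    show "vcmp ?S (P2c ?G d (id1 I i)) (hcmp ?S (id2 ?S (P1 ?G d)) (P0c ?G i)) = id2 ?S (P1 ?G d) \<and>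
        vcmp ?S (P2c ?G (id1 I i') d) (hcmp ?S (P0c ?G i') (id2 ?S (P1 ?G d))) = id2 ?S (P1 ?G d)" if d: "arr I d i i'" for d i i'
    proof -
      have d': "d \<in> Ar I" "src I d = i" "trg I d = i'" using d by (auto simp: arr_def)
      have "cmp1 ?S (P1 ?G d) (id1 ?S (P0 ?G i)) = P1 ?G d" "cmp1 ?S (id1 ?S (P0 ?G i')) (P1 ?G d) = P1 ?G d"
        using S.cmp1_id'[of "P1 ?G d"] ar[OF d'(1)] d' by (simp_all del: slice_incl_simps(1,2))
      then show ?thesis
        using coh_unit'[OF d'(1)] d' by simp
    qed
  qed
qed

section \<open>Bicofinal pseudofunctors\<close>

lemma bicofinal_ob:
  assumes "bicofinal I A G" "j \<in> Ob A"
  obtains i u where "i \<in> Ob I" "u \<in> Ar A" "src A u = j" "trg A u = P0 G i"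
  using assms unfolding bicofinal_def arr_def by metis

lemma bicofinal_ar:
  assumes "bicofinal I A G" "i \<in> Ob I" "u \<in> Ar A" "v \<in> Ar A" "trg A u = P0 G i" "trg A v = P0 G i" "src A v = src A u"
  obtains s \<theta> where "s \<in> Ar I" "src I s = i" "iso2 A \<theta>" "dom2 A \<theta> = P1 G s \<cdot>\<^bsub>A\<^esub> u" "cod2 A \<theta> = P1 G s \<cdot>\<^bsub>A\<^esub> v"
proof -
  have "\<exists>i' s \<theta>. arr I s i i' \<and> inv_cell A \<theta> (P1 G s \<cdot>\<^bsub>A\<^esub> u) (P1 G s \<cdot>\<^bsub>A\<^esub> v)"
    using assms unfolding bicofinal_def arr_def by blast
  then show thesis using that unfolding arr_def inv_cell_iff by blast
qed

lemma bicofinal_cl: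
  assumes "bicofinal I A G" "i \<in> Ob I" "\<alpha> \<in> Cl A" "\<beta> \<in> Cl A" "dom2 A \<beta> = dom2 A \<alpha>" "cod2 A \<beta> = cod2 A \<alpha>" "trg A (dom2 A \<alpha>) = P0 G i"
  obtains s where "s \<in> Ar I" "src I s = i" "id2 A (P1 G s) \<star>\<^bsub>A\<^esub> \<alpha> = id2 A (P1 G s) \<star>\<^bsub>A\<^esub> \<beta>"
proof -
  interpret pseudofunctor I A G using assms(1) by (simp add: bicofinal_def)
  have "arr A (dom2 A \<alpha>) (src A (dom2 A \<alpha>)) (P0 G i)" "arr A (cod2 A \<alpha>) (src A (dom2 A \<alpha>)) (P0 G i)"
    "cell A \<alpha> (dom2 A \<alpha>) (cod2 A \<alpha>)" "cell A \<beta> (dom2 A \<alpha>) (cod2 A \<alpha>)"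
    using assms by (auto simp: arr_def cell_def J.src_cod2 J.trg_cod2)
  then have "\<exists>i' s. arr I s i i' \<and> id2 A (P1 G s) \<star>\<^bsub>A\<^esub> \<alpha> = id2 A (P1 G s) \<star>\<^bsub>A\<^esub> \<beta>"
    using assms(1,2) unfolding bicofinal_def by blast
  then show thesis using that unfolding arr_def by blast
qed

text \<open>Everything is first composed with a 1-cell into the image of \<open>G\<close>. There
  bicofinality gives conditions (2) and (3) directly, while (1) is brought over from
  \<open>I\<close>.\<close>

lemma bicofinal_bifiltered:
  assumes G: "bicofinal I A G"
  shows "bifiltered A"
proof -
  interpret pseudofunctor I A G using G by (simp add: bicofinal_def)
  have bif: "bifiltered I" using G by (simp add: bicofinal_def)
  obtain i0 where i0: "i0 \<in> Ob I" using bif by (auto simp: bifiltered_def)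
  show ?thesis
    unfolding bifiltered_def
  proof (intro conjI ballI allI impI)
    show "two_category A" by (rule J.two_category_axioms)
    show "Ob A \<noteq> {}" using P0_Ob[OF i0] by blast
  next
    fix j j' assume j: "j \<in> Ob A" "j' \<in> Ob A"
    obtain i u where u: "i \<in> Ob I" "u \<in> Ar A" "src A u = j" "trg A u = P0 G i" by (rule bicofinal_ob[OF G j(1)])
    obtain i' u' where u': "i' \<in> Ob I" "u' \<in> Ar A" "src A u' = j'" "trg A u' = P0 G i'" by (rule bicofinal_ob[OF G j(2)])
    obtain f f' where f: "f \<in> Ar I" "f' \<in> Ar I" "src I f = i" "src I f' = i'" "trg I f' = trg I f"
      by (rule bifiltered_ob[OF bif u(1) u'(1)])
    show "\<exists>l f g. arr A f j l \<and> arr A g j' l"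
      by (rule exI[of _ "P0 G (trg I f)"], rule exI[of _ "P1 G f \<cdot>\<^bsub>A\<^esub> u"], rule exI[of _ "P1 G f' \<cdot>\<^bsub>A\<^esub> u'"])
        (use u u' f in \<open>simp add: arr_def\<close>)
  next
    fix j j' d d' assume d: "arr A d j j' \<and> arr A d' j j'"
    then have d': "d \<in> Ar A" "d' \<in> Ar A" "src A d = j" "src A d' = j" "trg A d = j'" "trg A d' = j'" "j' \<in> Ob A"
      by (auto simp: arr_def)
    obtain i u where u: "i \<in> Ob I" "u \<in> Ar A" "src A u = j'" "trg A u = P0 G i" by (rule bicofinal_ob[OF G d'(7)])
    obtain s \<theta> where s: "s \<in> Ar I" "src I s = i" "iso2 A \<theta>" "dom2 A \<theta> = P1 G s \<cdot>\<^bsub>A\<^esub> (u \<cdot>\<^bsub>A\<^esub> d)" "cod2 A \<theta> = P1 G s \<cdot>\<^bsub>A\<^esub> (u \<cdot>\<^bsub>A\<^esub> d')"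
      by (rule bicofinal_ar[OF G u(1), of "u \<cdot>\<^bsub>A\<^esub> d" "u \<cdot>\<^bsub>A\<^esub> d'"]) (use d' u in simp_all)
    show "\<exists>l f \<theta>. arr A f j' l \<and> inv_cell A \<theta> (f \<cdot>\<^bsub>A\<^esub> d) (f \<cdot>\<^bsub>A\<^esub> d')"
      by (rule exI[of _ "P0 G (trg I s)"], rule exI[of _ "P1 G s \<cdot>\<^bsub>A\<^esub> u"], rule exI[of _ \<theta>])
        (use d' u s in \<open>simp add: arr_def inv_cell_iff\<close>)
  next
    fix j j' d d' \<alpha> \<alpha>' assume "arr A d j j' \<and> arr A d' j j' \<and> cell A \<alpha> d d' \<and> cell A \<alpha>' d d'"
    then have a: "\<alpha> \<in> Cl A" "\<alpha>' \<in> Cl A" "dom2 A \<alpha> = d" "cod2 A \<alpha> = d'" "dom2 A \<alpha>' = d" "cod2 A \<alpha>' = d'" "trg A d = j'" "j' \<in> Ob A" "d \<in> Ar A"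
      by (auto simp: arr_def cell_def)
    obtain i u where u: "i \<in> Ob I" "u \<in> Ar A" "src A u = j'" "trg A u = P0 G i" by (rule bicofinal_ob[OF G a(8)])
    obtain s where s: "s \<in> Ar I" "src I s = i" "id2 A (P1 G s) \<star>\<^bsub>A\<^esub> (id2 A u \<star>\<^bsub>A\<^esub> \<alpha>) = id2 A (P1 G s) \<star>\<^bsub>A\<^esub> (id2 A u \<star>\<^bsub>A\<^esub> \<alpha>')"
      by (rule bicofinal_cl[OF G u(1), of "id2 A u \<star>\<^bsub>A\<^esub> \<alpha>" "id2 A u \<star>\<^bsub>A\<^esub> \<alpha>'"]) (use a u in simp_all)
    show "\<exists>l f. arr A f j' l \<and> id2 A f \<star>\<^bsub>A\<^esub> \<alpha> = id2 A f \<star>\<^bsub>A\<^esub> \<alpha>'"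
      by (rule exI[of _ "P0 G (trg I s)"], rule exI[of _ "P1 G s \<cdot>\<^bsub>A\<^esub> u"]) (use a u s in \<open>simp add: arr_def\<close>)
  qed
qed

text \<open>\<open>F\<close> is to be the composite of \<open>P\<close> and \<open>G\<close>
  strictly, coherence cells included, so that restriction along \<open>G\<close> needs no comparison
  cells. Inclusion into the pseudoslice followed by projection is of this kind.\<close>

locale bicofinal_restriction =
  G: pseudofunctor I A G + P: pseudofunctor A B P + F: pseudofunctor I B F
  for I :: "('i, 'j, 'k) twocat" and A :: "('l, 'm, 'n) twocat" and B :: "('o, 'a, 'c) twocat"
    and G :: "('i, 'j, 'k, 'l, 'm, 'n) psfun" and P :: "('l, 'm, 'n, 'o, 'a, 'c) psfun" and F :: "('i, 'j, 'k, 'o, 'a, 'c) psfun" +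
  assumes cofinal: "bicofinal I A G"
    and comp0: "i \<in> Ob I \<Longrightarrow> P0 F i = P0 P (P0 G i)"
    and comp1: "d \<in> Ar I \<Longrightarrow> P1 F d = P1 P (P1 G d)"
    and comp2: "\<alpha> \<in> Cl I \<Longrightarrow> P2 F \<alpha> = P2 P (P2 G \<alpha>)"
    and comp2c: "\<lbrakk>d \<in> Ar I; e \<in> Ar I; trg I d = src I e\<rbrakk> \<Longrightarrow>
      P2c F e d = P2 P (P2c G e d) \<bullet>\<^bsub>B\<^esub> P2c P (P1 G e) (P1 G d)"
    and comp0c: "i \<in> Ob I \<Longrightarrow> P0c F i = P2 P (P0c G i) \<bullet>\<^bsub>B\<^esub> P0c P (P0 G i)"
begin

lemma bif: "bifiltered I"
  using cofinal by (simp add: bicofinal_def)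

definition rst :: "('l, 'm, 'a, 'c) cocone \<Rightarrow> ('i, 'j, 'a, 'c) cocone" where
  "rst r = \<lparr>leg = (\<lambda>i\<in>Ob I. leg r (P0 G i)), legc = (\<lambda>d\<in>Ar I. legc r (P1 G d))\<rparr>"

lemma rst_simps [simp]:
  "i \<in> Ob I \<Longrightarrow> leg (rst r) i = leg r (P0 G i)" "d \<in> Ar I \<Longrightarrow> legc (rst r) d = legc r (P1 G d)"
  by (simp_all add: rst_def)

lemma pseudococone_rst:
  assumes r: "pseudococone B A P X r"
  shows "pseudococone B I F X (rst r)"
proof -
  note R = P.pseudococoneD[OF r] and E = P.pseudococone_eqs[OF r]
  show ?thesis
  proof (rule F.pseudococoneI)
    show "leg (rst r) \<in> extensional (Ob I)" "legc (rst r) \<in> extensional (Ar I)" by (simp_all add: rst_def)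
    show "leg (rst r) i \<in> Ar B" "src B (leg (rst r) i) = P0 F i" "trg B (leg (rst r) i) = X" if "i \<in> Ob I" for i
      using R(1-3)[of "P0 G i"] that comp0 by simp_all
    show "iso2 B (legc (rst r) d)" "dom2 B (legc (rst r) d) = leg (rst r) (trg I d) \<cdot>\<^bsub>B\<^esub> P1 F d" "cod2 B (legc (rst r) d) = leg (rst r) (src I d)"
      if "d \<in> Ar I" for d
      using R(4-6)[of "P1 G d"] that comp1 by simp_all
    show "legc (rst r) (cod2 I \<alpha>) \<bullet>\<^bsub>B\<^esub> (id2 B (leg (rst r) (trg I (dom2 I \<alpha>))) \<star>\<^bsub>B\<^esub> P2 F \<alpha>) = legc (rst r) (dom2 I \<alpha>)" if "\<alpha> \<in> Cl I" for \<alpha>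
      using E(1)[of "P2 G \<alpha>"] that comp2 by simp
    show "legc (rst r) (e \<cdot>\<^bsub>I\<^esub> d) \<bullet>\<^bsub>B\<^esub> (id2 B (leg (rst r) (trg I e)) \<star>\<^bsub>B\<^esub> P2c F e d) =
        legc (rst r) d \<bullet>\<^bsub>B\<^esub> (legc (rst r) e \<star>\<^bsub>B\<^esub> id2 B (P1 F d))" if d: "d \<in> Ar I" "e \<in> Ar I" "trg I d = src I e" for d e
    proof -
      let ?k = "P0 G (trg I e)" and ?c = "P2 P (P2c G e d)" and ?p = "P2c P (P1 G e) (P1 G d)"
      have k: "leg r ?k \<in> Ar B" "src B (leg r ?k) = P0 P ?k" using R(1,2)[of ?k] d by simp_all
      have "legc r (P1 G (e \<cdot>\<^bsub>I\<^esub> d)) \<bullet>\<^bsub>B\<^esub> (id2 B (leg r ?k) \<star>\<^bsub>B\<^esub> (?c \<bullet>\<^bsub>B\<^esub> ?p)) =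
        (legc r (P1 G (e \<cdot>\<^bsub>I\<^esub> d)) \<bullet>\<^bsub>B\<^esub> (id2 B (leg r ?k) \<star>\<^bsub>B\<^esub> ?c)) \<bullet>\<^bsub>B\<^esub> (id2 B (leg r ?k) \<star>\<^bsub>B\<^esub> ?p)"
        using d k R(4-6)[of "P1 G (e \<cdot>\<^bsub>I\<^esub> d)"] by simp
      \<comment> \<open>The coherence cell of \<open>G\<close> is a 2-cell of \<open>A\<close>, so
        compatibility of \<open>r\<close> with 2-cells absorbs it; what remains is the composition
        law of \<open>r\<close>.\<close>
      also have "legc r (P1 G (e \<cdot>\<^bsub>I\<^esub> d)) \<bullet>\<^bsub>B\<^esub> (id2 B (leg r ?k) \<star>\<^bsub>B\<^esub> ?c) = legc r (P1 G e \<cdot>\<^bsub>A\<^esub> P1 G d)"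
        using E(1)[of "P2c G e d"] d by simp
      finally show ?thesis
        using E(2)[of "P1 G d" "P1 G e"] d comp2c[OF d] comp1[OF d(1)] by simp
    qed
    show "legc (rst r) (id1 I i) \<bullet>\<^bsub>B\<^esub> (id2 B (leg (rst r) i) \<star>\<^bsub>B\<^esub> P0c F i) = id2 B (leg (rst r) i)" if i: "i \<in> Ob I" for i
    proof -
      let ?k = "P0 G i" and ?c = "P2 P (P0c G i)" and ?p = "P0c P (P0 G i)"
      have k: "leg r ?k \<in> Ar B" "src B (leg r ?k) = P0 P ?k" using R(1,2)[of ?k] i by simp_all
      have "legc r (P1 G (id1 I i)) \<bullet>\<^bsub>B\<^esub> (id2 B (leg r ?k) \<star>\<^bsub>B\<^esub> (?c \<bullet>\<^bsub>B\<^esub> ?p)) =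
        (legc r (P1 G (id1 I i)) \<bullet>\<^bsub>B\<^esub> (id2 B (leg r ?k) \<star>\<^bsub>B\<^esub> ?c)) \<bullet>\<^bsub>B\<^esub> (id2 B (leg r ?k) \<star>\<^bsub>B\<^esub> ?p)"
        using i k R(4-6)[of "P1 G (id1 I i)"] by simp
      also have "legc r (P1 G (id1 I i)) \<bullet>\<^bsub>B\<^esub> (id2 B (leg r ?k) \<star>\<^bsub>B\<^esub> ?c) = legc r (id1 A ?k)"
        using E(1)[of "P0c G i"] i by simp
      finally show ?thesis
        using E(3)[of "P0 G i"] i comp0c[OF i] by simp
    qed
  qed
qed

lemma rst_post:
  assumes "pseudococone B A P L q"
  shows "rst (cocone_post B A f q) = cocone_post B I f (rst q)"
  by (simp add: rst_def cocone_post_def cong: restrict_cong)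

context
  fixes X s r
  assumes s: "pseudococone B A P X s" and r: "pseudococone B A P X r"
begin

text \<open>The component at \<open>src u\<close> of the extension, computed at \<open>u : j \<rightarrow> G(i)\<close> from the component \<open>n\<close> at \<open>i\<close>.\<close>

definition ext :: "'m \<Rightarrow> 'c \<Rightarrow> 'c" where
  "ext u n = legc r u \<bullet>\<^bsub>B\<^esub> ((n \<star>\<^bsub>B\<^esub> id2 B (P1 P u)) \<bullet>\<^bsub>B\<^esub> inv2 B (legc s u))"

definition typed :: "'l \<Rightarrow> 'c \<Rightarrow> bool" where
  "typed j n \<longleftrightarrow> n \<in> Cl B \<and> dom2 B n = leg s j \<and> cod2 B n = leg r j"

lemma ext_typed:
  assumes "u \<in> Ar A" "typed (trg A u) n"
  shows "typed (src A u) (ext u n)"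
  using assms P.pseudococoneD(4-6)[OF s assms(1)] P.pseudococoneD(4-6)[OF r assms(1)] P.pseudococoneD(1-3)[OF s, of "trg A u"]
  by (simp add: typed_def ext_def)

lemma ext_eq:
  assumes "u \<in> Ar A" "typed (trg A u) n"
  shows "ext u n \<bullet>\<^bsub>B\<^esub> legc s u = legc r u \<bullet>\<^bsub>B\<^esub> (n \<star>\<^bsub>B\<^esub> id2 B (P1 P u))"
  using assms P.pseudococoneD(4-6)[OF s assms(1)] P.pseudococoneD(4-6)[OF r assms(1)] P.pseudococoneD(1-3)[OF s, of "trg A u"]
  by (simp add: typed_def ext_def)

lemma ext_unique:
  assumes "u \<in> Ar A" "typed (trg A u) n" "typed (src A u) w" "w \<bullet>\<^bsub>B\<^esub> legc s u = legc r u \<bullet>\<^bsub>B\<^esub> (n \<star>\<^bsub>B\<^esub> id2 B (P1 P u))"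
  shows "w = ext u n"
proof -
  have e: "w \<bullet>\<^bsub>B\<^esub> legc s u = ext u n \<bullet>\<^bsub>B\<^esub> legc s u" using assms(4) ext_eq[OF assms(1,2)] by simp
  show ?thesis
    by (rule P.J.vcmp_right_cancel[THEN iffD1, OF _ _ _ _ _ e])
      (use assms(1,3) ext_typed[OF assms(1,2)] P.pseudococoneD(4-6)[OF s assms(1)] in \<open>simp_all add: typed_def\<close>)
qed

lemma ext_iso2:
  assumes "u \<in> Ar A" "typed (trg A u) n" "iso2 B n"
  shows "iso2 B (ext u n)"
  using assms P.pseudococoneD(4-6)[OF s assms(1)] P.pseudococoneD(4-6)[OF r assms(1)] P.pseudococoneD(1-3)[OF s, of "trg A u"]
  by (simp add: typed_def ext_def)

text \<open>By the composition laws of \<open>s\<close> and \<open>r\<close>: the coherence cell of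
  \<open>P\<close> enters on both sides, is exchanged with \<open>n\<close>, and cancels.\<close>

lemma ext_cmp1:
  assumes u: "u \<in> Ar A" and n: "typed (trg A u) n" and w: "w \<in> Ar A" "trg A w = src A u"
  shows "ext (u \<cdot>\<^bsub>A\<^esub> w) n = ext w (ext u n)"
proof -
  let ?k = "trg A u" and ?p = "P2c P u w"
  note D = P.pseudococoneD(1-3)[OF s G.J.trg_Ob[OF u]] P.pseudococoneD(1-3)[OF r G.J.trg_Ob[OF u]]
    P.pseudococoneD(1-3)[OF s G.J.src_Ob[OF u]] P.pseudococoneD(1-3)[OF r G.J.src_Ob[OF u]]
    P.pseudococoneD(4-6)[OF s u] P.pseudococoneD(4-6)[OF r u] P.pseudococoneD(4-6)[OF s w(1)] P.pseudococoneD(4-6)[OF r w(1)]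
  have uw: "u \<cdot>\<^bsub>A\<^esub> w \<in> Ar A" "trg A (u \<cdot>\<^bsub>A\<^esub> w) = ?k" "src A (u \<cdot>\<^bsub>A\<^esub> w) = src A w" using u w by simp_all
  note D' = P.pseudococoneD(4-6)[OF s uw(1)] P.pseudococoneD(4-6)[OF r uw(1)]
  note T = n[unfolded typed_def] ext_typed[OF u n, unfolded typed_def]
  have tw: "typed (trg A w) (ext u n)" using ext_typed[OF u n] w by simp
  note T' = ext_typed[OF w(1) tw, unfolded typed_def]
  have Es: "legc s (u \<cdot>\<^bsub>A\<^esub> w) \<bullet>\<^bsub>B\<^esub> (id2 B (leg s ?k) \<star>\<^bsub>B\<^esub> ?p) = legc s w \<bullet>\<^bsub>B\<^esub> (legc s u \<star>\<^bsub>B\<^esub> id2 B (P1 P w))"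
    by (rule P.pseudococone_eqs(2)[OF s w(1) u w(2)])
  have Er: "legc r (u \<cdot>\<^bsub>A\<^esub> w) \<bullet>\<^bsub>B\<^esub> (id2 B (leg r ?k) \<star>\<^bsub>B\<^esub> ?p) = legc r w \<bullet>\<^bsub>B\<^esub> (legc r u \<star>\<^bsub>B\<^esub> id2 B (P1 P w))"
    by (rule P.pseudococone_eqs(2)[OF r w(1) u w(2)])
  have "(ext w (ext u n) \<bullet>\<^bsub>B\<^esub> legc s (u \<cdot>\<^bsub>A\<^esub> w)) \<bullet>\<^bsub>B\<^esub> (id2 B (leg s ?k) \<star>\<^bsub>B\<^esub> ?p) =
    ext w (ext u n) \<bullet>\<^bsub>B\<^esub> (legc s (u \<cdot>\<^bsub>A\<^esub> w) \<bullet>\<^bsub>B\<^esub> (id2 B (leg s ?k) \<star>\<^bsub>B\<^esub> ?p))"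
    using D D' T' u w uw by simp
  also have "\<dots> = (ext w (ext u n) \<bullet>\<^bsub>B\<^esub> legc s w) \<bullet>\<^bsub>B\<^esub> (legc s u \<star>\<^bsub>B\<^esub> id2 B (P1 P w))"
    unfolding Es using D D' T' u w uw by simp
  also have "\<dots> = legc r w \<bullet>\<^bsub>B\<^esub> ((ext u n \<bullet>\<^bsub>B\<^esub> legc s u) \<star>\<^bsub>B\<^esub> id2 B (P1 P w))"
    unfolding ext_eq[OF w(1) tw] using D T w u by simp
  also have "\<dots> = (legc r w \<bullet>\<^bsub>B\<^esub> (legc r u \<star>\<^bsub>B\<^esub> id2 B (P1 P w))) \<bullet>\<^bsub>B\<^esub> (n \<star>\<^bsub>B\<^esub> id2 B (P1 P u \<cdot>\<^bsub>B\<^esub> P1 P w))"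
    unfolding ext_eq[OF u n] using D T w u by simp
  also have "\<dots> = legc r (u \<cdot>\<^bsub>A\<^esub> w) \<bullet>\<^bsub>B\<^esub> ((id2 B (leg r ?k) \<star>\<^bsub>B\<^esub> ?p) \<bullet>\<^bsub>B\<^esub> (n \<star>\<^bsub>B\<^esub> id2 B (P1 P u \<cdot>\<^bsub>B\<^esub> P1 P w)))"
    unfolding Er[symmetric] using D D' T w u uw by simp
  also have "(id2 B (leg r ?k) \<star>\<^bsub>B\<^esub> ?p) \<bullet>\<^bsub>B\<^esub> (n \<star>\<^bsub>B\<^esub> id2 B (P1 P u \<cdot>\<^bsub>B\<^esub> P1 P w)) =
    (n \<star>\<^bsub>B\<^esub> id2 B (P1 P (u \<cdot>\<^bsub>A\<^esub> w))) \<bullet>\<^bsub>B\<^esub> (id2 B (leg s ?k) \<star>\<^bsub>B\<^esub> ?p)"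
    by (rule P.J.whisker_exchange'[symmetric]) (use D T w u in simp_all)
  also have "legc r (u \<cdot>\<^bsub>A\<^esub> w) \<bullet>\<^bsub>B\<^esub> ((n \<star>\<^bsub>B\<^esub> id2 B (P1 P (u \<cdot>\<^bsub>A\<^esub> w))) \<bullet>\<^bsub>B\<^esub> (id2 B (leg s ?k) \<star>\<^bsub>B\<^esub> ?p)) =
    (legc r (u \<cdot>\<^bsub>A\<^esub> w) \<bullet>\<^bsub>B\<^esub> (n \<star>\<^bsub>B\<^esub> id2 B (P1 P (u \<cdot>\<^bsub>A\<^esub> w)))) \<bullet>\<^bsub>B\<^esub> (id2 B (leg s ?k) \<star>\<^bsub>B\<^esub> ?p)"
    using D D' T w u uw by simp
  finally have e: "(ext w (ext u n) \<bullet>\<^bsub>B\<^esub> legc s (u \<cdot>\<^bsub>A\<^esub> w)) \<bullet>\<^bsub>B\<^esub> (id2 B (leg s ?k) \<star>\<^bsub>B\<^esub> ?p) =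
    (legc r (u \<cdot>\<^bsub>A\<^esub> w) \<bullet>\<^bsub>B\<^esub> (n \<star>\<^bsub>B\<^esub> id2 B (P1 P (u \<cdot>\<^bsub>A\<^esub> w)))) \<bullet>\<^bsub>B\<^esub> (id2 B (leg s ?k) \<star>\<^bsub>B\<^esub> ?p)" .
  have "ext w (ext u n) \<bullet>\<^bsub>B\<^esub> legc s (u \<cdot>\<^bsub>A\<^esub> w) = legc r (u \<cdot>\<^bsub>A\<^esub> w) \<bullet>\<^bsub>B\<^esub> (n \<star>\<^bsub>B\<^esub> id2 B (P1 P (u \<cdot>\<^bsub>A\<^esub> w)))"
    by (rule P.J.vcmp_right_cancel[THEN iffD1, OF _ _ _ _ _ e]) (use D D' T T' w u uw in simp_all)
  then show ?thesis
    by (intro ext_unique[symmetric]) (use uw n ext_typed[OF w(1) tw] in simp_all)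
qed

text \<open>The structure cells at \<open>u\<close> and \<open>v\<close> differ, for
  \<open>s\<close> as for \<open>r\<close>, by a whiskering of \<open>P2 P \<theta>\<close>, which
  slides past \<open>n\<close>.\<close>

lemma ext_2cell:
  assumes \<theta>: "\<theta> \<in> Cl A" "dom2 A \<theta> = u" "cod2 A \<theta> = v" and n: "typed (trg A u) n"
  shows "ext v n = ext u n"
proof -
  have u: "u \<in> Ar A" "v \<in> Ar A" "src A v = src A u" "trg A v = trg A u"
    using \<theta> G.J.src_cod2[of \<theta>] G.J.trg_cod2[of \<theta>] by auto
  let ?k = "trg A u"
  note D = P.pseudococoneD(1-3)[OF s G.J.trg_Ob[OF u(1)]] P.pseudococoneD(1-3)[OF r G.J.trg_Ob[OF u(1)]]
    P.pseudococoneD(4-6)[OF s u(1)] P.pseudococoneD(4-6)[OF r u(1)] P.pseudococoneD(4-6)[OF s u(2)] P.pseudococoneD(4-6)[OF r u(2)]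
  have n': "typed (trg A v) n" using n u by simp
  note T = n[unfolded typed_def] and T' = ext_typed[OF u(2) n', unfolded typed_def]
  have Es: "legc s v \<bullet>\<^bsub>B\<^esub> (id2 B (leg s ?k) \<star>\<^bsub>B\<^esub> P2 P \<theta>) = legc s u"
    using P.pseudococone_eqs(1)[OF s \<theta>(1)] \<theta> by simp
  have Er: "legc r v \<bullet>\<^bsub>B\<^esub> (id2 B (leg r ?k) \<star>\<^bsub>B\<^esub> P2 P \<theta>) = legc r u"
    using P.pseudococone_eqs(1)[OF r \<theta>(1)] \<theta> by simp
  have "ext v n \<bullet>\<^bsub>B\<^esub> legc s u = (ext v n \<bullet>\<^bsub>B\<^esub> legc s v) \<bullet>\<^bsub>B\<^esub> (id2 B (leg s ?k) \<star>\<^bsub>B\<^esub> P2 P \<theta>)"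
    unfolding Es[symmetric] by (rule P.J.vcmp_assoc'[symmetric]) (use D T' \<theta> u in simp_all)
  also have "\<dots> = legc r v \<bullet>\<^bsub>B\<^esub> ((n \<star>\<^bsub>B\<^esub> id2 B (P1 P v)) \<bullet>\<^bsub>B\<^esub> (id2 B (leg s ?k) \<star>\<^bsub>B\<^esub> P2 P \<theta>))"
    unfolding ext_eq[OF u(2) n'] using D T \<theta> u by simp
  also have "(n \<star>\<^bsub>B\<^esub> id2 B (P1 P v)) \<bullet>\<^bsub>B\<^esub> (id2 B (leg s ?k) \<star>\<^bsub>B\<^esub> P2 P \<theta>) = (id2 B (leg r ?k) \<star>\<^bsub>B\<^esub> P2 P \<theta>) \<bullet>\<^bsub>B\<^esub> (n \<star>\<^bsub>B\<^esub> id2 B (P1 P u))"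
    by (rule P.J.whisker_exchange') (use D T \<theta> u in simp_all)
  also have "legc r v \<bullet>\<^bsub>B\<^esub> ((id2 B (leg r ?k) \<star>\<^bsub>B\<^esub> P2 P \<theta>) \<bullet>\<^bsub>B\<^esub> (n \<star>\<^bsub>B\<^esub> id2 B (P1 P u))) =
     (legc r v \<bullet>\<^bsub>B\<^esub> (id2 B (leg r ?k) \<star>\<^bsub>B\<^esub> P2 P \<theta>)) \<bullet>\<^bsub>B\<^esub> (n \<star>\<^bsub>B\<^esub> id2 B (P1 P u))"
    by (rule P.J.vcmp_assoc'[symmetric]) (use D T \<theta> u in simp_all)
  finally have "ext v n \<bullet>\<^bsub>B\<^esub> legc s u = legc r u \<bullet>\<^bsub>B\<^esub> (n \<star>\<^bsub>B\<^esub> id2 B (P1 P u))"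
    unfolding Er .
  then show ?thesis
    by (intro ext_unique) (use u n ext_typed[OF u(2) n'] in simp_all)
qed

context
  fixes n :: "'i \<Rightarrow> 'c"
  assumes n: "\<And>i. i \<in> Ob I \<Longrightarrow> typed (P0 G i) (n i)"
    and n_nat: "\<And>t. t \<in> Ar I \<Longrightarrow> n (src I t) \<bullet>\<^bsub>B\<^esub> legc s (P1 G t) = legc r (P1 G t) \<bullet>\<^bsub>B\<^esub> (n (trg I t) \<star>\<^bsub>B\<^esub> id2 B (P1 P (P1 G t)))"
begin

lemma ext_P1:
  assumes "t \<in> Ar I"
  shows "ext (P1 G t) (n (trg I t)) = n (src I t)"
  by (rule ext_unique[symmetric]) (use assms n n_nat in simp_all)

lemma ext_stage:
  assumes "t \<in> Ar I" "u \<in> Ar A" "trg A u = P0 G (src I t)"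
  shows "ext (P1 G t \<cdot>\<^bsub>A\<^esub> u) (n (trg I t)) = ext u (n (src I t))"
  using ext_cmp1[of "P1 G t" "n (trg I t)" u] ext_P1[OF assms(1)] assms n by simp

text \<open>The targets are joined in \<open>I\<close>, and bicofinality identifies the resulting
  parallel 1-cells up to a 2-cell at a later stage; neither moving on along \<open>I\<close> nor a
  2-cell changes the value of \<open>ext\<close>.\<close>

lemma ext_independent:
  assumes u: "i \<in> Ob I" "u \<in> Ar A" "trg A u = P0 G i" and v: "i' \<in> Ob I" "v \<in> Ar A" "trg A v = P0 G i'" "src A v = src A u"
  shows "ext u (n i) = ext v (n i')"
proof -
  obtain f f' where f: "f \<in> Ar I" "f' \<in> Ar I" "src I f = i" "src I f' = i'" "trg I f' = trg I f"
    by (rule bifiltered_ob[OF bif u(1) v(1)])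
  let ?u = "P1 G f \<cdot>\<^bsub>A\<^esub> u" and ?v = "P1 G f' \<cdot>\<^bsub>A\<^esub> v"
  have uv: "?u \<in> Ar A" "?v \<in> Ar A" "trg A ?u = P0 G (trg I f)" "trg A ?v = P0 G (trg I f)" "src A ?v = src A ?u"
    using u v f by simp_all
  obtain s \<theta> where s: "s \<in> Ar I" "src I s = trg I f" "iso2 A \<theta>" "dom2 A \<theta> = P1 G s \<cdot>\<^bsub>A\<^esub> ?u" "cod2 A \<theta> = P1 G s \<cdot>\<^bsub>A\<^esub> ?v"
    by (rule bicofinal_ar[OF cofinal _ uv]) (use f in simp_all)
  have "ext u (n i) = ext ?u (n (trg I f))" using ext_stage[OF f(1) u(2)] u f by simp
  also have "\<dots> = ext (P1 G s \<cdot>\<^bsub>A\<^esub> ?u) (n (trg I s))" using ext_stage[OF s(1) uv(1)] uv s by simp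
  also have "\<dots> = ext (P1 G s \<cdot>\<^bsub>A\<^esub> ?v) (n (trg I s))"
    by (rule ext_2cell[OF iso2_Cl[OF s(3)] s(4,5), symmetric]) (use s uv n in simp_all)
  also have "\<dots> = ext ?v (n (trg I f))" using ext_stage[OF s(1) uv(2)] uv s by simp
  also have "\<dots> = ext v (n i')" using ext_stage[OF f(2) v(2)] v f by simp
  finally show ?thesis .
qed

text \<open>The component at \<open>j\<close> is computed from one chosen 1-cell into the image of
  \<open>G\<close>. Naturality along \<open>w\<close> amounts to independence of this choice,
  because from the source of \<open>w\<close> one may go through \<open>w\<close>.\<close>

lemma modification_extension:
  obtains m where "modification B A P X m" "mDom m = s" "mCod m = r" "\<And>i. i \<in> Ob I \<Longrightarrow> mAt m (P0 G i) = n i"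
    "\<And>j. j \<in> Ob A \<Longrightarrow> \<exists>i u. i \<in> Ob I \<and> u \<in> Ar A \<and> src A u = j \<and> trg A u = P0 G i \<and> mAt m j = ext u (n i)"
proof -
  obtain i0 u0 where iu: "\<And>j. j \<in> Ob A \<Longrightarrow> i0 j \<in> Ob I \<and> u0 j \<in> Ar A \<and> src A (u0 j) = j \<and> trg A (u0 j) = P0 G (i0 j)"
  proof -
    have "\<exists>p. j \<in> Ob A \<longrightarrow> fst p \<in> Ob I \<and> snd p \<in> Ar A \<and> src A (snd p) = j \<and> trg A (snd p) = P0 G (fst p)" for j
    proof (cases "j \<in> Ob A")
      case True
      obtain i u where "i \<in> Ob I" "u \<in> Ar A" "src A u = j" "trg A u = P0 G i" by (rule bicofinal_ob[OF cofinal True])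
      then show ?thesis by (intro exI[of _ "(i, u)"]) simp
    qed simp
    then obtain p where "\<And>j. j \<in> Ob A \<longrightarrow> fst (p j) \<in> Ob I \<and> snd (p j) \<in> Ar A \<and> src A (snd (p j)) = j \<and> trg A (snd (p j)) = P0 G (fst (p j))"
      by metis
    then show thesis using that[of "fst \<circ> p" "snd \<circ> p"] by simp
  qed
  define m where "m = \<lparr>mDom = s, mCod = r, mAt = (\<lambda>j\<in>Ob A. ext (u0 j) (n (i0 j)))\<rparr>"
  have m_simps [simp]: "mDom m = s" "mCod m = r" by (simp_all add: m_def)
  have mj: "mAt m j = ext (u0 j) (n (i0 j))" if "j \<in> Ob A" for j using that by (simp add: m_def)
  have mu: "mAt m (src A u) = ext u (n i)" if "i \<in> Ob I" "u \<in> Ar A" "trg A u = P0 G i" for i u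
  proof -
    have j: "src A u \<in> Ob A" using that by simp
    show ?thesis
      unfolding mj[OF j] by (rule ext_independent) (use iu[OF j] that in simp_all)
  qed
  have "modification B A P X m"
  proof (rule P.modificationI)
    show "mAt m \<in> extensional (Ob A)" by (simp add: m_def)
    show "mAt m j \<in> Cl B" "dom2 B (mAt m j) = leg (mDom m) j" "cod2 B (mAt m j) = leg (mCod m) j" if "j \<in> Ob A" for j
      using ext_typed[of "u0 j" "n (i0 j)"] iu[OF that] n mj[OF that] by (simp_all add: typed_def)
    fix w assume w: "w \<in> Ar A"
    obtain i u where u: "i \<in> Ob I" "u \<in> Ar A" "src A u = trg A w" "trg A u = P0 G i"
      by (rule bicofinal_ob[OF cofinal, of "trg A w"]) (use w in simp_all)
    have t: "typed (trg A w) (ext u (n i))" using ext_typed[of u "n i"] u n by simp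
    have "mAt m (src A w) = ext (u \<cdot>\<^bsub>A\<^esub> w) (n i)" using mu[of i "u \<cdot>\<^bsub>A\<^esub> w"] u w by simp
    also have "\<dots> = ext w (ext u (n i))" by (rule ext_cmp1) (use u w n in simp_all)
    finally show "mAt m (src A w) \<bullet>\<^bsub>B\<^esub> legc (mDom m) w = legc (mCod m) w \<bullet>\<^bsub>B\<^esub> (mAt m (trg A w) \<star>\<^bsub>B\<^esub> id2 B (P1 P w))"
      using ext_eq[OF w t] mu[of i u] u by simp
  qed (simp_all add: s r)
  moreover have "mAt m (P0 G i) = n i" if "i \<in> Ob I" for i
    using mu[of i "P1 G (id1 I i)"] ext_P1[of "id1 I i"] that by simp
  moreover have "\<exists>i u. i \<in> Ob I \<and> u \<in> Ar A \<and> src A u = j \<and> trg A u = P0 G i \<and> mAt m j = ext u (n i)" if "j \<in> Ob A" for j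
    using iu[OF that] mj[OF that] by blast
  ultimately show thesis
    by (intro that[of m]) simp_all
qed

end

text \<open>Naturality at a 1-cell \<open>u\<close> into the image of \<open>G\<close> forces the
  component at its source to be \<open>ext u\<close> of a component in that image.\<close>

lemma modification_restriction_eq:
  assumes m: "modification B A P X m" "mDom m = s" "mCod m = r" and m': "modification B A P X m'" "mDom m' = s" "mCod m' = r"
    and eq: "\<And>i. i \<in> Ob I \<Longrightarrow> mAt m (P0 G i) = mAt m' (P0 G i)"
  shows "m = m'"
proof (rule P.modif_eqI)
  fix j assume j: "j \<in> Ob A"
  obtain i u where u: "i \<in> Ob I" "u \<in> Ar A" "src A u = j" "trg A u = P0 G i" by (rule bicofinal_ob[OF cofinal j])
  have "mAt k j = ext u (mAt k (P0 G i))" if k: "modification B A P X k" "mDom k = s" "mCod k = r" for k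
    by (rule ext_unique[OF u(2), unfolded u(3,4)])
      (use P.modificationD(1-3)[OF k(1)] k P.modification_eq[OF k(1) u(2)] u j in \<open>simp_all add: typed_def\<close>)
  then show "mAt m j = mAt m' j" using m m' eq[OF u(1)] by simp
qed (use m m' P.modificationD(6) in simp_all)

end

text \<open>Restriction along \<open>G\<close> is fully faithful on pseudococones.\<close>

theorem is_bicolimit_of_restriction:
  assumes q: "pseudococone B A P L q" and bic: "is_bicolimit B I F L (rst q)"
  shows "is_bicolimit B A P L q"
proof (rule P.is_bicolimitI[OF is_bicolimitD(2)[OF bic] q])
  fix X assume X: "X \<in> Ob B"
  let ?K = "cocone_functor B A P L q X" and ?K' = "cocone_functor B I F L (rst q) X"
  note rq = pseudococone_rst[OF q] and Q = P.pseudococoneD(1-3)[OF q]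
  have ff: "fully_faithful ?K'" and es: "ess_surj ?K'" using is_bicolimitD(4,5)[OF bic X] .
  have K: "fDom ?K = hom_cat B L X" "fCod ?K = cocone_cat B A P X"
    "\<And>f. f \<in> Ar B \<Longrightarrow> src B f = L \<Longrightarrow> trg B f = X \<Longrightarrow> fOb ?K f = cocone_post B A f q"
    "\<And>f. f \<in> Cl B \<Longrightarrow> src B (dom2 B f) = L \<Longrightarrow> trg B (dom2 B f) = X \<Longrightarrow> fAr ?K f = cocone_post2 B A f q"
    by (simp_all add: cocone_functor_def)
  have K': "fDom ?K' = hom_cat B L X" "fCod ?K' = cocone_cat B I F X"
    "\<And>f. f \<in> Ar B \<Longrightarrow> src B f = L \<Longrightarrow> trg B f = X \<Longrightarrow> fOb ?K' f = cocone_post B I f (rst q)"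
    "\<And>f. f \<in> Cl B \<Longrightarrow> src B (dom2 B f) = L \<Longrightarrow> trg B (dom2 B f) = X \<Longrightarrow> fAr ?K' f = cocone_post2 B I f (rst q)"
    by (simp_all add: cocone_functor_def)
  define rm where "rm h = \<lparr>mDom = rst (mDom h), mCod = rst (mCod h), mAt = (\<lambda>i\<in>Ob I. mAt h (P0 G i))\<rparr>" for h :: "('l, 'm, 'a, 'c) modif"
  have rm: "modification B I F X (rm h)" if h: "modification B A P X h" for h
  proof (rule F.modificationI)
    show "pseudococone B I F X (mDom (rm h))" "pseudococone B I F X (mCod (rm h))"
      using P.modificationD(4,5)[OF h] pseudococone_rst by (simp_all add: rm_def)
    show "mAt (rm h) (src I d) \<bullet>\<^bsub>B\<^esub> legc (mDom (rm h)) d = legc (mCod (rm h)) d \<bullet>\<^bsub>B\<^esub> (mAt (rm h) (trg I d) \<star>\<^bsub>B\<^esub> id2 B (P1 F d))"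
      if "d \<in> Ar I" for d
      using P.modification_eq[OF h, of "P1 G d"] that comp1 by (simp add: rm_def)
  qed (use P.modificationD(1-3)[OF h] in \<open>simp_all add: rm_def\<close>)
  have rm_post2: "rm (cocone_post2 B A \<gamma> q) = cocone_post2 B I \<gamma> (rst q)" for \<gamma>
    by (rule F.modif_eqI) (simp_all add: rm_def rst_post[OF q])
  show "fully_faithful ?K \<and> ess_surj ?K"
  proof
    show "fully_faithful ?K"
      unfolding fully_faithful_def
    proof (intro ballI impI ex_ex1I)
      fix f g h assume *: "f \<in> cObj (fDom ?K)" "g \<in> cObj (fDom ?K)" "h \<in> cArr (fCod ?K)"
        "cDom (fCod ?K) h = fOb ?K f \<and> cCod (fCod ?K) h = fOb ?K g"
      then have f: "f \<in> Ar B" "src B f = L" "trg B f = X" and g: "g \<in> Ar B" "src B g = L" "trg B g = X"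
        and h: "modification B A P X h"
        unfolding K(1,2) by simp_all
      have hD: "mDom h = cocone_post B A f q" "mCod h = cocone_post B A g q"
        using *(4) K(3)[OF f] K(3)[OF g] unfolding K(2) by simp_all
      \<comment> \<open>The bicolimit over \<open>I\<close> realises the restriction of
        \<open>h\<close> by some \<gamma>; agreement on the image of \<open>G\<close> is then enough
        to recover \<open>h\<close> itself.\<close>
      obtain \<gamma> where \<gamma>: "\<gamma> \<in> cArr (hom_cat B L X)" "cDom (hom_cat B L X) \<gamma> = f" "cCod (hom_cat B L X) \<gamma> = g" "fAr ?K' \<gamma> = rm h"
        by (rule fully_faithful_ex[OF ff, of f g "rm h", unfolded K'(1,2)])
          (use f g rm[OF h] hD rst_post[OF q] K'(3)[OF f] K'(3)[OF g] in \<open>simp_all add: rm_def\<close>)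
      have \<gamma>': "\<gamma> \<in> Cl B" "dom2 B \<gamma> = f" "cod2 B \<gamma> = g" using \<gamma> by simp_all
      have p2: "modification B A P X (cocone_post2 B A \<gamma> q)"
        by (rule P.modification_post2[OF q]) (use \<gamma>' f in simp_all)
      have e: "rm (cocone_post2 B A \<gamma> q) = rm h"
        unfolding rm_post2 using \<gamma>(4) K'(4)[of \<gamma>] \<gamma>' f by simp
      have "cocone_post2 B A \<gamma> q = h"
      proof (rule modification_restriction_eq[OF _ _ p2 _ _ h hD])
        show "pseudococone B A P X (cocone_post B A f q)" "pseudococone B A P X (cocone_post B A g q)"
          using P.pseudococone_post[OF q f] P.pseudococone_post[OF q g] .
        show "mAt (cocone_post2 B A \<gamma> q) (P0 G i) = mAt h (P0 G i)" if "i \<in> Ob I" for i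
          using arg_cong[OF e, of "\<lambda>k. mAt k i"] that by (simp add: rm_def)
      qed (use \<gamma>' in simp_all)
      then show "\<exists>k. k \<in> cArr (fDom ?K) \<and> cDom (fDom ?K) k = f \<and> cCod (fDom ?K) k = g \<and> fAr ?K k = h"
        using \<gamma>(1-3) K(4)[of \<gamma>] \<gamma>' f unfolding K(1) by (intro exI[of _ \<gamma>]) simp
    next
      fix f g h \<gamma> \<delta> assume *: "\<gamma> \<in> cArr (fDom ?K) \<and> cDom (fDom ?K) \<gamma> = f \<and> cCod (fDom ?K) \<gamma> = g \<and> fAr ?K \<gamma> = h"
        "\<delta> \<in> cArr (fDom ?K) \<and> cDom (fDom ?K) \<delta> = f \<and> cCod (fDom ?K) \<delta> = g \<and> fAr ?K \<delta> = h"
      then have g: "\<gamma> \<in> Cl B" "src B (dom2 B \<gamma>) = L" "trg B (dom2 B \<gamma>) = X" "\<delta> \<in> Cl B" "src B (dom2 B \<delta>) = L" "trg B (dom2 B \<delta>) = X"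
        "dom2 B \<gamma> = dom2 B \<delta>" "cod2 B \<gamma> = cod2 B \<delta>" unfolding K(1) by auto
      have "cocone_post2 B A \<gamma> q = cocone_post2 B A \<delta> q"
        using * K(4)[OF g(1-3)] K(4)[OF g(4-6)] by metis
      then have "cocone_post2 B I \<gamma> (rst q) = cocone_post2 B I \<delta> (rst q)"
        using rm_post2 by metis
      then have "fAr ?K' \<gamma> = fAr ?K' \<delta>" using K'(4)[OF g(1-3)] K'(4)[OF g(4-6)] by simp
      then show "\<gamma> = \<delta>"
        by (intro fully_faithful_inj[OF ff F.is_functor_cocone_functor[OF rq], unfolded K'(1)]) (use g in simp_all)
    qed
    show "ess_surj ?K"
      unfolding ess_surj_def
    proof
      fix r assume "r \<in> cObj (fCod ?K)"
      then have r: "pseudococone B A P X r" unfolding K(2) by simp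
      obtain f e where f: "f \<in> Ar B" "src B f = L" "trg B f = X" and e: "cIso (cocone_cat B I F X) e" "mDom e = fOb ?K' f" "mCod e = rst r"
        using es pseudococone_rst[OF r] unfolding ess_surj_def K'(1,2) by auto
      have em: "modification B I F X e" using e(1) by (auto simp: cIso_def)
      have ei: "iso2 B (mAt e i)" if "i \<in> Ob I" for i using F.cocone_cat_cIso[OF em] e(1) that by blast
      have eD: "mDom e = rst (cocone_post B A f q)" using e(2) K'(3)[OF f] rst_post[OF q] by simp
      have p: "pseudococone B A P X (cocone_post B A f q)" by (rule P.pseudococone_post[OF q f])
      have ety: "typed (cocone_post B A f q) r (P0 G i) (mAt e i)" if "i \<in> Ob I" for i
        using F.modificationD(1-3)[OF em that] eD e(3) that by (simp add: typed_def[OF p r])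
      have enat: "mAt e (src I t) \<bullet>\<^bsub>B\<^esub> legc (cocone_post B A f q) (P1 G t) =
        legc r (P1 G t) \<bullet>\<^bsub>B\<^esub> (mAt e (trg I t) \<star>\<^bsub>B\<^esub> id2 B (P1 P (P1 G t)))" if "t \<in> Ar I" for t
        using F.modification_eq[OF em that] eD e(3) that comp1[OF that] by simp
      \<comment> \<open>The isomorphism over \<open>I\<close> is extended to \<open>A\<close>; its
        components are values of \<open>ext\<close> at invertible cells and hence
        invertible.\<close>
      obtain m where m: "modification B A P X m" "mDom m = cocone_post B A f q" "mCod m = r"
        "\<And>j. j \<in> Ob A \<Longrightarrow> \<exists>i u. i \<in> Ob I \<and> u \<in> Ar A \<and> src A u = j \<and> trg A u = P0 G i \<and> mAt m j = ext (cocone_post B A f q) r u (mAt e i)"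
        by (rule modification_extension[OF p r ety enat]) blast+
      have "iso2 B (mAt m j)" if j: "j \<in> Ob A" for j
      proof -
        obtain i u where u: "i \<in> Ob I" "u \<in> Ar A" "trg A u = P0 G i" "mAt m j = ext (cocone_post B A f q) r u (mAt e i)"
          using m(4)[OF j] by blast
        show ?thesis
          unfolding u(4) by (rule ext_iso2[OF p r u(2)]) (use u ety ei in simp_all)
      qed
      then have "cIso (cocone_cat B A P X) m" using P.cocone_cat_cIso[OF m(1)] by blast
      then show "\<exists>x\<in>cObj (fDom ?K). \<exists>e. cIso (fCod ?K) e \<and> cDom (fCod ?K) e = fOb ?K x \<and> cCod (fCod ?K) e = r"
        using f m K(3)[OF f] unfolding K(1,2) by (intro bexI[of _ f] exI[of _ m]) simp_all
    qed
  qed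
qed

end

section \<open>Bicofinality of the inclusion into the pseudoslice\<close>

context bicompact_bicolimit
begin

lemma slice_factor_ob:
  assumes "j \<in> Ob (pseudoslice B S L)" "fst j = K" "\<And>i. i \<in> Ob I \<Longrightarrow> P0 F i \<in> S"
  shows "\<exists>i d. i \<in> Ob I \<and> arr (pseudoslice B S L) d j (P0 F i, leg q i)"
  using assms(1)
proof (cases rule: pseudoslice_ObE)
  case (1 K' a)
  then have a: "a \<in> Ar B" "src B a = K" "trg B a = L" using assms(2) by simp_all
  obtain i x \<theta> where x: "pt x i" "iso2 B \<theta>" "dom2 B \<theta> = leg q i \<cdot>\<^bsub>B\<^esub> x" "cod2 B \<theta> = a"
    by (rule factor_ob[OF a])
  have "arr (pseudoslice B S L) (j, (P0 F i, leg q i), x, \<theta>) j (P0 F i, leg q i)"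
    using 1 assms(2,3) x ptD[OF x(1)] pseudococoneD(1-3)[OF q ptD(4)[OF x(1)]] by (simp add: arr_def)
  then show ?thesis using ptD(4)[OF x(1)] by blast
qed

lemma slice_factor_ar:
  assumes S: "\<And>i. i \<in> Ob I \<Longrightarrow> P0 F i \<in> S" and i: "i \<in> Ob I" and j: "fst j = K"
    and d: "arr (pseudoslice B S L) d j (P0 F i, leg q i)" and t: "arr (pseudoslice B S L) t j (P0 F i, leg q i)"
  shows "\<exists>i' s \<theta>. arr I s i i' \<and> inv_cell (pseudoslice B S L) \<theta>
    (P1 (slice_incl B I S L F q) s \<cdot>\<^bsub>pseudoslice B S L\<^esub> d) (P1 (slice_incl B I S L F q) s \<cdot>\<^bsub>pseudoslice B S L\<^esub> t)"
proof -
  let ?S = "pseudoslice B S L" and ?G = "slice_incl B I S L F q"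
  interpret S: two_category ?S by (rule J.two_category_pseudoslice)
  interpret G: pseudofunctor I ?S ?G by (rule pseudofunctor_slice_incl[OF q S])
  have d': "d \<in> Ar ?S" "src ?S d = j" "trg ?S d = (P0 F i, leg q i)" and t': "t \<in> Ar ?S" "src ?S t = j" "trg ?S t = (P0 F i, leg q i)"
    using d t by (simp_all add: arr_def)
  obtain a x \<phi> where D: "d = ((K, a), (P0 F i, leg q i), x, \<phi>)" "K \<in> S" "a \<in> Ar B" "src B a = K" "trg B a = L"
    "x \<in> Ar B" "src B x = K" "trg B x = P0 F i" "iso2 B \<phi>" "dom2 B \<phi> = leg q i \<cdot>\<^bsub>B\<^esub> x" "cod2 B \<phi> = a"
    using d'(1) by (rule pseudoslice_ArE) (use d' j in auto)
  obtain y \<psi> where T: "t = ((K, a), (P0 F i, leg q i), y, \<psi>)"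
    "y \<in> Ar B" "src B y = K" "trg B y = P0 F i" "iso2 B \<psi>" "dom2 B \<psi> = leg q i \<cdot>\<^bsub>B\<^esub> y" "cod2 B \<psi> = a"
    using t'(1) by (rule pseudoslice_ArE) (use t' d'(2) D(1) in auto)
  have x: "pt x i" and y: "pt y i" using D T i by (simp_all add: pt_def)
  \<comment> \<open>Both 1-cells start at the object with structure map \<open>a\<close>, so their
    triangles combine to an invertible 2-cell between the composites of the inclusion with
    \<open>x\<close> and with \<open>y\<close>.\<close>
  have \<beta>: "iso2 B (inv2 B \<psi> \<bullet>\<^bsub>B\<^esub> \<phi>)" "dom2 B (inv2 B \<psi> \<bullet>\<^bsub>B\<^esub> \<phi>) = leg q i \<cdot>\<^bsub>B\<^esub> x" "cod2 B (inv2 B \<psi> \<bullet>\<^bsub>B\<^esub> \<phi>) = leg q i \<cdot>\<^bsub>B\<^esub> y"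
    using D T by simp_all
  obtain s \<gamma> where s: "s \<in> Ar I" "src I s = i" and \<gamma>: "iso2 B \<gamma>" "dom2 B \<gamma> = P1 F s \<cdot>\<^bsub>B\<^esub> x" "cod2 B \<gamma> = P1 F s \<cdot>\<^bsub>B\<^esub> y"
    and e: "(legc q s \<star>\<^bsub>B\<^esub> id2 B y) \<bullet>\<^bsub>B\<^esub> (id2 B (leg q (trg I s)) \<star>\<^bsub>B\<^esub> \<gamma>) = (inv2 B \<psi> \<bullet>\<^bsub>B\<^esub> \<phi>) \<bullet>\<^bsub>B\<^esub> (legc q s \<star>\<^bsub>B\<^esub> id2 B x)"
    by (rule factor_iso2[OF x y \<beta>])
  note Q = pseudococoneD(1-3)[OF q I.trg_Ob[OF s(1)]] pseudococoneD(4-6)[OF q s(1)]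
  let ?d = "P1 ?G s \<cdot>\<^bsub>?S\<^esub> d" and ?t = "P1 ?G s \<cdot>\<^bsub>?S\<^esub> t"
  have dt: "?d \<in> Ar ?S" "?t \<in> Ar ?S" using G.P1_simps(1)[OF s(1)] d' t' s by simp_all
  have "\<psi> \<bullet>\<^bsub>B\<^esub> ((legc q s \<star>\<^bsub>B\<^esub> id2 B y) \<bullet>\<^bsub>B\<^esub> (id2 B (leg q (trg I s)) \<star>\<^bsub>B\<^esub> \<gamma>)) = \<phi> \<bullet>\<^bsub>B\<^esub> (legc q s \<star>\<^bsub>B\<^esub> id2 B x)"
    unfolding e using D T Q s by simp
  \<comment> \<open>The triangle equation for \<gamma> to be a 2-cell of the slice: the lifting
    equation composed with \<psi>.\<close>
  then have c: "(\<psi> \<bullet>\<^bsub>B\<^esub> (legc q s \<star>\<^bsub>B\<^esub> id2 B y)) \<bullet>\<^bsub>B\<^esub> (id2 B (leg q (trg I s)) \<star>\<^bsub>B\<^esub> \<gamma>) = \<phi> \<bullet>\<^bsub>B\<^esub> (legc q s \<star>\<^bsub>B\<^esub> id2 B x)"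
    using D T Q s \<gamma> by simp
  have cl: "(?d, ?t, \<gamma>) \<in> Cl ?S"
    using dt c \<gamma> s(2) unfolding D(1) T(1) by simp
  have "iso2 ?S (?d, ?t, \<gamma>)" by (rule J.iso2_pseudoslice[OF cl]) (use \<gamma> in simp)
  then have "inv_cell ?S (?d, ?t, \<gamma>) ?d ?t" by (simp add: inv_cell_iff)
  moreover have "arr I s i (trg I s)" using s by (simp add: arr_def)
  ultimately show ?thesis by blast
qed

lemma slice_faithful_cell:
  assumes S: "\<And>i. i \<in> Ob I \<Longrightarrow> P0 F i \<in> S" and i: "i \<in> Ob I" and j: "fst j = K"
    and d: "arr (pseudoslice B S L) d j (P0 F i, leg q i)" and \<alpha>: "cell (pseudoslice B S L) \<alpha> d t" "cell (pseudoslice B S L) \<beta> d t"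
  shows "\<exists>i' s. arr I s i i' \<and> id2 (pseudoslice B S L) (P1 (slice_incl B I S L F q) s) \<star>\<^bsub>pseudoslice B S L\<^esub> \<alpha> =
    id2 (pseudoslice B S L) (P1 (slice_incl B I S L F q) s) \<star>\<^bsub>pseudoslice B S L\<^esub> \<beta>"
proof -
  let ?S = "pseudoslice B S L" and ?G = "slice_incl B I S L F q"
  interpret S: two_category ?S by (rule J.two_category_pseudoslice)
  interpret G: pseudofunctor I ?S ?G by (rule pseudofunctor_slice_incl[OF q S])
  have d': "src ?S d = j" "trg ?S d = (P0 F i, leg q i)"
    using d by (simp_all add: arr_def)
  have A: "\<alpha> \<in> Cl ?S" "dom2 ?S \<alpha> = d" "cod2 ?S \<alpha> = t" and A': "\<beta> \<in> Cl ?S" "dom2 ?S \<beta> = d" "cod2 ?S \<beta> = t"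
    using \<alpha> by (simp_all add: cell_def)
  obtain K1 a L1 c x \<phi> y \<psi> \<theta> where T0: "\<alpha> = (((K1, a), (L1, c), x, \<phi>), ((K1, a), (L1, c), y, \<psi>), \<theta>)"
    "x \<in> Ar B" "src B x = K1" "trg B x = L1" "iso2 B \<psi>" "dom2 B \<psi> = c \<cdot>\<^bsub>B\<^esub> y"
    "\<theta> \<in> Cl B" "dom2 B \<theta> = x" "cod2 B \<theta> = y" "\<psi> \<bullet>\<^bsub>B\<^esub> (id2 B c \<star>\<^bsub>B\<^esub> \<theta>) = \<phi>"
    by (rule pseudoslice_ClE[OF A(1)])
  have dt: "d = ((K1, a), (L1, c), x, \<phi>)" "t = ((K1, a), (L1, c), y, \<psi>)" using A(2,3) unfolding T0(1) by simp_all
  have "(L1, c) = (P0 F i, leg q i)" "K1 = K" using d' j unfolding dt(1) by auto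
  then have *: "L1 = P0 F i" "c = leg q i" "K1 = K" by simp_all
  note T = T0[unfolded *]
  obtain \<theta>' where T': "\<beta> = (((K, a), (P0 F i, leg q i), x, \<phi>), ((K, a), (P0 F i, leg q i), y, \<psi>), \<theta>')"
    "\<theta>' \<in> Cl B" "dom2 B \<theta>' = x" "cod2 B \<theta>' = y" "\<psi> \<bullet>\<^bsub>B\<^esub> (id2 B (leg q i) \<star>\<^bsub>B\<^esub> \<theta>') = \<phi>"
  proof (rule pseudoslice_ClE[OF A'(1)])
    fix K2 a2 L2 c2 x2 \<phi>2 y2 \<psi>2 \<theta>' assume T2: "\<beta> = (((K2, a2), (L2, c2), x2, \<phi>2), ((K2, a2), (L2, c2), y2, \<psi>2), \<theta>')"
      "\<theta>' \<in> Cl B" "dom2 B \<theta>' = x2" "cod2 B \<theta>' = y2" "\<psi>2 \<bullet>\<^bsub>B\<^esub> (id2 B c2 \<star>\<^bsub>B\<^esub> \<theta>') = \<phi>2"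
    have "K2 = K" "a2 = a" "L2 = P0 F i" "c2 = leg q i" "x2 = x" "\<phi>2 = \<phi>" "y2 = y" "\<psi>2 = \<psi>"
      using A'(2,3) unfolding T2(1) dt * by simp_all
    with T2 show thesis by (intro that) simp_all
  qed
  note qi = pseudococoneD(1-3)[OF q i]
  have x: "pt (dom2 B \<theta>) i" using T i by (simp add: pt_def)
  \<comment> \<open>The triangle equations of the two 2-cells share \<phi> and \<psi>; cancelling
    \<psi> makes them agree after whiskering with the inclusion.\<close>
  have e: "\<psi> \<bullet>\<^bsub>B\<^esub> (id2 B (leg q i) \<star>\<^bsub>B\<^esub> \<theta>) = \<psi> \<bullet>\<^bsub>B\<^esub> (id2 B (leg q i) \<star>\<^bsub>B\<^esub> \<theta>')" using T(10) T'(5) by simp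
  have qe: "id2 B (leg q i) \<star>\<^bsub>B\<^esub> \<theta> = id2 B (leg q i) \<star>\<^bsub>B\<^esub> \<theta>'"
    by (rule J.vcmp_left_cancel[THEN iffD1, OF _ _ _ _ _ e]) (use T(2-9) T'(2-4) qi in simp_all)
  obtain s where s: "s \<in> Ar I" "src I s = i" "id2 B (P1 F s) \<star>\<^bsub>B\<^esub> \<theta> = id2 B (P1 F s) \<star>\<^bsub>B\<^esub> \<theta>'"
    by (rule faithful_cell[OF T(7) T'(2) _ _ x qe]) (use T(8,9) T'(3,4) in simp_all)
  have "id2 ?S (P1 ?G s) \<star>\<^bsub>?S\<^esub> \<alpha> = id2 ?S (P1 ?G s) \<star>\<^bsub>?S\<^esub> \<beta>"
    unfolding T(1) T'(1) using s(3) by simp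
  moreover have "arr I s i (trg I s)" using s by (simp add: arr_def)
  ultimately show ?thesis by blast
qed

end

theorem lemma3p2p5:
  fixes B :: "('o, 'u, 'u) twocat" and B0 :: "'o set" and b :: 'o
    and I :: "('u, 'u, 'u) twocat" and F :: "('u, 'u, 'u, 'o, 'u, 'u) psfun"
    and q :: "('u, 'u, 'u, 'u) cocone"
  assumes "universe TYPE('u)"
    and "finitely_biaccessible B"
    and "bicompact_generator B B0"
    and "b \<in> Ob B"
    and "small_twocat TYPE('u) I"
    and "bifiltered I"
    and "pseudofunctor I (full_sub B B0) F"
    and "is_bicolimit B I F b q"
  shows "bicofinal I (compact_slice B b) (slice_incl B I {K. bicompact B K} b F q)
    \<and> bifiltered (compact_slice B b)
    \<and> is_bicolimit B (compact_slice B b) (slice_proj B) b (slice_cocone B {K. bicompact B K} b)"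
proof -
  let ?S = "{K. bicompact B K}"
  let ?Sl = "pseudoslice B ?S b" and ?G = "slice_incl B I ?S b F q"
  have q: "pseudococone B I F b q" using is_bicolimitD(3)[OF assms(8)] .
  interpret F: pseudofunctor I B F by (rule is_bicolimitD(1)[OF assms(8)])
  interpret F0: pseudofunctor I "full_sub B B0" F by (rule assms(7))
  \<comment> \<open>\<open>F\<close> lands in the generator, whose objects are bicompact, so its
    values with their inclusions are objects of the slice over all bicompact objects.\<close>
  have S: "P0 F i \<in> ?S" if "i \<in> Ob I" for i
    using F0.P0_Ob[OF that] assms(3) by (simp add: full_sub_def bicompact_generator_def)
  have bb: "bicompact_bicolimit B I F b q K" if "K \<in> ?S" for K
    using that assms by (simp add: bicompact_bicolimit_def)
  interpret P: pseudofunctor ?Sl B "slice_proj B" by (rule F.J.pseudofunctor_slice_proj)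
  interpret G: pseudofunctor I ?Sl ?G by (rule F.pseudofunctor_slice_incl[OF q S])
  \<comment> \<open>The factorizations concern 1-cells out of one fixed bicompact object; for an
    object of the slice that is its first component.\<close>
  have bs: "bicompact_bicolimit B I F b q (fst j)" if j: "j \<in> Ob ?Sl" for j
    using j by (rule pseudoslice_ObE) (simp add: bb)
  have G0: "P0 ?G i = (P0 F i, leg q i)" for i by simp
  have cofinal: "bicofinal I ?Sl ?G"
    unfolding bicofinal_def G0
  proof (intro conjI ballI allI impI)
    show "bifiltered I" "pseudofunctor I ?Sl ?G" using assms(6) G.pseudofunctor_axioms .
  next
    fix j assume j: "j \<in> Ob ?Sl"
    show "\<exists>i d. i \<in> Ob I \<and> arr ?Sl d j (P0 F i, leg q i)"
      by (rule bicompact_bicolimit.slice_factor_ob[OF bs[OF j] j refl S])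
  next
    fix j i d t assume *: "i \<in> Ob I \<and> arr ?Sl d j (P0 F i, leg q i) \<and> arr ?Sl t j (P0 F i, leg q i)"
    then have j: "j \<in> Ob ?Sl" by (auto simp: arr_def)
    show "\<exists>i' s \<theta>. arr I s i i' \<and> inv_cell ?Sl \<theta> (P1 ?G s \<cdot>\<^bsub>?Sl\<^esub> d) (P1 ?G s \<cdot>\<^bsub>?Sl\<^esub> t)"
      by (rule bicompact_bicolimit.slice_factor_ar[OF bs[OF j] S _ refl]) (use * in blast)+
  next
    fix j i d t \<alpha> \<alpha>' assume *: "i \<in> Ob I \<and> arr ?Sl d j (P0 F i, leg q i) \<and> arr ?Sl t j (P0 F i, leg q i) \<and>
      cell ?Sl \<alpha> d t \<and> cell ?Sl \<alpha>' d t"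
    then have j: "j \<in> Ob ?Sl" by (auto simp: arr_def)
    show "\<exists>i' s. arr I s i i' \<and> id2 ?Sl (P1 ?G s) \<star>\<^bsub>?Sl\<^esub> \<alpha> = id2 ?Sl (P1 ?G s) \<star>\<^bsub>?Sl\<^esub> \<alpha>'"
      by (rule bicompact_bicolimit.slice_faithful_cell[OF bs[OF j] S _ refl]) (use * in blast)+
  qed
  \<comment> \<open>Projecting after the inclusion returns \<open>F\<close>, with coherence cells
    altered only by composition with identities.\<close>
  interpret R: bicofinal_restriction I ?Sl B ?G "slice_proj B" F
    by unfold_locales (use cofinal in \<open>simp_all add: slice_proj_def\<close>)
  \<comment> \<open>An equality and not merely an isomorphism, by extensionality of pseudococones,
    so the hypothesis on \<open>q\<close> applies as it stands.\<close>
  have "R.rst (slice_cocone B ?S b) = q"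
  proof -
    have "leg (slice_cocone B ?S b) (P0 ?G i) = leg q i" if "i \<in> Ob I" for i
      using G.P0_Ob[OF that] by (simp add: slice_cocone_def)
    moreover have "legc (slice_cocone B ?S b) (P1 ?G d) = legc q d" if "d \<in> Ar I" for d
      using G.P1_simps(1)[OF that] by (simp add: slice_cocone_def)
    moreover have "leg q \<in> extensional (Ob I)" "legc q \<in> extensional (Ar I)"
      using q by (simp_all add: pseudococone_def)
    ultimately have "leg (R.rst (slice_cocone B ?S b)) = leg q" "legc (R.rst (slice_cocone B ?S b)) = legc q"
      by (intro extensionalityI[of _ "Ob I"] extensionalityI[of _ "Ar I"]; simp add: R.rst_def)+
    then show ?thesis by (cases q, cases "R.rst (slice_cocone B {K. bicompact B K} b)") simp
  qed
  then have "is_bicolimit B ?Sl (slice_proj B) b (slice_cocone B ?S b)"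
    using R.is_bicolimit_of_restriction[OF F.J.pseudococone_slice_cocone] assms(8) by simp
  then show ?thesis using cofinal bicofinal_bifiltered[OF cofinal] by blast
qed

end
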